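(* There exists a constant $C_0>0$ depending only on $\|u_0\|_{H^1}$ such that the global solution $u\in C(\mathbb{R}:H^1(\mathbb{R}))\cap L^\infty(\mathbb{R}:H^1(\mathbb{R}))$ of the initial value problem $$\partial_t u - \mathcal{H}\partial_x^2 u + u\,\partial_x u = 0,\quad x,t\in\mathbb{R},\qquad u(x,0)=u_0(x)\in H^1(\mathbb{R}),$$ satisfies $$\lim_{t\to\infty}\|u(t)\|_{L^2(\{x\ge C_0 t\})}=0.$$
   Context: $\mathcal{H}$ denotes the Hilbert transform, $\mathcal{H}f(x)=\mathrm{p.v.}\frac{1}{\pi}\int_{\mathbb{R}}\frac{f(y)}{x-y}\,dy$; $u$ is real-valued. $\|u(t)\|_{L^2(\{x\ge C_0t\})}=\big(\int_{x\ge C_0 t}u^2(x,t)\,dx\big)^{1/2}$. *)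

theory Defs
  imports "HOL-Analysis.Analysis"
begin

definition test_fun :: "(real \<Rightarrow> real) \<Rightarrow> bool" where
  "test_fun \<psi> \<longleftrightarrow>
     (\<forall>k x. ((deriv ^^ k) \<psi>) differentiable (at x)) \<and>
     (\<exists>R. \<forall>x. R < \<bar>x\<bar> \<longrightarrow> \<psi> x = 0)"

definition L2 :: "(real \<Rightarrow> real) \<Rightarrow> bool" where
  "L2 f \<longleftrightarrow> f \<in> borel_measurable lborel \<and> integrable lborel (\<lambda>x. (f x)\<^sup>2)"

definition weak_deriv :: "(real \<Rightarrow> real) \<Rightarrow> (real \<Rightarrow> real) \<Rightarrow> bool" where
  "weak_deriv f g \<longleftrightarrow>
     (\<forall>\<psi>. test_fun \<psi> \<longrightarrow>
        (LINT x|lborel. f x * deriv \<psi> x) = - (LINT x|lborel. g x * \<psi> x))"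

definition H1 :: "(real \<Rightarrow> real) \<Rightarrow> bool" where
  "H1 f \<longleftrightarrow> L2 f \<and> (\<exists>g. L2 g \<and> weak_deriv f g)"

text \<open>A chosen weak derivative (unique almost everywhere for f in H1).\<close>
definition wderiv :: "(real \<Rightarrow> real) \<Rightarrow> real \<Rightarrow> real" where
  "wderiv f = (SOME g. L2 g \<and> weak_deriv f g)"

definition H1_norm :: "(real \<Rightarrow> real) \<Rightarrow> real" where
  "H1_norm f = sqrt ((LINT x|lborel. (f x)\<^sup>2) + (LINT x|lborel. (wderiv f x)\<^sup>2))"

definition hilbert :: "(real \<Rightarrow> real) \<Rightarrow> real \<Rightarrow> real" where
  "hilbert f x = Lim (at_right 0)
     (\<lambda>\<epsilon>. (1 / pi) * (LINT y:{y. \<epsilon> < \<bar>x - y\<bar>}|lborel. f y / (x - y)))"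

text \<open>u (written u x t) is a solution of the Benjamin-Ono initial value problem
  u_t - H u_xx + u u_x = 0, u(.,0) = u0, in the class C(R;H^1) \<inter> L^\<infinity>(R;H^1).
  The equation is understood in H^{-1} for every time t, i.e. paired with test
  functions: d/dt \<integral> u(x,t) \<psi>(x) dx = \<integral> (-(H u_x)(x,t) + u(x,t)^2/2) \<psi>'(x) dx.\<close>
definition BO_solution :: "(real \<Rightarrow> real) \<Rightarrow> (real \<Rightarrow> real \<Rightarrow> real) \<Rightarrow> bool" where
  "BO_solution u0 u \<longleftrightarrow>
     (\<forall>t. H1 (\<lambda>x. u x t)) \<and>
     (\<forall>t. ((\<lambda>s. H1_norm (\<lambda>x. u x s - u x t)) \<longlongrightarrow> 0) (at t)) \<and>
     (\<exists>B. \<forall>t. H1_norm (\<lambda>x. u x t) \<le> B) \<and>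
     (AE x in lborel. u x 0 = u0 x) \<and>
     (\<forall>\<psi> t. test_fun \<psi> \<longrightarrow>
        ((\<lambda>s. LINT x|lborel. u x s * \<psi> x) has_real_derivative
           (LINT x|lborel. (- hilbert (wderiv (\<lambda>y. u y t)) x + (u x t)\<^sup>2 / 2) * deriv \<psi> x))
        (at t))"

end

theory Submission
  imports Defs "HOL-Real_Asymp.Real_Asymp"
begin

text \<open>Let \<open>\<Phi>\<close> be increasing from \<open>0\<close> with slope \<open>\<Phi>' = b\<^sup>2\<close>, centred at \<open>T\<close> and of width
  \<open>\<mu> = T powr (3/4)\<close>, and consider \<open>I t = \<integral> (u x t)\<^sup>2 \<Phi> (x - c t) dx\<close>. In its time derivative the
  dispersive term produces minus the \<open>H^{1/2}\<close> seminorm of \<open>b u\<close>, up to commutators bounded by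
  \<open>\<mu> powr -2\<close> times the square of the \<open>L\<^sup>2\<close> norm. The cubic term is at most a product of that seminorm, the
  \<open>L\<^sup>2\<close> norm of \<open>u\<close> and the one of \<open>b u\<close>. By the inequality of arithmetic and geometric means it is
  absorbed, up to \<open>2 ||u||\<^sup>2 \<integral> \<Phi>' u\<^sup>2\<close>, which the drift \<open>- c \<integral> \<Phi>' u\<^sup>2\<close> dominates as soon as
  \<open>c \<ge> 2 ||u0||\<^sup>2\<close>, the \<open>L\<^sup>2\<close> norm being nonincreasing. Hence
  \<open>I T \<le> I 0 + O (T \<mu> powr -2)\<close>, where the error is \<open>O (T powr (-1/2))\<close>, and \<open>I 0\<close> tends to \<open>0\<close> because the
  weight leaves every compact set. Since \<open>\<Phi>\<close> is bounded below to the right of \<open>T\<close>, the speed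
  \<open>c + 1\<close> suffices.

  The pointwise principal value is handled by comparison with the conjugate Poisson integrals at
  strong Lebesgue points; these converge in \<open>L\<^sup>2\<close> by an explicit computation with Poisson kernels,
  without the Fourier transform.\<close>

subsection \<open>Square integrable functions\<close>

text \<open>With this sign of the dispersion, linear waves travel to the left, so a weight that
  increases in \<open>x\<close> gains a smoothing term and only the nonlinearity can carry mass to
  the right. The cubic term costs the square root of the seminorm, hence a speed quadratic in the
  norm.

  The exponent 3/4 is one choice between 1/2 and 1: above 1/2 the error \<open>T \<mu>^-2\<close>
  vanishes, below 1 the transition layer of the weight still moves away from every fixed point.

  Three obstacles shape the proof. The double integrals behind the commutators are shown to converge
  absolutely for test functions, so the inequality is proved there and carried to \<open>H1\<close>
  by density. The equation is tested only with functions independent of time, while the energy pairs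
  the solution with itself under a moving weight; factoring \<open>u(s)^2 - u(t)^2\<close> and
  continuity in \<open>H1\<close> bridge the gap. Finally \<open>hilbert\<close> is a pointwise
  \<open>Lim\<close>, for which neither linearity nor measurability is immediate, so it is
  identified almost everywhere with an \<open>L2\<close> limit.\<close>

definition l2 :: "(real \<Rightarrow> real) \<Rightarrow> real" where
  "l2 f = sqrt (LINT x|lborel. (f x)\<^sup>2)"

lemma L2_measurable [measurable_dest]: "L2 f \<Longrightarrow> f \<in> borel_measurable borel"
  by (simp add: L2_def)

lemma L2_square_integrable: "L2 f \<Longrightarrow> integrable lborel (\<lambda>x. (f x)\<^sup>2)"
  by (simp add: L2_def)

lemma L2I:
  "f \<in> borel_measurable borel \<Longrightarrow> integrable lborel (\<lambda>x. (f x)\<^sup>2) \<Longrightarrow> L2 f"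
  by (simp add: L2_def)

lemma l2_nonneg [simp]: "0 \<le> l2 f"
  by (simp add: l2_def)

lemma l2_square: "(l2 f)\<^sup>2 = (LINT x|lborel. (f x)\<^sup>2)"
  by (simp add: l2_def)

lemma L2_mult_integrable:
  assumes "L2 f" "L2 g"
  shows "integrable lborel (\<lambda>x. f x * g x)"
proof (rule Bochner_Integration.integrable_bound)
  show "integrable lborel (\<lambda>x. (f x)\<^sup>2 + (g x)\<^sup>2)"
    using assms by (auto simp: L2_square_integrable)
  have [measurable]: "f \<in> borel_measurable borel" "g \<in> borel_measurable borel"
    using assms by (auto simp: L2_measurable)
  show "(\<lambda>x. f x * g x) \<in> borel_measurable lborel" by measurable
  have "\<bar>a * b\<bar> \<le> a\<^sup>2 + b\<^sup>2" for a b :: real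
  proof -
    have "2 * \<bar>a\<bar> * \<bar>b\<bar> \<le> a\<^sup>2 + b\<^sup>2"
      using sum_squares_bound[of "\<bar>a\<bar>" "\<bar>b\<bar>"] by simp
    moreover have "0 \<le> \<bar>a\<bar> * \<bar>b\<bar>" by simp
    ultimately show ?thesis unfolding abs_mult by linarith
  qed
  then show "AE x in lborel. norm (f x * g x) \<le> norm ((f x)\<^sup>2 + (g x)\<^sup>2)"
    by auto
qed

lemma L2_bounded_mult:
  assumes "L2 f" and [measurable]: "g \<in> borel_measurable borel" and "\<And>x. \<bar>g x\<bar> \<le> K"
  shows "L2 (\<lambda>x. g x * f x)"
proof (rule L2I)
  have [measurable]: "f \<in> borel_measurable borel"
    using assms by (auto simp: L2_measurable)
  show "(\<lambda>x. g x * f x) \<in> borel_measurable borel" by measurable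
  show "integrable lborel (\<lambda>x. (g x * f x)\<^sup>2)"
  proof (rule Bochner_Integration.integrable_bound)
    show "integrable lborel (\<lambda>x. K\<^sup>2 * (f x)\<^sup>2)"
      using assms by (auto simp: L2_square_integrable)
    show "(\<lambda>x. (g x * f x)\<^sup>2) \<in> borel_measurable lborel" by measurable
    have "(g x * f x)\<^sup>2 \<le> K\<^sup>2 * (f x)\<^sup>2" for x
      unfolding power_mult_distrib
      by (intro mult_right_mono) (use assms(3)[of x] in \<open>auto simp: abs_le_square_iff[symmetric]\<close>)
    then show "AE x in lborel. norm ((g x * f x)\<^sup>2) \<le> norm (K\<^sup>2 * (f x)\<^sup>2)" by auto
  qed
qed

lemma l2_bounded_mult:
  assumes "L2 f" and [measurable]: "g \<in> borel_measurable borel" and "\<And>x. \<bar>g x\<bar> \<le> K"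
  shows "l2 (\<lambda>x. g x * f x) \<le> K * l2 f"
proof -
  have K: "0 \<le> K" using assms(3)[of 0] by linarith
  have *: "(g x * f x)\<^sup>2 \<le> K\<^sup>2 * (f x)\<^sup>2" for x
      unfolding power_mult_distrib
      by (intro mult_right_mono) (use assms(3)[of x] in \<open>auto simp: abs_le_square_iff[symmetric]\<close>)
  have "(LINT x|lborel. (g x * f x)\<^sup>2) \<le> (LINT x|lborel. K\<^sup>2 * (f x)\<^sup>2)"
    by (intro integral_mono)
      (use L2_bounded_mult[OF assms] assms(1) * in \<open>auto simp: L2_square_integrable\<close>)
  then have "l2 (\<lambda>x. g x * f x) \<le> sqrt (K\<^sup>2 * (LINT x|lborel. (f x)\<^sup>2))"
    unfolding l2_def real_sqrt_le_iff by simp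
  also have "\<dots> = K * l2 f"
    using K by (simp add: l2_def real_sqrt_mult)
  finally show ?thesis .
qed

lemma L2_cmult: "L2 f \<Longrightarrow> L2 (\<lambda>x. c * f x)"
  using L2_bounded_mult[of f "\<lambda>_. c" "\<bar>c\<bar>"] by simp

lemma L2_mult_bounded:
  "L2 f \<Longrightarrow> g \<in> borel_measurable borel \<Longrightarrow> (\<And>x. \<bar>g x\<bar> \<le> K) \<Longrightarrow> L2 (\<lambda>x. f x * g x)"
  using L2_bounded_mult[of f g K] by (simp add: mult.commute)

lemma L2_minus: "L2 f \<Longrightarrow> L2 (\<lambda>x. - f x)"
  using L2_cmult[of f "-1"] by simp

lemma L2_abs: "L2 f \<Longrightarrow> L2 (\<lambda>x. \<bar>f x\<bar>)"
  by (auto simp: L2_def)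

lemma L2_zero: "L2 (\<lambda>x. 0)"
  by (simp add: L2_def)

lemma L2_add:
  assumes "L2 f" "L2 g"
  shows "L2 (\<lambda>x. f x + g x)"
proof (rule L2I)
  have [measurable]: "f \<in> borel_measurable borel" "g \<in> borel_measurable borel"
    using assms by (auto simp: L2_measurable)
  show "(\<lambda>x. f x + g x) \<in> borel_measurable borel" by measurable
  have "integrable lborel (\<lambda>x. (f x)\<^sup>2 + (g x)\<^sup>2 + 2 * (f x * g x))"
    using assms by (auto simp: L2_square_integrable L2_mult_integrable)
  then show "integrable lborel (\<lambda>x. (f x + g x)\<^sup>2)"
    by (simp add: power2_sum mult.assoc)
qed

lemma L2_diff: "L2 f \<Longrightarrow> L2 g \<Longrightarrow> L2 (\<lambda>x. f x - g x)"
  using L2_add[of f "\<lambda>x. - g x"] L2_minus[of g] by simp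

lemma l2_add_square:
  assumes "L2 f" "L2 g"
  shows "(l2 (\<lambda>x. f x + g x))\<^sup>2 = (l2 f)\<^sup>2 + (l2 g)\<^sup>2 + 2 * (LINT x|lborel. f x * g x)"
proof -
  have "(l2 (\<lambda>x. f x + g x))\<^sup>2 = (LINT x|lborel. (f x)\<^sup>2 + (g x)\<^sup>2 + 2 * (f x * g x))"
    by (simp add: l2_square power2_sum mult.assoc)
  also have "\<dots> = (l2 f)\<^sup>2 + (l2 g)\<^sup>2 + 2 * (LINT x|lborel. f x * g x)"
    using assms by (simp add: l2_square L2_square_integrable L2_mult_integrable)
  finally show ?thesis .
qed

lemma l2_cmult: "l2 (\<lambda>x. c * f x) = \<bar>c\<bar> * l2 f"
  by (simp add: l2_def power_mult_distrib real_sqrt_mult)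

lemma l2_minus: "l2 (\<lambda>x. - f x) = l2 f"
  using l2_cmult[of "-1" f] by simp

lemma l2_zero [simp]: "l2 (\<lambda>x. 0) = 0"
  by (simp add: l2_def)

lemma l2_abs: "l2 (\<lambda>x. \<bar>f x\<bar>) = l2 f"
  by (simp add: l2_def)

lemma l2_commute: "l2 (\<lambda>x. f x - g x) = l2 (\<lambda>x. g x - f x)"
  using l2_minus[of "\<lambda>x. f x - g x"] by simp

text \<open>The premise matters: for a measurable function that is not square integrable the
  integral defaults to 0, and so does \<open>l2\<close>.\<close>

lemma l2_eq_0_AE:
  assumes "L2 f"
  shows "l2 f = 0 \<longleftrightarrow> (AE x in lborel. f x = 0)"
  using integral_nonneg_eq_0_iff_AE[OF L2_square_integrable[OF assms]]
  by (simp add: l2_def)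

lemma L2_Cauchy_Schwarz:
  assumes "L2 f" "L2 g"
  shows "\<bar>LINT x|lborel. f x * g x\<bar> \<le> l2 f * l2 g"
proof -
  define A B C where "A = (l2 f)\<^sup>2" and "B = (l2 g)\<^sup>2" and "C = (LINT x|lborel. f x * g x)"
  \<comment> \<open>Expanding \<open>B f - C g\<close> rather than \<open>f - (C / B) g\<close>
    avoids a division, so that \<open>B = 0\<close> is split off only at the end.\<close>
  have "0 \<le> (l2 (\<lambda>x. B * f x + (- C) * g x))\<^sup>2" by simp
  also have "\<dots> = (l2 (\<lambda>x. B * f x))\<^sup>2 + (l2 (\<lambda>x. (- C) * g x))\<^sup>2
     + 2 * (LINT x|lborel. (B * f x) * ((- C) * g x))"
    by (rule l2_add_square) (intro L2_cmult assms)+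
  also have "\<dots> = B * (A * B - C\<^sup>2)"
  proof -
    have "(LINT x|lborel. (B * f x) * ((- C) * g x)) = (LINT x|lborel. (- B * C) * (f x * g x))"
      by (simp add: mult_ac)
    also have "\<dots> = (- B * C) * C"
      by (simp only: integral_mult_right_zero C_def)
    finally have e: "(LINT x|lborel. (B * f x) * ((- C) * g x)) = (- B * C) * C" .
    show ?thesis unfolding e l2_cmult power_mult_distrib A_def[symmetric] B_def[symmetric]
      by (simp add: algebra_simps power2_eq_square)
  qed
  finally have *: "0 \<le> B * (A * B - C\<^sup>2)" .
  show ?thesis
  proof (cases "B = 0")
    case True
    then have "l2 g = 0" by (simp add: B_def)
    then have "AE x in lborel. g x = 0" using l2_eq_0_AE[OF assms(2)] by simp
    then have "C = (LINT x|(lborel::real measure). 0)"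
      unfolding C_def
      by (intro integral_cong_AE) (use assms in \<open>auto simp: L2_measurable\<close>)
    then show ?thesis by (simp add: C_def)
  next
    case False
    then have "B > 0" by (simp add: B_def)
    then have "C\<^sup>2 \<le> A * B" using * by (simp add: zero_le_mult_iff)
    then have "C\<^sup>2 \<le> (l2 f * l2 g)\<^sup>2" by (simp add: A_def B_def power_mult_distrib)
    then show ?thesis
      unfolding C_def by (metis abs_le_square_iff abs_of_nonneg l2_nonneg mult_nonneg_nonneg)
  qed
qed

lemma l2_triangle:
  assumes "L2 f" "L2 g"
  shows "l2 (\<lambda>x. f x + g x) \<le> l2 f + l2 g"
proof -
  have "(l2 (\<lambda>x. f x + g x))\<^sup>2 \<le> (l2 f + l2 g)\<^sup>2"
    using l2_add_square[OF assms] L2_Cauchy_Schwarz[OF assms] by (simp add: power2_sum)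
  then show ?thesis by (rule power2_le_imp_le) simp
qed

lemma l2_triangle_diff:
  assumes "L2 f" "L2 g"
  shows "l2 (\<lambda>x. f x - g x) \<le> l2 f + l2 g"
  using l2_triangle[OF assms(1) L2_minus[OF assms(2)]] by (simp add: l2_minus)

lemma l2_triangle_via:
  assumes "L2 f" "L2 g" "L2 h"
  shows "l2 (\<lambda>x. f x - h x) \<le> l2 (\<lambda>x. f x - g x) + l2 (\<lambda>x. g x - h x)"
  using l2_triangle[OF L2_diff[OF assms(1,2)] L2_diff[OF assms(2,3)]] by simp

lemma l2_reverse_triangle:
  assumes "L2 f" "L2 g"
  shows "\<bar>l2 f - l2 g\<bar> \<le> l2 (\<lambda>x. f x - g x)"
  using l2_triangle[OF L2_diff[OF assms] assms(2)]
    l2_triangle[OF L2_diff[OF assms(2,1)] assms(1)] l2_commute[of f g] by simp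

lemma l2_cong_AE:
  assumes "AE x in lborel. f x = g x" "f \<in> borel_measurable borel" "g \<in> borel_measurable borel"
  shows "l2 f = l2 g"
  unfolding l2_def
  by (rule arg_cong[where f=sqrt], rule integral_cong_AE) (use assms in auto)

lemma l2_mono:
  assumes "L2 g" "f \<in> borel_measurable borel" "\<And>x. \<bar>f x\<bar> \<le> \<bar>g x\<bar>"
  shows "L2 f" "l2 f \<le> l2 g"
proof -
  have *: "(f x)\<^sup>2 \<le> (g x)\<^sup>2" for x using assms(3) by (simp add: abs_le_square_iff)
  show "L2 f"
    by (intro L2I assms Bochner_Integration.integrable_bound[OF L2_square_integrable[OF assms(1)]])
       (use * assms(2) in auto)
  then show "l2 f \<le> l2 g"
    unfolding l2_def real_sqrt_le_iff
    by (intro integral_mono) (use * assms(1) in \<open>auto simp: L2_square_integrable\<close>)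
qed

section \<open>Convergence in mean and continuity of the pairing\<close>

lemma l2_tendsto_norm:
  assumes "\<And>n. L2 (f n)" "L2 g" "((\<lambda>n. l2 (\<lambda>x. f n x - g x)) \<longlongrightarrow> 0) F"
  shows "((\<lambda>n. l2 (f n)) \<longlongrightarrow> l2 g) F"
  unfolding tendsto_iff
proof (intro allI impI)
  fix e :: real assume "e > 0"
  then have "eventually (\<lambda>n. dist (l2 (\<lambda>x. f n x - g x)) 0 < e) F"
    using assms(3) by (auto simp: tendsto_iff)
  then show "eventually (\<lambda>n. dist (l2 (f n)) (l2 g) < e) F"
  proof (rule eventually_mono)
    fix n assume "dist (l2 (\<lambda>x. f n x - g x)) 0 < e"
    then show "dist (l2 (f n)) (l2 g) < e"
      using l2_reverse_triangle[OF assms(1)[of n] assms(2)] by (simp add: dist_real_def)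
  qed
qed

text \<open>Telescoping into \<open>(f n - f0) * g n + f0 * (g n - g0)\<close> leaves two
  Cauchy-Schwarz products. Bilinear expressions below pass to the limit by this lemma.\<close>

lemma L2_tendsto_pairing:
  assumes f: "\<And>n. L2 (f n)" "L2 f0" "((\<lambda>n. l2 (\<lambda>x. f n x - f0 x)) \<longlongrightarrow> 0) F"
  assumes g: "\<And>n. L2 (g n)" "L2 g0" "((\<lambda>n. l2 (\<lambda>x. g n x - g0 x)) \<longlongrightarrow> 0) F"
  shows "((\<lambda>n. LINT x|lborel. f n x * g n x) \<longlongrightarrow> (LINT x|lborel. f0 x * g0 x)) F"
proof (rule LIM_zero_cancel, rule Lim_null_comparison)
  have "((\<lambda>n. l2 (\<lambda>x. f n x - f0 x) * l2 (g n) + l2 f0 * l2 (\<lambda>x. g n x - g0 x))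
      \<longlongrightarrow> 0 * l2 g0 + l2 f0 * 0) F"
    by (intro tendsto_intros f g l2_tendsto_norm[OF g])
  then show "((\<lambda>n. l2 (\<lambda>x. f n x - f0 x) * l2 (g n) + l2 f0 * l2 (\<lambda>x. g n x - g0 x))
      \<longlongrightarrow> 0) F" by simp
  show "\<forall>\<^sub>F n in F. norm ((LINT x|lborel. f n x * g n x) - (LINT x|lborel. f0 x * g0 x))
     \<le> l2 (\<lambda>x. f n x - f0 x) * l2 (g n) + l2 f0 * l2 (\<lambda>x. g n x - g0 x)"
  proof (rule always_eventually, rule allI)
    fix n
    have "(LINT x|lborel. f n x * g n x) - (LINT x|lborel. f0 x * g0 x)
       = (LINT x|lborel. (f n x - f0 x) * g n x + f0 x * (g n x - g0 x))"
      using f g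
      by (subst Bochner_Integration.integral_diff[symmetric])
        (auto simp: L2_mult_integrable algebra_simps intro!: Bochner_Integration.integral_cong)
    also have "\<dots> = (LINT x|lborel. (f n x - f0 x) * g n x) + (LINT x|lborel. f0 x * (g n x - g0 x))"
      using f g by (intro Bochner_Integration.integral_add L2_mult_integrable L2_diff)
    finally show "norm ((LINT x|lborel. f n x * g n x) - (LINT x|lborel. f0 x * g0 x))
     \<le> l2 (\<lambda>x. f n x - f0 x) * l2 (g n) + l2 f0 * l2 (\<lambda>x. g n x - g0 x)"
      using L2_Cauchy_Schwarz[OF L2_diff[OF f(1)[of n] f(2)] g(1)[of n]]
        L2_Cauchy_Schwarz[OF f(2) L2_diff[OF g(1)[of n] g(2)]] by simp
  qed
qed

lemma l2_tendsto_const [simp]: "((\<lambda>n. l2 (\<lambda>x. f x - f x)) \<longlongrightarrow> 0) F"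
  by (simp add: l2_def)

lemma l2_tendsto_add:
  assumes f: "\<And>n. L2 (f n)" "L2 f0" "((\<lambda>n. l2 (\<lambda>x. f n x - f0 x)) \<longlongrightarrow> 0) F"
  assumes g: "\<And>n. L2 (g n)" "L2 g0" "((\<lambda>n. l2 (\<lambda>x. g n x - g0 x)) \<longlongrightarrow> 0) F"
  shows "((\<lambda>n. l2 (\<lambda>x. (f n x + g n x) - (f0 x + g0 x))) \<longlongrightarrow> 0) F"
proof (rule Lim_null_comparison)
  show "((\<lambda>n. l2 (\<lambda>x. f n x - f0 x) + l2 (\<lambda>x. g n x - g0 x)) \<longlongrightarrow> 0) F"
    using tendsto_add[OF f(3) g(3)] by simp
  show "\<forall>\<^sub>F n in F. norm (l2 (\<lambda>x. (f n x + g n x) - (f0 x + g0 x)))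
     \<le> l2 (\<lambda>x. f n x - f0 x) + l2 (\<lambda>x. g n x - g0 x)"
    using l2_triangle[OF L2_diff[OF f(1,2)] L2_diff[OF g(1,2)]]
    by (intro always_eventually) (simp add: algebra_simps)
qed

lemma l2_tendsto_bounded_mult:
  assumes f: "\<And>n. L2 (f n)" "L2 f0" "((\<lambda>n. l2 (\<lambda>x. f n x - f0 x)) \<longlongrightarrow> 0) F"
    and g: "g \<in> borel_measurable borel" "\<And>x. \<bar>g x\<bar> \<le> K"
  shows "((\<lambda>n. l2 (\<lambda>x. g x * f n x - g x * f0 x)) \<longlongrightarrow> 0) F"
proof (rule Lim_null_comparison)
  show "((\<lambda>n. K * l2 (\<lambda>x. f n x - f0 x)) \<longlongrightarrow> 0) F"
    using tendsto_mult_left[OF f(3), of K] by simp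
  show "\<forall>\<^sub>F n in F. norm (l2 (\<lambda>x. g x * f n x - g x * f0 x)) \<le> K * l2 (\<lambda>x. f n x - f0 x)"
    using l2_bounded_mult[OF L2_diff[OF f(1,2)] g]
    by (intro always_eventually) (simp add: algebra_simps)
qed

lemma L2_bounded_integrable:
  assumes "integrable lborel f" "\<And>x. \<bar>f x\<bar> \<le> K"
  shows "L2 f"
proof (rule L2I)
  have [measurable]: "f \<in> borel_measurable borel" using assms(1) by auto
  then show "f \<in> borel_measurable borel" .
  show "integrable lborel (\<lambda>x. (f x)\<^sup>2)"
  proof (rule Bochner_Integration.integrable_bound)
    show "integrable lborel (\<lambda>x. K * f x)" using assms by auto
    show "AE x in lborel. norm ((f x)\<^sup>2) \<le> norm (K * f x)"
    proof (intro AE_I2)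
      fix x have "\<bar>f x\<bar> * \<bar>f x\<bar> \<le> K * \<bar>f x\<bar>" using assms(2)[of x] by (intro mult_right_mono) auto
      also have "\<dots> \<le> \<bar>K\<bar> * \<bar>f x\<bar>" by (intro mult_right_mono) auto
      finally show "norm ((f x)\<^sup>2) \<le> norm (K * f x)" by (simp add: power2_eq_square abs_mult)
    qed
  qed measurable
qed

section \<open>Translations and reflections\<close>

lemma integral_shift:
  fixes f :: "real \<Rightarrow> 'a :: {banach, second_countable_topology}"
  shows "(LINT x|lborel. f (x - t)) = (LINT x|lborel. f x)"
  using lborel_integral_real_affine[of 1 f "-t"] by simp

lemma integrable_shift:
  fixes f :: "real \<Rightarrow> 'a :: {banach, second_countable_topology}"
  shows "integrable lborel (\<lambda>x. f (x - t)) \<longleftrightarrow> integrable lborel f"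
  using lborel_integrable_real_affine_iff[of 1 f "-t"] by simp

lemma integral_reflect_shift:
  fixes f :: "real \<Rightarrow> 'a :: {banach, second_countable_topology}"
  shows "(LINT y|lborel. f (t - y)) = (LINT x|lborel. f x)"
  using lborel_integral_real_affine[of "-1" f t] by simp

lemma integrable_reflect_shift:
  fixes f :: "real \<Rightarrow> 'a :: {banach, second_countable_topology}"
  shows "integrable lborel (\<lambda>y. f (t - y)) \<longleftrightarrow> integrable lborel f"
  using lborel_integrable_real_affine_iff[of "-1" f t] by simp

lemma L2_shift: "L2 f \<Longrightarrow> L2 (\<lambda>x. f (x - t))"
  by (auto simp: L2_def integrable_shift[of "\<lambda>x. (f x)\<^sup>2"])

lemma l2_shift: "l2 (\<lambda>x. f (x - t)) = l2 f"
  by (simp add: l2_def integral_shift[of "\<lambda>x. (f x)\<^sup>2"])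

lemma L2_reflect_shift: "L2 f \<Longrightarrow> L2 (\<lambda>y. f (t - y))"
  by (auto simp: L2_def integrable_reflect_shift[of "\<lambda>x. (f x)\<^sup>2"])

lemma l2_reflect_shift: "l2 (\<lambda>y. f (t - y)) = l2 f"
  by (simp add: l2_def integral_reflect_shift[of "\<lambda>x. (f x)\<^sup>2"])

section \<open>Completeness, dense subspaces and continuity of translation\<close>

lemma L2_Fatou:
  assumes h: "\<And>k. L2 (h k)" and [measurable]: "h0 \<in> borel_measurable borel"
    and lim: "AE x in lborel. (\<lambda>k. h k x) \<longlonglongrightarrow> h0 x"
    and le: "\<And>k::nat. l2 (h k) \<le> C"
  shows "L2 h0" "l2 h0 \<le> C"
proof -
  have [measurable]: "h k \<in> borel_measurable borel" for k
    using h by (auto simp: L2_measurable)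
  have C: "0 \<le> C" using le[of 0] l2_nonneg[of "h 0"] by linarith
  have nn: "(\<integral>\<^sup>+ x. ennreal ((h k x)\<^sup>2) \<partial>lborel) \<le> ennreal (C\<^sup>2)" for k
  proof -
    have "(\<integral>\<^sup>+ x. ennreal ((h k x)\<^sup>2) \<partial>lborel) = ennreal ((l2 (h k))\<^sup>2)"
      unfolding l2_square by (rule nn_integral_eq_integral) (use h in \<open>auto simp: L2_square_integrable\<close>)
    also have "\<dots> \<le> ennreal (C\<^sup>2)"
      by (intro ennreal_leI power_mono le) simp
    finally show ?thesis .
  qed
  have "(\<integral>\<^sup>+ x. ennreal ((h0 x)\<^sup>2) \<partial>lborel)
      = (\<integral>\<^sup>+ x. liminf (\<lambda>k. ennreal ((h k x)\<^sup>2)) \<partial>lborel)"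
  proof (rule nn_integral_cong_AE)
    show "AE x in lborel. ennreal ((h0 x)\<^sup>2) = liminf (\<lambda>k. ennreal ((h k x)\<^sup>2))"
      using lim
    proof eventually_elim
      fix x assume "(\<lambda>k. h k x) \<longlonglongrightarrow> h0 x"
      then have "(\<lambda>k. ennreal ((h k x)\<^sup>2)) \<longlonglongrightarrow> ennreal ((h0 x)\<^sup>2)"
        by (intro tendsto_ennrealI tendsto_power)
      then show "ennreal ((h0 x)\<^sup>2) = liminf (\<lambda>k. ennreal ((h k x)\<^sup>2))"
        by (metis lim_imp_Liminf trivial_limit_sequentially)
    qed
  qed
  also have "\<dots> \<le> liminf (\<lambda>k. \<integral>\<^sup>+ x. ennreal ((h k x)\<^sup>2) \<partial>lborel)"
    by (rule nn_integral_liminf) measurable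
  also have "\<dots> \<le> liminf (\<lambda>k::nat. ennreal (C\<^sup>2))"
    by (rule Liminf_mono) (use nn in auto)
  also have "\<dots> = ennreal (C\<^sup>2)"
    by (simp add: Liminf_const)
  finally have *: "(\<integral>\<^sup>+ x. ennreal ((h0 x)\<^sup>2) \<partial>lborel) \<le> ennreal (C\<^sup>2)" .
  have int: "integrable lborel (\<lambda>x. (h0 x)\<^sup>2)"
    by (rule integrableI_nonneg) (use * in \<open>auto simp: le_less_trans[OF _ ennreal_less_top]\<close>)
  then show L: "L2 h0" by (intro L2I) auto
  have "ennreal ((l2 h0)\<^sup>2) \<le> ennreal (C\<^sup>2)"
    using * unfolding l2_square by (subst (asm) nn_integral_eq_integral) (use int in auto)
  then have "(l2 h0)\<^sup>2 \<le> C\<^sup>2" by simp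
  then show "l2 h0 \<le> C" by (rule power2_le_imp_le) (rule C)
qed

text \<open>Squared increments weighted by \<open>2 ^ k\<close> still have summable integrals, since
  \<open>2 ^ k * (1/16) ^ k = (1/8) ^ k\<close>. Their sum is therefore finite almost everywhere,
  and the growing weight is enough to recover absolute convergence of the increments
  themselves.\<close>

lemma AE_convergent_of_fast_Cauchy:
  assumes f: "\<And>k. L2 (f k)" and d: "\<And>k::nat. l2 (\<lambda>x. f (Suc k) x - f k x) \<le> (1/4) ^ k"
  shows "AE x in lborel. convergent (\<lambda>k. f k x)"
proof -
  have [measurable]: "f k \<in> borel_measurable borel" for k
    using f by (auto simp: L2_measurable)
  define a where "a k x = 2 ^ k * (f (Suc k) x - f k x)\<^sup>2" for k x
  have [measurable]: "a k \<in> borel_measurable borel" for k unfolding a_def by measurable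
  have nn: "(\<integral>\<^sup>+ x. ennreal (a k x) \<partial>lborel) \<le> ennreal ((1/8) ^ k)" for k
  proof -
    have L: "L2 (\<lambda>x. f (Suc k) x - f k x)" by (intro L2_diff f)
    have "(\<integral>\<^sup>+ x. ennreal (a k x) \<partial>lborel) = ennreal (LINT x|lborel. a k x)"
      unfolding a_def
      by (rule nn_integral_eq_integral) (use L2_square_integrable[OF L] in auto)
    also have "(LINT x|lborel. a k x) = 2 ^ k * (l2 (\<lambda>x. f (Suc k) x - f k x))\<^sup>2"
      unfolding a_def l2_square by simp
    also have "\<dots> \<le> 2 ^ k * ((1/4) ^ k)\<^sup>2"
      by (intro mult_left_mono power_mono d) auto
    also have "\<dots> = (1/8) ^ k"
      by (simp add: power2_eq_square flip: power_mult_distrib)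
    finally show ?thesis by (simp add: ennreal_leI)
  qed
  have "(\<integral>\<^sup>+ x. (\<Sum>k. ennreal (a k x)) \<partial>lborel) = (\<Sum>k. \<integral>\<^sup>+ x. ennreal (a k x) \<partial>lborel)"
    by (rule nn_integral_suminf) measurable
  also have "\<dots> \<le> (\<Sum>k. ennreal ((1/8) ^ k))"
    by (intro suminf_le nn) auto
  also have "\<dots> = ennreal (\<Sum>k. (1/8) ^ k)"
    by (rule suminf_ennreal2) (auto intro!: summable_geometric)
  finally have "(\<integral>\<^sup>+ x. (\<Sum>k. ennreal (a k x)) \<partial>lborel) \<noteq> \<infinity>"
    by (metis ennreal_less_top infinity_ennreal_def le_less_trans less_irrefl)
  then have "AE x in lborel. (\<Sum>k. ennreal (a k x)) \<noteq> \<infinity>"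
    by (intro nn_integral_noteq_infinite) measurable
  then show ?thesis
  proof eventually_elim
    fix x assume "(\<Sum>k. ennreal (a k x)) \<noteq> \<infinity>"
    then have s: "summable (\<lambda>k. a k x)"
      by (intro summable_suminf_not_top) (auto simp: a_def)
    have "summable (\<lambda>k. f (Suc k) x - f k x)"
    proof (rule summable_comparison_test')
      show "summable (\<lambda>k. (1/2) ^ k + a k x)"
        by (intro summable_add s summable_geometric) simp
      fix k :: nat
      define z where "z = \<bar>f (Suc k) x - f k x\<bar>"
      \<comment> \<open>The inequality of arithmetic and geometric means, in the form
        \<open>2 * z \<le> (1/2) ^ k + 2 ^ k * z^2\<close>; both terms on the right are
        summable.\<close>
      have "0 \<le> (1 - 2 ^ k * z)\<^sup>2 + 2 ^ k * z * 2 * 0" by simp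
      then have "2 ^ k * z * 2 \<le> 1 + (2 ^ k * z)\<^sup>2"
        by (simp add: power2_eq_square algebra_simps)
      then have "2 ^ k * (2 * z) \<le> 2 ^ k * ((1/2) ^ k + 2 ^ k * z\<^sup>2)"
        by (simp add: power2_eq_square algebra_simps power_divide flip: power_mult_distrib)
      then have "2 * z \<le> (1/2) ^ k + 2 ^ k * z\<^sup>2" by simp
      moreover have "0 \<le> z" by (simp add: z_def)
      ultimately have "z \<le> (1/2) ^ k + 2 ^ k * z\<^sup>2" by linarith
      then show "norm (f (Suc k) x - f k x) \<le> (1/2) ^ k + a k x"
        by (simp add: z_def a_def)
    qed
    then have "convergent (\<lambda>n. \<Sum>k<n. f (Suc k) x - f k x)"
      using summable_iff_convergent by blast
    moreover have "(\<Sum>k<n. f (Suc k) x - f k x) = f n x - f 0 x" for n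
      by (rule sum_lessThan_telescope)
    ultimately have "convergent (\<lambda>n. (f n x - f 0 x) + f 0 x)"
      by (intro convergent_add convergent_const) simp
    then show "convergent (\<lambda>k. f k x)"
      by simp
  qed
qed

lemma L2_complete:
  assumes f: "\<And>n::nat. L2 (f n)"
    and C: "\<And>e. e > 0 \<Longrightarrow> \<exists>N. \<forall>m\<ge>N. \<forall>n\<ge>N. l2 (\<lambda>x. f m x - f n x) < e"
  obtains g where "L2 g" "(\<lambda>n. l2 (\<lambda>x. f n x - g x)) \<longlonglongrightarrow> 0"
proof -
  have "\<forall>k. \<exists>N. \<forall>m\<ge>N. \<forall>n\<ge>N. l2 (\<lambda>x. f m x - f n x) < (1/4) ^ k"
    using C by simp
  then obtain N where N: "\<And>k m n. m \<ge> N k \<Longrightarrow> n \<ge> N k \<Longrightarrow> l2 (\<lambda>x. f m x - f n x) < (1/4) ^ k"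
    by metis
  \<comment> \<open>Summing the thresholds makes the indices monotone and at least
    \<open>N k\<close>; the extra \<open>k\<close> drives them to infinity.\<close>
  define r where "r k = (\<Sum>i\<le>k. N i) + k" for k
  have rN: "r k \<ge> N k" for k
    unfolding r_def using member_le_sum[of k "{..k}" N] by simp
  have rS: "r (Suc k) \<ge> r k" for k unfolding r_def by simp
  have rk: "r k \<ge> k" for k unfolding r_def by simp
  have "AE x in lborel. convergent (\<lambda>k. f (r k) x)"
    by (rule AE_convergent_of_fast_Cauchy)
       (use f rN rS in \<open>auto intro!: less_imp_le[OF N] intro: order_trans\<close>)
  moreover define g where "g x = lim (\<lambda>k. f (r k) x)" for x
  ultimately have lim: "AE x in lborel. (\<lambda>k. f (r k) x) \<longlonglongrightarrow> g x"
    by (simp add: convergent_LIMSEQ_iff)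
  have [measurable]: "f k \<in> borel_measurable borel" for k
    using f by (auto simp: L2_measurable)
  have [measurable]: "g \<in> borel_measurable borel"
    unfolding g_def by measurable
  \<comment> \<open>Fatou with \<open>n\<close> fixed, along the tail of the subsequence: the Cauchy
    bound against every late term passes to the limit function, integrability included.\<close>
  have main: "L2 (\<lambda>x. f n x - g x) \<and> l2 (\<lambda>x. f n x - g x) \<le> e"
    if "\<And>m. m \<ge> M \<Longrightarrow> l2 (\<lambda>x. f n x - f m x) \<le> e" for n e M
  proof -
    have "AE x in lborel. (\<lambda>k. f n x - f (r (k + M)) x) \<longlonglongrightarrow> f n x - g x"
      using lim by eventually_elim (intro tendsto_intros LIMSEQ_ignore_initial_segment)
    moreover have "l2 (\<lambda>x. f n x - f (r (k + M)) x) \<le> e" for k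
      by (rule that) (use rk[of "k + M"] in simp)
    ultimately show ?thesis
      using L2_Fatou[of "\<lambda>k x. f n x - f (r (k + M)) x" "\<lambda>x. f n x - g x" e]
      by (auto simp: L2_diff f)
  qed
  have "L2 (\<lambda>x. f (N 0) x - g x)"
    using main[of "N 0" "N 0" 1] N[of 0 "N 0"] by (auto intro: less_imp_le)
  from L2_diff[OF f[of "N 0"] this] have "L2 g" by simp
  moreover have "(\<lambda>n. l2 (\<lambda>x. f n x - g x)) \<longlonglongrightarrow> 0"
  proof (rule LIMSEQ_I)
    fix e :: real assume "e > 0"
    then obtain M where M: "\<And>m n. m \<ge> M \<Longrightarrow> n \<ge> M \<Longrightarrow> l2 (\<lambda>x. f m x - f n x) < e / 2"
      using C[of "e/2"] by auto
    show "\<exists>no. \<forall>n\<ge>no. norm (l2 (\<lambda>x. f n x - g x) - 0) < e"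
    proof (intro exI allI impI)
      fix n assume "n \<ge> M"
      then have "l2 (\<lambda>x. f n x - g x) \<le> e / 2"
        using main[of M n "e/2"] M by (auto intro: less_imp_le)
      then show "norm (l2 (\<lambda>x. f n x - g x) - 0) < e" using \<open>e > 0\<close> by simp
    qed
  qed
  ultimately show ?thesis by (rule that)
qed

lemma l2_dominated:
  assumes f [measurable]: "\<And>n::nat. f n \<in> borel_measurable borel" and w: "L2 w"
    and [measurable]: "g \<in> borel_measurable borel"
    and le: "\<And>n x. \<bar>f n x - g x\<bar> \<le> w x"
    and lim: "AE x in lborel. (\<lambda>n. f n x) \<longlonglongrightarrow> g x"
  shows "(\<lambda>n. l2 (\<lambda>x. f n x - g x)) \<longlonglongrightarrow> 0"
proof -
  have "(\<lambda>n. LINT x|lborel. (f n x - g x)\<^sup>2) \<longlonglongrightarrow> (LINT x|(lborel::real measure). 0)"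
  proof (rule integral_dominated_convergence)
    show "integrable lborel (\<lambda>x. (w x)\<^sup>2)" using w by (rule L2_square_integrable)
    show "AE x in lborel. (\<lambda>n. (f n x - g x)\<^sup>2) \<longlonglongrightarrow> 0"
      using lim
    proof eventually_elim
      fix x assume "(\<lambda>n. f n x) \<longlonglongrightarrow> g x"
      then have "(\<lambda>n. (f n x - g x)\<^sup>2) \<longlonglongrightarrow> (g x - g x)\<^sup>2" by (intro tendsto_intros)
      then show "(\<lambda>n. (f n x - g x)\<^sup>2) \<longlonglongrightarrow> 0" by simp
    qed
    show "AE x in lborel. norm ((f n x - g x)\<^sup>2) \<le> (w x)\<^sup>2" for n
      using power_mono[OF le[of n], of _ 2] by (auto intro!: AE_I2)
  qed measurable
  then have "(\<lambda>n. sqrt (LINT x|lborel. (f n x - g x)\<^sup>2)) \<longlonglongrightarrow> sqrt 0"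
    by (intro tendsto_real_sqrt) simp
  then show ?thesis by (simp add: l2_def)
qed

lemma L2_indicator_interval: "L2 (\<lambda>x. c * indicator {a..b::real} x)"
proof -
  have "integrable lborel (\<lambda>x. c * indicator {a..b} x :: real)"
    by (intro integrable_mult_right integrable_real_indicator) (auto simp: emeasure_lborel_Icc_eq)
  then show ?thesis
    by (rule L2_bounded_integrable[where K="\<bar>c\<bar>"]) (auto simp: indicator_def)
qed

lemma L2_compact_support:
  assumes "continuous_on UNIV h" "\<And>x. R < \<bar>x\<bar> \<Longrightarrow> h x = 0"
  obtains K where "K \<ge> 0" "\<And>x. \<bar>h x\<bar> \<le> K" "\<And>x. \<bar>h x\<bar> \<le> K * indicator {-R..R} x"
    "L2 h" "integrable lborel h"
proof -
  have "compact (h ` {-R..R})"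
    by (rule compact_continuous_image) (auto intro: continuous_on_subset[OF assms(1)])
  then have "bounded (h ` {-R..R})" by (rule compact_imp_bounded)
  then obtain K0 where "\<forall>y \<in> h ` {-R..R}. \<bar>y\<bar> \<le> K0"
    unfolding bounded_real by (elim exE)
  then have K0: "\<bar>h x\<bar> \<le> K0" if "x \<in> {-R..R}" for x
    using that by simp
  define K where "K = \<bar>K0\<bar>"
  have K: "0 \<le> K" by (simp add: K_def)
  have 1: "\<bar>h x\<bar> \<le> K * indicator {-R..R} x" for x
  proof (cases "x \<in> {-R..R}")
    case True
    then show ?thesis using K0[OF True] by (simp add: K_def)
  next
    case False
    then have "R < \<bar>x\<bar>" by auto
    then show ?thesis using assms(2)[of x] K by simp
  qed
  have 2: "\<bar>h x\<bar> \<le> K" for x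
    using 1[of x] by (rule order_trans) (use K in \<open>simp add: indicator_def\<close>)
  have [measurable]: "h \<in> borel_measurable borel"
    using assms(1) by (rule borel_measurable_continuous_onI)
  have 3: "integrable lborel h"
  proof (rule Bochner_Integration.integrable_bound)
    show "integrable lborel (\<lambda>x. K * indicator {-R..R} x :: real)"
      by (intro integrable_mult_right integrable_real_indicator) (auto simp: emeasure_lborel_Icc_eq)
    show "AE x in lborel. norm (h x) \<le> norm (K * indicator {-R..R} x :: real)"
      using 1 by (auto intro!: AE_I2 order_trans[OF _ abs_ge_self])
  qed measurable
  show ?thesis
    by (rule that[OF K 2 1 L2_bounded_integrable[OF 3 2] 3])
qed

text \<open>Measurability yields continuous functions converging to \<open>f\<close> off a
  negligible set, but without any domination. Clamping the values to \<open>[-m, m]\<close> and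
  multiplying by a trapezoid that vanishes beyond \<open>m + 1\<close> keeps continuity and supplies
  a bounded, compactly supported majorant. First \<open>m\<close> is chosen to approximate
  \<open>f\<close>, then the index of the sequence.\<close>

lemma L2_dense_continuous:
  assumes "L2 f" "e > 0"
  obtains h R where "continuous_on UNIV h" "\<And>x. R < \<bar>x\<bar> \<Longrightarrow> h x = 0" "l2 (\<lambda>x. f x - h x) < e"
proof -
  have [measurable]: "f \<in> borel_measurable borel" using assms by (auto simp: L2_measurable)
  have "f measurable_on UNIV"
    by (rule lebesgue_measurable_imp_measurable_on) (auto intro: borel_measurable_if_D measurable_completion)
  then obtain N g where N: "negligible N" and g: "\<And>n::nat. continuous_on UNIV (g n)"
    and lim: "\<And>x. x \<notin> N \<Longrightarrow> (\<lambda>n. g n x) \<longlonglongrightarrow> f x"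
    unfolding measurable_on_def by auto
  have [measurable]: "g n \<in> borel_measurable borel" for n
    using g by (rule borel_measurable_continuous_onI)
  define cut where "cut m x = max 0 (min 1 (m + 1 - \<bar>x\<bar>))" for m x :: real
  define clamp where "clamp m x = max (-m) (min m x)" for m x :: real
  have [measurable]: "cut m \<in> borel_measurable borel" "clamp m \<in> borel_measurable borel" for m
    unfolding cut_def clamp_def by measurable
  have "(\<lambda>m. l2 (\<lambda>x. cut (real m) x * clamp (real m) (f x) - f x)) \<longlonglongrightarrow> 0"
  proof (rule l2_dominated[OF _ L2_abs[OF assms(1)]])
    fix m :: nat and x :: real
    have c: "0 \<le> cut (real m) x" "cut (real m) x \<le> 1" by (auto simp: cut_def)
    have "\<bar>c * clamp (real m) y - y\<bar> \<le> \<bar>y\<bar>" if "0 \<le> c" "c \<le> 1" for c y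
    proof (cases "y \<ge> 0")
      case True
      then have "0 \<le> clamp (real m) y" "clamp (real m) y \<le> y" by (auto simp: clamp_def)
      then have "0 \<le> c * clamp (real m) y" "c * clamp (real m) y \<le> 1 * y"
        using that by (intro mult_nonneg_nonneg mult_mono; simp)+
      then show ?thesis using True by simp
    next
      case False
      then have "0 \<le> - clamp (real m) y" "- clamp (real m) y \<le> - y" by (auto simp: clamp_def)
      then have "0 \<le> c * (- clamp (real m) y)" "c * (- clamp (real m) y) \<le> 1 * (- y)"
        using that False by (intro mult_nonneg_nonneg mult_mono; simp)+
      then show ?thesis using False by simp
    qed
    from this[OF c] show "\<bar>cut (real m) x * clamp (real m) (f x) - f x\<bar> \<le> \<bar>f x\<bar>" .
  next
    show "AE x in lborel. (\<lambda>m. cut (real m) x * clamp (real m) (f x)) \<longlonglongrightarrow> f x"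
    proof (rule AE_I2, rule tendsto_eventually)
      fix x
      obtain M :: nat where M: "\<bar>x\<bar> \<le> real M" "\<bar>f x\<bar> \<le> real M"
        using real_arch_simple[of "max \<bar>x\<bar> \<bar>f x\<bar>"] by auto
      show "\<forall>\<^sub>F m in sequentially. cut (real m) x * clamp (real m) (f x) = f x"
        using eventually_ge_at_top[of M]
        by eventually_elim (use M in \<open>auto simp: cut_def clamp_def abs_le_iff max_def min_def\<close>)
    qed
  qed measurable
  then obtain m :: nat where m: "l2 (\<lambda>x. cut (real m) x * clamp (real m) (f x) - f x) < e / 2"
    using assms(2) by (auto dest!: LIMSEQ_D[of _ 0 "e/2"])
  define W where "W = (\<lambda>x. 2 * real m * indicator {-(real m + 1)..real m + 1} x :: real)"
  have cl: "\<bar>clamp (real m) y\<bar> \<le> real m" for y by (auto simp: clamp_def)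
  have "(\<lambda>n. l2 (\<lambda>x. cut (real m) x * clamp (real m) (g n x) - cut (real m) x * clamp (real m) (f x)))
     \<longlonglongrightarrow> 0"
  proof (rule l2_dominated[where w = W])
    show "L2 W" unfolding W_def by (rule L2_indicator_interval)
    fix n :: nat and x :: real
    have "\<bar>cut (real m) x * (clamp (real m) (g n x) - clamp (real m) (f x))\<bar> \<le>
      indicator {-(real m + 1)..real m + 1} x * (2 * real m)"
      unfolding abs_mult
      by (intro mult_mono) (use cl[of "g n x"] cl[of "f x"] in \<open>auto simp: cut_def indicator_def\<close>)
    then show "\<bar>cut (real m) x * clamp (real m) (g n x) - cut (real m) x * clamp (real m) (f x)\<bar> \<le> W x"
      by (simp add: W_def algebra_simps)
  next
    have "AE x in lborel. x \<notin> N"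
      using N by (metis AE_completion_iff AE_not_in negligible_iff_null_sets)
    then show "AE x in lborel. (\<lambda>n. cut (real m) x * clamp (real m) (g n x))
       \<longlonglongrightarrow> cut (real m) x * clamp (real m) (f x)"
    proof eventually_elim
      fix x assume "x \<notin> N"
      then show "(\<lambda>n. cut (real m) x * clamp (real m) (g n x))
       \<longlonglongrightarrow> cut (real m) x * clamp (real m) (f x)"
        unfolding clamp_def by (intro tendsto_intros lim)
    qed
  qed measurable
  then obtain n :: nat where n: "l2 (\<lambda>x. cut (real m) x * clamp (real m) (g n x)
      - cut (real m) x * clamp (real m) (f x)) < e / 2"
    using assms(2) by (auto dest!: LIMSEQ_D[of _ 0 "e/2"])
  have h: "continuous_on UNIV (\<lambda>x. cut (real m) x * clamp (real m) (g n x))"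
    unfolding cut_def clamp_def by (intro continuous_intros g)
  have F: "L2 (\<lambda>x. cut (real m) x * clamp (real m) (f x))"
  proof (rule l2_mono[OF L2_indicator_interval[of "real m" "-(real m + 1)" "real m + 1"]])
    show "\<bar>cut (real m) x * clamp (real m) (f x)\<bar> \<le>
        \<bar>real m * indicator {- (real m + 1)..real m + 1} x\<bar>" for x
      unfolding abs_mult mult.commute[of "\<bar>real m\<bar>"]
      by (intro mult_mono) (use cl[of "f x"] in \<open>auto simp: cut_def indicator_def\<close>)
  qed measurable
  have h0: "cut (real m) x * clamp (real m) (g n x) = 0" if "real m + 1 < \<bar>x\<bar>" for x
    using that by (auto simp: cut_def)
  have H: "L2 (\<lambda>x. cut (real m) x * clamp (real m) (g n x))"
    by (rule L2_compact_support[of _ "real m + 1", OF h h0])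
  show ?thesis
  proof (rule that[OF h h0])
    show "l2 (\<lambda>x. f x - cut (real m) x * clamp (real m) (g n x)) < e"
      using l2_triangle_via[OF assms(1) F H] m n
        l2_commute[of f "\<lambda>x. cut (real m) x * clamp (real m) (f x)"]
        l2_commute[of "\<lambda>x. cut (real m) x * clamp (real m) (f x)"
           "\<lambda>x. cut (real m) x * clamp (real m) (g n x)"]
      by linarith
  qed
qed

text \<open>For continuous functions of compact support this is dominated convergence, since
  translates by less than 1 live on a common interval. In general two approximations of size
  \<open>e / 3\<close> are paid, translation being an isometry.\<close>

lemma L2_translation_continuous:
  assumes f: "L2 f"
  shows "((\<lambda>t. l2 (\<lambda>x. f (x - t) - f x)) \<longlongrightarrow> 0) (at 0)"
  unfolding tendsto_at_iff_sequentially comp_def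
proof (intro allI impI LIMSEQ_I)
  fix X :: "nat \<Rightarrow> real" and e :: real
  assume "X \<longlonglongrightarrow> 0" "e > 0"
  obtain h R where h: "continuous_on UNIV h" "\<And>x. R < \<bar>x\<bar> \<Longrightarrow> h x = 0"
      "l2 (\<lambda>x. f x - h x) < e / 3"
    by (rule L2_dense_continuous[OF f, of "e/3"]) (use \<open>e > 0\<close> in auto)
  obtain K where K: "K \<ge> 0" "\<And>x. \<bar>h x\<bar> \<le> K" "\<And>x. \<bar>h x\<bar> \<le> K * indicator {-R..R} x" "L2 h"
    by (rule L2_compact_support[of h R, OF h(1,2)]) (assumption | rule that)+
  obtain N where N: "\<And>n. n \<ge> N \<Longrightarrow> \<bar>X n\<bar> < 1"
    using LIMSEQ_D[OF \<open>X \<longlonglongrightarrow> 0\<close>, of 1] by auto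
  have "(\<lambda>n. l2 (\<lambda>x. h (x - X (n + N)) - h x)) \<longlonglongrightarrow> 0"
  proof (rule l2_dominated[where w="\<lambda>x. (2 * K) * indicator {-(R+1)..R+1} x"])
    show "L2 (\<lambda>x. (2 * K) * indicator {-(R+1)..R+1} x)" by (rule L2_indicator_interval)
    fix n x
    have "\<bar>h (x - X (n + N))\<bar> \<le> K * indicator {-(R+1)..R+1} x"
    proof (cases "x \<in> {-(R+1)..R+1}")
      case True
      then show ?thesis using K(2)[of "x - X (n + N)"] by simp
    next
      case False
      then have "R < \<bar>x - X (n + N)\<bar>" using N[of "n + N"] by auto
      then show ?thesis using h(2) K(1) by (simp add: indicator_def)
    qed
    moreover have "\<bar>h x\<bar> \<le> K * indicator {-(R+1)..R+1} x"
      using K(1) K(2)[of x] K(3)[of x] by (cases "x \<in> {-R..R}") (auto simp: indicator_def)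
    ultimately show "\<bar>h (x - X (n + N)) - h x\<bar> \<le> (2 * K) * indicator {-(R+1)..R+1} x"
      by linarith
  next
    show "AE x in lborel. (\<lambda>n. h (x - X (n + N))) \<longlonglongrightarrow> h x"
    proof (rule AE_I2)
      fix x
      have "(\<lambda>n. x - X (n + N)) \<longlonglongrightarrow> x - 0"
        by (intro tendsto_intros LIMSEQ_ignore_initial_segment \<open>X \<longlonglongrightarrow> 0\<close>)
      then show "(\<lambda>n. h (x - X (n + N))) \<longlonglongrightarrow> h x"
        using continuous_on_tendsto_compose[OF h(1), of "\<lambda>n. x - X (n + N)" x] by simp
    qed
  next
    have [measurable]: "h \<in> borel_measurable borel" using K(4) by (rule L2_measurable)
    show "h \<in> borel_measurable borel" "(\<lambda>x. h (x - X (n + N))) \<in> borel_measurable borel" for n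
      by measurable
  qed
  then have "(\<lambda>n. l2 (\<lambda>x. h (x - X n) - h x)) \<longlonglongrightarrow> 0"
    by (rule LIMSEQ_offset)
  from LIMSEQ_D[OF this, of "e/3"] \<open>e > 0\<close>
  have "\<exists>M. \<forall>n\<ge>M. l2 (\<lambda>x. h (x - X n) - h x) < e / 3" by simp
  then obtain M where M: "\<forall>n\<ge>M. l2 (\<lambda>x. h (x - X n) - h x) < e / 3"
    by (elim exE)
  show "\<exists>no. \<forall>n\<ge>no. norm (l2 (\<lambda>x. f (x - X n) - f x) - 0) < e"
  proof (intro exI[of _ M] allI impI)
    fix n assume "n \<ge> M"
    have "l2 (\<lambda>x. f (x - X n) - h (x - X n)) = l2 (\<lambda>x. f x - h x)"
      using l2_shift[of "\<lambda>x. f x - h x" "X n"] by simp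
    moreover have "l2 (\<lambda>x. f (x - X n) - f x) \<le> l2 (\<lambda>x. f (x - X n) - h (x - X n)) + l2 (\<lambda>x. h (x - X n) - f x)"
      by (intro l2_triangle_via L2_shift f K)
    moreover have "l2 (\<lambda>x. h (x - X n) - f x) \<le> l2 (\<lambda>x. h (x - X n) - h x) + l2 (\<lambda>x. h x - f x)"
      by (intro l2_triangle_via L2_shift f K)
    ultimately show "norm (l2 (\<lambda>x. f (x - X n) - f x) - 0) < e"
      using M[rule_format, OF \<open>n \<ge> M\<close>] h(3) l2_commute[of h f] l2_nonneg[of "\<lambda>x. f (x - X n) - f x"]
      by (simp only: real_norm_def abs_of_nonneg diff_zero)
  qed
qed

text \<open>Both mollification and the Poisson kernel at a small scale are controlled by this average
  of the modulus of continuity.\<close>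

lemma averaged_translation_tendsto_0:
  assumes f: "L2 f" and k: "integrable lborel k"
  shows "((\<lambda>a. LINT s|lborel. k s * (l2 (\<lambda>x. f (x - a * s) - f x))\<^sup>2) \<longlongrightarrow> 0) (at_right 0)"
  unfolding tendsto_at_iff_sequentially comp_def
proof (intro allI impI)
  fix X :: "nat \<Rightarrow> real"
  assume pos: "\<forall>i. X i \<in> {0<..} - {0}" and lim: "X \<longlonglongrightarrow> 0"
  have [measurable]: "f \<in> borel_measurable borel" "k \<in> borel_measurable borel"
    using f k by (auto simp: L2_measurable)
  have "(\<lambda>i. LINT s|lborel. k s * (l2 (\<lambda>x. f (x - X i * s) - f x))\<^sup>2)
     \<longlonglongrightarrow> (LINT s|(lborel::real measure). 0)"
  proof (rule integral_dominated_convergence)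
    show "integrable lborel (\<lambda>s. \<bar>k s\<bar> * (2 * l2 f)\<^sup>2)" using k by auto
    show "(\<lambda>s. k s * (l2 (\<lambda>x. f (x - X i * s) - f x))\<^sup>2) \<in> borel_measurable lborel" for i
      unfolding l2_square by measurable
    show "AE s in lborel. norm (k s * (l2 (\<lambda>x. f (x - X i * s) - f x))\<^sup>2) \<le> \<bar>k s\<bar> * (2 * l2 f)\<^sup>2" for i
    proof (intro AE_I2)
      fix s
      have "l2 (\<lambda>x. f (x - X i * s) - f x) \<le> 2 * l2 f"
        using l2_triangle_diff[OF L2_shift[OF f, of "X i * s"] f] by (simp add: l2_shift)
      then show "norm (k s * (l2 (\<lambda>x. f (x - X i * s) - f x))\<^sup>2) \<le> \<bar>k s\<bar> * (2 * l2 f)\<^sup>2"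
        using power_mono[of "l2 (\<lambda>x. f (x - X i * s) - f x)" "2 * l2 f" 2]
        by (simp add: abs_mult mult_left_mono)
    qed
    show "AE s in lborel. (\<lambda>i. k s * (l2 (\<lambda>x. f (x - X i * s) - f x))\<^sup>2) \<longlonglongrightarrow> 0"
    proof (intro AE_I2)
      fix s :: real
      have "(\<lambda>i. l2 (\<lambda>x. f (x - X i * s) - f x)) \<longlonglongrightarrow> 0"
      \<comment> \<open>The limit of the previous lemma is punctured at 0, so \<open>s = 0\<close>,
        where nothing is translated, is treated apart.\<close>
      proof (cases "s = 0")
        case False
        have "(\<lambda>i. X i * s) \<longlonglongrightarrow> 0" using tendsto_mult_right[OF lim, of s] by simp
        moreover have "X i * s \<noteq> 0" for i using pos[rule_format, of i] False by auto
        ultimately have "filterlim (\<lambda>i. X i * s) (at 0) sequentially"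
          by (auto simp: filterlim_at)
        from filterlim_compose[OF L2_translation_continuous[OF f] this] show ?thesis .
      qed (simp add: l2_def)
      from tendsto_mult_left[OF tendsto_power[OF this, of 2], of "k s"]
      show "(\<lambda>i. k s * (l2 (\<lambda>x. f (x - X i * s) - f x))\<^sup>2) \<longlonglongrightarrow> 0" by simp
    qed
  qed simp
  then show "(\<lambda>i. LINT s|lborel. k s * (l2 (\<lambda>x. f (x - X i * s) - f x))\<^sup>2) \<longlonglongrightarrow> 0" by simp
qed

subsection \<open>Smooth functions and mollification\<close>

text \<open>\<open>Cn n f\<close> says that \<open>f\<close> is \<open>n + 1\<close> times differentiable.\<close>

definition Cn :: "nat \<Rightarrow> (real \<Rightarrow> real) \<Rightarrow> bool" where
  "Cn n f \<longleftrightarrow> (\<forall>k\<le>n. \<forall>x. (deriv ^^ k) f differentiable (at x))"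

definition smooth :: "(real \<Rightarrow> real) \<Rightarrow> bool" where
  "smooth f \<longleftrightarrow> (\<forall>k x. (deriv ^^ k) f differentiable (at x))"

lemma smooth_iff_Cn: "smooth f \<longleftrightarrow> (\<forall>n. Cn n f)"
  by (auto simp: smooth_def Cn_def)

lemma Cn_0: "Cn 0 f \<longleftrightarrow> (\<forall>x. f differentiable (at x))"
  by (simp add: Cn_def)

lemma Cn_Suc: "Cn (Suc n) f \<longleftrightarrow> (\<forall>x. f differentiable (at x)) \<and> Cn n (deriv f)"
proof
  assume A: "Cn (Suc n) f"
  have "(deriv ^^ k) (deriv f) differentiable at x" if "k \<le> n" for k x
  proof -
    have "(deriv ^^ Suc k) f differentiable at x"
      using A that unfolding Cn_def by blast
    then show ?thesis by (simp only: funpow_Suc_right comp_def)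
  qed
  moreover have "f differentiable at x" for x
    using A unfolding Cn_def by (metis funpow_0 zero_le)
  ultimately show "(\<forall>x. f differentiable (at x)) \<and> Cn n (deriv f)" unfolding Cn_def by blast
next
  assume A: "(\<forall>x. f differentiable (at x)) \<and> Cn n (deriv f)"
  show "Cn (Suc n) f" unfolding Cn_def
  proof (intro allI impI)
    fix k x assume k: "k \<le> Suc n"
    show "(deriv ^^ k) f differentiable at x"
    proof (cases k)
      case (Suc j)
      then have "(deriv ^^ j) (deriv f) differentiable at x"
        using A k by (auto simp: Cn_def)
      then show ?thesis unfolding Suc by (simp only: funpow_Suc_right comp_def)
    qed (use A in simp)
  qed
qed

lemma deriv_eqI: "(\<And>x. (f has_real_derivative f' x) (at x)) \<Longrightarrow> deriv f = f'"
  by (auto simp: DERIV_imp_deriv)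

lemma Cn_0I: "(\<And>x. (f has_real_derivative f' x) (at x)) \<Longrightarrow> Cn 0 f"
  unfolding Cn_0 by (auto simp: real_differentiable_def)

lemma Cn_SucI:
  assumes "\<And>x. (f has_real_derivative f' x) (at x)" "Cn n f'"
  shows "Cn (Suc n) f"
  unfolding Cn_Suc using assms deriv_eqI[OF assms(1)] by (auto simp: real_differentiable_def)

lemma Cn_Suc_DERIV: "Cn n f \<Longrightarrow> (f has_real_derivative deriv f x) (at x)"
  using Cn_def[of n f] by (metis DERIV_deriv_iff_real_differentiable funpow_0 zero_le)

lemma Cn_SucD: "Cn (Suc n) f \<Longrightarrow> Cn n f"
  by (auto simp: Cn_def)

lemma smooth_DERIV: "smooth f \<Longrightarrow> (f has_real_derivative deriv f x) (at x)"
  unfolding smooth_iff_Cn using Cn_Suc_DERIV by blast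

lemma smooth_deriv: "smooth f \<Longrightarrow> smooth (deriv f)"
  unfolding smooth_iff_Cn using Cn_Suc by blast

lemma smooth_continuous: "smooth f \<Longrightarrow> continuous_on A f"
  by (meson DERIV_continuous_on has_field_derivative_at_within smooth_DERIV)

lemma smooth_measurable: "smooth f \<Longrightarrow> f \<in> borel_measurable borel"
  by (rule borel_measurable_continuous_onI) (rule smooth_continuous)

lemma smooth_of_DERIV:
  assumes "\<And>x. (f has_real_derivative f' x) (at x)" "smooth f'"
  shows "smooth f"
  unfolding smooth_iff_Cn
proof
  fix n show "Cn n f"
    using assms by (cases n) (auto simp: smooth_iff_Cn intro: Cn_0I Cn_SucI)
qed

lemma Cn_const: "Cn n (\<lambda>x. c)"
proof (induction n arbitrary: c)
  case (Suc n)
  show ?case by (rule Cn_SucI[where f'="\<lambda>x. 0"]) (auto intro!: derivative_eq_intros Suc)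
qed (auto simp: Cn_0)

lemma smooth_const: "smooth (\<lambda>x. c)"
  by (simp add: smooth_iff_Cn Cn_const)

lemma smooth_ident: "smooth (\<lambda>x. x)"
  by (rule smooth_of_DERIV[where f'="\<lambda>_. 1"]) (auto intro!: derivative_eq_intros smooth_const)

lemma Cn_add: "Cn n f \<Longrightarrow> Cn n g \<Longrightarrow> Cn n (\<lambda>x. f x + g x)"
proof (induction n arbitrary: f g)
  case 0
  then show ?case by (auto simp: Cn_0 intro!: derivative_intros)
next
  case (Suc n)
  show ?case
    by (rule Cn_SucI[where f'="\<lambda>x. deriv f x + deriv g x"])
      (use Suc Cn_Suc in \<open>auto intro!: DERIV_add Cn_Suc_DERIV\<close>)
qed

lemma Cn_mult: "Cn n f \<Longrightarrow> Cn n g \<Longrightarrow> Cn n (\<lambda>x. f x * g x)"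
proof (induction n arbitrary: f g)
  case 0
  then show ?case by (auto simp: Cn_0 intro!: derivative_intros)
next
  case (Suc n)
  have "Cn n f" "Cn n g" "Cn n (deriv f)" "Cn n (deriv g)"
    using Suc.prems Cn_SucD Cn_Suc by auto
  then have "Cn n (\<lambda>x. deriv f x * g x + deriv g x * f x)"
    by (intro Cn_add Suc.IH)
  then show ?case
    by (rule Cn_SucI[rotated]) (auto intro!: DERIV_mult Cn_Suc_DERIV[OF Suc.prems(1)] Cn_Suc_DERIV[OF Suc.prems(2)])
qed

lemma smooth_mult: "smooth f \<Longrightarrow> smooth g \<Longrightarrow> smooth (\<lambda>x. f x * g x)"
  by (simp add: smooth_iff_Cn Cn_mult)

lemma Cn_affine: "Cn n f \<Longrightarrow> Cn n (\<lambda>x. f (a * x + b))"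
proof (induction n arbitrary: f)
  case 0
  have "((\<lambda>x. f (a * x + b)) has_real_derivative deriv f (a * x + b) * a) (at x)" for x
    by (rule DERIV_chain2[OF Cn_Suc_DERIV[OF 0]]) (auto intro!: derivative_eq_intros)
  then show ?case by (rule Cn_0I)
next
  case (Suc n)
  have "((\<lambda>x. f (a * x + b)) has_real_derivative deriv f (a * x + b) * a) (at x)" for x
    by (rule DERIV_chain2[OF Cn_Suc_DERIV[OF Suc.prems]]) (auto intro!: derivative_eq_intros)
  moreover have "Cn n (\<lambda>x. deriv f (a * x + b) * a)"
    using Suc by (intro Cn_mult Cn_const Suc.IH) (simp add: Cn_Suc)
  ultimately show ?case by (rule Cn_SucI)
qed

lemma smooth_affine: "smooth f \<Longrightarrow> smooth (\<lambda>x. f (a * x + b))"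
  by (simp add: smooth_iff_Cn Cn_affine)

lemma test_fun_iff: "test_fun f \<longleftrightarrow> smooth f \<and> (\<exists>R. \<forall>x. R < \<bar>x\<bar> \<longrightarrow> f x = 0)"
  by (simp add: test_fun_def smooth_def)

lemma test_fun_smooth: "test_fun f \<Longrightarrow> smooth f"
  by (simp add: test_fun_iff)

lemma test_fun_deriv:
  assumes "test_fun f" shows "test_fun (deriv f)"
proof -
  from assms obtain R where R: "\<forall>x. R < \<bar>x\<bar> \<longrightarrow> f x = 0" and f: "smooth f"
    by (auto simp: test_fun_iff)
  have "deriv f x = 0" if x: "R < \<bar>x\<bar>" for x
  proof -
    have "open {x::real. R < \<bar>x\<bar>}" by (intro open_Collect_less continuous_intros)
    then have "eventually (\<lambda>y. R < \<bar>y\<bar>) (nhds x)" using x by (auto simp: eventually_nhds)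
    then have "eventually (\<lambda>y. f y = 0) (nhds x)" by eventually_elim (use R in auto)
    then have "deriv f x = deriv (\<lambda>_. 0) x" by (rule deriv_cong_ev) simp
    then show ?thesis by simp
  qed
  then show ?thesis using f by (auto simp: test_fun_iff smooth_deriv)
qed

lemma test_fun_mult_smooth:
  assumes "test_fun f" "smooth g" shows "test_fun (\<lambda>x. f x * g x)"
  using assms by (auto simp: test_fun_iff smooth_mult)

lemma test_fun_cmult:
  assumes "test_fun f" shows "test_fun (\<lambda>x. c * f x)"
  using test_fun_mult_smooth[OF assms smooth_const[of c]] by (simp add: mult.commute)

lemma test_fun_affine:
  assumes f: "test_fun f" and a: "a \<noteq> 0" shows "test_fun (\<lambda>x. f (a * x + b))"
proof -
  from f obtain R where R: "\<forall>x. R < \<bar>x\<bar> \<longrightarrow> f x = 0" by (auto simp: test_fun_iff)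
  have "f (a * x + b) = 0" if "(\<bar>R\<bar> + \<bar>b\<bar>) / \<bar>a\<bar> < \<bar>x\<bar>" for x
  proof -
    have "\<bar>R\<bar> + \<bar>b\<bar> < \<bar>a * x\<bar>" using that a by (simp add: divide_less_eq abs_mult mult.commute)
    then have "R < \<bar>a * x + b\<bar>" by linarith
    then show ?thesis using R by auto
  qed
  then show ?thesis using f by (auto simp: test_fun_iff smooth_affine)
qed

lemma test_fun_bounded:
  assumes "test_fun f"
  obtains K R where "K \<ge> 0" "\<And>x. \<bar>f x\<bar> \<le> K" "\<And>x. \<bar>f x\<bar> \<le> K * indicator {-R..R} x"
    "L2 f" "integrable lborel f"
proof -
  from assms obtain R where R: "\<And>x. R < \<bar>x\<bar> \<Longrightarrow> f x = 0" and f: "smooth f"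
    by (auto simp: test_fun_iff)
  show ?thesis
    by (rule L2_compact_support[of f R, OF smooth_continuous[OF f] R]) (assumption | rule that)+
qed

lemma test_fun_L2: "test_fun f \<Longrightarrow> L2 f"
  by (rule test_fun_bounded)

lemma test_fun_integrable: "test_fun f \<Longrightarrow> integrable lborel f"
  by (rule test_fun_bounded)

lemma test_fun_continuous: "test_fun f \<Longrightarrow> continuous_on A f"
  by (intro smooth_continuous test_fun_smooth)

lemma test_fun_measurable [measurable_dest]: "test_fun f \<Longrightarrow> f \<in> borel_measurable borel"
  by (intro smooth_measurable test_fun_smooth)

lemma test_fun_DERIV: "test_fun f \<Longrightarrow> (f has_real_derivative deriv f x) (at x)"
  by (intro smooth_DERIV test_fun_smooth)

section \<open>A smooth bump of compact support\<close>

lemma tendsto_exp_neg_inverse_over_power: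
  "((\<lambda>x::real. exp (- 1 / x) / x ^ k) \<longlongrightarrow> 0) (at_right 0)"
proof -
  have "((\<lambda>x::real. (inverse x) ^ k / exp (inverse x)) \<longlongrightarrow> 0) (at_right 0)"
    by (rule filterlim_compose[OF tendsto_power_div_exp_0 filterlim_inverse_at_top_right])
  moreover have "(inverse x) ^ k / exp (inverse x) = exp (- 1 / x) / x ^ k" for x :: real
    by (simp add: field_simps exp_minus)
  ultimately show ?thesis by simp
qed

text \<open>The classical function that is flat at 0, divided by a power. The family over all
  \<open>k\<close> is closed under differentiation up to linear combinations, so a single induction
  with \<open>k\<close> arbitrary gives smoothness.\<close>

definition flat :: "nat \<Rightarrow> real \<Rightarrow> real" where
  "flat k x = (if x > 0 then exp (- 1 / x) / x ^ k else 0)"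

lemma flat_tendsto_0: "(flat k \<longlongrightarrow> 0) (at 0)"
proof (rule filterlim_split_at)
  show "(flat k \<longlongrightarrow> 0) (at_left 0)"
    by (rule tendsto_eventually)
      (auto simp: flat_def eventually_at_filter intro!: always_eventually)
  have "eventually (\<lambda>x. exp (- 1 / x) / x ^ k = flat k x) (at_right (0::real))"
    by (auto simp: flat_def eventually_at_filter intro!: always_eventually)
  then show "(flat k \<longlongrightarrow> 0) (at_right 0)"
    by (rule Lim_transform_eventually[OF tendsto_exp_neg_inverse_over_power])
qed

text \<open>At 0 the difference quotient of \<open>flat k\<close> is \<open>flat (Suc k)\<close>
  itself, which tends to 0. Away from 0 the function agrees locally with 0 or with an elementary
  expression.\<close>

lemma flat_DERIV:
  "(flat k has_real_derivative (flat (k + 2) x - real k * flat (k + 1) x)) (at x)"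
proof (cases x "0::real" rule: linorder_cases)
  case less
  have "((\<lambda>x. 0) has_real_derivative 0) (at x)" by simp
  then have "(flat k has_real_derivative 0) (at x)"
    by (rule has_field_derivative_transform_within_open[of _ _ _ "{..<0}"])
      (use less in \<open>auto simp: flat_def\<close>)
  then show ?thesis using less by (simp add: flat_def)
next
  case equal
  have "((\<lambda>h. (flat k (0 + h) - flat k 0) / h) \<longlongrightarrow> 0) (at 0)"
  proof (rule Lim_transform_eventually[OF flat_tendsto_0[of "Suc k"]])
    show "eventually (\<lambda>h. flat (Suc k) h = (flat k (0 + h) - flat k 0) / h) (at 0)"
      by (auto simp: flat_def eventually_at_filter intro!: always_eventually)
  qed
  then show ?thesis unfolding DERIV_def using equal by (simp add: flat_def)
next
  case greater
  have "((\<lambda>x. exp (- 1 / x) / x ^ k) has_real_derivative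
     ((exp (- 1 / x) * (1 / x\<^sup>2)) * x ^ k - exp (- 1 / x) * (real k * x ^ (k - Suc 0))) / (x ^ k * x ^ k)) (at x)"
    using greater
    by (auto intro!: derivative_eq_intros simp: power2_eq_square field_simps)
  moreover have "((exp (- 1 / x) * (1 / x\<^sup>2)) * x ^ k - exp (- 1 / x) * (real k * x ^ (k - Suc 0))) / (x ^ k * x ^ k)
      = flat (k + 2) x - real k * flat (k + 1) x"
    using greater by (cases k) (auto simp: flat_def field_simps power2_eq_square)
  ultimately have "((\<lambda>x. exp (- 1 / x) / x ^ k) has_real_derivative
      (flat (k + 2) x - real k * flat (k + 1) x)) (at x)" by simp
  then show ?thesis
    by (rule has_field_derivative_transform_within_open[of _ _ _ "{0<..}"])
      (use greater in \<open>auto simp: flat_def\<close>)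
qed

lemma smooth_flat: "smooth (flat k)"
  unfolding smooth_iff_Cn
proof
  fix n show "Cn n (flat k)"
  proof (induction n arbitrary: k)
    case 0
    show ?case by (rule Cn_0I[OF flat_DERIV])
  next
    case (Suc n)
    have "Cn n (\<lambda>x. flat (k + 2) x + (- real k) * flat (k + 1) x)"
      by (intro Cn_add Cn_mult Cn_const Suc)
    then have "Cn n (\<lambda>x. flat (k + 2) x - real k * flat (k + 1) x)" by simp
    then show ?case by (rule Cn_SucI[OF flat_DERIV])
  qed
qed

lemma ex_bump:
  obtains \<rho> where "test_fun \<rho>" "\<And>x. 0 \<le> \<rho> x" "\<rho> 0 > 0" "(LINT x|lborel. \<rho> x) = 1"
proof -
  \<comment> \<open>Each factor is flat at one endpoint of \<open>[-1, 1]\<close>; the arguments are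
    written as affine maps to match \<open>smooth_affine\<close>.\<close>
  define b where "b x = flat 0 (1 * x + 1) * flat 0 ((-1) * x + 1)" for x
  have "smooth b" unfolding b_def by (intro smooth_mult smooth_affine smooth_flat)
  moreover have "b x = 0" if "1 < \<bar>x\<bar>" for x
    using that by (auto simp: b_def flat_def)
  ultimately have t: "test_fun b" by (auto simp: test_fun_iff)
  have pos: "0 \<le> b x" for x by (simp add: b_def flat_def)
  have b0: "0 < b 0" by (simp add: b_def flat_def)
  have "0 \<le> (LINT x|lborel. b x)" by (simp add: pos)
  moreover have "(LINT x|lborel. b x) \<noteq> 0"
  proof
    assume "(LINT x|lborel. b x) = 0"
    then have "AE x in lborel. b x = 0"
      using integral_nonneg_eq_0_iff_AE[OF test_fun_integrable[OF t]] pos by simp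
    moreover have "0 < b x" if "x \<in> {-1<..<1}" for x
      using that by (auto simp: b_def flat_def)
    ultimately have "AE x in lborel. x \<notin> {-1<..<1::real}"
      by (auto elim!: eventually_mono) (metis less_irrefl)
    then have "{-1<..<1::real} \<in> null_sets lborel"
      by (subst AE_iff_null_sets) auto
    then show False by (auto simp: null_sets_def)
  qed
  ultimately have I: "0 < (LINT x|lborel. b x)" by simp
  show ?thesis
  proof (rule that[of "\<lambda>x. inverse (LINT x|lborel. b x) * b x"])
    show "(LINT x|lborel. inverse (LINT x|lborel. b x) * b x) = 1"
      using I by simp
  qed (use I pos b0 test_fun_cmult[OF t] in auto)
qed

section \<open>Mollification and density of test functions\<close>

definition conv :: "(real \<Rightarrow> real) \<Rightarrow> (real \<Rightarrow> real) \<Rightarrow> real \<Rightarrow> real" where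
  "conv k f x = (LINT y|lborel. k (x - y) * f y)"

definition dilate :: "real \<Rightarrow> (real \<Rightarrow> real) \<Rightarrow> real \<Rightarrow> real" where
  "dilate a k z = k (z / a) / a"

lemma conv_measurable [measurable]:
  assumes [measurable]: "k \<in> borel_measurable borel" "f \<in> borel_measurable borel"
  shows "conv k f \<in> borel_measurable borel"
  unfolding conv_def by measurable

lemma lipschitz_of_DERIV:
  fixes f :: "real \<Rightarrow> real"
  assumes "\<And>x. (f has_real_derivative f' x) (at x)" "\<And>x. \<bar>f' x\<bar> \<le> K"
  shows "\<bar>f a - f b\<bar> \<le> K * \<bar>a - b\<bar>"
  using field_differentiable_bound[of UNIV f f' K a b] assms by auto

text \<open>The difference quotients of the kernel converge in \<open>L2\<close>, being bounded by
  the Lipschitz constant on a common interval, so pairing with \<open>f\<close> passes to the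
  limit.\<close>

lemma conv_DERIV:
  assumes \<rho>: "test_fun \<rho>" and f: "L2 f"
  shows "(conv \<rho> f has_real_derivative conv (deriv \<rho>) f x) (at x)"
  unfolding DERIV_def tendsto_at_iff_sequentially comp_def
proof (intro allI impI)
  fix h :: "nat \<Rightarrow> real"
  assume h0: "\<forall>i. h i \<in> UNIV - {0}" and lim: "h \<longlonglongrightarrow> 0"
  have \<rho>': "test_fun (deriv \<rho>)" using \<rho> by (rule test_fun_deriv)
  obtain K where K: "K \<ge> 0" "\<And>x. \<bar>deriv \<rho> x\<bar> \<le> K"
    by (rule test_fun_bounded[OF \<rho>']) (rule that)
  obtain R where R: "\<And>x. R < \<bar>x\<bar> \<Longrightarrow> \<rho> x = 0" using \<rho> by (auto simp: test_fun_iff)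
  obtain R' where R': "\<And>x. R' < \<bar>x\<bar> \<Longrightarrow> deriv \<rho> x = 0" using \<rho>' by (auto simp: test_fun_iff)
  obtain N where N: "\<And>n. n \<ge> N \<Longrightarrow> \<bar>h n\<bar> < 1"
    using LIMSEQ_D[OF lim, of 1] by auto
  \<comment> \<open>The extra 1 absorbs the shift \<open>h (n + N)\<close>, so that all quotients
    vanish outside one interval.\<close>
  define S where "S = max R R' + 1"
  define q where "q n y = (\<rho> (x + h (n + N) - y) - \<rho> (x - y)) / h (n + N)" for n y
  have [measurable]: "\<rho> \<in> borel_measurable borel" "deriv \<rho> \<in> borel_measurable borel"
    using \<rho> \<rho>' by (auto simp: test_fun_measurable)
  have "continuous_on UNIV (\<lambda>y. \<rho> (x + c - y))" for c
    by (intro continuous_on_compose2[OF test_fun_continuous[OF \<rho>, of UNIV]] continuous_intros) auto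
  have L\<rho>: "L2 (\<lambda>y. \<rho> (c - y))" for c by (intro L2_reflect_shift test_fun_L2 \<rho>)
  have Lq: "L2 (q n)" for n
    using L2_cmult[OF L2_diff[OF L\<rho>[of "x + h (n + N)"] L\<rho>[of x]], of "1 / h (n + N)"]
    by (simp add: q_def[abs_def])
  have "(\<lambda>n. l2 (\<lambda>y. q n y - deriv \<rho> (x - y))) \<longlonglongrightarrow> 0"
  proof (rule l2_dominated[where w="\<lambda>y. 2 * K * indicator {x - S..x + S} y"])
    show "L2 (\<lambda>y. 2 * K * indicator {x - S..x + S} y)" by (rule L2_indicator_interval)
    show "q n \<in> borel_measurable borel" for n using Lq by (rule L2_measurable)
    show "(\<lambda>y. deriv \<rho> (x - y)) \<in> borel_measurable borel" by measurable
    show "\<bar>q n y - deriv \<rho> (x - y)\<bar> \<le> 2 * K * indicator {x - S..x + S} y" for n y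
    proof (cases "y \<in> {x - S..x + S}")
      case True
      have "\<bar>\<rho> (x + h (n + N) - y) - \<rho> (x - y)\<bar> \<le> K * \<bar>(x + h (n + N) - y) - (x - y)\<bar>"
        by (rule lipschitz_of_DERIV[OF test_fun_DERIV[OF \<rho>] K(2)])
      then have "\<bar>q n y\<bar> \<le> K"
        using h0 unfolding q_def by (simp add: divide_le_eq)
      then show ?thesis using True K(2)[of "x - y"] by simp
    next
      case False
      then have "R < \<bar>x + h (n + N) - y\<bar>" "R < \<bar>x - y\<bar>" "R' < \<bar>x - y\<bar>"
        using N[of "n + N"] by (auto simp: S_def)
      then show ?thesis using False R R' by (simp add: q_def)
    qed
    show "AE y in lborel. (\<lambda>n. q n y) \<longlonglongrightarrow> deriv \<rho> (x - y)"
    proof (rule AE_I2)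
      fix y
      have "((\<lambda>h. (\<rho> (x - y + h) - \<rho> (x - y)) / h) \<longlongrightarrow> deriv \<rho> (x - y)) (at 0)"
        using test_fun_DERIV[OF \<rho>, of "x - y"] unfolding DERIV_def .
      then have "((\<lambda>n. (\<rho> (x - y + h n) - \<rho> (x - y)) / h n) \<longlongrightarrow> deriv \<rho> (x - y)) sequentially"
        using h0 lim unfolding tendsto_at_iff_sequentially comp_def by blast
      from LIMSEQ_ignore_initial_segment[OF this, of N]
      show "(\<lambda>n. q n y) \<longlonglongrightarrow> deriv \<rho> (x - y)"
        unfolding q_def by (simp add: algebra_simps)
    qed
  qed
  then have "(\<lambda>n. LINT y|lborel. q n y * f y) \<longlonglongrightarrow> (LINT y|lborel. deriv \<rho> (x - y) * f y)"
    by (intro L2_tendsto_pairing Lq f L2_reflect_shift test_fun_L2 \<rho>') auto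
  moreover have "(LINT y|lborel. q n y * f y) = (conv \<rho> f (x + h (n + N)) - conv \<rho> f x) / h (n + N)" for n
  proof -
    have "(LINT y|lborel. q n y * f y)
       = (LINT y|lborel. (\<rho> (x + h (n + N) - y) * f y - \<rho> (x - y) * f y) / h (n + N))"
      by (intro Bochner_Integration.integral_cong) (auto simp: q_def left_diff_distrib)
    also have "\<dots> = (conv \<rho> f (x + h (n + N)) - conv \<rho> f x) / h (n + N)"
      unfolding conv_def integral_divide_zero
      by (subst Bochner_Integration.integral_diff) (intro L2_mult_integrable L\<rho> f refl)+
    finally show ?thesis .
  qed
  ultimately have "(\<lambda>n. (conv \<rho> f (x + h (n + N)) - conv \<rho> f x) / h (n + N)) \<longlonglongrightarrow> conv (deriv \<rho>) f x"
    by (simp add: conv_def)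
  then show "(\<lambda>n. (conv \<rho> f (x + h n) - conv \<rho> f x) / h n) \<longlonglongrightarrow> conv (deriv \<rho>) f x"
    by (rule LIMSEQ_offset)
qed

lemma smooth_conv:
  assumes "test_fun \<rho>" and f: "L2 f" shows "smooth (conv \<rho> f)"
  unfolding smooth_iff_Cn
proof
  fix n show "Cn n (conv \<rho> f)"
    using assms(1)
  proof (induction n arbitrary: \<rho>)
    case 0
    show ?case by (rule Cn_0I[OF conv_DERIV[OF 0 f]])
  next
    case (Suc n)
    show ?case by (rule Cn_SucI[OF conv_DERIV[OF Suc.prems f]]) (intro Suc.IH test_fun_deriv Suc.prems)
  qed
qed

lemma conv_dilate:
  assumes "a > 0"
  shows "conv (dilate a k) f x = (LINT s|lborel. k s * f (x - a * s))"
proof -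
  have "conv (dilate a k) f x = \<bar>- a\<bar> *\<^sub>R (LINT s|lborel. dilate a k (x - (x + (-a) * s)) * f (x + (-a) * s))"
    unfolding conv_def by (rule lborel_integral_real_affine) (use assms in auto)
  also have "\<dots> = (LINT s|lborel. a * (dilate a k (a * s) * f (x - a * s)))"
    using assms by simp
  also have "\<dots> = (LINT s|lborel. k s * f (x - a * s))"
    using assms by (intro Bochner_Integration.integral_cong) (auto simp: dilate_def)
  finally show ?thesis .
qed

text \<open>Jensen's inequality for a probability density: the variance of \<open>d\<close> about
  its weighted mean is nonnegative.\<close>

lemma weighted_mean_square_le:
  fixes k d :: "'a \<Rightarrow> real"
  assumes k: "integrable M k" "\<And>x. 0 \<le> k x" "(LINT x|M. k x) = 1"
    and [measurable]: "d \<in> borel_measurable M" and d: "integrable M (\<lambda>x. k x * (d x)\<^sup>2)"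
  shows "integrable M (\<lambda>x. k x * d x)" "(LINT x|M. k x * d x)\<^sup>2 \<le> (LINT x|M. k x * (d x)\<^sup>2)"
proof -
  have [measurable]: "k \<in> borel_measurable M" using k by auto
  show i: "integrable M (\<lambda>x. k x * d x)"
  proof (rule Bochner_Integration.integrable_bound)
    show "integrable M (\<lambda>x. k x + k x * (d x)\<^sup>2)" using k d by auto
    have "\<bar>d x\<bar> \<le> 1 + (d x)\<^sup>2" for x
      using sum_squares_bound[of 1 "\<bar>d x\<bar>"] by (simp add: power2_abs)
    then have "k x * \<bar>d x\<bar> \<le> k x * (1 + (d x)\<^sup>2)" for x by (intro mult_left_mono k)
    then show "AE x in M. norm (k x * d x) \<le> norm (k x + k x * (d x)\<^sup>2)"
      using k(2) by (auto simp: abs_mult algebra_simps intro!: AE_I2)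
  qed measurable
  define m where "m = (LINT x|M. k x * d x)"
  have "0 \<le> (LINT x|M. k x * (d x - m)\<^sup>2)"
    by (intro Bochner_Integration.integral_nonneg) (simp add: k)
  also have "\<dots> = (LINT x|M. k x * (d x)\<^sup>2 - 2 * m * (k x * d x) + m\<^sup>2 * k x)"
    by (intro Bochner_Integration.integral_cong) (auto simp: power2_eq_square algebra_simps)
  also have "\<dots> = (LINT x|M. k x * (d x)\<^sup>2) - 2 * m * m + m\<^sup>2 * 1"
    using i d k by (simp add: m_def)
  finally show "(LINT x|M. k x * d x)\<^sup>2 \<le> (LINT x|M. k x * (d x)\<^sup>2)"
    by (simp add: m_def power2_eq_square)
qed

text \<open>As the kernel has mass 1, the error at \<open>x\<close> is a weighted mean of
  \<open>f (x - a * s) - f x\<close>. Jensen bounds its square by the mean of the squares, and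
  Fubini integrates that bound in \<open>x\<close> first.\<close>

lemma conv_approx:
  assumes k: "integrable lborel k" "\<And>x. 0 \<le> k x" "(LINT x|lborel. k x) = 1"
    and f: "L2 f" and a: "a > 0"
  shows "L2 (\<lambda>x. conv (dilate a k) f x - f x)"
    "(l2 (\<lambda>x. conv (dilate a k) f x - f x))\<^sup>2
       \<le> (LINT s|lborel. k s * (l2 (\<lambda>x. f (x - a * s) - f x))\<^sup>2)"
proof -
  have [measurable]: "k \<in> borel_measurable borel" "f \<in> borel_measurable borel"
    using k f by (auto simp: L2_measurable)
  have [measurable]: "dilate a k \<in> borel_measurable borel" unfolding dilate_def by measurable
  define D where "D s x = f (x - a * s) - f x" for s x
  have [measurable]: "(\<lambda>(s, x). D s x) \<in> borel_measurable (lborel \<Otimes>\<^sub>M lborel)"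
    "\<And>x. (\<lambda>s. D s x) \<in> borel_measurable borel" "\<And>x. (\<lambda>s. D x s) \<in> borel_measurable borel"
    unfolding D_def by measurable
  have LD: "L2 (D s)" for s unfolding D_def by (intro L2_diff L2_shift f)
  have lD: "(l2 (D s))\<^sup>2 \<le> (2 * l2 f)\<^sup>2" for s
    using l2_triangle_diff[OF L2_shift[OF f, of "a * s"] f]
    unfolding D_def[abs_def] by (intro power_mono) (auto simp: l2_shift)
  have [measurable]: "(\<lambda>s. (l2 (D s))\<^sup>2) \<in> borel_measurable borel"
    unfolding l2_square D_def by measurable
  have ik: "integrable lborel (\<lambda>s. k s * (l2 (D s))\<^sup>2)"
  proof (rule Bochner_Integration.integrable_bound)
    show "integrable lborel (\<lambda>s. k s * (2 * l2 f)\<^sup>2)" using k by auto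
    show "AE s in lborel. norm (k s * (l2 (D s))\<^sup>2) \<le> norm (k s * (2 * l2 f)\<^sup>2)"
      using mult_left_mono[OF lD k(2)] k(2) by (auto simp: abs_mult)
  qed measurable
  have int: "integrable (lborel \<Otimes>\<^sub>M lborel) (\<lambda>(s, x). k s * (D s x)\<^sup>2)"
  proof (rule lborel_pair.Fubini_integrable)
    show "integrable lborel (\<lambda>s. LINT x|lborel. norm (case (s, x) of (s, x) \<Rightarrow> k s * (D s x)\<^sup>2))"
      using ik k(2) by (simp add: l2_square abs_mult)
    show "AE s in lborel. integrable lborel (\<lambda>x. case (s, x) of (s, x) \<Rightarrow> k s * (D s x)\<^sup>2)"
      using L2_square_integrable[OF LD] by simp
  qed measurable
  have AE1: "AE x in lborel. integrable lborel (\<lambda>s. k s * (D s x)\<^sup>2)"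
    and int2: "integrable lborel (\<lambda>x. LINT s|lborel. k s * (D s x)\<^sup>2)"
    and eq2: "(LINT x|lborel. LINT s|lborel. k s * (D s x)\<^sup>2)
       = (LINT s|lborel. LINT x|lborel. k s * (D s x)\<^sup>2)"
    using lborel_pair.AE_integrable_snd[OF int] lborel_pair.integrable_snd[OF int]
      lborel_pair.Fubini_integral[OF int] by auto
  have AE2: "AE x in lborel. (conv (dilate a k) f x - f x)\<^sup>2 \<le> (LINT s|lborel. k s * (D s x)\<^sup>2)"
    using AE1
  proof eventually_elim
    fix x assume i: "integrable lborel (\<lambda>s. k s * (D s x)\<^sup>2)"
    note J = weighted_mean_square_le[OF k _ i]
    have "conv (dilate a k) f x = (LINT s|lborel. k s * D s x + k s * f x)"
      unfolding conv_dilate[OF a] by (simp add: D_def algebra_simps)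
    also have "\<dots> = (LINT s|lborel. k s * D s x) + f x"
      using J(1) k by simp
    finally show "(conv (dilate a k) f x - f x)\<^sup>2 \<le> (LINT s|lborel. k s * (D s x)\<^sup>2)"
      using J(2) by simp
  qed
  show L: "L2 (\<lambda>x. conv (dilate a k) f x - f x)"
  proof (rule L2I)
    show "integrable lborel (\<lambda>x. (conv (dilate a k) f x - f x)\<^sup>2)"
      by (rule Bochner_Integration.integrable_bound[OF int2]) (use AE2 in auto)
  qed measurable
  have "(l2 (\<lambda>x. conv (dilate a k) f x - f x))\<^sup>2 \<le> (LINT x|lborel. LINT s|lborel. k s * (D s x)\<^sup>2)"
    unfolding l2_square by (rule integral_mono_AE[OF L2_square_integrable[OF L] int2 AE2])
  then show "(l2 (\<lambda>x. conv (dilate a k) f x - f x))\<^sup>2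
       \<le> (LINT s|lborel. k s * (l2 (\<lambda>x. f (x - a * s) - f x))\<^sup>2)"
    unfolding eq2 by (simp add: l2_square D_def)
qed

lemma conv_approx_tendsto:
  assumes k: "integrable lborel k" "\<And>x. 0 \<le> k x" "(LINT x|lborel. k x) = 1" and f: "L2 f"
  shows "((\<lambda>a. l2 (\<lambda>x. conv (dilate a k) f x - f x)) \<longlongrightarrow> 0) (at_right 0)"
proof -
  have 1: "((\<lambda>a. sqrt (LINT s|lborel. k s * (l2 (\<lambda>x. f (x - a * s) - f x))\<^sup>2)) \<longlongrightarrow> sqrt 0) (at_right 0)"
    by (intro tendsto_real_sqrt averaged_translation_tendsto_0 f k)
  have 2: "eventually (\<lambda>a. norm (l2 (\<lambda>x. conv (dilate a k) f x - f x))
     \<le> sqrt (LINT s|lborel. k s * (l2 (\<lambda>x. f (x - a * s) - f x))\<^sup>2)) (at_right 0)"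
    using eventually_at_right_less
    by eventually_elim (auto intro!: real_le_rsqrt conv_approx k f)
  show ?thesis
    using Lim_null_comparison[OF 2] 1 by simp
qed

text \<open>Mollify, then cut off at a scale tending to infinity. The mollified function has the
  mollified weak derivative as its derivative, and the derivative of the cutoff carries a factor
  tending to 0.\<close>

lemma H1_dense:
  assumes f: "L2 f" and g: "L2 g" and w: "weak_deriv f g"
  obtains \<psi> where "\<And>n::nat. test_fun (\<psi> n)" "(\<lambda>n. l2 (\<lambda>x. \<psi> n x - f x)) \<longlonglongrightarrow> 0"
    "(\<lambda>n. l2 (\<lambda>x. deriv (\<psi> n) x - g x)) \<longlonglongrightarrow> 0"
proof -
  obtain \<rho> where \<rho>: "test_fun \<rho>" "\<And>x. 0 \<le> \<rho> x" "\<rho> 0 > 0" "(LINT x|lborel. \<rho> x) = 1"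
    by (rule ex_bump) (rule that)
  define \<epsilon> where "\<epsilon> n = 1 / real (Suc n)" for n
  have \<epsilon>: "0 < \<epsilon> n" for n by (simp add: \<epsilon>_def)
  have \<epsilon>0: "\<epsilon> \<longlonglongrightarrow> 0" unfolding \<epsilon>_def by (rule LIMSEQ_Suc[OF lim_1_over_n])
  have \<epsilon>r: "filterlim \<epsilon> (at_right 0) sequentially"
    using \<epsilon>0 \<epsilon> by (auto simp: filterlim_at less_imp_neq[THEN not_sym])
  define m where "m n = conv (dilate (\<epsilon> n) \<rho>) f" for n
  define m' where "m' n = conv (dilate (\<epsilon> n) \<rho>) g" for n
  have td: "test_fun (dilate (\<epsilon> n) \<rho>)" for n
    using test_fun_cmult[OF test_fun_affine[OF \<rho>(1), of "1 / \<epsilon> n" 0], of "1 / \<epsilon> n"] \<epsilon>[of n]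
    by (simp add: dilate_def[abs_def])
  have sm: "smooth (m n)" for n unfolding m_def by (intro smooth_conv td f)
  have dm: "(m n has_real_derivative m' n x) (at x)" for n x
  proof -
    \<comment> \<open>The weak derivative is tested against the reflected and translated mollifier.
      Reflection flips the sign of its derivative, which cancels the sign in
      \<open>weak_deriv\<close>.\<close>
    have t: "test_fun (\<lambda>y. dilate (\<epsilon> n) \<rho> ((-1) * y + x))" by (intro test_fun_affine td) simp
    have "((\<lambda>y. dilate (\<epsilon> n) \<rho> ((-1) * y + x)) has_real_derivative
        deriv (dilate (\<epsilon> n) \<rho>) ((-1) * y + x) * (-1)) (at y)" for y
      by (rule DERIV_chain2[OF test_fun_DERIV[OF td]]) (auto intro!: derivative_eq_intros)
    from deriv_eqI[OF this]
    have d: "deriv (\<lambda>y. dilate (\<epsilon> n) \<rho> ((-1) * y + x)) = (\<lambda>y. - deriv (dilate (\<epsilon> n) \<rho>) (x - y))"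
      by simp
    have "(LINT y|lborel. f y * - deriv (dilate (\<epsilon> n) \<rho>) (x - y)) = - (LINT y|lborel. g y * dilate (\<epsilon> n) \<rho> (x - y))"
      using w[unfolded weak_deriv_def, rule_format, OF t] unfolding d by simp
    then have "conv (deriv (dilate (\<epsilon> n) \<rho>)) f x = m' n x"
      unfolding conv_def m'_def by (simp add: mult.commute)
    then show ?thesis using conv_DERIV[OF td f, of n x] unfolding m_def by simp
  qed
  have L: "L2 (m n)" "L2 (m' n)" for n
    using L2_add[OF conv_approx(1)[OF test_fun_integrable[OF \<rho>(1)] \<rho>(2,4) f \<epsilon>] f]
      L2_add[OF conv_approx(1)[OF test_fun_integrable[OF \<rho>(1)] \<rho>(2,4) g \<epsilon>] g]
    unfolding m_def m'_def by simp_all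
  have lim: "(\<lambda>n. l2 (\<lambda>x. m n x - f x)) \<longlonglongrightarrow> 0" "(\<lambda>n. l2 (\<lambda>x. m' n x - g x)) \<longlonglongrightarrow> 0"
    unfolding m_def m'_def
    by (rule filterlim_compose[OF conv_approx_tendsto[OF test_fun_integrable[OF \<rho>(1)] \<rho>(2,4)] \<epsilon>r]; fact)+
  define \<eta> where "\<eta> x = (1 / \<rho> 0) * \<rho> x" for x
  have t\<eta>: "test_fun \<eta>" unfolding \<eta>_def by (intro test_fun_cmult \<rho>)
  have \<eta>0: "\<eta> 0 = 1" using \<rho>(3) by (simp add: \<eta>_def)
  obtain K where K: "0 \<le> K" "\<And>x. \<bar>\<eta> x\<bar> \<le> K" by (rule test_fun_bounded[OF t\<eta>]) (rule that)
  obtain K' where K': "0 \<le> K'" "\<And>x. \<bar>deriv \<eta> x\<bar> \<le> K'"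
    by (rule test_fun_bounded[OF test_fun_deriv[OF t\<eta>]]) (rule that)
  have [measurable]: "\<eta> \<in> borel_measurable borel" "deriv \<eta> \<in> borel_measurable borel"
    using t\<eta> by (auto intro: test_fun_measurable test_fun_deriv)
  \<comment> \<open>The bump normalised to 1 at the origin and stretched to width
    \<open>1 / \<epsilon> n\<close>; it tends to 1 pointwise.\<close>
  define c where "c n x = \<eta> (\<epsilon> n * x + 0)" for n x
  have tc: "test_fun (c n)" for n
    unfolding c_def using \<epsilon>[of n] by (intro test_fun_affine t\<eta>) auto
  have dc: "(c n has_real_derivative \<epsilon> n * deriv \<eta> (\<epsilon> n * x)) (at x)" for n x
  proof -
    have "(c n has_real_derivative deriv \<eta> (\<epsilon> n * x + 0) * \<epsilon> n) (at x)" unfolding c_def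
      by (rule DERIV_chain2[OF test_fun_DERIV[OF t\<eta>]]) (auto intro!: derivative_eq_intros)
    then show ?thesis by (simp add: mult.commute)
  qed
  have cK: "\<bar>c n x\<bar> \<le> K" for n x unfolding c_def by (rule K)
  have [measurable]: "c n \<in> borel_measurable borel" for n unfolding c_def by measurable
  have cut: "(\<lambda>n. l2 (\<lambda>x. c n x * v n x - v0 x)) \<longlonglongrightarrow> 0"
    if v: "\<And>n. L2 (v n)" "L2 v0" "(\<lambda>n. l2 (\<lambda>x. v n x - v0 x)) \<longlonglongrightarrow> 0" for v v0
  proof -
    have [measurable]: "v0 \<in> borel_measurable borel" using v by (auto simp: L2_measurable)
    have 1: "(\<lambda>n. l2 (\<lambda>x. c n x * v0 x - v0 x)) \<longlonglongrightarrow> 0"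
    proof (rule l2_dominated[where w="\<lambda>x. (K + 1) * \<bar>v0 x\<bar>"])
      show "L2 (\<lambda>x. (K + 1) * \<bar>v0 x\<bar>)" by (intro L2_cmult L2_abs v)
      show "\<bar>c n x * v0 x - v0 x\<bar> \<le> (K + 1) * \<bar>v0 x\<bar>" for n x
      proof -
        have "\<bar>c n x * v0 x - v0 x\<bar> = \<bar>c n x - 1\<bar> * \<bar>v0 x\<bar>"
          by (simp add: left_diff_distrib flip: abs_mult)
        also have "\<dots> \<le> (K + 1) * \<bar>v0 x\<bar>"
          by (intro mult_right_mono) (use cK[of n x] in auto)
        finally show ?thesis .
      qed
      show "AE x in lborel. (\<lambda>n. c n x * v0 x) \<longlonglongrightarrow> v0 x"
      proof (rule AE_I2)
        fix x
        have "(\<lambda>n. \<epsilon> n * x) \<longlonglongrightarrow> 0" using tendsto_mult_right[OF \<epsilon>0, of x] by simp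
        then have "(\<lambda>n. \<eta> (\<epsilon> n * x)) \<longlonglongrightarrow> \<eta> 0"
          by (rule continuous_on_tendsto_compose[OF test_fun_continuous[OF t\<eta>, of UNIV]]) auto
        from tendsto_mult_right[OF this, of "v0 x"]
        show "(\<lambda>n. c n x * v0 x) \<longlonglongrightarrow> v0 x" by (simp add: \<eta>0 c_def)
      qed
    qed measurable
    have 2: "(\<lambda>n. K * l2 (\<lambda>x. v n x - v0 x) + l2 (\<lambda>x. c n x * v0 x - v0 x)) \<longlonglongrightarrow> 0"
      using tendsto_add[OF tendsto_mult_left[OF v(3), of K] 1] by simp
    show ?thesis
    proof (rule Lim_null_comparison[OF always_eventually 2], rule allI)
      fix n
      have La: "L2 (\<lambda>x. c n x * v n x)" "L2 (\<lambda>x. c n x * v0 x)"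
        by (rule L2_bounded_mult[OF v(1) _ cK], measurable) (rule L2_bounded_mult[OF v(2) _ cK], measurable)
      have "l2 (\<lambda>x. c n x * v n x - c n x * v0 x) \<le> K * l2 (\<lambda>x. v n x - v0 x)"
        using l2_bounded_mult[OF L2_diff[OF v(1)[of n] v(2)], of "c n" K] cK
        by (simp add: right_diff_distrib)
      then show "norm (l2 (\<lambda>x. c n x * v n x - v0 x)) \<le> K * l2 (\<lambda>x. v n x - v0 x) + l2 (\<lambda>x. c n x * v0 x - v0 x)"
        using l2_triangle_via[OF La v(2)] by simp
    qed
  qed
  show ?thesis
  proof (rule that)
    show "test_fun (\<lambda>x. c n x * m n x)" for n by (intro test_fun_mult_smooth tc sm)
    show "(\<lambda>n. l2 (\<lambda>x. c n x * m n x - f x)) \<longlonglongrightarrow> 0" by (intro cut L f lim)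
    have d: "deriv (\<lambda>x. c n x * m n x) = (\<lambda>x. \<epsilon> n * (deriv \<eta> (\<epsilon> n * x) * m n x) + c n x * m' n x)" for n
      by (rule deriv_eqI) (rule DERIV_cong[OF DERIV_mult[OF dc dm]], simp)
    have Lx: "L2 (\<lambda>x. deriv \<eta> (\<epsilon> n * x) * m n x)" for n
      by (rule L2_bounded_mult[OF L(1)]) (use K' in auto)
    have lx: "l2 (\<lambda>x. deriv \<eta> (\<epsilon> n * x) * m n x) \<le> K' * l2 (m n)" for n
      by (rule l2_bounded_mult[OF L(1)]) (use K' in auto)
    \<comment> \<open>The cutoff's own derivative contributes only \<open>\<epsilon> n\<close> times
      a bounded quantity.\<close>
    have z: "(\<lambda>n. l2 (\<lambda>x. \<epsilon> n * (deriv \<eta> (\<epsilon> n * x) * m n x) - 0)) \<longlonglongrightarrow> 0"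
    proof (rule Lim_null_comparison[OF always_eventually], rule allI)
      show "norm (l2 (\<lambda>x. \<epsilon> n * (deriv \<eta> (\<epsilon> n * x) * m n x) - 0)) \<le> \<epsilon> n * (K' * l2 (m n))" for n
        using lx[of n] \<epsilon>[of n] by (simp add: l2_cmult)
      have "(\<lambda>n. \<epsilon> n * (K' * l2 (m n))) \<longlonglongrightarrow> 0 * (K' * l2 f)"
        by (intro tendsto_mult \<epsilon>0 tendsto_const l2_tendsto_norm L f lim)
      then show "(\<lambda>n. \<epsilon> n * (K' * l2 (m n))) \<longlonglongrightarrow> 0" by simp
    qed
    have "(\<lambda>n. l2 (\<lambda>x. (\<epsilon> n * (deriv \<eta> (\<epsilon> n * x) * m n x) + c n x * m' n x) - (0 + g x))) \<longlonglongrightarrow> 0"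
      by (rule l2_tendsto_add[OF L2_cmult[OF Lx] L2_zero z L2_bounded_mult[OF L(2) _ cK] g cut[OF L(2) g lim(2)]])
         measurable
    then show "(\<lambda>n. l2 (\<lambda>x. deriv (\<lambda>x. c n x * m n x) x - g x)) \<longlonglongrightarrow> 0"
      unfolding d by simp
  qed
qed

subsection \<open>Poisson kernels\<close>

lemma integral_FTC_UNIV:
  fixes f F :: "real \<Rightarrow> real"
  assumes "\<And>x. (F has_real_derivative f x) (at x)" "\<And>x. isCont f x" "integrable lborel f"
    and "(F \<longlongrightarrow> A) at_bot" "(F \<longlongrightarrow> B) at_top"
  shows "(LINT x|lborel. f x) = B - A"
proof -
  have "(LBINT x=-\<infinity>..\<infinity>. f x) = B - A"
    by (rule interval_integral_FTC_integrable)
       (use assms in \<open>auto simp: has_real_derivative_iff_has_vector_derivative[symmetric]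
          ereal_tendsto_simps1 set_integrable_def\<close>)
  then show ?thesis
    by (simp add: interval_lebesgue_integral_def set_lebesgue_integral_def)
qed

lemma integrable_inverse_1_plus_square': "integrable lborel (\<lambda>x::real. 1 / (1 + x\<^sup>2))"
  and integral_inverse_1_plus_square: "(LINT x|lborel. 1 / (1 + x\<^sup>2)) = pi"
proof -
  have 1: "1 + x\<^sup>2 \<noteq> 0" for x :: real
    using zero_le_power2[of x] by linarith
  have d: "(arctan has_real_derivative 1 / (1 + x\<^sup>2)) (at x)" for x
    by (auto intro!: derivative_eq_intros simp: divide_simps)
  have c: "isCont (\<lambda>x. 1 / (1 + x\<^sup>2)) x" for x :: real
    using 1 by (intro continuous_intros) auto
  note FTC = interval_integral_FTC_nonneg[of "-\<infinity>" "\<infinity>" arctan "\<lambda>x. 1 / (1 + x\<^sup>2)" "-pi/2" "pi/2"]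
  have "set_integrable lborel (einterval (-\<infinity>) \<infinity>) (\<lambda>x::real. 1 / (1 + x\<^sup>2))"
    by (rule FTC(1)) (use d c tendsto_arctan_at_bot tendsto_arctan_at_top in \<open>auto simp: ereal_tendsto_simps1\<close>)
  then show i: "integrable lborel (\<lambda>x::real. 1 / (1 + x\<^sup>2))"
    by (simp add: set_integrable_def)
  show "(LINT x|lborel. 1 / (1 + x\<^sup>2)) = pi"
    using integral_FTC_UNIV[OF d c i, of "-pi/2" "pi/2"] tendsto_arctan_at_bot tendsto_arctan_at_top
    by simp
qed

text \<open>The Poisson kernel of the upper half-plane at height \<open>a\<close>. Its conjugate
  kernel \<open>QK a\<close> tends to the Hilbert kernel \<open>1 / (pi * z)\<close> as
  \<open>a\<close> decreases to 0.\<close>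

definition PK :: "real \<Rightarrow> real \<Rightarrow> real" where
  "PK a z = a / (pi * (z\<^sup>2 + a\<^sup>2))"

definition QK :: "real \<Rightarrow> real \<Rightarrow> real" where
  "QK a z = z / (pi * (z\<^sup>2 + a\<^sup>2))"

lemma PK_measurable [measurable]: "PK a \<in> borel_measurable borel"
  unfolding PK_def by measurable

lemma QK_measurable [measurable]: "QK a \<in> borel_measurable borel"
  unfolding QK_def by measurable

lemma PK_nonneg: "0 \<le> a \<Longrightarrow> 0 \<le> PK a z"
  by (simp add: PK_def)

lemma QK_minus: "QK a (- z) = - QK a z"
  by (simp add: QK_def)

lemma PK_dilate: "a > 0 \<Longrightarrow> PK a = dilate a (PK 1)"
proof
  fix z assume a: "a > 0"
  then have e: "(z / a)\<^sup>2 + 1\<^sup>2 = (z\<^sup>2 + a\<^sup>2) / a\<^sup>2" by (simp add: field_simps)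
  show "PK a z = dilate a (PK 1) z"
    unfolding PK_def dilate_def e using a by (simp add: power2_eq_square)
qed

lemma sum_power2_pos: "a > 0 \<Longrightarrow> 0 < z\<^sup>2 + (a::real)\<^sup>2"
  by (simp add: add_nonneg_pos)

lemma PK_integrable_1: "integrable lborel (PK 1)" "(LINT x|lborel. PK 1 x) = 1"
proof -
  have *: "PK 1 = (\<lambda>x. (1 / pi) * (1 / (1 + x\<^sup>2)))"
    by (auto simp: PK_def add.commute)
  show "integrable lborel (PK 1)"
    unfolding * using integrable_inverse_1_plus_square' by (intro integrable_mult_right)
  show "(LINT x|lborel. PK 1 x) = 1"
    unfolding * integral_mult_right_zero integral_inverse_1_plus_square by simp
qed

lemma PK_integrable: "a > 0 \<Longrightarrow> integrable lborel (PK a)"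
  and PK_integral: "a > 0 \<Longrightarrow> (LINT x|lborel. PK a x) = 1"
proof -
  assume a: "a > 0"
  have "integrable lborel (\<lambda>x. PK 1 (0 + (1 / a) * x))"
    using a by (intro lborel_integrable_real_affine PK_integrable_1) auto
  then show "integrable lborel (PK a)"
    using a by (simp add: PK_dilate[OF a] dilate_def[abs_def])
  show "(LINT x|lborel. PK a x) = 1"
    using lborel_integral_real_affine[of "1 / a" "PK 1" 0] PK_integrable_1(2) a
    by (simp add: PK_dilate[OF a] dilate_def[abs_def] field_simps)
qed

lemma PK_square_le: assumes "a > 0" shows "(PK a z)\<^sup>2 \<le> (1 / (pi * a)) * PK a z"
proof -
  have "PK a z \<le> 1 / (pi * a)"
  proof -
    have "a / (pi * (z\<^sup>2 + a\<^sup>2)) \<le> a / (pi * a\<^sup>2)"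
      using assms sum_power2_pos[OF assms, of z] by (intro divide_left_mono mult_left_mono) auto
    then show ?thesis using assms by (simp add: PK_def power2_eq_square)
  qed
  then have "PK a z * PK a z \<le> (1 / (pi * a)) * PK a z"
    using PK_nonneg[of a z] assms by (intro mult_right_mono) auto
  then show ?thesis by (simp add: power2_eq_square)
qed

lemma QK_square_le: assumes "a > 0" shows "(QK a z)\<^sup>2 \<le> (1 / (pi * a)) * PK a z"
proof -
  have "z\<^sup>2 \<le> z\<^sup>2 + a\<^sup>2" by simp
  then have "z\<^sup>2 / (pi * (z\<^sup>2 + a\<^sup>2))\<^sup>2 \<le> (z\<^sup>2 + a\<^sup>2) / (pi * (z\<^sup>2 + a\<^sup>2))\<^sup>2"
    by (intro divide_right_mono) auto
  also have "\<dots> = (1 / (pi * a)) * PK a z"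
    using assms sum_power2_pos[OF assms, of z] by (simp add: PK_def power2_eq_square)
  finally show ?thesis by (simp add: QK_def power_divide)
qed

lemma PK_L2: assumes "a > 0" shows "L2 (PK a)"
proof (rule L2I)
  show "integrable lborel (\<lambda>z. (PK a z)\<^sup>2)"
  proof (rule Bochner_Integration.integrable_bound)
    show "integrable lborel (\<lambda>z. (1 / (pi * a)) * PK a z)"
      using assms by (intro integrable_mult_right PK_integrable)
    show "AE z in lborel. norm ((PK a z)\<^sup>2) \<le> norm ((1 / (pi * a)) * PK a z)"
      using order_trans[OF PK_square_le[OF assms] abs_ge_self] by (intro AE_I2) simp
  qed measurable
qed measurable

text \<open>\<open>QK a\<close> decays only like \<open>1 / z\<close>: it is square integrable but
  not integrable. Convolution with it is therefore defined pointwise, while its \<open>L2\<close>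
  bounds have to come from differences of such kernels.\<close>

lemma QK_L2: assumes "a > 0" shows "L2 (QK a)"
proof (rule L2I)
  show "integrable lborel (\<lambda>z. (QK a z)\<^sup>2)"
  proof (rule Bochner_Integration.integrable_bound)
    show "integrable lborel (\<lambda>z. (1 / (pi * a)) * PK a z)"
      using assms by (intro integrable_mult_right PK_integrable)
    show "AE z in lborel. norm ((QK a z)\<^sup>2) \<le> norm ((1 / (pi * a)) * PK a z)"
      using order_trans[OF QK_square_le[OF assms] abs_ge_self] by (intro AE_I2) simp
  qed measurable
qed measurable

lemma l2_QK_le: assumes "a > 0" shows "l2 (QK a) \<le> sqrt (1 / (pi * a))"
proof -
  have "(LINT z|lborel. (QK a z)\<^sup>2) \<le> (LINT z|lborel. (1 / (pi * a)) * PK a z)"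
    by (intro integral_mono L2_square_integrable QK_L2 integrable_mult_right PK_integrable QK_square_le assms)
  then show ?thesis using assms by (simp add: l2_def PK_integral)
qed

text \<open>Everything follows from \<open>PK a + \<i> QK a = \<i> / (\<pi> (z + \<i> a))\<close> and partial fractions for
  \<open>1 / ((x - y \<plusminus> \<i> a) (y + \<i> b))\<close>; the logarithms cancel at infinity. For \<open>x = 0\<close> and
  \<open>a = b\<close> the second partial fraction decomposition degenerates.\<close>

lemma kernel_convolutions:
  assumes a: "a > 0" and b: "b > 0" and x: "x \<noteq> 0"
  shows "(LINT y|lborel. QK a (x - y) * QK b y) = - PK (a + b) x"
    and "(LINT y|lborel. PK a (x - y) * QK b y) = QK (a + b) x"
proof -
  define A where "A y = PK a (x - y)" for y
  define B where "B y = QK a (x - y)" for y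
  define C where "C y = PK b y" for y
  define D where "D y = QK b y" for y
  have L: "L2 A" "L2 B" "L2 C" "L2 D"
    unfolding A_def[abs_def] B_def[abs_def] C_def[abs_def] D_def[abs_def]
    using a b by (auto intro: L2_reflect_shift PK_L2 QK_L2)
  note int = L2_mult_integrable[OF L(1) L(3)] L2_mult_integrable[OF L(1) L(4)]
     L2_mult_integrable[OF L(2) L(3)] L2_mult_integrable[OF L(2) L(4)]
  define AC AD BC BD where "AC = (LINT y|lborel. A y * C y)" and "AD = (LINT y|lborel. A y * D y)"
    and "BC = (LINT y|lborel. B y * C y)" and "BD = (LINT y|lborel. B y * D y)"
  note defs = AC_def AD_def BC_def BD_def
  have iA: "integrable lborel A" "integrable lborel C" "(LINT y|lborel. A y) = 1" "(LINT y|lborel. C y) = 1"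
    unfolding A_def[abs_def] C_def[abs_def] using a b
    by (auto simp: integrable_reflect_shift integral_reflect_shift PK_integrable PK_integral)
  have alg: "pi * (x * (B y * D y - A y * C y) + (a + b) * (A y * D y + B y * C y)) = B y + D y"
       "pi * ((a + b) * (B y * D y - A y * C y) - x * (A y * D y + B y * C y)) = - (A y + C y)"
       "pi * (x * (B y * D y + A y * C y) - (b - a) * (A y * D y - B y * C y)) = B y + D y"
       "pi * ((b - a) * (B y * D y + A y * C y) + x * (A y * D y - B y * C y)) = A y - C y" for y
  proof -
    define p where "p = x - y"
    define M N where "M = p\<^sup>2 + a\<^sup>2" and "N = y\<^sup>2 + b\<^sup>2"
    have MN: "M > 0" "N > 0" using a b by (auto simp: M_def N_def sum_power2_pos)
    have xp: "x = p + y" by (simp add: p_def)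
    have e: "A y = a / (pi * M)" "B y = p / (pi * M)" "C y = b / (pi * N)" "D y = y / (pi * N)"
      by (auto simp: A_def B_def C_def D_def PK_def QK_def M_def N_def p_def)
    show "pi * (x * (B y * D y - A y * C y) + (a + b) * (A y * D y + B y * C y)) = B y + D y"
       "pi * ((a + b) * (B y * D y - A y * C y) - x * (A y * D y + B y * C y)) = - (A y + C y)"
       "pi * (x * (B y * D y + A y * C y) - (b - a) * (A y * D y - B y * C y)) = B y + D y"
       "pi * ((b - a) * (B y * D y + A y * C y) + x * (A y * D y - B y * C y)) = A y - C y"
      unfolding e xp using MN
      by (simp_all add: divide_simps)
         (simp_all add: M_def N_def power2_eq_square algebra_simps)
  qed
  \<comment> \<open>Neither summand is integrable alone; the identity displays the sum as a
    combination of products of \<open>L2\<close> functions.\<close>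
  have iBD: "integrable lborel (\<lambda>y. B y + D y)"
    unfolding alg(1)[symmetric] using int by auto
  have BD0: "(LINT y|lborel. B y + D y) = 0"
  proof -
    define F where "F y = (1 / (2 * pi)) * (ln (y\<^sup>2 + b\<^sup>2) - ln ((x - y)\<^sup>2 + a\<^sup>2))" for y
    have d: "(F has_real_derivative (B y + D y)) (at y)" for y
      unfolding F_def B_def D_def QK_def
      using sum_power2_pos[OF a, of "x - y"] sum_power2_pos[OF b, of y]
      by (auto intro!: derivative_eq_intros simp: divide_simps) (auto simp: algebra_simps)
    have c: "isCont (\<lambda>y. B y + D y) y" for y
      unfolding B_def D_def QK_def
      using sum_power2_pos[OF a, of "x - y"] sum_power2_pos[OF b, of y]
      by (intro continuous_intros) auto
    have "(F \<longlongrightarrow> 0) at_bot" "(F \<longlongrightarrow> 0) at_top"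
      unfolding F_def by real_asymp+
    from integral_FTC_UNIV[OF d c iBD this] show ?thesis by simp
  qed
  have 1: "x * (BD - AC) + (a + b) * (AD + BC) = 0"
  proof -
    have "(LINT y|lborel. B y + D y) = pi * (x * (BD - AC) + (a + b) * (AD + BC))"
      unfolding alg(1)[symmetric] using int by (simp add: defs)
    then show ?thesis using BD0 by simp
  qed
  have 2: "pi * ((a + b) * (BD - AC) - x * (AD + BC)) = - 2"
  proof -
    have "(LINT y|lborel. - (A y + C y)) = pi * ((a + b) * (BD - AC) - x * (AD + BC))"
      unfolding alg(2)[symmetric] using int by (simp add: defs)
    moreover have "(LINT y|lborel. - (A y + C y)) = - 2" using iA by simp
    ultimately show ?thesis by simp
  qed
  have 3: "x * (BD + AC) - (b - a) * (AD - BC) = 0"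
  proof -
    have "(LINT y|lborel. B y + D y) = pi * (x * (BD + AC) - (b - a) * (AD - BC))"
      unfolding alg(3)[symmetric] using int by (simp add: defs)
    then show ?thesis using BD0 by simp
  qed
  have 4: "(b - a) * (BD + AC) + x * (AD - BC) = 0"
  proof -
    have "(LINT y|lborel. A y - C y) = pi * ((b - a) * (BD + AC) + x * (AD - BC))"
      unfolding alg(4)[symmetric] using int by (simp add: defs)
    moreover have "(LINT y|lborel. A y - C y) = 0" using iA by simp
    ultimately show ?thesis by simp
  qed
  \<comment> \<open>Two linear 2 by 2 systems, one in \<open>BD - AC\<close> and
    \<open>AD + BC\<close>, one in \<open>BD + AC\<close> and \<open>AD - BC\<close>, with these
    determinants up to sign. The second system is homogeneous, hence \<open>BD = - AC\<close> and
    \<open>AD = BC\<close>.\<close>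
  have s: "x\<^sup>2 + (b - a)\<^sup>2 > 0" "x\<^sup>2 + (a + b)\<^sup>2 > 0" using x by (auto simp: add_pos_nonneg)
  have "(x\<^sup>2 + (b - a)\<^sup>2) * (BD + AC) = x * (x * (BD + AC) - (b - a) * (AD - BC)) + (b - a) * ((b - a) * (BD + AC) + x * (AD - BC))"
    by (simp add: algebra_simps power2_eq_square)
  then have "(x\<^sup>2 + (b - a)\<^sup>2) * (BD + AC) = 0"
    unfolding 3 4 by simp
  then have X': "BD + AC = 0" using s(1) by (metis less_irrefl mult_eq_0_iff)
  have "x * (AD - BC) = 0" using 4 X' by simp
  then have Y': "AD - BC = 0" using x by simp
  have "pi * ((x\<^sup>2 + (a + b)\<^sup>2) * (BD - AC)) = pi * x * (x * (BD - AC) + (a + b) * (AD + BC))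
     + (a + b) * (pi * ((a + b) * (BD - AC) - x * (AD + BC)))"
    by (simp add: algebra_simps power2_eq_square)
  then have X: "pi * ((x\<^sup>2 + (a + b)\<^sup>2) * (BD - AC)) = - 2 * (a + b)" using 1 2 by simp
  have "pi * ((x\<^sup>2 + (a + b)\<^sup>2) * (AD + BC)) = pi * (a + b) * (x * (BD - AC) + (a + b) * (AD + BC))
     - x * (pi * ((a + b) * (BD - AC) - x * (AD + BC)))"
    by (simp add: algebra_simps power2_eq_square)
  then have Y: "pi * ((x\<^sup>2 + (a + b)\<^sup>2) * (AD + BC)) = 2 * x" using 1 2 by simp
  have "pi * ((x\<^sup>2 + (a + b)\<^sup>2) * (2 * BD)) = - 2 * (a + b)"
    using X X' by (simp add: eq_neg_iff_add_eq_0[symmetric])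
  moreover have solve: "v = c / (pi * m)" if "pi * (m * (2 * v)) = 2 * c" "m > 0" for v c m :: real
    using that by (simp add: field_simps)
  ultimately have "BD = - (a + b) / (pi * (x\<^sup>2 + (a + b)\<^sup>2))"
    using s(2) by (intro solve) auto
  then have "BD = - PK (a + b) x"
    by (simp only: PK_def minus_divide_left)
  then show "(LINT y|lborel. QK a (x - y) * QK b y) = - PK (a + b) x"
    by (simp add: BD_def B_def D_def)
  have "pi * ((x\<^sup>2 + (a + b)\<^sup>2) * (2 * AD)) = 2 * x"
    using Y Y' by simp
  then have "AD = QK (a + b) x"
    using solve[of "x\<^sup>2 + (a + b)\<^sup>2" AD x] s(2) by (simp add: QK_def)
  then show "(LINT y|lborel. PK a (x - y) * QK b y) = QK (a + b) x"
    by (simp add: AD_def A_def D_def)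
qed

section \<open>Convolution operators on \<open>L2\<close>\<close>

lemma conv_bound:
  assumes "L2 k" "L2 f" shows "\<bar>conv k f x\<bar> \<le> l2 k * l2 f"
  unfolding conv_def
  using L2_Cauchy_Schwarz[OF L2_reflect_shift[OF assms(1)] assms(2)] by (simp add: l2_reflect_shift)

text \<open>Fubini applies because the convolution of \<open>\<bar>l\<bar>\<close> and
  \<open>\<bar>f\<bar>\<close> is bounded by Cauchy-Schwarz and \<open>k\<close> is
  integrable.\<close>

lemma conv_assoc:
  assumes k: "integrable lborel k" and l: "L2 l" and f: "L2 f"
  shows "conv k (conv l f) x = (LINT z|lborel. (LINT y|lborel. k (x - y) * l (y - z)) * f z)"
proof -
  have [measurable]: "k \<in> borel_measurable borel" "l \<in> borel_measurable borel" "f \<in> borel_measurable borel"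
    using k l f by (auto simp: L2_measurable)
  have int: "integrable (lborel \<Otimes>\<^sub>M lborel) (\<lambda>(y, z). k (x - y) * (l (y - z) * f z))"
  proof (rule lborel_pair.Fubini_integrable)
    have eq: "(LINT z|lborel. norm (case (y, z) of (y, z) \<Rightarrow> k (x - y) * (l (y - z) * f z)))
       = \<bar>k (x - y)\<bar> * conv (\<lambda>x. \<bar>l x\<bar>) (\<lambda>x. \<bar>f x\<bar>) y" for y
      by (simp add: conv_def abs_mult)
    show "integrable lborel (\<lambda>y. LINT z|lborel. norm (case (y, z) of (y, z) \<Rightarrow> k (x - y) * (l (y - z) * f z)))"
      unfolding eq
    proof (rule Bochner_Integration.integrable_bound)
      show "integrable lborel (\<lambda>y. \<bar>k (x - y)\<bar> * (l2 l * l2 f))"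
        using k by (auto simp: integrable_reflect_shift)
      have "\<bar>conv (\<lambda>x. \<bar>l x\<bar>) (\<lambda>x. \<bar>f x\<bar>) y\<bar> \<le> l2 l * l2 f" for y
        using conv_bound[OF L2_abs[OF l] L2_abs[OF f]] by (simp add: l2_abs)
      then show "AE y in lborel. norm (\<bar>k (x - y)\<bar> * conv (\<lambda>x. \<bar>l x\<bar>) (\<lambda>x. \<bar>f x\<bar>) y)
         \<le> norm (\<bar>k (x - y)\<bar> * (l2 l * l2 f))"
        by (intro AE_I2) (simp add: abs_mult mult_left_mono)
    qed measurable
    show "AE y in lborel. integrable lborel (\<lambda>z. case (y, z) of (y, z) \<Rightarrow> k (x - y) * (l (y - z) * f z))"
      using L2_mult_integrable[OF L2_reflect_shift[OF l] f] by auto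
  qed measurable
  have "conv k (conv l f) x = (LINT y|lborel. LINT z|lborel. k (x - y) * (l (y - z) * f z))"
    by (simp add: conv_def)
  also have "\<dots> = (LINT z|lborel. LINT y|lborel. k (x - y) * (l (y - z) * f z))"
    by (rule lborel_pair.Fubini_integral[OF int, symmetric])
  also have "\<dots> = (LINT z|lborel. (LINT y|lborel. k (x - y) * l (y - z)) * f z)"
    by (simp flip: mult.assoc)
  finally show ?thesis .
qed

text \<open>Schur's test: the product \<open>f y * h x\<close> is bounded by the sum of the squares,
  and each square meets the kernel in an integrable function of the other variable.\<close>

lemma schur_integrable:
  assumes k: "integrable lborel k" and f: "L2 f" and h: "L2 h"
  shows "integrable (lborel \<Otimes>\<^sub>M lborel) (\<lambda>(x, y). k (x - y) * (f y * h x))"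
proof -
  have [measurable]: "k \<in> borel_measurable borel" "h \<in> borel_measurable borel" "f \<in> borel_measurable borel"
    using k h f by (auto simp: L2_measurable)
  have 1: "integrable (lborel \<Otimes>\<^sub>M lborel) (\<lambda>(x, y). k (t * (x - y)) * (v x)\<^sup>2)"
    if v: "L2 v" and t: "t = 1 \<or> t = -1" for v and t :: real
  proof -
    have [measurable]: "v \<in> borel_measurable borel" using v by (rule L2_measurable)
    have e: "integrable lborel (\<lambda>y. k (t * (x - y)))"
      "(LINT y|lborel. \<bar>k (t * (x - y))\<bar>) = (LINT y|lborel. \<bar>k y\<bar>)" for x
      using t integrable_reflect_shift[of k x] integrable_shift[of k x] k
        integral_reflect_shift[of "\<lambda>x. \<bar>k x\<bar>" x] integral_shift[of "\<lambda>x. \<bar>k x\<bar>" x]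
      by auto
    show ?thesis
    proof (rule lborel_pair.Fubini_integrable)
      show "integrable lborel (\<lambda>x. LINT y|lborel. norm (case (x, y) of (x, y) \<Rightarrow> k (t * (x - y)) * (v x)\<^sup>2))"
        using L2_square_integrable[OF v] by (simp add: abs_mult e)
      show "AE x in lborel. integrable lborel (\<lambda>y. case (x, y) of (x, y) \<Rightarrow> k (t * (x - y)) * (v x)\<^sup>2)"
        using e by auto
    qed measurable
  qed
  have 2: "integrable (lborel \<Otimes>\<^sub>M lborel) (\<lambda>(x, y). k (x - y) * (f y)\<^sup>2)"
    using 1[OF f, of "-1"] by (subst lborel_pair.integrable_product_swap_iff[symmetric]) simp
  show ?thesis
  proof (rule Bochner_Integration.integrable_bound)
    show "integrable (lborel \<Otimes>\<^sub>M lborel)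
      (\<lambda>p. \<bar>case p of (x, y) \<Rightarrow> k (x - y) * (f y)\<^sup>2\<bar> + \<bar>case p of (x, y) \<Rightarrow> k (1 * (x - y)) * (h x)\<^sup>2\<bar>)"
      by (intro Bochner_Integration.integrable_add integrable_abs 1 2 h) simp
    have *: "\<bar>c * (u * v)\<bar> \<le> \<bar>c * u\<^sup>2\<bar> + \<bar>c * v\<^sup>2\<bar>" for c u v :: real
    proof -
      have "2 * \<bar>u\<bar> * \<bar>v\<bar> \<le> u\<^sup>2 + v\<^sup>2" using sum_squares_bound[of "\<bar>u\<bar>" "\<bar>v\<bar>"] by simp
      moreover have "0 \<le> \<bar>u\<bar> * \<bar>v\<bar>" by simp
      ultimately have "\<bar>u * v\<bar> \<le> u\<^sup>2 + v\<^sup>2" unfolding abs_mult by linarith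
      then have "\<bar>c\<bar> * \<bar>u * v\<bar> \<le> \<bar>c\<bar> * (u\<^sup>2 + v\<^sup>2)" by (intro mult_left_mono) auto
      then show ?thesis by (simp add: abs_mult distrib_left)
    qed
    show "AE p in lborel \<Otimes>\<^sub>M lborel. norm (case p of (x, y) \<Rightarrow> k (x - y) * (f y * h x))
      \<le> norm (\<bar>case p of (x, y) \<Rightarrow> k (x - y) * (f y)\<^sup>2\<bar> + \<bar>case p of (x, y) \<Rightarrow> k (1 * (x - y)) * (h x)\<^sup>2\<bar>)"
      using * by (auto intro!: AE_I2)
  qed measurable
qed

lemma conv_adjoint:
  assumes k: "integrable lborel k" and f: "L2 f" and h: "L2 h"
  shows "(LINT x|lborel. conv k f x * h x) = (LINT y|lborel. f y * conv (\<lambda>z. k (- z)) h y)"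
proof -
  have "(LINT x|lborel. conv k f x * h x) = (LINT x|lborel. LINT y|lborel. k (x - y) * (f y * h x))"
    by (simp add: conv_def mult.assoc flip: integral_mult_left_zero)
  also have "\<dots> = (LINT y|lborel. LINT x|lborel. k (x - y) * (f y * h x))"
    by (rule lborel_pair.Fubini_integral[OF schur_integrable[OF assms], symmetric])
  also have "\<dots> = (LINT y|lborel. f y * conv (\<lambda>z. k (- z)) h y)"
    by (simp add: conv_def mult.left_commute mult.commute flip: integral_mult_right_zero)
  finally show ?thesis .
qed

text \<open>Young's inequality without its constant: Jensen with the density
  \<open>\<bar>k\<bar> / K\<close> bounds the square of the convolution, and Fubini shows that the
  bound is integrable.\<close>

lemma L2_conv:
  assumes k: "integrable lborel k" and f: "L2 f"
  shows "L2 (conv k f)"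
proof -
  have [measurable]: "k \<in> borel_measurable borel" "f \<in> borel_measurable borel"
    using k f by (auto simp: L2_measurable)
  have m: "conv k f \<in> borel_measurable borel" by measurable
  define K where "K = (LINT y|lborel. \<bar>k y\<bar>)"
  have Kx: "(LINT y|lborel. \<bar>k (x - y)\<bar>) = K" for x
    unfolding K_def by (rule integral_reflect_shift[of "\<lambda>x. \<bar>k x\<bar>"])
  have ikx: "integrable lborel (\<lambda>y. \<bar>k (x - y)\<bar>)" for x
    using k by (intro integrable_abs) (simp add: integrable_reflect_shift)
  show ?thesis
  \<comment> \<open>The density must be normalised, so a kernel of mass 0 is handled first.\<close>
  proof (cases "K = 0")
    case True
    have "conv k f x = 0" for x
    proof -
      have "AE y in lborel. \<bar>k (x - y)\<bar> = 0"
        using integral_nonneg_eq_0_iff_AE[OF ikx[of x]] Kx[of x] True by simp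
      then have "AE y in lborel. k (x - y) * f y = 0" by eventually_elim simp
      then have "conv k f x = (LINT y|(lborel::real measure). 0)"
        unfolding conv_def by (intro integral_cong_AE) auto
      then show ?thesis by simp
    qed
    then have "conv k f = (\<lambda>x. 0)" by auto
    then show ?thesis by (simp add: L2_zero)
  next
    case False
    then have K: "K > 0" unfolding K_def
      by (metis Bochner_Integration.integral_nonneg abs_ge_zero less_eq_real_def)
    have F: "integrable (lborel \<Otimes>\<^sub>M lborel) (\<lambda>(x, y). \<bar>k (x - y)\<bar> * (f y)\<^sup>2)"
    proof -
      have "integrable (lborel \<Otimes>\<^sub>M lborel) (\<lambda>(x, y). \<bar>k (y - x)\<bar> * (f x)\<^sup>2)"
      proof (rule lborel_pair.Fubini_integrable)
        have e: "(LINT y|lborel. \<bar>k (y - x)\<bar>) = K" for x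
          unfolding K_def by (rule integral_shift[of "\<lambda>x. \<bar>k x\<bar>"])
        show "integrable lborel (\<lambda>x. LINT y|lborel. norm (case (x, y) of (x, y) \<Rightarrow> \<bar>k (y - x)\<bar> * (f x)\<^sup>2))"
          using L2_square_integrable[OF f] by (simp add: abs_mult e)
        show "AE x in lborel. integrable lborel (\<lambda>y. case (x, y) of (x, y) \<Rightarrow> \<bar>k (y - x)\<bar> * (f x)\<^sup>2)"
          using k by (auto simp: integrable_shift[of "\<lambda>x. \<bar>k x\<bar>"])
      qed measurable
      then show ?thesis by (subst lborel_pair.integrable_product_swap_iff[symmetric]) simp
    qed
    have AE1: "AE x in lborel. integrable lborel (\<lambda>y. \<bar>k (x - y)\<bar> * (f y)\<^sup>2)"
      and int2: "integrable lborel (\<lambda>x. LINT y|lborel. \<bar>k (x - y)\<bar> * (f y)\<^sup>2)"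
      using lborel_pair.AE_integrable_fst[OF F] lborel_pair.integrable_fst[OF F] by auto
    have AE2: "AE x in lborel. (conv k f x)\<^sup>2 \<le> K * (LINT y|lborel. \<bar>k (x - y)\<bar> * (f y)\<^sup>2)"
      using AE1
    proof eventually_elim
      fix x assume i: "integrable lborel (\<lambda>y. \<bar>k (x - y)\<bar> * (f y)\<^sup>2)"
      have i': "integrable lborel (\<lambda>y. (\<bar>k (x - y)\<bar> / K) * \<bar>f y\<bar>\<^sup>2)"
        using integrable_divide[OF i, of K] by simp
      have "(LINT y|lborel. (\<bar>k (x - y)\<bar> / K) * \<bar>f y\<bar>)\<^sup>2 \<le> (LINT y|lborel. (\<bar>k (x - y)\<bar> / K) * \<bar>f y\<bar>\<^sup>2)"
        by (rule weighted_mean_square_le(2)[OF _ _ _ _ i']) (use K Kx ikx in auto)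
      then have *: "(LINT y|lborel. \<bar>k (x - y)\<bar> * \<bar>f y\<bar>)\<^sup>2 \<le> K * (LINT y|lborel. \<bar>k (x - y)\<bar> * (f y)\<^sup>2)"
        using K by (simp add: power_divide field_simps power2_eq_square)
      have "\<bar>conv k f x\<bar> \<le> (LINT y|lborel. \<bar>k (x - y)\<bar> * \<bar>f y\<bar>)"
        unfolding conv_def using integral_abs_bound[of lborel "\<lambda>y. k (x - y) * f y"] by (simp add: abs_mult)
      from power_mono[OF this, of 2] *
      show "(conv k f x)\<^sup>2 \<le> K * (LINT y|lborel. \<bar>k (x - y)\<bar> * (f y)\<^sup>2)" by simp
    qed
    show ?thesis
      by (rule L2I[OF m Bochner_Integration.integrable_bound[OF integrable_mult_right[OF int2, of K]]])
         (use AE2 in \<open>auto elim!: eventually_mono intro: order_trans[OF _ abs_ge_self]\<close>)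
  qed
qed

section \<open>Poisson and conjugate Poisson integrals in \<open>L2\<close>\<close>

lemma l2_square_mult: "(l2 f)\<^sup>2 = (LINT x|lborel. f x * f x)"
  unfolding l2_square by (simp only: power2_eq_square)

lemma AE_neq: "AE z in lborel. z \<noteq> (x::real)"
  by (rule AE_lborel_singleton)

lemma conv_diff_kernel:
  assumes "L2 k" "L2 l" "L2 f"
  shows "conv (\<lambda>z. k z - l z) f x = conv k f x - conv l f x"
  unfolding conv_def left_diff_distrib
  by (intro Bochner_Integration.integral_diff L2_mult_integrable L2_reflect_shift assms)

lemma conv_diff_fun:
  assumes "L2 k" "L2 f" "L2 g"
  shows "conv k (\<lambda>y. f y - g y) x = conv k f x - conv k g x"
  unfolding conv_def right_diff_distrib
  by (intro Bochner_Integration.integral_diff L2_mult_integrable L2_reflect_shift assms)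

text \<open>On the Fourier side this is the squared modulus of the transform of \<open>g\<close>
  weighted by \<open>exp (- a |xi|)\<close>. It stands in for Plancherel's theorem: norms of
  conjugate Poisson integrals are expressed through it.\<close>

definition poisson_form :: "(real \<Rightarrow> real) \<Rightarrow> real \<Rightarrow> real" where
  "poisson_form g a = (LINT x|lborel. g x * conv (PK a) g x)"

lemma L2_conv_PK: "a > 0 \<Longrightarrow> L2 g \<Longrightarrow> L2 (conv (PK a) g)"
  by (intro L2_conv PK_integrable)

lemma conv_PK_tendsto:
  assumes "L2 g"
  shows "((\<lambda>a. l2 (\<lambda>x. conv (PK a) g x - g x)) \<longlongrightarrow> 0) (at_right 0)"
proof (rule Lim_transform_eventually)
  show "((\<lambda>a. l2 (\<lambda>x. conv (dilate a (PK 1)) g x - g x)) \<longlongrightarrow> 0) (at_right 0)"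
    by (rule conv_approx_tendsto[OF PK_integrable_1(1) PK_nonneg PK_integrable_1(2) assms]) simp
  show "\<forall>\<^sub>F a in at_right 0. l2 (\<lambda>x. conv (dilate a (PK 1)) g x - g x) = l2 (\<lambda>x. conv (PK a) g x - g x)"
    using eventually_at_right_less by eventually_elim (simp add: PK_dilate[symmetric])
qed

text \<open>The constant is 2 for the distance of the Poisson integral from \<open>g\<close>, a mean
  of differences of translates, plus 1 for \<open>g\<close> itself.\<close>

lemma l2_conv_PK_le:
  assumes a: "a > 0" and g: "L2 g"
  shows "l2 (conv (PK a) g) \<le> 3 * l2 g"
proof -
  have "(LINT s|lborel. PK 1 s * (l2 (\<lambda>x. g (x - a * s) - g x))\<^sup>2) \<le> (LINT s|lborel. PK 1 s * (2 * l2 g)\<^sup>2)"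
  proof (rule integral_mono')
    show "integrable lborel (\<lambda>s. PK 1 s * (2 * l2 g)\<^sup>2)" using PK_integrable_1 by auto
    fix s
    have "l2 (\<lambda>x. g (x - a * s) - g x) \<le> 2 * l2 g"
      using l2_triangle_diff[OF L2_shift[OF g, of "a * s"] g] by (simp add: l2_shift)
    then show "PK 1 s * (l2 (\<lambda>x. g (x - a * s) - g x))\<^sup>2 \<le> PK 1 s * (2 * l2 g)\<^sup>2"
      by (intro mult_left_mono power_mono PK_nonneg) auto
  qed (simp add: PK_nonneg)
  also have "\<dots> = (2 * l2 g)\<^sup>2" using PK_integrable_1 by simp
  finally have "(l2 (\<lambda>x. conv (PK a) g x - g x))\<^sup>2 \<le> (2 * l2 g)\<^sup>2"
    using conv_approx(2)[OF PK_integrable_1(1) PK_nonneg PK_integrable_1(2) g a]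
    by (simp add: PK_dilate[OF a])
  then have "l2 (\<lambda>x. conv (PK a) g x - g x) \<le> 2 * l2 g"
    by (rule power2_le_imp_le) simp
  then show ?thesis
    using l2_triangle[OF L2_diff[OF L2_conv_PK[OF a g] g] g] by simp
qed

lemma poisson_form_bound: "a > 0 \<Longrightarrow> L2 g \<Longrightarrow> \<bar>poisson_form g a\<bar> \<le> 3 * (l2 g)\<^sup>2"
  using L2_Cauchy_Schwarz[of g "conv (PK a) g"] l2_conv_PK_le[of a g]
    mult_left_mono[of "l2 (conv (PK a) g)" "3 * l2 g" "l2 g"]
  by (simp add: poisson_form_def L2_conv_PK power2_eq_square)

lemma poisson_form_tendsto:
  assumes g: "L2 g"
  shows "(poisson_form g \<longlongrightarrow> (l2 g)\<^sup>2) (at_right 0)"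
  unfolding tendsto_at_iff_sequentially comp_def
proof (intro allI impI)
  fix X :: "nat \<Rightarrow> real" assume X: "\<forall>i. X i \<in> {0<..} - {0}" "X \<longlonglongrightarrow> 0"
  have "(\<lambda>i. l2 (\<lambda>x. conv (PK (X i)) g x - g x)) \<longlonglongrightarrow> 0"
    using conv_PK_tendsto[OF g] X unfolding tendsto_at_iff_sequentially comp_def by blast
  then have "(\<lambda>i. LINT x|lborel. g x * conv (PK (X i)) g x) \<longlonglongrightarrow> (LINT x|lborel. g x * g x)"
    using X by (intro L2_tendsto_pairing g L2_conv_PK) auto
  then show "(\<lambda>i. poisson_form g (X i)) \<longlonglongrightarrow> (l2 g)\<^sup>2"
    unfolding poisson_form_def l2_square_mult .
qed

text \<open>The tails \<open>1 / z\<close> cancel, leaving a difference of order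
  \<open>z^-3\<close>, which a multiple of the Poisson kernel dominates. This brings the difference
  under the theory of integrable kernels.\<close>

lemma QK_diff_integrable:
  assumes a: "a > 0" and b: "b > 0"
  shows "integrable lborel (\<lambda>z. QK a z - QK b z)"
proof (rule Bochner_Integration.integrable_bound)
  show "integrable lborel (\<lambda>z. (\<bar>b\<^sup>2 - a\<^sup>2\<bar> / (2 * b * a)) * PK a z)"
    using a by (intro integrable_mult_right PK_integrable)
  show "AE z in lborel. norm (QK a z - QK b z) \<le> norm ((\<bar>b\<^sup>2 - a\<^sup>2\<bar> / (2 * b * a)) * PK a z)"
  proof (rule AE_I2)
    fix z
    define M N where "M = z\<^sup>2 + a\<^sup>2" and "N = z\<^sup>2 + b\<^sup>2"
    have MN: "M > 0" "N > 0" using a b by (auto simp: M_def N_def sum_power2_pos)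
    have "QK a z - QK b z = z * (b\<^sup>2 - a\<^sup>2) / (pi * M * N)"
    proof -
      have e: "b\<^sup>2 - a\<^sup>2 = N - M" by (simp add: M_def N_def)
      show ?thesis
        unfolding e unfolding QK_def M_def[symmetric] N_def[symmetric]
        using MN by (simp add: field_simps)
    qed
    then have "norm (QK a z - QK b z) = (\<bar>z\<bar> / N) * (\<bar>b\<^sup>2 - a\<^sup>2\<bar> / (pi * M))"
      using MN by (simp add: abs_mult)
    also have "\<dots> \<le> (1 / (2 * b)) * (\<bar>b\<^sup>2 - a\<^sup>2\<bar> / (pi * M))"
    proof (rule mult_right_mono)
      have "2 * \<bar>z\<bar> * b \<le> N" using sum_squares_bound[of "\<bar>z\<bar>" b] by (simp add: N_def)
      then show "\<bar>z\<bar> / N \<le> 1 / (2 * b)" using MN b by (simp add: field_simps)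
    qed (use MN in auto)
    also have "\<dots> = (\<bar>b\<^sup>2 - a\<^sup>2\<bar> / (2 * b * a)) * PK a z"
      unfolding PK_def M_def[symmetric] using a b MN by (simp add: field_simps)
    also have "\<dots> \<le> norm ((\<bar>b\<^sup>2 - a\<^sup>2\<bar> / (2 * b * a)) * PK a z)"
      by (simp only: real_norm_def abs_ge_self)
    finally show "norm (QK a z - QK b z) \<le> norm ((\<bar>b\<^sup>2 - a\<^sup>2\<bar> / (2 * b * a)) * PK a z)" .
  qed
qed measurable

text \<open>Convolution with the odd kernel \<open>R\<close> is skew-adjoint, so the squared norm is
  minus the pairing of \<open>g\<close> with the twofold convolution. By
  \<open>kernel_convolutions\<close> the latter is a combination of Poisson integrals at the heights
  \<open>2 * a\<close>, \<open>a + b\<close> and \<open>2 * b\<close>.\<close>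

lemma l2_QK_diff_square:
  assumes a: "a > 0" and b: "b > 0" and g: "L2 g"
  defines "R \<equiv> \<lambda>z. QK a z - QK b z"
  shows "L2 (conv R g)"
    "(l2 (conv R g))\<^sup>2 = poisson_form g (2 * a) - 2 * poisson_form g (a + b) + poisson_form g (2 * b)"
proof -
  have iR: "integrable lborel R" unfolding R_def by (rule QK_diff_integrable[OF a b])
  have LR: "L2 R" unfolding R_def by (intro L2_diff QK_L2 a b)
  have [measurable]: "R \<in> borel_measurable borel" "g \<in> borel_measurable borel"
    using LR g by (auto simp: L2_measurable)
  show L: "L2 (conv R g)" by (rule L2_conv[OF iR g])
  have RR: "(LINT y|lborel. R (x - y) * R (y - z)) = - PK (2 * a) (x - z) + 2 * PK (a + b) (x - z) - PK (2 * b) (x - z)"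
    if "z \<noteq> x" for x z
  proof -
    have xz: "x - z \<noteq> 0" using that by simp
    have L': "L2 (\<lambda>y. QK c (x - z - y))" "L2 (\<lambda>y. QK c y)" if "c > 0" for c
      using that by (auto intro: L2_reflect_shift QK_L2)
    have int: "integrable lborel (\<lambda>y. QK c (x - z - y) * QK d y)" if "c > 0" "d > 0" for c d
      using that by (intro L2_mult_integrable L')
    have "(LINT y|lborel. R (x - y) * R (y - z)) = (LINT y|lborel. R (x - z - y) * R y)"
      using integral_shift[of "\<lambda>y. R (x - z - y) * R y" z] by (simp add: algebra_simps)
    also have "\<dots> = (LINT y|lborel. QK a (x - z - y) * QK a y - QK a (x - z - y) * QK b y
        - QK b (x - z - y) * QK a y + QK b (x - z - y) * QK b y)"
      unfolding R_def by (intro Bochner_Integration.integral_cong) (auto simp: algebra_simps)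
    also have "\<dots> = - PK (a + a) (x - z) + PK (a + b) (x - z) + PK (b + a) (x - z) - PK (b + b) (x - z)"
      using int a b kernel_convolutions(1)[OF _ _ xz] by simp
    finally show ?thesis by (simp add: add.commute)
  qed
  have cc: "conv R (conv R g) x = - conv (PK (2 * a)) g x + 2 * conv (PK (a + b)) g x - conv (PK (2 * b)) g x" for x
  proof -
    have i: "integrable lborel (\<lambda>z. PK c (x - z) * g z)" if "c > 0" for c
      using that by (intro L2_mult_integrable L2_reflect_shift PK_L2 g)
    have "conv R (conv R g) x = (LINT z|lborel. (LINT y|lborel. R (x - y) * R (y - z)) * g z)"
      by (rule conv_assoc[OF iR LR g])
    also have "\<dots> = (LINT z|lborel. (- PK (2 * a) (x - z) * g z + 2 * (PK (a + b) (x - z) * g z)) - PK (2 * b) (x - z) * g z)"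
    proof (rule integral_cong_AE)
      show "AE z in lborel. (LINT y|lborel. R (x - y) * R (y - z)) * g z
        = - PK (2 * a) (x - z) * g z + 2 * (PK (a + b) (x - z) * g z) - PK (2 * b) (x - z) * g z"
        using AE_neq[of x] by eventually_elim (subst RR, simp, simp add: algebra_simps)
    qed measurable
    also have "\<dots> = - conv (PK (2 * a)) g x + 2 * conv (PK (a + b)) g x - conv (PK (2 * b)) g x"
      using i a b by (simp add: conv_def)
    finally show ?thesis .
  qed
  have Rm: "(\<lambda>z. R (- z)) = (\<lambda>z. - R z)" by (auto simp: R_def QK_minus)
  have i: "integrable lborel (\<lambda>x. g x * conv (PK c) g x)" if "c > 0" for c
    using that by (intro L2_mult_integrable L2_conv_PK g)
  have "(l2 (conv R g))\<^sup>2 = (LINT x|lborel. conv R g x * conv R g x)"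
    by (rule l2_square_mult)
  also have "\<dots> = (LINT x|lborel. g x * conv (\<lambda>z. - R z) (conv R g) x)"
    unfolding conv_adjoint[OF iR g L] Rm ..
  also have "\<dots> = (LINT x|lborel. g x * - conv R (conv R g) x)"
    by (simp add: conv_def[of "\<lambda>z. - R z"] conv_def[of R "conv R g"])
  also have "\<dots> = (LINT x|lborel. g x * conv (PK (2 * a)) g x - 2 * (g x * conv (PK (a + b)) g x) + g x * conv (PK (2 * b)) g x)"
    unfolding cc by (intro Bochner_Integration.integral_cong) (auto simp: algebra_simps)
  also have "\<dots> = poisson_form g (2 * a) - 2 * poisson_form g (a + b) + poisson_form g (2 * b)"
    using i a b by (simp add: poisson_form_def)
  finally show "(l2 (conv R g))\<^sup>2 = poisson_form g (2 * a) - 2 * poisson_form g (a + b) + poisson_form g (2 * b)" .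
qed

lemma conv_QK_tendsto_0_at_infinity:
  assumes g: "L2 g"
  shows "(\<lambda>n. conv (QK (real (Suc n))) g x) \<longlonglongrightarrow> 0"
proof (rule Lim_null_comparison)
  show "\<forall>\<^sub>F n in sequentially. norm (conv (QK (real (Suc n))) g x) \<le> sqrt (1 / (pi * real (Suc n))) * l2 g"
  proof (rule always_eventually, rule allI)
    fix n
    have "norm (conv (QK (real (Suc n))) g x) \<le> l2 (QK (real (Suc n))) * l2 g"
      using conv_bound[OF QK_L2 g, of "real (Suc n)"] by simp
    also have "\<dots> \<le> sqrt (1 / (pi * real (Suc n))) * l2 g"
      by (intro mult_right_mono l2_QK_le) auto
    finally show "norm (conv (QK (real (Suc n))) g x) \<le> sqrt (1 / (pi * real (Suc n))) * l2 g" .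
  qed
  have "(\<lambda>n. sqrt ((1 / pi) * (1 / real (Suc n))) * l2 g) \<longlonglongrightarrow> sqrt ((1 / pi) * 0) * l2 g"
    by (intro tendsto_intros LIMSEQ_Suc[OF lim_1_over_n])
  then show "(\<lambda>n. sqrt (1 / (pi * real (Suc n))) * l2 g) \<longlonglongrightarrow> 0" by simp
qed

text \<open>Let the second height tend to infinity in the previous difference. The subtracted
  integral vanishes pointwise, and Fatou keeps the bound, which comes from
  \<open>3 * (1 + 2 + 1) = 12 \<le> 4^2\<close>.\<close>

lemma
  assumes a: "a > 0" and g: "L2 g"
  shows L2_conv_QK: "L2 (conv (QK a) g)" and l2_conv_QK_le: "l2 (conv (QK a) g) \<le> 4 * l2 g"
proof -
  have [measurable]: "g \<in> borel_measurable borel" using g by (rule L2_measurable)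
  define h where "h n = conv (\<lambda>z. QK a z - QK (real (Suc n)) z) g" for n
  have h: "L2 (h n)" "l2 (h n) \<le> 4 * l2 g" for n
  proof -
    note sq = l2_QK_diff_square[OF a _ g, of "real (Suc n)"]
    show "L2 (h n)" unfolding h_def by (rule sq) simp
    have "(l2 (h n))\<^sup>2 \<le> (4 * l2 g)\<^sup>2"
      using sq(2) poisson_form_bound[OF _ g, of "2 * a"] poisson_form_bound[OF _ g, of "a + real (Suc n)"]
        poisson_form_bound[OF _ g, of "2 * real (Suc n)"] a zero_le_power2[of "l2 g"]
      unfolding h_def by (simp only: power_mult_distrib) simp
    then show "l2 (h n) \<le> 4 * l2 g" by (rule power2_le_imp_le) simp
  qed
  have "(\<lambda>n. h n x) \<longlonglongrightarrow> conv (QK a) g x" for x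
  proof -
    have "h n x = conv (QK a) g x - conv (QK (real (Suc n))) g x" for n
      unfolding h_def by (intro conv_diff_kernel QK_L2 a g) simp
    moreover have "(\<lambda>n. conv (QK a) g x - conv (QK (real (Suc n))) g x) \<longlonglongrightarrow> conv (QK a) g x - 0"
      by (intro tendsto_intros conv_QK_tendsto_0_at_infinity g)
    ultimately show ?thesis by simp
  qed
  then show "L2 (conv (QK a) g)" "l2 (conv (QK a) g) \<le> 4 * l2 g"
    using L2_Fatou[of h "conv (QK a) g" "4 * l2 g"] h by auto
qed

text \<open>The \<open>L\<^sup>2\<close> limit of the conjugate Poisson integrals is the Hilbert transform.\<close>

lemma ex_L2_hilbert:
  assumes g: "L2 g"
  obtains G where "L2 G" "((\<lambda>a. l2 (\<lambda>x. conv (QK a) g x - G x)) \<longlongrightarrow> 0) (at_right 0)"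
proof -
  have sq: "(l2 (\<lambda>x. conv (QK a) g x - conv (QK b) g x))\<^sup>2
      = poisson_form g (2 * a) - 2 * poisson_form g (a + b) + poisson_form g (2 * b)" if "a > 0" "b > 0" for a b
  proof -
    have "(\<lambda>x. conv (QK a) g x - conv (QK b) g x) = conv (\<lambda>z. QK a z - QK b z) g"
      by (rule ext) (simp add: conv_diff_kernel QK_L2 that g)
    then show ?thesis using l2_QK_diff_square(2)[OF that g] by simp
  qed
  \<comment> \<open>All three forms tend to the squared norm of \<open>g\<close>, and their
    coefficients 1, -2, 1 add up to 0; hence the Cauchy property.\<close>
  have C: "\<exists>d>0. \<forall>a b. 0 < a \<longrightarrow> a < d \<longrightarrow> 0 < b \<longrightarrow> b < d \<longrightarrow>
     l2 (\<lambda>x. conv (QK a) g x - conv (QK b) g x) < e" if e: "e > 0" for e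
  proof -
    have "\<forall>\<^sub>F a in at_right 0. dist (poisson_form g a) ((l2 g)\<^sup>2) < e\<^sup>2 / 4"
      by (rule tendstoD[OF poisson_form_tendsto[OF g]]) (use e in simp)
    then obtain d where d: "d > 0" "\<And>a. 0 < a \<Longrightarrow> a < d \<Longrightarrow> \<bar>poisson_form g a - (l2 g)\<^sup>2\<bar> < e\<^sup>2 / 4"
      unfolding eventually_at_right_field dist_real_def by auto
    show ?thesis
    proof (intro exI[of _ "d / 2"] conjI allI impI)
      fix a b assume ab: "0 < a" "a < d / 2" "0 < b" "b < d / 2"
      have "(l2 (\<lambda>x. conv (QK a) g x - conv (QK b) g x))\<^sup>2 < e\<^sup>2"
      proof -
        have "\<bar>poisson_form g (2 * a) - (l2 g)\<^sup>2\<bar> < e\<^sup>2 / 4" "\<bar>poisson_form g (2 * b) - (l2 g)\<^sup>2\<bar> < e\<^sup>2 / 4"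
          "\<bar>poisson_form g (a + b) - (l2 g)\<^sup>2\<bar> < e\<^sup>2 / 4"
          by (rule d(2); use ab in simp)+
        then show ?thesis unfolding sq[OF ab(1,3)] by linarith
      qed
      then show "l2 (\<lambda>x. conv (QK a) g x - conv (QK b) g x) < e"
        using e by (intro power2_less_imp_less[of _ e]) auto
    qed (use d in simp)
  qed
  define \<epsilon> where "\<epsilon> n = 1 / real (Suc n)" for n
  have \<epsilon>: "0 < \<epsilon> n" for n by (simp add: \<epsilon>_def)
  have \<epsilon>0: "\<epsilon> \<longlonglongrightarrow> 0" unfolding \<epsilon>_def by (rule LIMSEQ_Suc[OF lim_1_over_n])
  have small: "\<exists>N. \<forall>n\<ge>N. \<epsilon> n < d" if "d > 0" for d
    using LIMSEQ_D[OF \<epsilon>0 that] \<epsilon> by (auto simp: abs_of_pos)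
  obtain G where G: "L2 G" "(\<lambda>n. l2 (\<lambda>x. conv (QK (\<epsilon> n)) g x - G x)) \<longlonglongrightarrow> 0"
  proof (rule L2_complete[of "\<lambda>n. conv (QK (\<epsilon> n)) g"])
    show "L2 (conv (QK (\<epsilon> n)) g)" for n by (intro L2_conv_QK \<epsilon> g)
    fix e :: real assume "e > 0"
    from C[OF this] obtain d where d: "d > 0" "\<And>a b. 0 < a \<Longrightarrow> a < d \<Longrightarrow> 0 < b \<Longrightarrow> b < d \<Longrightarrow>
     l2 (\<lambda>x. conv (QK a) g x - conv (QK b) g x) < e" by auto
    from small[OF d(1)] obtain N where "\<forall>n\<ge>N. \<epsilon> n < d" ..
    then show "\<exists>N. \<forall>m\<ge>N. \<forall>n\<ge>N. l2 (\<lambda>x. conv (QK (\<epsilon> m)) g x - conv (QK (\<epsilon> n)) g x) < e"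
      using d(2) \<epsilon> by blast
  qed
  show ?thesis
  proof (rule that[OF G(1)])
    show "((\<lambda>a. l2 (\<lambda>x. conv (QK a) g x - G x)) \<longlongrightarrow> 0) (at_right 0)"
      unfolding tendsto_iff
    proof (intro allI impI)
      fix e :: real assume e: "e > 0"
      from C[of "e / 2"] e obtain d where d: "d > 0" "\<And>a b. 0 < a \<Longrightarrow> a < d \<Longrightarrow> 0 < b \<Longrightarrow> b < d \<Longrightarrow>
       l2 (\<lambda>x. conv (QK a) g x - conv (QK b) g x) < e / 2" by auto
      from small[OF d(1)] obtain N where N: "\<forall>n\<ge>N. \<epsilon> n < d" ..
      from LIMSEQ_D[OF G(2), of "e / 2"] e obtain M where
        M: "\<forall>n\<ge>M. l2 (\<lambda>x. conv (QK (\<epsilon> n)) g x - G x) < e / 2" by auto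
      define n where "n = max N M"
      have "l2 (\<lambda>x. conv (QK a) g x - G x) < e" if a: "0 < a" "a < d" for a
      proof -
        have "l2 (\<lambda>x. conv (QK a) g x - G x) \<le> l2 (\<lambda>x. conv (QK a) g x - conv (QK (\<epsilon> n)) g x)
          + l2 (\<lambda>x. conv (QK (\<epsilon> n)) g x - G x)"
          by (intro l2_triangle_via L2_conv_QK a \<epsilon> g G)
        also have "\<dots> < e / 2 + e / 2"
          using N M a \<epsilon>[of n] by (intro add_strict_mono d(2)) (auto simp: n_def)
        finally show ?thesis by simp
      qed
      then show "\<forall>\<^sub>F a in at_right 0. dist (l2 (\<lambda>x. conv (QK a) g x - G x)) 0 < e"
        unfolding eventually_at_right_field using d(1) by auto
    qed
  qed
qed

text \<open>The conjugate Poisson integral of \<open>g\<close> is the Poisson integral of its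
  Hilbert transform \<open>G\<close>. The composition rule
  \<open>PK a * QK \<epsilon> = QK (a + \<epsilon>)\<close>, as convolution kernels, is applied to
  \<open>g\<close> and \<open>\<epsilon>\<close> is sent to 0 on both sides.\<close>

lemma conv_QK_eq_conv_PK:
  assumes g: "L2 g" and G: "L2 G" "((\<lambda>a. l2 (\<lambda>x. conv (QK a) g x - G x)) \<longlongrightarrow> 0) (at_right 0)"
    and a: "a > 0"
  shows "conv (QK a) g x = conv (PK a) G x"
proof -
  have [measurable]: "g \<in> borel_measurable borel" using g by (rule L2_measurable)
  define \<epsilon> where "\<epsilon> n = 1 / real (Suc n)" for n
  have \<epsilon>: "0 < \<epsilon> n" for n by (simp add: \<epsilon>_def)
  have \<epsilon>0: "\<epsilon> \<longlonglongrightarrow> 0" unfolding \<epsilon>_def by (rule LIMSEQ_Suc[OF lim_1_over_n])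
  have "(\<lambda>n. l2 (\<lambda>x. conv (QK (\<epsilon> n)) g x - G x)) \<longlonglongrightarrow> 0"
    using G(2) \<epsilon>0 \<epsilon> unfolding tendsto_at_iff_sequentially comp_def by auto
  then have 1: "(\<lambda>n. conv (PK a) (conv (QK (\<epsilon> n)) g) x) \<longlonglongrightarrow> conv (PK a) G x"
    unfolding conv_def[of "PK a"]
    by (intro L2_tendsto_pairing L2_reflect_shift PK_L2 a L2_conv_QK g G \<epsilon>) auto
  have eq: "conv (PK a) (conv (QK (\<epsilon> n)) g) x = conv (QK (a + \<epsilon> n)) g x" for n
  proof -
    have "conv (PK a) (conv (QK (\<epsilon> n)) g) x
        = (LINT z|lborel. (LINT y|lborel. PK a (x - y) * QK (\<epsilon> n) (y - z)) * g z)"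
      by (intro conv_assoc PK_integrable QK_L2 a g \<epsilon>)
    also have "\<dots> = (LINT z|lborel. QK (a + \<epsilon> n) (x - z) * g z)"
    proof (rule integral_cong_AE)
      show "AE z in lborel. (LINT y|lborel. PK a (x - y) * QK (\<epsilon> n) (y - z)) * g z = QK (a + \<epsilon> n) (x - z) * g z"
        using AE_neq[of x]
      proof eventually_elim
        fix z assume "z \<noteq> x"
        then show "(LINT y|lborel. PK a (x - y) * QK (\<epsilon> n) (y - z)) * g z = QK (a + \<epsilon> n) (x - z) * g z"
          using integral_shift[of "\<lambda>y. PK a (x - z - y) * QK (\<epsilon> n) y" z] kernel_convolutions(2)[OF a \<epsilon>[of n], of "x - z"]
          by (simp add: algebra_simps)
      qed
    qed measurable
    finally show ?thesis by (simp add: conv_def)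
  qed
  have "(\<lambda>n. l2 (\<lambda>y. QK (a + \<epsilon> n) (x - y) - QK a (x - y))) \<longlonglongrightarrow> 0"
  proof (rule l2_dominated[where w="\<lambda>y. 2 * \<bar>QK a (x - y)\<bar>"])
    show "L2 (\<lambda>y. 2 * \<bar>QK a (x - y)\<bar>)"
      by (intro L2_cmult L2_abs L2_reflect_shift QK_L2 a)
    show "\<bar>QK (a + \<epsilon> n) (x - y) - QK a (x - y)\<bar> \<le> 2 * \<bar>QK a (x - y)\<bar>" for n y
    proof -
      define z where "z = x - y"
      have "\<bar>QK (a + \<epsilon> n) z\<bar> \<le> \<bar>QK a z\<bar>"
      proof -
        have "a\<^sup>2 \<le> (a + \<epsilon> n)\<^sup>2" using a \<epsilon>[of n] by (intro power_mono) auto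
        then have "\<bar>z\<bar> / (pi * (z\<^sup>2 + (a + \<epsilon> n)\<^sup>2)) \<le> \<bar>z\<bar> / (pi * (z\<^sup>2 + a\<^sup>2))"
          using sum_power2_pos[OF a, of z] a \<epsilon>[of n] sum_power2_pos[of "a + \<epsilon> n" z]
          by (intro divide_left_mono mult_left_mono) auto
        then show ?thesis by (simp add: QK_def abs_mult)
      qed
      then show ?thesis unfolding z_def[symmetric] by linarith
    qed
    show "AE y in lborel. (\<lambda>n. QK (a + \<epsilon> n) (x - y)) \<longlonglongrightarrow> QK a (x - y)"
    proof (rule AE_I2)
      fix y
      have "(\<lambda>n. (x - y) / (pi * ((x - y)\<^sup>2 + (a + \<epsilon> n)\<^sup>2))) \<longlonglongrightarrow> (x - y) / (pi * ((x - y)\<^sup>2 + (a + 0)\<^sup>2))"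
        using sum_power2_pos[OF a, of "x - y"] by (intro tendsto_intros \<epsilon>0) auto
      then show "(\<lambda>n. QK (a + \<epsilon> n) (x - y)) \<longlonglongrightarrow> QK a (x - y)" by (simp add: QK_def)
    qed
  qed measurable
  then have 2: "(\<lambda>n. conv (QK (a + \<epsilon> n)) g x) \<longlonglongrightarrow> conv (QK a) g x"
    unfolding conv_def
    by (intro L2_tendsto_pairing L2_reflect_shift QK_L2 g) (use a \<epsilon> in \<open>auto intro: add_pos_pos\<close>)
  show ?thesis
    using LIMSEQ_unique[OF 2] 1 unfolding eq by blast
qed

subsection \<open>Maximal function and Lebesgue points\<close>

text \<open>Vitali's covering lemma: disjoint balls with large averages, enlarged five times, cover
  every point at which the maximal function exceeds \<open>\<mu>\<close>. The exceptional set
  \<open>U\<close> is that countable union of closed balls, which makes it Borel by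
  construction.\<close>

lemma maximal_weak_type:
  fixes h :: "real \<Rightarrow> ennreal"
  assumes [measurable]: "h \<in> borel_measurable borel" and fin: "(\<integral>\<^sup>+x. h x \<partial>lborel) < \<infinity>" and lam: "\<mu> > 0"
  obtains U where "U \<in> sets borel" "emeasure lborel U \<le> ennreal (5 / \<mu>) * (\<integral>\<^sup>+x. h x \<partial>lborel)"
    "\<And>x r. x \<notin> U \<Longrightarrow> r > 0 \<Longrightarrow> (\<integral>\<^sup>+y. h y * indicator (cball x r) y \<partial>lborel) \<le> ennreal (2 * r * \<mu>)"
proof -
  have [measurable]: "cball x s \<in> sets borel" for x s :: real by simp
  define I where "I x r = (\<integral>\<^sup>+y. h y * indicator (cball x r) y \<partial>lborel)" for x r :: real
  define E where "E = {x. \<exists>r>0. ennreal (2 * r * \<mu>) < I x r}"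
  have "\<forall>x\<in>E. \<exists>r. 0 < r \<and> ennreal (2 * r * \<mu>) < I x r" by (auto simp: E_def)
  from bchoice[OF this] obtain r where r': "\<forall>x\<in>E. 0 < r x \<and> ennreal (2 * r x * \<mu>) < I x (r x)" ..
  then have r: "0 < r x \<and> ennreal (2 * r x * \<mu>) < I x (r x)" if "x \<in> E" for x using that by blast
  obtain H where H: "(\<integral>\<^sup>+x. h x \<partial>lborel) = ennreal H" "H \<ge> 0"
    using fin by (cases "\<integral>\<^sup>+x. h x \<partial>lborel") auto
  \<comment> \<open>The covering lemma needs bounded radii; finiteness of the total integral
    provides the bound.\<close>
  have rb: "r x \<le> H / (2 * \<mu>)" if "x \<in> E" for x
  proof -
    have "ennreal (2 * r x * \<mu>) \<le> I x (r x)" using r[OF that] by auto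
    also have "\<dots> \<le> ennreal H"
      unfolding I_def H(1)[symmetric] by (intro nn_integral_mono) (simp split: split_indicator)
    finally have "2 * r x * \<mu> \<le> H" using H by simp
    then show ?thesis using lam by (simp add: field_simps)
  qed
  obtain C where C: "countable C" "C \<subseteq> E"
     "pairwise (\<lambda>i j. disjnt (cball i (r i)) (cball j (r j))) C"
     "E \<subseteq> (\<Union>i\<in>C. cball i (5 * r i))"
  proof (rule Vitali_covering_lemma_cballs[where S=E and K=E and a="\<lambda>x. x" and r=r and B="H / (2 * \<mu>)"])
    show "E \<subseteq> (\<Union>i\<in>E. cball i (r i))"
    proof
      fix x assume "x \<in> E"
      moreover from this have "x \<in> cball x (r x)" using r[of x] by simp
      ultimately show "x \<in> (\<Union>i\<in>E. cball i (r i))" by blast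
    qed
    show "0 < r i \<and> r i \<le> H / (2 * \<mu>)" if "i \<in> E" for i
      using r[OF that] rb[OF that] by simp
  qed (rule that)
  define U where "U = (\<Union>i\<in>C. cball i (5 * r i))"
  have U: "U \<in> sets borel" unfolding U_def by (intro sets.countable_UN' C) auto
  have em: "emeasure lborel (cball i (5 * r i)) \<le> ennreal (5 / \<mu>) * I i (r i)" if "i \<in> C" for i
  proof -
    have ri: "0 < r i" "ennreal (2 * r i * \<mu>) < I i (r i)" using r that C(2) by auto
    have "emeasure lborel (cball i (5 * r i)) = ennreal (10 * r i)"
      using ri by (simp add: cball_eq_atLeastAtMost)
    also have "\<dots> = ennreal (5 / \<mu>) * ennreal (2 * r i * \<mu>)"
      using ri lam by (simp flip: ennreal_mult)
    also have "\<dots> \<le> ennreal (5 / \<mu>) * I i (r i)"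
      using ri by (intro mult_left_mono) auto
    finally show ?thesis .
  qed
  \<comment> \<open>By disjointness each point lies in at most one of the chosen balls, so their
    integrals add up to at most the total one.\<close>
  have disj: "(\<integral>\<^sup>+i. indicator (cball i (r i)) y \<partial>count_space C) \<le> (1::ennreal)" for y
  proof (cases "\<exists>i\<in>C. y \<in> cball i (r i)")
    case True
    then obtain j where j: "j \<in> C" "y \<in> cball j (r j)" by blast
    have "indicator (cball i (r i)) y = (indicator {j} i :: ennreal)" if "i \<in> C" for i
    proof (cases "i = j")
      case False
      then have "disjnt (cball i (r i)) (cball j (r j))"
        using C(3) j(1) that unfolding pairwise_def by blast
      then have "y \<notin> cball i (r i)" using j(2) unfolding disjnt_def by blast
      then show ?thesis using False by (simp del: mem_cball)
    qed (use j in simp)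
    then have "(\<integral>\<^sup>+i. indicator (cball i (r i)) y \<partial>count_space C) = (\<integral>\<^sup>+i. indicator {j} i \<partial>count_space C)"
      by (intro nn_integral_cong) auto
    also have "\<dots> = emeasure (count_space C) {j}" using j by (intro nn_integral_indicator) auto
    also have "\<dots> = 1" using j by (simp add: emeasure_count_space)
    finally show ?thesis by simp
  next
    case False
    then have "(\<integral>\<^sup>+i. indicator (cball i (r i)) y \<partial>count_space C) = (\<integral>\<^sup>+i. (0::ennreal) \<partial>count_space C)"
      by (intro nn_integral_cong) auto
    then show ?thesis by simp
  qed
  have "emeasure lborel U = (\<integral>\<^sup>+y. indicator U y \<partial>lborel)" using U by simp
  also have "\<dots> \<le> (\<integral>\<^sup>+y. \<integral>\<^sup>+i. indicator (cball i (5 * r i)) y \<partial>count_space C \<partial>lborel)"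
  proof (rule nn_integral_mono)
    fix y
    show "(indicator U y :: ennreal) \<le> (\<integral>\<^sup>+i. indicator (cball i (5 * r i)) y \<partial>count_space C)"
    proof (cases "y \<in> U")
      case True
      then obtain j where j: "j \<in> C" "y \<in> cball j (5 * r j)" by (auto simp: U_def)
      have "(indicator U y :: ennreal) = emeasure (count_space C) {j}"
        using True j by (simp add: emeasure_count_space)
      also have "\<dots> = (\<integral>\<^sup>+i. indicator {j} i \<partial>count_space C)"
        using j by (intro nn_integral_indicator[symmetric]) auto
      also have "\<dots> \<le> (\<integral>\<^sup>+i. indicator (cball i (5 * r i)) y \<partial>count_space C)"
        using j by (intro nn_integral_mono) (auto simp: indicator_def)
      finally show ?thesis .
    qed simp
  qed
  also have "\<dots> = (\<integral>\<^sup>+i. emeasure lborel (cball i (5 * r i)) \<partial>count_space C)"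
    by (subst nn_integral_count_space_nn_integral[OF C(1)])
      (auto intro!: borel_measurable_indicator borel_measurable_times_ennreal borel_closed)
  also have "\<dots> \<le> (\<integral>\<^sup>+i. ennreal (5 / \<mu>) * I i (r i) \<partial>count_space C)"
    by (intro nn_integral_mono em) simp
  also have "\<dots> = ennreal (5 / \<mu>) * (\<integral>\<^sup>+i. I i (r i) \<partial>count_space C)"
    by (rule nn_integral_cmult) simp
  also have "(\<integral>\<^sup>+i. I i (r i) \<partial>count_space C)
      = (\<integral>\<^sup>+y. \<integral>\<^sup>+i. h y * indicator (cball i (r i)) y \<partial>count_space C \<partial>lborel)"
    unfolding I_def by (subst nn_integral_count_space_nn_integral[OF C(1)])
      (auto intro!: borel_measurable_indicator borel_measurable_times_ennreal borel_closed)
  also have "\<dots> = (\<integral>\<^sup>+y. h y * (\<integral>\<^sup>+i. indicator (cball i (r i)) y \<partial>count_space C) \<partial>lborel)"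
    by (intro nn_integral_cong nn_integral_cmult) simp
  also have "\<dots> \<le> (\<integral>\<^sup>+y. h y * 1 \<partial>lborel)"
    by (intro nn_integral_mono mult_left_mono disj) simp
  finally have "emeasure lborel U \<le> ennreal (5 / \<mu>) * (\<integral>\<^sup>+x. h x \<partial>lborel)"
    by (simp add: mult_left_mono)
  moreover have "(\<integral>\<^sup>+y. h y * indicator (cball x s) y \<partial>lborel) \<le> ennreal (2 * s * \<mu>)"
    if "x \<notin> U" "s > 0" for x s
  proof -
    have "x \<notin> E" using C(4) that by (auto simp: U_def)
    then have "\<not> ennreal (2 * s * \<mu>) < I x s" using that(2) unfolding E_def by blast
    then show ?thesis by (simp add: I_def not_less)
  qed
  ultimately show ?thesis using U that by blast
qed

text \<open>Only the least \<open>k\<close> with \<open>\<bar>x - y\<bar> \<le> 2 ^ k * a\<close> is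
  used. For \<open>k > 0\<close> minimality gives a distance above \<open>2 ^ (k - 1) * a\<close>,
  and the quadratic decay yields \<open>(1/4) ^ k\<close> with one factor 4 lost.\<close>

lemma PK_le_dyadic:
  assumes a: "a > 0"
  shows "ennreal (PK a (x - y)) \<le> (\<Sum>k. ennreal (4 / (pi * a) * (1/4) ^ k) * indicator (cball x (2 ^ k * a)) y)"
    (is "_ \<le> suminf ?f")
proof -
  define z where "z = x - y"
  have ex: "\<exists>k. \<bar>z\<bar> \<le> 2 ^ k * a"
  proof -
    obtain k where "\<bar>z\<bar> / a < 2 ^ k" using real_arch_pow[of 2 "\<bar>z\<bar> / a"] by auto
    then show ?thesis using a by (auto simp: divide_less_eq intro!: exI[of _ k])
  qed
  define k where "k = (LEAST k. \<bar>z\<bar> \<le> 2 ^ k * a)"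
  have k: "\<bar>z\<bar> \<le> 2 ^ k * a" unfolding k_def by (rule LeastI_ex[OF ex])
  have "PK a z \<le> 4 / (pi * a) * (1/4) ^ k"
  proof (cases k)
    case 0
    have "PK a z \<le> a / (pi * a\<^sup>2)"
      unfolding PK_def using a sum_power2_pos[OF a, of z]
      by (intro divide_left_mono mult_left_mono) auto
    also have "\<dots> \<le> 4 / (pi * a) * (1/4) ^ k" using a 0 by (simp add: power2_eq_square field_simps)
    finally show ?thesis .
  next
    case (Suc j)
    then have "\<not> \<bar>z\<bar> \<le> 2 ^ j * a" unfolding k_def by (metis lessI not_less_Least)
    then have "(2 ^ j * a)\<^sup>2 \<le> z\<^sup>2"
      using a power_mono[of "2 ^ j * a" "\<bar>z\<bar>" 2] by simp
    moreover have "(2 ^ j * a)\<^sup>2 = 4 ^ j * a\<^sup>2"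
      using power_mult_distrib[of "2::real" 2 j] by (simp add: power_mult_distrib power2_eq_square)
    ultimately have "4 ^ j * a\<^sup>2 \<le> z\<^sup>2 + a\<^sup>2"
      using zero_le_power2[of a] by linarith
    then have "PK a z \<le> a / (pi * (4 ^ j * a\<^sup>2))"
      unfolding PK_def using a sum_power2_pos[OF a, of z]
      by (intro divide_left_mono mult_left_mono) auto
    also have "\<dots> = 4 / (pi * a) * (1/4) ^ k" using a Suc by (simp add: power2_eq_square field_simps)
    finally show ?thesis .
  qed
  then have "ennreal (PK a (x - y)) \<le> ?f k"
    using k by (simp add: z_def dist_real_def ennreal_leI)
  also have "\<dots> \<le> suminf ?f"
  proof -
    have "F k \<le> suminf F" for F :: "nat \<Rightarrow> ennreal"
      using sum_le_suminf[of F "{k}"] by simp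
    then show ?thesis .
  qed
  finally show ?thesis .
qed

text \<open>The coefficients \<open>(1/4) ^ k\<close> beat the lengths of the dyadic balls, which
  grow like \<open>2 ^ k\<close>, leaving a geometric series with sum
  \<open>16 * \<mu> / pi\<close>.\<close>

lemma poisson_le_maximal:
  fixes h :: "real \<Rightarrow> ennreal"
  assumes [measurable]: "h \<in> borel_measurable borel" and lam: "\<mu> > 0" and a: "a > 0"
    and M: "\<And>r. r > 0 \<Longrightarrow> (\<integral>\<^sup>+y. h y * indicator (cball x r) y \<partial>lborel) \<le> ennreal (2 * r * \<mu>)"
  shows "(\<integral>\<^sup>+y. ennreal (PK a (x - y)) * h y \<partial>lborel) \<le> ennreal (6 * \<mu>)"
proof -
  define c where "c k = 4 / (pi * a) * (1/4) ^ k" for k :: nat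
  have c: "c k \<ge> 0" for k using a by (simp add: c_def)
  have [measurable]: "cball x r \<in> sets borel" for r by simp
  have "(\<integral>\<^sup>+y. ennreal (PK a (x - y)) * h y \<partial>lborel)
     \<le> (\<integral>\<^sup>+y. (\<Sum>k. ennreal (c k) * (h y * indicator (cball x (2 ^ k * a)) y)) \<partial>lborel)"
  proof (rule nn_integral_mono)
    fix y
    have "ennreal (PK a (x - y)) * h y \<le> (\<Sum>k. ennreal (c k) * indicator (cball x (2 ^ k * a)) y) * h y"
      unfolding c_def by (intro mult_right_mono PK_le_dyadic a) simp
    also have "\<dots> = (\<Sum>k. ennreal (c k) * (h y * indicator (cball x (2 ^ k * a)) y))"
      by (subst ennreal_suminf_multc[symmetric]) (simp add: mult_ac)
    finally show "ennreal (PK a (x - y)) * h y \<le> (\<Sum>k. ennreal (c k) * (h y * indicator (cball x (2 ^ k * a)) y))" .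
  qed
  also have "\<dots> = (\<Sum>k. ennreal (c k) * (\<integral>\<^sup>+y. h y * indicator (cball x (2 ^ k * a)) y \<partial>lborel))"
    by (subst nn_integral_suminf) (measurable, simp add: nn_integral_cmult)
  also have "\<dots> \<le> (\<Sum>k. ennreal (c k) * ennreal (2 * (2 ^ k * a) * \<mu>))"
    by (intro suminf_le mult_left_mono M) (use a in auto)
  also have "\<dots> = (\<Sum>k. ennreal ((8 * \<mu> / pi) * (1/2) ^ k))"
  proof (rule arg_cong[where f=suminf], rule ext)
    fix k
    have "(4::real) ^ k = 2 ^ k * 2 ^ k" by (simp flip: power_mult_distrib)
    then have "c k * (2 * (2 ^ k * a) * \<mu>) = (8 * \<mu> / pi) * (1/2) ^ k"
      using a by (simp add: c_def power_divide)
    then show "ennreal (c k) * ennreal (2 * (2 ^ k * a) * \<mu>) = ennreal ((8 * \<mu> / pi) * (1/2) ^ k)"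
      using c a lam by (simp flip: ennreal_mult)
  qed
  also have "\<dots> = ennreal (\<Sum>k. (8 * \<mu> / pi) * (1/2) ^ k)"
    using lam by (intro suminf_ennreal2) (auto intro!: summable_mult summable_geometric)
  also have "(\<Sum>k. (8 * \<mu> / pi) * (1/2) ^ k) = 16 * \<mu> / pi"
    using suminf_mult[OF summable_geometric[of "1/2::real"], of "8 * \<mu> / pi"] by (simp add: suminf_geometric)
  also have "16 * \<mu> / pi \<le> 6 * \<mu>"
    using pi_gt3 lam by (simp add: field_simps)
  finally show ?thesis by (simp add: ennreal_leI order_trans)
qed

text \<open>As \<open>a\<close> decreases to \<open>0\<close>, this tends to \<open>0\<close> at the strong Lebesgue points of \<open>f\<close>.\<close>

definition osc :: "(real \<Rightarrow> real) \<Rightarrow> real \<Rightarrow> real \<Rightarrow> real" where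
  "osc f a x = (LINT y|lborel. PK a (x - y) * (f y - f x)\<^sup>2)"

lemma PK_mult_L2_square_integrable:
  assumes a: "a > 0" and f: "L2 f"
  shows "integrable lborel (\<lambda>y. PK a (x - y) * (f y)\<^sup>2)"
proof (rule Bochner_Integration.integrable_bound)
  have [measurable]: "f \<in> borel_measurable borel" using f by (rule L2_measurable)
  show "integrable lborel (\<lambda>y. (1 / (pi * a)) * (f y)\<^sup>2)" using f by (intro integrable_mult_right L2_square_integrable)
  show "(\<lambda>y. PK a (x - y) * (f y)\<^sup>2) \<in> borel_measurable lborel" by measurable
  have "PK a z \<le> 1 / (pi * a)" for z
  proof -
    have "a / (pi * (z\<^sup>2 + a\<^sup>2)) \<le> a / (pi * a\<^sup>2)"
      using a sum_power2_pos[OF a, of z] by (intro divide_left_mono mult_left_mono) auto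
    then show ?thesis using a by (simp add: PK_def power2_eq_square)
  qed
  then have "PK a (x - y) * (f y)\<^sup>2 \<le> (1 / (pi * a)) * (f y)\<^sup>2" for y by (rule mult_right_mono) simp
  then show "AE y in lborel. norm (PK a (x - y) * (f y)\<^sup>2) \<le> norm ((1 / (pi * a)) * (f y)\<^sup>2)"
    using PK_nonneg[of a] a by (intro AE_I2) (simp add: abs_mult)
qed

lemma osc_integrable:
  assumes a: "a > 0" and f: "L2 f"
  shows "integrable lborel (\<lambda>y. PK a (x - y) * (f y - c)\<^sup>2)"
proof -
  have "integrable lborel (\<lambda>y. PK a (x - y) * (f y)\<^sup>2 - 2 * c * (PK a (x - y) * f y) + c\<^sup>2 * PK a (x - y))"
    using a f by (intro Bochner_Integration.integrable_add Bochner_Integration.integrable_diff integrable_mult_right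
       PK_mult_L2_square_integrable L2_mult_integrable L2_reflect_shift PK_L2)
      (auto simp: integrable_reflect_shift PK_integrable)
  then show ?thesis by (simp add: power2_diff algebra_simps)
qed

lemma osc_nonneg: "a > 0 \<Longrightarrow> 0 \<le> osc f a x"
  unfolding osc_def by (intro Bochner_Integration.integral_nonneg mult_nonneg_nonneg PK_nonneg) auto

text \<open>For a small perturbation \<open>q\<close> of a good function \<open>h\<close>, the
  second term is governed by the maximal function of \<open>q^2\<close> and the third by Markov's
  inequality; the factors 3 are the price of squaring a sum of three terms.\<close>

lemma osc_add_le:
  assumes a: "a > 0" and h: "L2 h" and q: "L2 q" and f: "\<And>x. f x = h x + q x"
  shows "osc f a x \<le> 3 * osc h a x + 3 * (LINT y|lborel. PK a (x - y) * (q y)\<^sup>2) + 3 * (q x)\<^sup>2"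
proof -
  have Lf: "L2 f" using L2_add[OF h q] f by (simp add: f[abs_def])
  have i: "integrable lborel (\<lambda>y. PK a (x - y))" "(LINT y|lborel. PK a (x - y)) = 1"
    using a by (auto simp: integrable_reflect_shift PK_integrable integral_reflect_shift PK_integral)
  have "osc f a x \<le> (LINT y|lborel. 3 * (PK a (x - y) * (h y - h x)\<^sup>2) + 3 * (PK a (x - y) * (q y)\<^sup>2) + 3 * (q x)\<^sup>2 * PK a (x - y))"
    unfolding osc_def
  proof (rule integral_mono)
    fix y
    have *: "(u + v - w)\<^sup>2 \<le> 3 * u\<^sup>2 + 3 * v\<^sup>2 + 3 * w\<^sup>2" for u v w :: real
    proof -
      have "3 * u\<^sup>2 + 3 * v\<^sup>2 + 3 * w\<^sup>2 - (u + v - w)\<^sup>2 = (u - v)\<^sup>2 + (u + w)\<^sup>2 + (v + w)\<^sup>2"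
        by (simp add: power2_eq_square algebra_simps)
      then show ?thesis using zero_le_power2[of "u - v"] zero_le_power2[of "u + w"] zero_le_power2[of "v + w"] by linarith
    qed
    have "PK a (x - y) * (f y - f x)\<^sup>2 \<le> PK a (x - y) * (3 * (h y - h x)\<^sup>2 + 3 * (q y)\<^sup>2 + 3 * (q x)\<^sup>2)"
      using *[of "h y - h x" "q y" "q x"] a by (intro mult_left_mono PK_nonneg) (auto simp: f algebra_simps)
    then show "PK a (x - y) * (f y - f x)\<^sup>2 \<le> 3 * (PK a (x - y) * (h y - h x)\<^sup>2) + 3 * (PK a (x - y) * (q y)\<^sup>2) + 3 * (q x)\<^sup>2 * PK a (x - y)"
      by (simp add: algebra_simps)
  qed (intro Bochner_Integration.integrable_add integrable_mult_right
        osc_integrable[OF a Lf] osc_integrable[OF a h] PK_mult_L2_square_integrable[OF a q] i)+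
  also have "\<dots> = 3 * osc h a x + 3 * (LINT y|lborel. PK a (x - y) * (q y)\<^sup>2) + 3 * (q x)\<^sup>2"
    using a h q i by (simp add: osc_integrable PK_mult_L2_square_integrable osc_def)
  finally show ?thesis .
qed

lemma osc_tendsto_of_continuous:
  assumes h: "continuous_on UNIV h" "\<And>x. \<bar>h x\<bar> \<le> K"
  shows "((\<lambda>a. osc h a x) \<longlongrightarrow> 0) (at_right 0)"
  unfolding tendsto_at_iff_sequentially comp_def
proof (intro allI impI)
  fix X :: "nat \<Rightarrow> real" assume X: "\<forall>i. X i \<in> {0<..} - {0}" "X \<longlonglongrightarrow> 0"
  have [measurable]: "h \<in> borel_measurable borel" using h(1) by (rule borel_measurable_continuous_onI)
  have e: "osc h (X i) x = (LINT s|lborel. PK 1 s * (h (x - X i * s) - h x)\<^sup>2)" for i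
  proof -
    have Xi: "X i > 0" using X(1) by auto
    show ?thesis
      using conv_dilate[OF Xi, of "PK 1" "\<lambda>y. (h y - h x)\<^sup>2" x]
      by (simp add: osc_def conv_def PK_dilate[OF Xi, symmetric])
  qed
  have "(\<lambda>i. LINT s|lborel. PK 1 s * (h (x - X i * s) - h x)\<^sup>2) \<longlonglongrightarrow> (LINT s|(lborel::real measure). 0)"
  proof (rule integral_dominated_convergence)
    show "integrable lborel (\<lambda>s. PK 1 s * (2 * K)\<^sup>2)" using PK_integrable_1 by auto
    show "AE s in lborel. (\<lambda>i. PK 1 s * (h (x - X i * s) - h x)\<^sup>2) \<longlonglongrightarrow> 0"
    proof (rule AE_I2)
      fix s
      have "(\<lambda>i. x - X i * s) \<longlonglongrightarrow> x - 0 * s" by (intro tendsto_intros X)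
      then have "(\<lambda>i. h (x - X i * s)) \<longlonglongrightarrow> h x"
        using continuous_on_tendsto_compose[OF h(1), of "\<lambda>i. x - X i * s" x] by simp
      then have "(\<lambda>i. PK 1 s * (h (x - X i * s) - h x)\<^sup>2) \<longlonglongrightarrow> PK 1 s * (h x - h x)\<^sup>2"
        by (intro tendsto_intros)
      then show "(\<lambda>i. PK 1 s * (h (x - X i * s) - h x)\<^sup>2) \<longlonglongrightarrow> 0" by simp
    qed
    show "AE s in lborel. norm (PK 1 s * (h (x - X i * s) - h x)\<^sup>2) \<le> PK 1 s * (2 * K)\<^sup>2" for i
    proof (rule AE_I2)
      fix s
      have "\<bar>h (x - X i * s) - h x\<bar> \<le> 2 * K" using h(2)[of "x - X i * s"] h(2)[of x] by linarith
      from power_mono[OF this, of 2] have "(h (x - X i * s) - h x)\<^sup>2 \<le> (2 * K)\<^sup>2" by simp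
      then have "PK 1 s * (h (x - X i * s) - h x)\<^sup>2 \<le> PK 1 s * (2 * K)\<^sup>2"
        by (intro mult_left_mono PK_nonneg) auto
      then show "norm (PK 1 s * (h (x - X i * s) - h x)\<^sup>2) \<le> PK 1 s * (2 * K)\<^sup>2"
        using PK_nonneg[of 1 s] by (simp add: abs_mult)
    qed
  qed measurable
  then show "(\<lambda>i. osc h (X i) x) \<longlonglongrightarrow> 0" unfolding e by simp
qed

text \<open>Approximate \<open>f\<close> by a continuous function; the weak type inequality bounds the measure of
  the set where the error has a large maximal function.\<close>

lemma osc_exceptional_set:
  assumes f: "L2 f" and e: "e > 0" and \<eta>: "\<eta> > 0"
  obtains W where "W \<in> sets borel" "emeasure lborel W \<le> ennreal \<eta>"
    "\<And>x. x \<notin> W \<Longrightarrow> \<forall>\<^sub>F a in at_right 0. osc f a x \<le> e"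
proof -
  \<comment> \<open>The two exceptional sets have total measure at most
    \<open>(5 / \<mu> + 12 / e) * s^2 = (372 / e) * s^2\<close> for \<open>\<mu> = e / 72\<close>;
    1000 in place of 372 leaves room.\<close>
  define s where "s = sqrt (\<eta> * e / 1000)"
  have s: "s > 0" using e \<eta> by (simp add: s_def)
  obtain h R where h: "continuous_on UNIV h" "\<And>x. R < \<bar>x\<bar> \<Longrightarrow> h x = 0" "l2 (\<lambda>x. f x - h x) < s"
    by (rule L2_dense_continuous[OF f s]) (rule that)
  obtain K where K: "\<And>x. \<bar>h x\<bar> \<le> K" "L2 h"
    by (rule L2_compact_support[of h R, OF h(1) h(2)]) (assumption | rule that)+
  define q where "q x = f x - h x" for x
  have q: "L2 q" unfolding q_def by (intro L2_diff f K)
  have [measurable]: "q \<in> borel_measurable borel" using q by (rule L2_measurable)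
  have nn: "(\<integral>\<^sup>+x. ennreal ((q x)\<^sup>2) \<partial>lborel) \<le> ennreal (s\<^sup>2)"
  proof -
    have "(\<integral>\<^sup>+x. ennreal ((q x)\<^sup>2) \<partial>lborel) = ennreal ((l2 q)\<^sup>2)"
      unfolding l2_square using L2_square_integrable[OF q] by (intro nn_integral_eq_integral) auto
    also have "\<dots> \<le> ennreal (s\<^sup>2)"
      using h(3) by (intro ennreal_leI power_mono) (auto simp: q_def[abs_def])
    finally show ?thesis .
  qed
  \<comment> \<open>Chosen so that the maximal term contributes
    \<open>3 * 6 * \<mu> = e / 4\<close>. The other two terms, each at most
    \<open>3 * e / 12\<close>, add \<open>e / 4\<close> apiece.\<close>
  define \<mu> where "\<mu> = e / 72"
  have lam: "\<mu> > 0" using e by (simp add: \<mu>_def)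
  obtain U where U: "U \<in> sets borel" "emeasure lborel U \<le> ennreal (5 / \<mu>) * (\<integral>\<^sup>+x. ennreal ((q x)\<^sup>2) \<partial>lborel)"
    "\<And>x r. x \<notin> U \<Longrightarrow> r > 0 \<Longrightarrow> (\<integral>\<^sup>+y. ennreal ((q y)\<^sup>2) * indicator (cball x r) y \<partial>lborel) \<le> ennreal (2 * r * \<mu>)"
    by (rule maximal_weak_type[of "\<lambda>x. ennreal ((q x)\<^sup>2)" \<mu>])
      (use nn lam in \<open>auto simp: le_less_trans[OF nn ennreal_less_top] intro: that\<close>)
  define V where "V = {x. 1 \<le> ennreal (12 / e) * ennreal ((q x)\<^sup>2)}"
  have [measurable]: "V \<in> sets borel" unfolding V_def by measurable
  have "emeasure lborel {x\<in>UNIV. 1 \<le> ennreal (12 / e) * ennreal ((q x)\<^sup>2)}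
      \<le> ennreal (12 / e) * (\<integral>\<^sup>+x. ennreal ((q x)\<^sup>2) * indicator UNIV x \<partial>lborel)"
    by (rule nn_integral_Markov_inequality) auto
  then have V: "emeasure lborel V \<le> ennreal (12 / e) * (\<integral>\<^sup>+x. ennreal ((q x)\<^sup>2) \<partial>lborel)"
    by (simp add: V_def)
  show ?thesis
  proof (rule that[of "U \<union> V"])
    show "U \<union> V \<in> sets borel" using U by measurable
    have "emeasure lborel (U \<union> V) \<le> emeasure lborel U + emeasure lborel V"
      using U by (intro emeasure_subadditive) auto
    also have "\<dots> \<le> ennreal (5 / \<mu>) * ennreal (s\<^sup>2) + ennreal (12 / e) * ennreal (s\<^sup>2)"
      by (intro add_mono order_trans[OF U(2)] order_trans[OF V] mult_left_mono nn) auto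
    also have "\<dots> = ennreal (372 / 1000 * \<eta>)"
      using e \<eta> s by (simp add: \<mu>_def s_def flip: ennreal_mult ennreal_plus)
    also have "\<dots> \<le> ennreal \<eta>" using \<eta> by (intro ennreal_leI) auto
    finally show "emeasure lborel (U \<union> V) \<le> ennreal \<eta>" .
    fix x assume x: "x \<notin> U \<union> V"
    have "ennreal ((12 / e) * (q x)\<^sup>2) = ennreal (12 / e) * ennreal ((q x)\<^sup>2)"
      by (rule ennreal_mult) (use e in auto)
    moreover have "\<not> 1 \<le> ennreal (12 / e) * ennreal ((q x)\<^sup>2)" using x by (auto simp only: V_def)
    ultimately have "ennreal ((12 / e) * (q x)\<^sup>2) < 1" by (simp only: not_le)
    then have "(12 / e) * (q x)\<^sup>2 < 1" by (simp only: ennreal_less_one_iff)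
    then have qx: "(q x)\<^sup>2 \<le> e / 12" using e by (simp add: field_simps)
    have P: "(LINT y|lborel. PK a (x - y) * (q y)\<^sup>2) \<le> 6 * \<mu>" if a: "a > 0" for a
    proof -
      have "ennreal (LINT y|lborel. PK a (x - y) * (q y)\<^sup>2) = (\<integral>\<^sup>+y. ennreal (PK a (x - y) * (q y)\<^sup>2) \<partial>lborel)"
        using a PK_nonneg[of a] by (intro nn_integral_eq_integral[symmetric] PK_mult_L2_square_integrable q) auto
      also have "\<dots> = (\<integral>\<^sup>+y. ennreal (PK a (x - y)) * ennreal ((q y)\<^sup>2) \<partial>lborel)"
        using a PK_nonneg[of a] by (intro nn_integral_cong ennreal_mult) auto
      also have "\<dots> \<le> ennreal (6 * \<mu>)"
        by (rule poisson_le_maximal[OF _ lam a]) (use U(3) x in auto)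
      finally show ?thesis using lam by simp
    qed
    have "\<forall>\<^sub>F a in at_right 0. osc h a x < e / 12"
      using order_tendstoD(2)[OF osc_tendsto_of_continuous[OF h(1) K(1), of x], of "e / 12"] e by simp
    then show "\<forall>\<^sub>F a in at_right 0. osc f a x \<le> e"
      using eventually_at_right_less
    proof eventually_elim
      fix a assume a: "osc h a x < e / 12" "0 < a"
      have "osc f a x \<le> 3 * osc h a x + 3 * (LINT y|lborel. PK a (x - y) * (q y)\<^sup>2) + 3 * (q x)\<^sup>2"
        by (rule osc_add_le[OF a(2) K(2) q]) (simp add: q_def)
      then show "osc f a x \<le> e" using a(1) P[OF a(2)] qx e by (simp add: \<mu>_def)
    qed
  qed
qed

lemma AE_osc_tendsto:
  assumes f: "L2 f"
  shows "AE x in lborel. ((\<lambda>a. osc f a x) \<longlongrightarrow> 0) (at_right 0)"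
proof -
  have ae: "AE x in lborel. \<forall>\<^sub>F a in at_right 0. osc f a x \<le> e" if e: "e > 0" for e
  proof -
    have "\<exists>W. W \<in> sets borel \<and> emeasure lborel W \<le> ennreal (1 / real (Suc n)) \<and>
      (\<forall>x. x \<notin> W \<longrightarrow> (\<forall>\<^sub>F a in at_right 0. osc f a x \<le> e))" for n
      by (rule osc_exceptional_set[OF f e, of "1 / real (Suc n)"]) auto
    then obtain W where W: "\<And>n. W n \<in> sets borel" "\<And>n. emeasure lborel (W n) \<le> ennreal (1 / real (Suc n))"
      "\<And>n x. x \<notin> W n \<Longrightarrow> \<forall>\<^sub>F a in at_right 0. osc f a x \<le> e"
      by metis
    \<comment> \<open>A point outside any single \<open>W n\<close> is good, so the bad points lie
      in the intersection, whose measure is below every \<open>1 / (n + 1)\<close>.\<close>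
    have "emeasure lborel (\<Inter>n. W n) \<le> ennreal (1 / real (Suc n))" for n
      by (rule order_trans[OF emeasure_mono W(2)]) (use W(1) in auto)
    moreover have "(\<lambda>n. ennreal (1 / real (Suc n))) \<longlonglongrightarrow> ennreal 0"
      by (intro tendsto_ennrealI LIMSEQ_Suc[OF lim_1_over_n])
    ultimately have "emeasure lborel (\<Inter>n. W n) \<le> ennreal 0"
      by (intro LIMSEQ_le_const[of _ "ennreal 0"]) auto
    then have "(\<Inter>n. W n) \<in> null_sets lborel" using W(1) by (auto simp: null_sets_def)
    then show ?thesis by (rule AE_I') (use W(3) in auto)
  qed
  have "AE x in lborel. \<forall>n. \<forall>\<^sub>F a in at_right 0. osc f a x \<le> 1 / real (Suc n)"
    unfolding AE_all_countable by (intro allI ae) simp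
  then show ?thesis
  proof eventually_elim
    fix x assume x: "\<forall>n. \<forall>\<^sub>F a in at_right 0. osc f a x \<le> 1 / real (Suc n)"
    show "((\<lambda>a. osc f a x) \<longlongrightarrow> 0) (at_right 0)"
      unfolding tendsto_iff
    proof (intro allI impI)
      fix e :: real assume "e > 0"
      then obtain n where n: "1 / real (Suc n) < e" using nat_approx_posE by blast
      from x have "\<forall>\<^sub>F a in at_right 0. osc f a x \<le> 1 / real (Suc n)" ..
      then show "\<forall>\<^sub>F a in at_right 0. dist (osc f a x) 0 < e"
        using eventually_at_right_less
        by eventually_elim (use n osc_nonneg[of _ f x] in \<open>auto simp: dist_real_def\<close>)
    qed
  qed
qed

subsection \<open>The Hilbert transform\<close>

text \<open>The Hilbert kernel truncated near the diagonal. The strict inequality is the one in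
  \<open>hilbert\<close>, and it makes the kernel pointwise continuous from the right in
  \<open>\<epsilon>\<close>.\<close>

definition TK :: "real \<Rightarrow> real \<Rightarrow> real" where
  "TK \<epsilon> z = (if \<epsilon> < \<bar>z\<bar> then 1 / (pi * z) else 0)"

lemma TK_measurable [measurable]: "TK \<epsilon> \<in> borel_measurable borel"
  unfolding TK_def by measurable

lemma TK_minus: "TK \<epsilon> (- z) = - TK \<epsilon> z"
  by (simp add: TK_def)

text \<open>Beyond the truncation the difference is
  \<open>\<epsilon>^2 / (pi * z * (z^2 + \<epsilon>^2))\<close>, where one factor
  \<open>\<epsilon> / \<bar>z\<bar>\<close> is below 1; inside it is
  \<open>- QK \<epsilon> z\<close> with \<open>\<bar>z\<bar> \<le> \<epsilon>\<close>. Truncated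
  integrals are thereby compared with Poisson averages.\<close>

lemma TK_QK_le: assumes "\<epsilon> > 0" shows "\<bar>TK \<epsilon> z - QK \<epsilon> z\<bar> \<le> PK \<epsilon> z"
proof -
  define M where "M = z\<^sup>2 + \<epsilon>\<^sup>2"
  have M: "M > 0" using assms by (simp add: M_def sum_power2_pos)
  show ?thesis
  proof (cases "\<epsilon> < \<bar>z\<bar>")
    case True
    then have z: "z \<noteq> 0" using assms by auto
    have "TK \<epsilon> z - QK \<epsilon> z = (M - z\<^sup>2) / (pi * z * M)"
    proof -
      have "TK \<epsilon> z = 1 / (pi * z)" "QK \<epsilon> z = z / (pi * M)"
        using True by (simp_all add: TK_def QK_def M_def)
      then show ?thesis using z M by (simp add: field_simps power2_eq_square)
    qed
    also have "M - z\<^sup>2 = \<epsilon> * \<epsilon>" by (simp add: M_def power2_eq_square)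
    finally have "\<bar>TK \<epsilon> z - QK \<epsilon> z\<bar> = (\<epsilon> / \<bar>z\<bar>) * (\<epsilon> / (pi * M))"
      using M assms by (simp add: abs_mult)
    also have "\<dots> \<le> 1 * (\<epsilon> / (pi * M))"
      using True assms M by (intro mult_right_mono) auto
    finally show ?thesis by (simp add: PK_def M_def)
  next
    case False
    then have "\<bar>TK \<epsilon> z - QK \<epsilon> z\<bar> = \<bar>z\<bar> / (pi * M)"
      using M by (simp add: TK_def QK_def M_def[symmetric] abs_mult)
    also have "\<dots> \<le> \<epsilon> / (pi * M)" using False M by (intro divide_right_mono) auto
    finally show ?thesis by (simp add: PK_def M_def)
  qed
qed

lemma TK_QK_integrable: "\<epsilon> > 0 \<Longrightarrow> integrable lborel (\<lambda>z. TK \<epsilon> z - QK \<epsilon> z)"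
  by (rule Bochner_Integration.integrable_bound[OF PK_integrable[of \<epsilon>]])
    (use TK_QK_le[of \<epsilon>] in \<open>auto intro: order_trans[OF _ abs_ge_self]\<close>)

lemma TK_L2: assumes "\<epsilon> > 0" shows "L2 (TK \<epsilon>)"
proof -
  have "L2 (\<lambda>z. TK \<epsilon> z - QK \<epsilon> z)"
    by (rule l2_mono(1)[OF PK_L2[OF assms]]) (use TK_QK_le[OF assms] PK_nonneg[of \<epsilon>] assms in auto)
  from L2_add[OF this QK_L2[OF assms]] show ?thesis by simp
qed

lemma truncated_eq_conv:
  "(1 / pi) * (LINT y:{y. \<epsilon> < \<bar>x - y\<bar>}|lborel. g y / (x - y)) = conv (TK \<epsilon>) g x"
proof -
  have "conv (TK \<epsilon>) g x = (LINT y|lborel. (1 / pi) * (indicator {y. \<epsilon> < \<bar>x - y\<bar>} y *\<^sub>R (g y / (x - y))))"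
    unfolding conv_def by (intro Bochner_Integration.integral_cong) (auto simp: TK_def indicator_def)
  then show ?thesis
    unfolding set_lebesgue_integral_def by (simp only: integral_mult_right_zero)
qed

lemma hilbert_eq_Lim: "hilbert g x = Lim (at_right 0) (\<lambda>\<epsilon>. conv (TK \<epsilon>) g x)"
  unfolding hilbert_def truncated_eq_conv ..

lemma poisson_average_le_osc:
  assumes a: "a > 0" and f: "L2 f"
  shows "integrable lborel (\<lambda>y. PK a (x - y) * (f y - f x))"
    "(LINT y|lborel. PK a (x - y) * \<bar>f y - f x\<bar>) \<le> sqrt (osc f a x)"
proof -
  have [measurable]: "f \<in> borel_measurable borel" using f by (rule L2_measurable)
  have i: "integrable lborel (\<lambda>y. PK a (x - y))" "(LINT y|lborel. PK a (x - y)) = 1"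
    using a by (auto simp: integrable_reflect_shift PK_integrable integral_reflect_shift PK_integral)
  have nn: "0 \<le> PK a z" for z using a by (intro PK_nonneg) auto
  show "integrable lborel (\<lambda>y. PK a (x - y) * (f y - f x))"
    by (rule weighted_mean_square_le(1)[OF i(1) nn i(2) _ osc_integrable[OF a f]]) measurable
  have "(LINT y|lborel. PK a (x - y) * \<bar>f y - f x\<bar>)\<^sup>2 \<le> (LINT y|lborel. PK a (x - y) * \<bar>f y - f x\<bar>\<^sup>2)"
    by (rule weighted_mean_square_le(2)[OF i(1) nn i(2)]) (use osc_integrable[OF a f] in auto)
  then show "(LINT y|lborel. PK a (x - y) * \<bar>f y - f x\<bar>) \<le> sqrt (osc f a x)"
    by (intro real_le_rsqrt) (simp add: osc_def)
qed

lemma conv_PK_osc: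
  assumes a: "a > 0" and f: "L2 f"
  shows "\<bar>conv (PK a) f x - f x\<bar> \<le> sqrt (osc f a x)"
proof -
  have i: "integrable lborel (\<lambda>y. PK a (x - y))" "(LINT y|lborel. PK a (x - y)) = 1"
    using a by (auto simp: integrable_reflect_shift PK_integrable integral_reflect_shift PK_integral)
  have "conv (PK a) f x = (LINT y|lborel. PK a (x - y) * (f y - f x) + PK a (x - y) * f x)"
    unfolding conv_def by (simp add: algebra_simps)
  also have "\<dots> = (LINT y|lborel. PK a (x - y) * (f y - f x)) + f x"
    using poisson_average_le_osc(1)[OF a f] i by simp
  finally have "\<bar>conv (PK a) f x - f x\<bar> = \<bar>LINT y|lborel. PK a (x - y) * (f y - f x)\<bar>" by simp
  also have "\<dots> \<le> (LINT y|lborel. \<bar>PK a (x - y) * (f y - f x)\<bar>)" by (rule integral_abs_bound)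
  also have "\<dots> = (LINT y|lborel. PK a (x - y) * \<bar>f y - f x\<bar>)"
    using PK_nonneg[of a] a by (simp add: abs_mult)
  also have "\<dots> \<le> sqrt (osc f a x)" by (rule poisson_average_le_osc(2)[OF a f])
  finally show ?thesis .
qed

text \<open>The kernel \<open>TK \<epsilon> - QK \<epsilon>\<close> is odd, so it only sees the oscillation of \<open>g\<close>.\<close>

lemma conv_TK_QK_osc:
  assumes e: "\<epsilon> > 0" and g: "L2 g"
  shows "\<bar>conv (TK \<epsilon>) g x - conv (QK \<epsilon>) g x\<bar> \<le> sqrt (osc g \<epsilon> x)"
proof -
  have [measurable]: "g \<in> borel_measurable borel" using g by (rule L2_measurable)
  define k where "k z = TK \<epsilon> z - QK \<epsilon> z" for z
  have ik: "integrable lborel k" unfolding k_def by (rule TK_QK_integrable[OF e])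
  have Lk: "L2 k" unfolding k_def by (intro L2_diff TK_L2 QK_L2 e)
  have odd: "(LINT y|lborel. k (x - y)) = 0"
  proof -
    have "(LINT y|lborel. k (0 - y)) = (LINT y|lborel. k y)" by (rule integral_reflect_shift)
    moreover have "k (0 - y) = - k y" for y by (simp add: k_def TK_minus QK_minus)
    ultimately have "(LINT y|lborel. k y) = 0" by simp
    then show ?thesis by (simp add: integral_reflect_shift[of k])
  qed
  have i: "integrable lborel (\<lambda>y. k (x - y) * g y)" by (intro L2_mult_integrable L2_reflect_shift Lk g)
  have i': "integrable lborel (\<lambda>y. k (x - y))" using ik by (simp add: integrable_reflect_shift)
  have "conv (TK \<epsilon>) g x - conv (QK \<epsilon>) g x = conv k g x"
    unfolding k_def[abs_def] by (intro conv_diff_kernel[symmetric] TK_L2 QK_L2 e g)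
  also have "\<dots> = (LINT y|lborel. k (x - y) * g y - k (x - y) * g x)"
    unfolding conv_def using i i' odd by simp
  also have "\<dots> = (LINT y|lborel. k (x - y) * (g y - g x))" by (simp add: algebra_simps)
  finally have "\<bar>conv (TK \<epsilon>) g x - conv (QK \<epsilon>) g x\<bar> = \<bar>LINT y|lborel. k (x - y) * (g y - g x)\<bar>" by simp
  also have "\<dots> \<le> (LINT y|lborel. \<bar>k (x - y) * (g y - g x)\<bar>)" by (rule integral_abs_bound)
  also have "\<dots> \<le> (LINT y|lborel. PK \<epsilon> (x - y) * \<bar>g y - g x\<bar>)"
  proof (rule integral_mono)
    show "integrable lborel (\<lambda>y. \<bar>k (x - y) * (g y - g x)\<bar>)"
      using Bochner_Integration.integrable_diff[OF i integrable_mult_left[OF i', of "g x"]]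
      by (intro integrable_abs) (simp add: algebra_simps)
    show "integrable lborel (\<lambda>y. PK \<epsilon> (x - y) * \<bar>g y - g x\<bar>)"
      using integrable_abs[OF poisson_average_le_osc(1)[OF e g, of x]] PK_nonneg[of \<epsilon>] e
      by (simp add: abs_mult)
    show "\<bar>k (x - y) * (g y - g x)\<bar> \<le> PK \<epsilon> (x - y) * \<bar>g y - g x\<bar>" for y
      unfolding abs_mult k_def by (intro mult_right_mono TK_QK_le e) auto
  qed
  also have "\<dots> \<le> sqrt (osc g \<epsilon> x)" by (rule poisson_average_le_osc(2)[OF e g])
  finally show ?thesis .
qed

text \<open>The conjugate Poisson integral of \<open>g\<close> is inserted between the two sides. It
  differs from the truncation by the oscillation of \<open>g\<close>, and, being the Poisson
  integral of \<open>G\<close>, from \<open>G x\<close> by the oscillation of \<open>G\<close>. Both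
  vanish at almost every point.\<close>

lemma truncated_tendsto_AE:
  assumes g: "L2 g" and G: "L2 G" "((\<lambda>a. l2 (\<lambda>x. conv (QK a) g x - G x)) \<longlongrightarrow> 0) (at_right 0)"
  shows "AE x in lborel. ((\<lambda>\<epsilon>. conv (TK \<epsilon>) g x) \<longlongrightarrow> G x) (at_right 0)"
  using AE_osc_tendsto[OF g] AE_osc_tendsto[OF G(1)]
proof eventually_elim
  fix x assume o: "((\<lambda>a. osc g a x) \<longlongrightarrow> 0) (at_right 0)" "((\<lambda>a. osc G a x) \<longlongrightarrow> 0) (at_right 0)"
  have 1: "((\<lambda>a. sqrt (osc g a x) + sqrt (osc G a x)) \<longlongrightarrow> 0) (at_right 0)"
    using tendsto_add[OF tendsto_real_sqrt[OF o(1)] tendsto_real_sqrt[OF o(2)]] by simp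
  have 2: "\<forall>\<^sub>F \<epsilon> in at_right 0. norm (conv (TK \<epsilon>) g x - G x) \<le> sqrt (osc g \<epsilon> x) + sqrt (osc G \<epsilon> x)"
    using eventually_at_right_less
  proof eventually_elim
    fix \<epsilon> :: real assume e: "0 < \<epsilon>"
    show "norm (conv (TK \<epsilon>) g x - G x) \<le> sqrt (osc g \<epsilon> x) + sqrt (osc G \<epsilon> x)"
      using conv_TK_QK_osc[OF e g, of x] conv_PK_osc[OF e G(1), of x] conv_QK_eq_conv_PK[OF g G e, of x]
      unfolding real_norm_def by linarith
  qed
  show "((\<lambda>\<epsilon>. conv (TK \<epsilon>) g x) \<longlongrightarrow> G x) (at_right 0)"
    by (rule LIM_zero_cancel[OF Lim_null_comparison[OF 2 1]])
qed

text \<open>Approaching from above only deletes part of the kernel, so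
  \<open>\<bar>TK \<epsilon>\<bar>\<close> itself dominates the differences.\<close>

lemma conv_TK_right_continuous:
  assumes g: "L2 g" and e: "\<epsilon> > 0" and X: "\<And>n. X n > \<epsilon>" "X \<longlonglongrightarrow> \<epsilon>"
  shows "(\<lambda>n. conv (TK (X n)) g x) \<longlonglongrightarrow> conv (TK \<epsilon>) g x"
proof -
  have pos: "X n > 0" for n using X(1)[of n] e by linarith
  have "(\<lambda>n. l2 (\<lambda>y. TK (X n) (x - y) - TK \<epsilon> (x - y))) \<longlonglongrightarrow> 0"
  proof (rule l2_dominated[where w="\<lambda>y. \<bar>TK \<epsilon> (x - y)\<bar>"])
    show "L2 (\<lambda>y. \<bar>TK \<epsilon> (x - y)\<bar>)" by (intro L2_abs L2_reflect_shift TK_L2 e)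
    show "\<bar>TK (X n) (x - y) - TK \<epsilon> (x - y)\<bar> \<le> \<bar>TK \<epsilon> (x - y)\<bar>" for n y
      using X(1)[of n] by (auto simp: TK_def)
    show "AE y in lborel. (\<lambda>n. TK (X n) (x - y)) \<longlonglongrightarrow> TK \<epsilon> (x - y)"
    proof (rule AE_I2, rule tendsto_eventually)
      fix y
      show "\<forall>\<^sub>F n in sequentially. TK (X n) (x - y) = TK \<epsilon> (x - y)"
      proof (cases "\<epsilon> < \<bar>x - y\<bar>")
        case True
        from order_tendstoD(2)[OF X(2) True] show ?thesis
          by eventually_elim (use True in \<open>simp add: TK_def\<close>)
      next
        case False
        then have "\<not> X n < \<bar>x - y\<bar>" for n using X(1)[of n] by linarith
        then show ?thesis using False by (simp add: TK_def)
      qed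
    qed
  qed measurable
  then show ?thesis
    unfolding conv_def by (intro L2_tendsto_pairing L2_reflect_shift TK_L2 e pos g) auto
qed

text \<open>Since \<open>Lim\<close> is a fixed junk value where the limit does not exist, only the set of
  convergence has to be measurable, and by right continuity it is determined by rational
  truncation parameters.\<close>

lemma hilbert_measurable:
  assumes g: "L2 g"
  shows "hilbert g \<in> borel_measurable borel"
proof -
  have [measurable]: "g \<in> borel_measurable borel" using g by (rule L2_measurable)
  define S where "S \<epsilon> x = conv (TK \<epsilon>) g x" for \<epsilon> x
  have [measurable]: "S \<epsilon> \<in> borel_measurable borel" for \<epsilon> unfolding S_def by measurable
  define C where "C x \<longleftrightarrow> (\<forall>k::nat. \<exists>n::nat. \<forall>p::rat. \<forall>q::rat. 0 < p \<longrightarrow> real_of_rat p < 1 / real (Suc n) \<longrightarrow>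
     0 < q \<longrightarrow> real_of_rat q < 1 / real (Suc n) \<longrightarrow> \<bar>S (real_of_rat p) x - S (real_of_rat q) x\<bar> \<le> 1 / real (Suc k))" for x
  have [measurable]: "Measurable.pred borel C" unfolding C_def by measurable
  have rat: "\<exists>p. (\<forall>n. of_rat (p n) > \<epsilon> \<and> real_of_rat (p n) < d) \<and> (\<lambda>n. real_of_rat (p n)) \<longlonglongrightarrow> \<epsilon>"
    if "\<epsilon> < d" for \<epsilon> d :: real
  proof -
    have "\<exists>p. real_of_rat p > \<epsilon> \<and> real_of_rat p < min d (\<epsilon> + 1 / real (Suc n))" for n
      using of_rat_dense[of \<epsilon> "min d (\<epsilon> + 1 / real (Suc n))"] that by auto
    then obtain p where p: "\<And>n. real_of_rat (p n) > \<epsilon> \<and> real_of_rat (p n) < min d (\<epsilon> + 1 / real (Suc n))"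
      by metis
    have "(\<lambda>n. real_of_rat (p n)) \<longlonglongrightarrow> \<epsilon>"
    proof (rule tendsto_sandwich[of "\<lambda>_. \<epsilon>" _ _ "\<lambda>n. \<epsilon> + 1 / real (Suc n)"])
      have "(\<lambda>n. \<epsilon> + 1 / real (Suc n)) \<longlonglongrightarrow> \<epsilon> + 0"
        by (intro tendsto_intros LIMSEQ_Suc[OF lim_1_over_n])
      then show "(\<lambda>n. \<epsilon> + 1 / real (Suc n)) \<longlonglongrightarrow> \<epsilon>" by simp
    qed (use p in \<open>auto intro!: always_eventually less_imp_le\<close>)
    then show ?thesis using p by (intro exI[of _ p]) auto
  qed
  have ext: "\<bar>S a x - S b x\<bar> \<le> c"
    if c: "\<And>p q. 0 < p \<Longrightarrow> real_of_rat p < d \<Longrightarrow> 0 < q \<Longrightarrow> real_of_rat q < d \<Longrightarrow>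
      \<bar>S (real_of_rat p) x - S (real_of_rat q) x\<bar> \<le> c" and ab: "0 < a" "a < d" "0 < b" "b < d" for a b c d x
  proof -
    obtain p where p: "\<And>n. real_of_rat (p n) > a" "\<And>n. real_of_rat (p n) < d" "(\<lambda>n. real_of_rat (p n)) \<longlonglongrightarrow> a"
      using rat[OF ab(2)] by blast
    obtain q where q: "\<And>n. real_of_rat (q n) > b" "\<And>n. real_of_rat (q n) < d" "(\<lambda>n. real_of_rat (q n)) \<longlonglongrightarrow> b"
      using rat[OF ab(4)] by blast
    have "(\<lambda>n. \<bar>S (real_of_rat (p n)) x - S (real_of_rat (q n)) x\<bar>) \<longlonglongrightarrow> \<bar>S a x - S b x\<bar>"
      unfolding S_def
      by (intro tendsto_intros conv_TK_right_continuous g ab p q)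
    moreover have "\<bar>S (real_of_rat (p n)) x - S (real_of_rat (q n)) x\<bar> \<le> c" for n
    proof (rule c)
      show "0 < p n" "0 < q n"
        using p(1)[of n] q(1)[of n] ab zero_less_of_rat_iff[where 'a=real] by (metis less_trans)+
    qed (use p q in auto)
    ultimately show ?thesis by (intro LIMSEQ_le_const2) auto
  qed
  have C1: "C x" if "(( \<lambda>\<epsilon>. S \<epsilon> x) \<longlongrightarrow> l) (at_right 0)" for x l
    unfolding C_def
  proof
    fix k :: nat
    have "\<forall>\<^sub>F \<epsilon> in at_right 0. dist (S \<epsilon> x) l < 1 / (2 * real (Suc k))"
      by (rule tendstoD[OF that]) simp
    then obtain d where d: "d > 0" "\<And>\<epsilon>. 0 < \<epsilon> \<Longrightarrow> \<epsilon> < d \<Longrightarrow> \<bar>S \<epsilon> x - l\<bar> < 1 / (2 * real (Suc k))"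
      unfolding eventually_at_right_field dist_real_def by auto
    obtain n where n: "1 / real (Suc n) < d" using d(1) nat_approx_posE by blast
    show "\<exists>n::nat. \<forall>p::rat. \<forall>q::rat. 0 < p \<longrightarrow> real_of_rat p < 1 / real (Suc n) \<longrightarrow>
     0 < q \<longrightarrow> real_of_rat q < 1 / real (Suc n) \<longrightarrow> \<bar>S (real_of_rat p) x - S (real_of_rat q) x\<bar> \<le> 1 / real (Suc k)"
    proof (intro exI[of _ n] allI impI)
      fix p q :: rat
      assume pq: "0 < p" "real_of_rat p < 1 / real (Suc n)" "0 < q" "real_of_rat q < 1 / real (Suc n)"
      have "\<bar>S (real_of_rat p) x - l\<bar> < 1 / (2 * real (Suc k))" "\<bar>S (real_of_rat q) x - l\<bar> < 1 / (2 * real (Suc k))"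
      proof -
        have "0 < real_of_rat p" "real_of_rat p < d" "0 < real_of_rat q" "real_of_rat q < d"
          using pq less_trans[OF _ n] by (simp_all only: zero_less_of_rat_iff)
        then show "\<bar>S (real_of_rat p) x - l\<bar> < 1 / (2 * real (Suc k))" "\<bar>S (real_of_rat q) x - l\<bar> < 1 / (2 * real (Suc k))"
          using d(2) by blast+
      qed
      then have "\<bar>S (real_of_rat p) x - l\<bar> + \<bar>S (real_of_rat q) x - l\<bar> \<le> 1 / (2 * real (Suc k)) + 1 / (2 * real (Suc k))"
        by (intro add_mono less_imp_le)
      also have "\<dots> = 1 / real (Suc k)" by (simp add: field_simps)
      finally show "\<bar>S (real_of_rat p) x - S (real_of_rat q) x\<bar> \<le> 1 / real (Suc k)" by linarith
    qed
  qed
  have C2: "((\<lambda>\<epsilon>. S \<epsilon> x) \<longlongrightarrow> lim (\<lambda>n. S (1 / real (Suc n)) x)) (at_right 0)" if "C x" for x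
  proof -
    have cauchy: "\<exists>n::nat. \<forall>a b. 0 < a \<longrightarrow> a < 1 / real (Suc n) \<longrightarrow> 0 < b \<longrightarrow> b < 1 / real (Suc n) \<longrightarrow>
      \<bar>S a x - S b x\<bar> \<le> 1 / real (Suc k)" for k
    proof -
      from that have "\<exists>n::nat. \<forall>p::rat. \<forall>q::rat. 0 < p \<longrightarrow> real_of_rat p < 1 / real (Suc n) \<longrightarrow>
         0 < q \<longrightarrow> real_of_rat q < 1 / real (Suc n) \<longrightarrow> \<bar>S (real_of_rat p) x - S (real_of_rat q) x\<bar> \<le> 1 / real (Suc k)"
        unfolding C_def by (rule spec)
      then obtain n where n: "\<forall>p::rat. \<forall>q::rat. 0 < p \<longrightarrow> real_of_rat p < 1 / real (Suc n) \<longrightarrow>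
         0 < q \<longrightarrow> real_of_rat q < 1 / real (Suc n) \<longrightarrow> \<bar>S (real_of_rat p) x - S (real_of_rat q) x\<bar> \<le> 1 / real (Suc k)"
        by (elim exE)
      show ?thesis
        by (intro exI[of _ n] allI impI, rule ext[OF n[rule_format]])
    qed
    define s where "s n = S (1 / real (Suc n)) x" for n
    have lt: "1 / real (Suc m) < 1 / real (Suc n)" if "n < m" for m n
      using that by (simp add: frac_less2)
    have "Cauchy s"
      unfolding Cauchy_def dist_real_def
    proof (intro allI impI)
      fix e :: real assume "e > 0"
      then obtain k where k: "1 / real (Suc k) < e" using nat_approx_posE by blast
      from cauchy[of k] obtain n where "\<forall>a b. 0 < a \<longrightarrow> a < 1 / real (Suc n) \<longrightarrow> 0 < b \<longrightarrow> b < 1 / real (Suc n) \<longrightarrow>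
        \<bar>S a x - S b x\<bar> \<le> 1 / real (Suc k)" by (elim exE)
      note n = this[rule_format]
      show "\<exists>M. \<forall>m\<ge>M. \<forall>n\<ge>M. \<bar>s m - s n\<bar> < e"
      proof (intro exI[of _ "Suc n"] allI impI)
        fix i j assume "Suc n \<le> i" "Suc n \<le> j"
        then have "\<bar>s i - s j\<bar> \<le> 1 / real (Suc k)"
          unfolding s_def by (intro n lt) simp_all
        then show "\<bar>s i - s j\<bar> < e" using k by (rule le_less_trans)
      qed
    qed
    then have "s \<longlonglongrightarrow> lim s" by (simp add: Cauchy_convergent_iff convergent_LIMSEQ_iff)
    have "((\<lambda>\<epsilon>. S \<epsilon> x) \<longlongrightarrow> lim s) (at_right 0)"
      unfolding tendsto_iff
    proof (intro allI impI)
      fix e :: real assume "e > 0"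
      then obtain k where k: "1 / real (Suc k) < e" using nat_approx_posE by blast
      from cauchy[of k] obtain n where "\<forall>a b. 0 < a \<longrightarrow> a < 1 / real (Suc n) \<longrightarrow> 0 < b \<longrightarrow> b < 1 / real (Suc n) \<longrightarrow>
        \<bar>S a x - S b x\<bar> \<le> 1 / real (Suc k)" by (elim exE)
      note n = this[rule_format]
      have "\<bar>S a x - lim s\<bar> < e" if a: "0 < a" "a < 1 / real (Suc n)" for a
      proof -
        have "(\<lambda>m. \<bar>S a x - s m\<bar>) \<longlonglongrightarrow> \<bar>S a x - lim s\<bar>"
          by (intro tendsto_intros \<open>s \<longlonglongrightarrow> lim s\<close>)
        then have "\<bar>S a x - lim s\<bar> \<le> 1 / real (Suc k)"
        proof (rule LIMSEQ_le_const2)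
          show "\<exists>N. \<forall>m\<ge>N. \<bar>S a x - s m\<bar> \<le> 1 / real (Suc k)"
          proof (intro exI[of _ "Suc n"] allI impI)
            fix m assume "Suc n \<le> m"
            then show "\<bar>S a x - s m\<bar> \<le> 1 / real (Suc k)"
              unfolding s_def by (intro n a lt) simp_all
          qed
        qed
        then show ?thesis using k by simp
      qed
      then show "\<forall>\<^sub>F a in at_right 0. dist (S a x) (lim s) < e"
        unfolding eventually_at_right_field dist_real_def by (intro exI[of _ "1 / real (Suc n)"]) auto
    qed
    then show ?thesis unfolding s_def .
  qed
  \<comment> \<open>Where no limit exists the predicate inside \<open>Lim\<close> is constantly
    false, so \<open>Lim\<close> returns the one value \<open>THE l. False\<close>, independent of
    \<open>x\<close>.\<close>
  have "hilbert g = (\<lambda>x. if C x then lim (\<lambda>n. S (1 / real (Suc n)) x) else (THE l::real. False))"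
  proof
    fix x
    show "hilbert g x = (if C x then lim (\<lambda>n. S (1 / real (Suc n)) x) else (THE l::real. False))"
    proof (cases "C x")
      case True
      then show ?thesis
        using tendsto_Lim[OF _ C2[OF True]] by (simp add: hilbert_eq_Lim S_def)
    next
      case False
      then have "\<not> ((\<lambda>\<epsilon>. S \<epsilon> x) \<longlongrightarrow> l) (at_right 0)" for l using C1 by blast
      then show ?thesis using False by (simp add: hilbert_eq_Lim t2_space_class.Lim_def S_def)
    qed
  qed
  also have "\<dots> \<in> borel_measurable borel" by measurable
  finally show ?thesis .
qed

text \<open>The truncated integrals converge almost everywhere to the \<open>L2\<close> limit of the
  conjugate Poisson integrals, so the pointwise definition of \<open>hilbert\<close> inherits the
  properties of that limit.\<close>

lemma
  assumes g: "L2 g"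
  shows L2_hilbert: "L2 (hilbert g)"
    and conv_QK_tendsto_hilbert: "((\<lambda>a. l2 (\<lambda>x. conv (QK a) g x - hilbert g x)) \<longlongrightarrow> 0) (at_right 0)"
proof -
  obtain G where G: "L2 G" "((\<lambda>a. l2 (\<lambda>x. conv (QK a) g x - G x)) \<longlongrightarrow> 0) (at_right 0)"
    by (rule ex_L2_hilbert[OF g])
  have [measurable]: "g \<in> borel_measurable borel" "G \<in> borel_measurable borel" "hilbert g \<in> borel_measurable borel"
    using g G by (auto simp: L2_measurable hilbert_measurable)
  have ae: "AE x in lborel. G x = hilbert g x"
    using truncated_tendsto_AE[OF g G]
  proof eventually_elim
    fix x assume "((\<lambda>\<epsilon>. conv (TK \<epsilon>) g x) \<longlongrightarrow> G x) (at_right 0)"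
    from tendsto_Lim[OF _ this] show "G x = hilbert g x" by (simp add: hilbert_eq_Lim)
  qed
  show "L2 (hilbert g)"
  proof (rule L2I)
    have "integrable lborel (\<lambda>x. (G x)\<^sup>2) \<longleftrightarrow> integrable lborel (\<lambda>x. (hilbert g x)\<^sup>2)"
      by (intro integrable_cong_AE) (use ae in auto)
    then show "integrable lborel (\<lambda>x. (hilbert g x)\<^sup>2)" using L2_square_integrable[OF G(1)] by simp
  qed measurable
  have "l2 (\<lambda>x. conv (QK a) g x - G x) = l2 (\<lambda>x. conv (QK a) g x - hilbert g x)" for a
    by (rule l2_cong_AE) (use ae in auto)
  then show "((\<lambda>a. l2 (\<lambda>x. conv (QK a) g x - hilbert g x)) \<longlongrightarrow> 0) (at_right 0)"
    using G(2) by simp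
qed

lemma l2_hilbert_le:
  assumes g: "L2 g" shows "l2 (hilbert g) \<le> 4 * l2 g"
proof (rule field_le_epsilon)
  fix e :: real assume "e > 0"
  have "\<forall>\<^sub>F a in at_right 0. 0 < a \<and> l2 (\<lambda>x. conv (QK a) g x - hilbert g x) < e"
    using eventually_conj[OF eventually_at_right_less order_tendstoD(2)[OF conv_QK_tendsto_hilbert[OF g] \<open>e > 0\<close>]] by simp
  then obtain a where a: "0 < a" "l2 (\<lambda>x. conv (QK a) g x - hilbert g x) < e"
    using eventually_happens'[of "at_right (0::real)"] by auto
  have "l2 (\<lambda>x. conv (QK a) g x - (conv (QK a) g x - hilbert g x)) \<le> l2 (conv (QK a) g) + l2 (\<lambda>x. conv (QK a) g x - hilbert g x)"
    by (intro l2_triangle_diff L2_diff L2_conv_QK L2_hilbert g a)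
  then show "l2 (hilbert g) \<le> 4 * l2 g + e" using a l2_conv_QK_le[OF a(1) g] by simp
qed

text \<open>At points without convergence \<open>hilbert\<close> need not respect differences, so
  the estimate is taken from the conjugate Poisson integrals, which are linear, and passed to the
  limit.\<close>

lemma l2_hilbert_diff_le:
  assumes f: "L2 f" and g: "L2 g"
  shows "l2 (\<lambda>x. hilbert f x - hilbert g x) \<le> 4 * l2 (\<lambda>x. f x - g x)"
proof (rule field_le_epsilon)
  fix e :: real assume e: "e > 0"
  have "\<forall>\<^sub>F a in at_right 0. 0 < a \<and> l2 (\<lambda>x. conv (QK a) f x - hilbert f x) < e / 2 \<and> l2 (\<lambda>x. conv (QK a) g x - hilbert g x) < e / 2"
    by (intro eventually_conj eventually_at_right_less order_tendstoD(2)[OF conv_QK_tendsto_hilbert] f g) (use e in auto)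
  then obtain a where a: "0 < a" "l2 (\<lambda>x. conv (QK a) f x - hilbert f x) < e / 2" "l2 (\<lambda>x. conv (QK a) g x - hilbert g x) < e / 2"
    using eventually_happens'[of "at_right (0::real)"] by auto
  have L: "L2 (hilbert f)" "L2 (conv (QK a) f)" "L2 (conv (QK a) g)" "L2 (hilbert g)"
    by (intro L2_conv_QK L2_hilbert f g a)+
  have "l2 (\<lambda>x. conv (QK a) f x - conv (QK a) g x) = l2 (conv (QK a) (\<lambda>y. f y - g y))"
    using conv_diff_fun[OF QK_L2[OF a(1)] f g] by (simp add: fun_eq_iff flip: conv_diff_fun[OF QK_L2[OF a(1)] f g])
  also have "\<dots> \<le> 4 * l2 (\<lambda>x. f x - g x)" by (intro l2_conv_QK_le a L2_diff f g)
  finally have 1: "l2 (\<lambda>x. conv (QK a) f x - conv (QK a) g x) \<le> 4 * l2 (\<lambda>x. f x - g x)" .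
  show "l2 (\<lambda>x. hilbert f x - hilbert g x) \<le> 4 * l2 (\<lambda>x. f x - g x) + e"
    using l2_triangle_via[OF L(1,2,4)] l2_triangle_via[OF L(2,3,4)] 1 a l2_commute[of "hilbert f" "conv (QK a) f"] by linarith
qed

lemma filterlim_inverse_Suc_at_right: "filterlim (\<lambda>n. 1 / real (Suc n)) (at_right 0) sequentially"
proof -
  have "(\<lambda>n. 1 / real (Suc n)) \<longlonglongrightarrow> 0" by (rule LIMSEQ_Suc[OF lim_1_over_n])
  then show ?thesis by (auto simp: filterlim_at simp del: of_nat_Suc)
qed

lemma hilbert_pairing:
  assumes g: "L2 g" and w: "L2 w"
  shows "(\<lambda>n. LINT x|lborel. conv (QK (1 / real (Suc n))) g x * w x) \<longlonglongrightarrow> (LINT x|lborel. hilbert g x * w x)"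
proof (rule L2_tendsto_pairing[OF _ _ _ w w])
  show "L2 (conv (QK (1 / real (Suc n))) g)" for n by (intro L2_conv_QK g) simp
  show "L2 (hilbert g)" by (rule L2_hilbert[OF g])
  show "(\<lambda>n. l2 (\<lambda>x. conv (QK (1 / real (Suc n))) g x - hilbert g x)) \<longlonglongrightarrow> 0"
    by (rule filterlim_compose[OF conv_QK_tendsto_hilbert[OF g] filterlim_inverse_Suc_at_right])
qed simp

subsection \<open>Quadratic forms of the Hilbert transform\<close>

lemma integrable_product_bounded:
  fixes f h :: "real \<Rightarrow> real"
  assumes f: "integrable lborel f" and h: "integrable lborel h"
    and [measurable]: "k \<in> borel_measurable (lborel \<Otimes>\<^sub>M lborel)" and k: "\<And>p. \<bar>k p\<bar> \<le> K"
  shows "integrable (lborel \<Otimes>\<^sub>M lborel) (\<lambda>(x, y). k (x, y) * (f x * h y))"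
proof (rule lborel_pair.Fubini_integrable)
  have [measurable]: "f \<in> borel_measurable borel" "h \<in> borel_measurable borel" using f h by auto
  show "(\<lambda>(x, y). k (x, y) * (f x * h y)) \<in> borel_measurable (lborel \<Otimes>\<^sub>M lborel)" by measurable
  have i: "integrable lborel (\<lambda>y. k (x, y) * (f x * h y))" for x
  proof (rule Bochner_Integration.integrable_bound)
    show "integrable lborel (\<lambda>y. K * (f x * h y))" using h by auto
    have "\<bar>k (x, y) * (f x * h y)\<bar> \<le> \<bar>K * (f x * h y)\<bar>" for y
      unfolding abs_mult by (intro mult_right_mono) (use k[of "(x, y)"] in auto)
    then show "AE y in lborel. norm (k (x, y) * (f x * h y)) \<le> norm (K * (f x * h y))" by simp
  qed measurable
  then show "AE x in lborel. integrable lborel (\<lambda>y. case (x, y) of (x, y) \<Rightarrow> k (x, y) * (f x * h y))" by simp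
  show "integrable lborel (\<lambda>x. LINT y|lborel. norm (case (x, y) of (x, y) \<Rightarrow> k (x, y) * (f x * h y)))"
  proof (rule Bochner_Integration.integrable_bound)
    show "integrable lborel (\<lambda>x. K * (LINT y|lborel. \<bar>h y\<bar>) * f x)" using f by auto
    show "AE x in lborel. norm (LINT y|lborel. norm (case (x, y) of (x, y) \<Rightarrow> k (x, y) * (f x * h y)))
       \<le> norm (K * (LINT y|lborel. \<bar>h y\<bar>) * f x)"
    proof (rule AE_I2)
      fix x
      have K: "0 \<le> K" using k[of undefined] by linarith
      have "(LINT y|lborel. \<bar>k (x, y) * (f x * h y)\<bar>) \<le> (LINT y|lborel. K * \<bar>f x\<bar> * \<bar>h y\<bar>)"
      proof (rule integral_mono)
        show "\<bar>k (x, y) * (f x * h y)\<bar> \<le> K * \<bar>f x\<bar> * \<bar>h y\<bar>" for y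
          unfolding abs_mult mult.assoc by (intro mult_right_mono k) auto
      qed (use i h in \<open>auto intro!: integrable_abs\<close>)
      then show "norm (LINT y|lborel. norm (case (x, y) of (x, y) \<Rightarrow> k (x, y) * (f x * h y)))
         \<le> norm (K * (LINT y|lborel. \<bar>h y\<bar>) * f x)"
        using K by (simp add: abs_mult mult_ac)
    qed
  qed measurable
qed

lemma integrable_difference_kernel:
  fixes k h :: "real \<Rightarrow> real"
  assumes k: "integrable lborel k" and h: "integrable lborel h"
  shows "integrable (lborel \<Otimes>\<^sub>M lborel) (\<lambda>(x, y). k (x - y) * h x)"
    and "integrable (lborel \<Otimes>\<^sub>M lborel) (\<lambda>(x, y). k (x - y) * h y)"
proof -
  have [measurable]: "k \<in> borel_measurable borel" "h \<in> borel_measurable borel" using k h by auto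
  have *: "integrable (lborel \<Otimes>\<^sub>M lborel) (\<lambda>(x, y). k (t * (x - y)) * h x)"
    if t: "t = 1 \<or> t = -1" for t :: real
  proof -
    have e: "integrable lborel (\<lambda>y. k (t * (x - y)))"
      "(LINT y|lborel. \<bar>k (t * (x - y))\<bar>) = (LINT y|lborel. \<bar>k y\<bar>)" for x
      using t integrable_reflect_shift[of k x] integrable_shift[of k x] k
        integral_reflect_shift[of "\<lambda>x. \<bar>k x\<bar>" x] integral_shift[of "\<lambda>x. \<bar>k x\<bar>" x]
      by auto
    show ?thesis
    proof (rule lborel_pair.Fubini_integrable)
      show "integrable lborel (\<lambda>x. LINT y|lborel. norm (case (x, y) of (x, y) \<Rightarrow> k (t * (x - y)) * h x))"
        using h by (simp add: abs_mult e)
      show "AE x in lborel. integrable lborel (\<lambda>y. case (x, y) of (x, y) \<Rightarrow> k (t * (x - y)) * h x)"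
        using e by auto
    qed measurable
  qed
  show "integrable (lborel \<Otimes>\<^sub>M lborel) (\<lambda>(x, y). k (x - y) * h x)"
    using *[of 1] by simp
  show "integrable (lborel \<Otimes>\<^sub>M lborel) (\<lambda>(x, y). k (x - y) * h y)"
    using *[of "-1"] by (subst lborel_pair.integrable_product_swap_iff[symmetric]) simp
qed

lemma integral_symmetrize:
  assumes "integrable (lborel \<Otimes>\<^sub>M lborel) (\<lambda>(x, y). F x y)"
  shows "integrable (lborel \<Otimes>\<^sub>M lborel) (\<lambda>(x, y). F x y + F y x)"
    "integral\<^sup>L (lborel \<Otimes>\<^sub>M lborel) (\<lambda>(x, y). F x y)
      = (1 / 2) * integral\<^sup>L (lborel \<Otimes>\<^sub>M lborel) (\<lambda>(x, y). F x y + F (y :: real) (x :: real) :: real)"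
proof -
  have i: "integrable (lborel \<Otimes>\<^sub>M lborel) (\<lambda>(x, y). F y x)"
    using lborel_pair.integrable_product_swap[OF assms] by simp
  have e: "integral\<^sup>L (lborel \<Otimes>\<^sub>M lborel) (\<lambda>(x, y). F y x) = integral\<^sup>L (lborel \<Otimes>\<^sub>M lborel) (\<lambda>(x, y). F x y)"
    using lborel_pair.integral_product_swap[of "\<lambda>(x, y). F x y"] assms by (simp add: case_prod_unfold)
  show "integrable (lborel \<Otimes>\<^sub>M lborel) (\<lambda>(x, y). F x y + F y x)"
    using Bochner_Integration.integrable_add[OF assms i] by (simp add: case_prod_unfold)
  have "integral\<^sup>L (lborel \<Otimes>\<^sub>M lborel) (\<lambda>(x, y). F x y + F y x)
     = integral\<^sup>L (lborel \<Otimes>\<^sub>M lborel) (\<lambda>(x, y). F x y) + integral\<^sup>L (lborel \<Otimes>\<^sub>M lborel) (\<lambda>(x, y). F y x)"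
    using Bochner_Integration.integral_add[OF assms i] by (simp add: case_prod_unfold)
  then show "integral\<^sup>L (lborel \<Otimes>\<^sub>M lborel) (\<lambda>(x, y). F x y)
      = (1 / 2) * integral\<^sup>L (lborel \<Otimes>\<^sub>M lborel) (\<lambda>(x, y). F x y + F y x)"
    using e by simp
qed

lemma integral_by_parts_test:
  assumes u: "test_fun u" and v: "\<And>x. (v has_real_derivative v' x) (at x)" "continuous_on UNIV v'"
  shows "integrable lborel (\<lambda>x. deriv u x * v x)" "integrable lborel (\<lambda>x. u x * v' x)"
    "(LINT x|lborel. deriv u x * v x) = - (LINT x|lborel. u x * v' x)"
proof -
  have cv: "continuous_on UNIV v" using v(1) DERIV_continuous_on by blast
  obtain R where R: "\<And>x. R < \<bar>x\<bar> \<Longrightarrow> u x = 0" using u by (auto simp: test_fun_iff)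
  obtain R' where R': "\<And>x. R' < \<bar>x\<bar> \<Longrightarrow> deriv u x = 0" using test_fun_deriv[OF u] by (auto simp: test_fun_iff)
  note c = continuous_on_mult[OF test_fun_continuous[OF test_fun_deriv[OF u]] cv]
    continuous_on_mult[OF test_fun_continuous[OF u] v(2)]
  show 1: "integrable lborel (\<lambda>x. deriv u x * v x)"
    by (rule L2_compact_support[OF c(1), of R']) (use R' in auto)
  show 2: "integrable lborel (\<lambda>x. u x * v' x)"
    by (rule L2_compact_support[OF c(2), of R]) (use R in auto)
  have "(LINT x|lborel. deriv u x * v x + u x * v' x) = 0 - 0"
  proof (rule integral_FTC_UNIV)
    show "((\<lambda>x. u x * v x) has_real_derivative deriv u x * v x + u x * v' x) (at x)" for x
      by (rule DERIV_cong[OF DERIV_mult[OF test_fun_DERIV[OF u] v(1)]]) simp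
    show "isCont (\<lambda>x. deriv u x * v x + u x * v' x) x" for x
      using continuous_on_add[OF c] by (simp add: continuous_on_eq_continuous_at)
    show "((\<lambda>x. u x * v x) \<longlongrightarrow> 0) at_bot"
      by (rule tendsto_eventually, rule eventually_mono[OF eventually_gt_at_bot[of "- \<bar>R\<bar>"]]) (use R in auto)
    show "((\<lambda>x. u x * v x) \<longlongrightarrow> 0) at_top"
      by (rule tendsto_eventually, rule eventually_mono[OF eventually_gt_at_top[of "\<bar>R\<bar>"]]) (use R in auto)
  qed (use 1 2 in auto)
  then show "(LINT x|lborel. deriv u x * v x) = - (LINT x|lborel. u x * v' x)"
    using 1 2 by simp
qed

lemma QK_abs_le: "\<bar>QK a z\<bar> \<le> 1 / (pi * \<bar>z\<bar>)"
proof (cases "z = 0")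
  case False
  then have "\<bar>z\<bar> / (pi * (z\<^sup>2 + a\<^sup>2)) \<le> \<bar>z\<bar> / (pi * z\<^sup>2)"
    by (intro divide_left_mono mult_left_mono) (auto simp: add_pos_nonneg)
  also have "\<dots> = 1 / (pi * \<bar>z\<bar>)"
  proof -
    have "c / (pi * c\<^sup>2) = 1 / (pi * c)" if "c \<noteq> 0" for c :: real
      using that by (simp add: power2_eq_square)
    from this[of "\<bar>z\<bar>"] show ?thesis using False by simp
  qed
  finally show ?thesis by (simp add: QK_def abs_mult)
qed (simp add: QK_def)

lemma QK_bounded: assumes "a > 0" shows "\<bar>QK a z\<bar> \<le> 1 / (pi * a)"
proof -
  have "2 * \<bar>z\<bar> * a \<le> z\<^sup>2 + a\<^sup>2" using sum_squares_bound[of "\<bar>z\<bar>" a] by simp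
  moreover have "0 \<le> \<bar>z\<bar> * a" using assms by simp
  ultimately have "\<bar>z\<bar> * a \<le> z\<^sup>2 + a\<^sup>2" by linarith
  then show ?thesis using assms sum_power2_pos[OF assms, of z]
    by (simp add: QK_def abs_mult divide_simps)
qed

lemma QK_tendsto: "(\<lambda>n. QK (1 / real (Suc n)) z) \<longlonglongrightarrow> 1 / (pi * z)"
proof (cases "z = 0")
  case False
  have "(\<lambda>n. z / (pi * (z\<^sup>2 + (1 / real (Suc n))\<^sup>2))) \<longlonglongrightarrow> z / (pi * (z\<^sup>2 + 0\<^sup>2))"
    using False by (intro tendsto_intros LIMSEQ_Suc[OF lim_1_over_n]) auto
  then show ?thesis using False by (simp add: QK_def power2_eq_square)
qed (simp add: QK_def)

text \<open>Symmetrization replaces \<open>\<Phi> x\<close> by a difference quotient, which is no longer singular.\<close>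

lemma hilbert_form_commutator:
  assumes g: "test_fun g" and [measurable]: "\<Phi> \<in> borel_measurable borel"
    and M: "\<And>x. \<bar>\<Phi> x\<bar> \<le> M" and lip: "\<And>x y. \<bar>\<Phi> x - \<Phi> y\<bar> \<le> M * \<bar>x - y\<bar>"
  shows "(LINT x|lborel. hilbert g x * (g x * \<Phi> x))
    = (1 / (2 * pi)) * integral\<^sup>L (lborel \<Otimes>\<^sub>M lborel) (\<lambda>(x, y). (\<Phi> x - \<Phi> y) / (x - y) * (g x * g y))"
proof -
  have [measurable]: "g \<in> borel_measurable borel" using g by (rule test_fun_measurable)
  have Lg: "L2 g" and ig: "integrable lborel g" using g by (auto intro: test_fun_L2 test_fun_integrable)
  have M0: "0 \<le> M" using M[of 0] by linarith
  have L\<Phi>: "L2 (\<lambda>x. g x * \<Phi> x)" by (rule L2_mult_bounded[OF Lg _ M]) measurable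
  have i\<Phi>: "integrable lborel (\<lambda>x. g x * \<Phi> x)"
  proof (rule Bochner_Integration.integrable_bound)
    show "integrable lborel (\<lambda>x. M * g x)" using ig by auto
    show "AE x in lborel. norm (g x * \<Phi> x) \<le> norm (M * g x)"
      using M M0 by (intro AE_I2) (simp add: abs_mult mult.commute mult_right_mono)
  qed measurable
  define \<epsilon> where "\<epsilon> n = 1 / real (Suc n)" for n
  have \<epsilon>: "0 < \<epsilon> n" for n by (simp add: \<epsilon>_def)
  have eq: "(LINT x|lborel. conv (QK (\<epsilon> n)) g x * (g x * \<Phi> x))
     = (1 / 2) * integral\<^sup>L (lborel \<Otimes>\<^sub>M lborel) (\<lambda>(x, y). QK (\<epsilon> n) (x - y) * (\<Phi> x - \<Phi> y) * (g x * g y))" for n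
  proof -
    have i: "integrable (lborel \<Otimes>\<^sub>M lborel) (\<lambda>(x, y). QK (\<epsilon> n) (x - y) * ((g x * \<Phi> x) * g y))"
      using integrable_product_bounded[OF i\<Phi> ig, of "\<lambda>(x, y). QK (\<epsilon> n) (x - y)" "1 / (pi * \<epsilon> n)"] QK_bounded[OF \<epsilon>]
      by (simp add: case_prod_unfold)
    have "(LINT x|lborel. conv (QK (\<epsilon> n)) g x * (g x * \<Phi> x))
       = (LINT x|lborel. LINT y|lborel. QK (\<epsilon> n) (x - y) * ((g x * \<Phi> x) * g y))"
      by (simp add: conv_def mult_ac flip: integral_mult_right_zero)
    also have "\<dots> = integral\<^sup>L (lborel \<Otimes>\<^sub>M lborel) (\<lambda>(x, y). QK (\<epsilon> n) (x - y) * ((g x * \<Phi> x) * g y))"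
      by (rule lborel_pair.integral_fst[OF i])
    also have "\<dots> = (1 / 2) * integral\<^sup>L (lborel \<Otimes>\<^sub>M lborel) (\<lambda>(x, y).
       QK (\<epsilon> n) (x - y) * ((g x * \<Phi> x) * g y) + QK (\<epsilon> n) (y - x) * ((g y * \<Phi> y) * g x))"
      by (rule integral_symmetrize(2)[OF i])
    also have "(\<lambda>(x, y). QK (\<epsilon> n) (x - y) * ((g x * \<Phi> x) * g y) + QK (\<epsilon> n) (y - x) * ((g y * \<Phi> y) * g x))
        = (\<lambda>(x, y). QK (\<epsilon> n) (x - y) * (\<Phi> x - \<Phi> y) * (g x * g y))"
    proof (rule ext, clarify)
      fix x y
      have "QK (\<epsilon> n) (y - x) = - QK (\<epsilon> n) (x - y)" using QK_minus[of "\<epsilon> n" "x - y"] by simp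
      then show "QK (\<epsilon> n) (x - y) * ((g x * \<Phi> x) * g y) + QK (\<epsilon> n) (y - x) * ((g y * \<Phi> y) * g x)
         = QK (\<epsilon> n) (x - y) * (\<Phi> x - \<Phi> y) * (g x * g y)" by (simp add: algebra_simps)
    qed
    finally show ?thesis .
  qed
  have "(\<lambda>n. integral\<^sup>L (lborel \<Otimes>\<^sub>M lborel) (\<lambda>p. QK (\<epsilon> n) (fst p - snd p) * (\<Phi> (fst p) - \<Phi> (snd p)) * (g (fst p) * g (snd p))))
     \<longlonglongrightarrow> integral\<^sup>L (lborel \<Otimes>\<^sub>M lborel) (\<lambda>p. 1 / (pi * (fst p - snd p)) * (\<Phi> (fst p) - \<Phi> (snd p)) * (g (fst p) * g (snd p)))"
  proof (rule integral_dominated_convergence)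
    have "integrable (lborel \<Otimes>\<^sub>M lborel) (\<lambda>(x, y). (\<lambda>_. M / pi) (x, y) * (\<bar>g x\<bar> * \<bar>g y\<bar>))"
      by (rule integrable_product_bounded[where K="\<bar>M / pi\<bar>"]) (use ig in auto)
    then show "integrable (lborel \<Otimes>\<^sub>M lborel) (\<lambda>p. M / pi * (\<bar>g (fst p)\<bar> * \<bar>g (snd p)\<bar>))"
      by (simp add: case_prod_unfold)
    show "AE p in lborel \<Otimes>\<^sub>M lborel. (\<lambda>n. QK (\<epsilon> n) (fst p - snd p) * (\<Phi> (fst p) - \<Phi> (snd p)) * (g (fst p) * g (snd p)))
       \<longlonglongrightarrow> 1 / (pi * (fst p - snd p)) * (\<Phi> (fst p) - \<Phi> (snd p)) * (g (fst p) * g (snd p))"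
      unfolding \<epsilon>_def by (intro AE_I2 tendsto_intros QK_tendsto)
    show "AE p in lborel \<Otimes>\<^sub>M lborel. norm (QK (\<epsilon> n) (fst p - snd p) * (\<Phi> (fst p) - \<Phi> (snd p)) * (g (fst p) * g (snd p)))
        \<le> M / pi * (\<bar>g (fst p)\<bar> * \<bar>g (snd p)\<bar>)" for n
    proof (rule AE_I2)
      fix p :: "real \<times> real"
      obtain x y where p: "p = (x, y)" by (cases p)
      \<comment> \<open>The Lipschitz bound of the weight cancels the singularity of the kernel,
        uniformly in \<open>n\<close>.\<close>
      have "\<bar>QK (\<epsilon> n) (x - y)\<bar> * \<bar>\<Phi> x - \<Phi> y\<bar> \<le> M / pi"
      proof (cases "x = y")
        case False
        have "\<bar>QK (\<epsilon> n) (x - y)\<bar> * \<bar>\<Phi> x - \<Phi> y\<bar> \<le> (1 / (pi * \<bar>x - y\<bar>)) * (M * \<bar>x - y\<bar>)"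
          by (intro mult_mono QK_abs_le lip) auto
        then show ?thesis using False by simp
      qed (use M0 in simp)
      then have "(\<bar>QK (\<epsilon> n) (x - y)\<bar> * \<bar>\<Phi> x - \<Phi> y\<bar>) * (\<bar>g x\<bar> * \<bar>g y\<bar>) \<le> M / pi * (\<bar>g x\<bar> * \<bar>g y\<bar>)"
        by (rule mult_right_mono) simp
      then show "norm (QK (\<epsilon> n) (fst p - snd p) * (\<Phi> (fst p) - \<Phi> (snd p)) * (g (fst p) * g (snd p)))
        \<le> M / pi * (\<bar>g (fst p)\<bar> * \<bar>g (snd p)\<bar>)"
        unfolding p by (simp only: fst_conv snd_conv real_norm_def abs_mult)
    qed
  qed measurable
  from tendsto_mult_left[OF this, of "1 / 2"]
  have "(\<lambda>n. LINT x|lborel. conv (QK (\<epsilon> n)) g x * (g x * \<Phi> x)) \<longlonglongrightarrow> (1 / 2) *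
      integral\<^sup>L (lborel \<Otimes>\<^sub>M lborel) (\<lambda>p. 1 / (pi * (fst p - snd p)) * (\<Phi> (fst p) - \<Phi> (snd p)) * (g (fst p) * g (snd p)))"
    unfolding eq by (simp add: case_prod_unfold)
  from LIMSEQ_unique[OF hilbert_pairing[OF Lg L\<Phi>] this[unfolded \<epsilon>_def]]
  have "(LINT x|lborel. hilbert g x * (g x * \<Phi> x)) = (1 / 2) *
      integral\<^sup>L (lborel \<Otimes>\<^sub>M lborel) (\<lambda>p. (1 / pi) * ((\<Phi> (fst p) - \<Phi> (snd p)) / (fst p - snd p) * (g (fst p) * g (snd p))))"
    by simp
  then show ?thesis
    by (simp only: integral_mult_right_zero case_prod_unfold)
qed

text \<open>The derivative of \<open>QK a\<close>. With the opposite sign it tends to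
  \<open>1 / (pi * z^2)\<close>, the kernel of the \<open>H^{1/2}\<close> seminorm.\<close>

definition DQ :: "real \<Rightarrow> real \<Rightarrow> real" where
  "DQ a z = (a\<^sup>2 - z\<^sup>2) / (pi * (z\<^sup>2 + a\<^sup>2)\<^sup>2)"

lemma DQ_measurable [measurable]: "DQ a \<in> borel_measurable borel"
  unfolding DQ_def by measurable

lemma DQ_minus: "DQ a (- z) = DQ a z"
  by (simp add: DQ_def)

lemma QK_DERIV: assumes "a > 0" shows "(QK a has_real_derivative DQ a z) (at z)"
proof -
  define m where "m = z\<^sup>2 + a\<^sup>2"
  have m: "m > 0" using assms by (simp add: m_def sum_power2_pos)
  have "((\<lambda>z. z / (pi * (z\<^sup>2 + a\<^sup>2))) has_real_derivative (1 * (pi * m) - z * (pi * (2 * z))) / ((pi * m) * (pi * m))) (at z)"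
    using m unfolding m_def by (auto intro!: derivative_eq_intros)
  moreover have "(1 * (pi * m) - z * (pi * (2 * z))) / ((pi * m) * (pi * m)) = DQ a z"
  proof -
    have "1 * (pi * m) - z * (pi * (2 * z)) = pi * (a\<^sup>2 - z\<^sup>2)" by (simp add: m_def power2_eq_square algebra_simps)
    then show ?thesis by (simp add: DQ_def flip: m_def) (simp add: power2_eq_square)
  qed
  ultimately show ?thesis by (simp add: QK_def[abs_def])
qed

lemma DQ_continuous: "a > 0 \<Longrightarrow> continuous_on UNIV (\<lambda>y. DQ a (f y))" if "continuous_on UNIV f" for f :: "real \<Rightarrow> real"
  unfolding DQ_def using sum_power2_pos[of a]
  by (intro continuous_intros that) (auto simp: less_le)

lemma DQ_abs_le: assumes "a > 0" shows "\<bar>DQ a z\<bar> \<le> 1 / (pi * (z\<^sup>2 + a\<^sup>2))"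
proof -
  define m where "m = z\<^sup>2 + a\<^sup>2"
  have m: "m > 0" using assms by (simp add: m_def sum_power2_pos)
  have "\<bar>a\<^sup>2 - z\<^sup>2\<bar> \<le> m" unfolding m_def by (simp add: abs_le_iff)
  then have "\<bar>a\<^sup>2 - z\<^sup>2\<bar> / (pi * m\<^sup>2) \<le> m / (pi * m\<^sup>2)"
    using m by (intro divide_right_mono) auto
  also have "m / (pi * m\<^sup>2) = 1 / (pi * m)" using m by (simp add: power2_eq_square)
  finally show ?thesis using m by (simp add: DQ_def abs_mult m_def)
qed

lemma DQ_integrable: assumes "a > 0" shows "integrable lborel (DQ a)"
proof (rule Bochner_Integration.integrable_bound)
  show "integrable lborel (\<lambda>z. (1 / a) * PK a z)" using assms by (intro integrable_mult_right PK_integrable)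
  show "AE z in lborel. norm (DQ a z) \<le> norm ((1 / a) * PK a z)"
    using DQ_abs_le[OF assms] assms by (intro AE_I2) (simp add: PK_def abs_mult)
qed measurable

lemma DQ_integral: assumes "a > 0" shows "(LINT z|lborel. DQ a z) = 0"
proof -
  have "(LINT z|lborel. DQ a z) = 0 - 0"
  proof (rule integral_FTC_UNIV[OF QK_DERIV[OF assms] _ DQ_integrable[OF assms]])
    show "isCont (DQ a) x" for x
      using DQ_continuous[of "\<lambda>x. x", OF continuous_on_id assms] by (simp add: continuous_on_eq_continuous_at)
    show "(QK a \<longlongrightarrow> 0) at_bot" "(QK a \<longlongrightarrow> 0) at_top"
      unfolding QK_def[abs_def] by real_asymp+
  qed
  then show ?thesis by simp
qed

lemma DQ_tendsto: assumes "z \<noteq> 0" shows "(\<lambda>n. - DQ (1 / real (Suc n)) z) \<longlonglongrightarrow> 1 / (pi * z\<^sup>2)"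
proof -
  have "(\<lambda>n. - (((1 / real (Suc n))\<^sup>2 - z\<^sup>2) / (pi * (z\<^sup>2 + (1 / real (Suc n))\<^sup>2)\<^sup>2)))
    \<longlonglongrightarrow> - ((0\<^sup>2 - z\<^sup>2) / (pi * (z\<^sup>2 + 0\<^sup>2)\<^sup>2))"
    using assms by (intro tendsto_intros LIMSEQ_Suc[OF lim_1_over_n]) auto
  then show ?thesis using assms by (simp add: DQ_def power2_eq_square)
qed

text \<open>Near the diagonal the Lipschitz bounds cancel \<open>(x - y)^2\<close>; far from it that
  square decays fast enough, and the numerator vanishes unless one of the points lies in the
  support.\<close>

lemma integrable_difference_quotients:
  fixes u v :: "real \<Rightarrow> real"
  assumes [measurable]: "u \<in> borel_measurable borel" "v \<in> borel_measurable borel"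
    and u: "\<And>x. \<bar>u x\<bar> \<le> C" "\<And>x y. \<bar>u x - u y\<bar> \<le> C * \<bar>x - y\<bar>" "\<And>x. R < \<bar>x\<bar> \<Longrightarrow> u x = 0"
    and v: "\<And>x. \<bar>v x\<bar> \<le> C" "\<And>x y. \<bar>v x - v y\<bar> \<le> C * \<bar>x - y\<bar>" "\<And>x. R < \<bar>x\<bar> \<Longrightarrow> v x = 0"
  shows "integrable (lborel \<Otimes>\<^sub>M lborel) (\<lambda>(x, y). \<bar>(u x - u y) * (v x - v y)\<bar> / (x - y)\<^sup>2)"
    and "integrable (lborel \<Otimes>\<^sub>M lborel) (\<lambda>(x, y). (u x - u y) * (v x - v y) / (x - y)\<^sup>2)"
proof -
  define S where "S x = (indicator {-R..R} x :: real)" for x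
  have [measurable]: "S \<in> borel_measurable borel" unfolding S_def by measurable
  have iS: "integrable lborel S"
    unfolding S_def[abs_def] by (intro integrable_real_indicator) (auto simp: emeasure_lborel_Icc_eq)
  \<comment> \<open>Bounding the product by \<open>4 * C^2\<close> and by \<open>C^2 * z^2\<close>
    gives, after division by \<open>z^2\<close>, at most \<open>5 * C^2 / (1 + z^2)\<close>. The
    last quotient is a multiple of \<open>PK 1\<close>, and 8 leaves room.\<close>
  define W where "W x y = (8 * pi * C\<^sup>2) * (PK 1 (x - y) * S x + PK 1 (x - y) * S y)" for x y
  have iW: "integrable (lborel \<Otimes>\<^sub>M lborel) (\<lambda>(x, y). W x y)"
    using integrable_mult_right[OF Bochner_Integration.integrable_add[OF integrable_difference_kernel[OF PK_integrable_1(1) iS]], of "8 * pi * C\<^sup>2"]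
    by (simp add: W_def case_prod_unfold)
  have C: "0 \<le> C" using u(1)[of 0] by linarith
  have le: "\<bar>(u x - u y) * (v x - v y)\<bar> / (x - y)\<^sup>2 \<le> W x y" for x y
  proof (cases "x = y \<or> (R < \<bar>x\<bar> \<and> R < \<bar>y\<bar>)")
    case True
    have "0 \<le> W x y" unfolding W_def S_def
      by (intro mult_nonneg_nonneg add_nonneg_nonneg PK_nonneg) auto
    then show ?thesis using True u(3) v(3) by auto
  next
    case False
    define z where "z = x - y"
    have z: "z \<noteq> 0" using False by (simp add: z_def)
    have S: "1 \<le> S x + S y" using False by (auto simp: S_def indicator_def)
    have "\<bar>(u x - u y) * (v x - v y)\<bar> \<le> (2 * C) * (2 * C)"
      unfolding abs_mult
    proof (rule mult_mono)
      show "\<bar>u x - u y\<bar> \<le> 2 * C" using u(1)[of x] u(1)[of y] by linarith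
      show "\<bar>v x - v y\<bar> \<le> 2 * C" using v(1)[of x] v(1)[of y] by linarith
    qed (use C in auto)
    moreover have "\<bar>(u x - u y) * (v x - v y)\<bar> \<le> (C * \<bar>z\<bar>) * (C * \<bar>z\<bar>)"
      unfolding abs_mult z_def by (intro mult_mono u v) (use C in auto)
    moreover have "(C * \<bar>z\<bar>) * (C * \<bar>z\<bar>) = C\<^sup>2 * z\<^sup>2"
      by (simp add: power2_eq_square)
    moreover have "0 \<le> C\<^sup>2 * z\<^sup>2" by simp
    ultimately have "\<bar>(u x - u y) * (v x - v y)\<bar> * (1 + z\<^sup>2) \<le> 8 * C\<^sup>2 * z\<^sup>2"
    proof -
      assume a: "\<bar>(u x - u y) * (v x - v y)\<bar> \<le> (2 * C) * (2 * C)"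
        "\<bar>(u x - u y) * (v x - v y)\<bar> \<le> (C * \<bar>z\<bar>) * (C * \<bar>z\<bar>)" "(C * \<bar>z\<bar>) * (C * \<bar>z\<bar>) = C\<^sup>2 * z\<^sup>2" "0 \<le> C\<^sup>2 * z\<^sup>2"
      have "\<bar>(u x - u y) * (v x - v y)\<bar> * z\<^sup>2 \<le> (2 * C) * (2 * C) * z\<^sup>2"
        using a(1) by (rule mult_right_mono) simp
      then have "\<bar>(u x - u y) * (v x - v y)\<bar> * z\<^sup>2 \<le> 4 * (C\<^sup>2 * z\<^sup>2)" by (simp add: power2_eq_square)
      then show ?thesis using a(2,3,4) by (simp add: distrib_left)
    qed
    then have "\<bar>(u x - u y) * (v x - v y)\<bar> / z\<^sup>2 \<le> 8 * C\<^sup>2 / (1 + z\<^sup>2)"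
      using z by (simp add: divide_le_eq le_divide_eq add_pos_nonneg)
    also have "8 * C\<^sup>2 / (1 + z\<^sup>2) = (8 * pi * C\<^sup>2) * PK 1 z" by (simp add: PK_def add.commute)
    also have "\<dots> \<le> (8 * pi * C\<^sup>2) * (PK 1 z * (S x + S y))"
      using mult_left_mono[OF S, of "PK 1 z"] PK_nonneg[of 1 z] by (intro mult_left_mono) auto
    finally show ?thesis by (simp add: W_def z_def distrib_left)
  qed
  show i: "integrable (lborel \<Otimes>\<^sub>M lborel) (\<lambda>(x, y). \<bar>(u x - u y) * (v x - v y)\<bar> / (x - y)\<^sup>2)"
    by (rule Bochner_Integration.integrable_bound[OF iW])
      (use le in \<open>auto intro!: AE_I2 intro: order_trans[OF _ abs_ge_self]\<close>)
  show "integrable (lborel \<Otimes>\<^sub>M lborel) (\<lambda>(x, y). (u x - u y) * (v x - v y) / (x - y)\<^sup>2)"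
    by (rule Bochner_Integration.integrable_bound[OF i]) auto
qed

text \<open>Integration by parts moves the derivative from \<open>u\<close> to the regularised
  kernel. Symmetrization then contributes the factor 1/2, and the limit of \<open>- DQ\<close> the
  factor \<open>1 / pi\<close>.\<close>

lemma hilbert_form_difference_quotients:
  assumes u: "test_fun u" and [measurable]: "v \<in> borel_measurable borel"
    and uC: "\<And>x. \<bar>u x\<bar> \<le> C" "\<And>x y. \<bar>u x - u y\<bar> \<le> C * \<bar>x - y\<bar>" "\<And>x. R < \<bar>x\<bar> \<Longrightarrow> u x = 0"
    and vC: "\<And>x. \<bar>v x\<bar> \<le> C" "\<And>x y. \<bar>v x - v y\<bar> \<le> C * \<bar>x - y\<bar>" "\<And>x. R < \<bar>x\<bar> \<Longrightarrow> v x = 0"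
  shows "(LINT x|lborel. hilbert (deriv u) x * v x)
    = (1 / (2 * pi)) * integral\<^sup>L (lborel \<Otimes>\<^sub>M lborel) (\<lambda>(x, y). (u x - u y) * (v x - v y) / (x - y)\<^sup>2)"
proof -
  have [measurable]: "u \<in> borel_measurable borel" using u by (rule test_fun_measurable)
  have Lu: "L2 u" and Lg: "L2 (deriv u)" using u by (auto intro: test_fun_L2 test_fun_deriv)
  have C: "0 \<le> C" using uC(1)[of 0] by linarith
  have Lv: "L2 v"
    by (rule l2_mono(1)[OF L2_indicator_interval[of C "-R" R]])
      (use vC(1,3) C in \<open>auto simp: indicator_def abs_le_iff not_le\<close>)
  define \<epsilon> where "\<epsilon> n = 1 / real (Suc n)" for n
  have \<epsilon>: "0 < \<epsilon> n" for n by (simp add: \<epsilon>_def)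
  have eq: "(LINT x|lborel. conv (QK (\<epsilon> n)) (deriv u) x * v x)
     = (1 / 2) * integral\<^sup>L (lborel \<Otimes>\<^sub>M lborel) (\<lambda>p. - DQ (\<epsilon> n) (fst p - snd p) * ((u (fst p) - u (snd p)) * (v (fst p) - v (snd p))))" for n
  proof -
    have c: "conv (QK (\<epsilon> n)) (deriv u) x = conv (DQ (\<epsilon> n)) u x" for x
    proof -
      have d: "((\<lambda>y. QK (\<epsilon> n) (x - y)) has_real_derivative - DQ (\<epsilon> n) (x - y)) (at y)" for y
      proof -
        have "((\<lambda>y. QK (\<epsilon> n) (x - y)) has_real_derivative DQ (\<epsilon> n) (x - y) * (- 1)) (at y)"
          by (rule DERIV_chain2[OF QK_DERIV[OF \<epsilon>]]) (auto intro!: derivative_eq_intros)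
        then show ?thesis by simp
      qed
      have "continuous_on UNIV (\<lambda>y. - DQ (\<epsilon> n) (x - y))"
        by (intro continuous_on_minus DQ_continuous \<epsilon> continuous_intros)
      from integral_by_parts_test(3)[OF u d this] show ?thesis
        by (simp add: conv_def mult.commute)
    qed
    have i1: "integrable (lborel \<Otimes>\<^sub>M lborel) (\<lambda>(x, y). DQ (\<epsilon> n) (x - y) * (u y * v x))"
      by (rule schur_integrable[OF DQ_integrable[OF \<epsilon>] Lu Lv])
    \<comment> \<open>Subtracting the diagonal value \<open>u x\<close> costs nothing, because
      \<open>DQ\<close> has mean zero, and produces the difference \<open>u y - u x\<close>.\<close>
    have i2: "integrable (lborel \<Otimes>\<^sub>M lborel) (\<lambda>(x, y). DQ (\<epsilon> n) (x - y) * (u x * v x))"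
      by (rule integrable_difference_kernel(1)[OF DQ_integrable[OF \<epsilon>] L2_mult_integrable[OF Lu Lv]])
    have i: "integrable (lborel \<Otimes>\<^sub>M lborel) (\<lambda>(x, y). DQ (\<epsilon> n) (x - y) * (u y - u x) * v x)"
      using Bochner_Integration.integrable_diff[OF i1 i2] by (simp add: case_prod_unfold algebra_simps)
    have "(LINT x|lborel. conv (QK (\<epsilon> n)) (deriv u) x * v x)
        = (LINT x|lborel. LINT y|lborel. DQ (\<epsilon> n) (x - y) * (u y * v x))"
      unfolding c by (simp add: conv_def mult.assoc flip: integral_mult_left_zero)
    also have "\<dots> = integral\<^sup>L (lborel \<Otimes>\<^sub>M lborel) (\<lambda>(x, y). DQ (\<epsilon> n) (x - y) * (u y * v x))"
      by (rule lborel_pair.integral_fst[OF i1])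
    also have "\<dots> = integral\<^sup>L (lborel \<Otimes>\<^sub>M lborel) (\<lambda>(x, y). DQ (\<epsilon> n) (x - y) * (u y * v x))
        - integral\<^sup>L (lborel \<Otimes>\<^sub>M lborel) (\<lambda>(x, y). DQ (\<epsilon> n) (x - y) * (u x * v x))"
    proof -
      have "integral\<^sup>L (lborel \<Otimes>\<^sub>M lborel) (\<lambda>(x, y). DQ (\<epsilon> n) (x - y) * (u x * v x))
         = (LINT x|lborel. LINT y|lborel. DQ (\<epsilon> n) (x - y) * (u x * v x))"
        by (rule lborel_pair.integral_fst[OF i2, symmetric])
      also have "\<dots> = 0" by (simp add: integral_reflect_shift[of "DQ (\<epsilon> n)"] DQ_integral[OF \<epsilon>])
      finally show ?thesis by simp
    qed
    also have "\<dots> = integral\<^sup>L (lborel \<Otimes>\<^sub>M lborel) (\<lambda>(x, y). DQ (\<epsilon> n) (x - y) * (u y - u x) * v x)"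
      using Bochner_Integration.integral_diff[OF i1 i2] by (simp add: case_prod_unfold algebra_simps)
    also have "\<dots> = (1 / 2) * integral\<^sup>L (lborel \<Otimes>\<^sub>M lborel) (\<lambda>(x, y).
        DQ (\<epsilon> n) (x - y) * (u y - u x) * v x + DQ (\<epsilon> n) (y - x) * (u x - u y) * v y)"
      by (rule integral_symmetrize(2)[OF i])
    also have "(\<lambda>(x, y). DQ (\<epsilon> n) (x - y) * (u y - u x) * v x + DQ (\<epsilon> n) (y - x) * (u x - u y) * v y)
      = (\<lambda>p. - DQ (\<epsilon> n) (fst p - snd p) * ((u (fst p) - u (snd p)) * (v (fst p) - v (snd p))))"
    proof (rule ext, clarify)
      fix x y
      have "DQ (\<epsilon> n) (y - x) = DQ (\<epsilon> n) (x - y)" using DQ_minus[of "\<epsilon> n" "x - y"] by simp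
      then show "DQ (\<epsilon> n) (x - y) * (u y - u x) * v x + DQ (\<epsilon> n) (y - x) * (u x - u y) * v y
        = - DQ (\<epsilon> n) (fst (x, y) - snd (x, y)) * ((u (fst (x, y)) - u (snd (x, y))) * (v (fst (x, y)) - v (snd (x, y))))"
        by (simp add: algebra_simps)
    qed
    finally show ?thesis .
  qed
  have "(\<lambda>n. integral\<^sup>L (lborel \<Otimes>\<^sub>M lborel) (\<lambda>p. - DQ (\<epsilon> n) (fst p - snd p) * ((u (fst p) - u (snd p)) * (v (fst p) - v (snd p)))))
     \<longlonglongrightarrow> integral\<^sup>L (lborel \<Otimes>\<^sub>M lborel) (\<lambda>p. (1 / pi) * ((u (fst p) - u (snd p)) * (v (fst p) - v (snd p)) / (fst p - snd p)\<^sup>2))"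
  proof (rule integral_dominated_convergence)
    show "integrable (lborel \<Otimes>\<^sub>M lborel) (\<lambda>p. (1 / pi) * (\<bar>(u (fst p) - u (snd p)) * (v (fst p) - v (snd p))\<bar> / (fst p - snd p)\<^sup>2))"
      using integrable_mult_right[OF integrable_difference_quotients(1)[of u v C R], of "1 / pi"] uC vC
      by (simp add: case_prod_unfold)
    show "AE p in lborel \<Otimes>\<^sub>M lborel. (\<lambda>n. - DQ (\<epsilon> n) (fst p - snd p) * ((u (fst p) - u (snd p)) * (v (fst p) - v (snd p))))
       \<longlonglongrightarrow> (1 / pi) * ((u (fst p) - u (snd p)) * (v (fst p) - v (snd p)) / (fst p - snd p)\<^sup>2)"
    proof (rule AE_I2)
      fix p :: "real \<times> real"
      show "(\<lambda>n. - DQ (\<epsilon> n) (fst p - snd p) * ((u (fst p) - u (snd p)) * (v (fst p) - v (snd p))))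
       \<longlonglongrightarrow> (1 / pi) * ((u (fst p) - u (snd p)) * (v (fst p) - v (snd p)) / (fst p - snd p)\<^sup>2)"
      proof (cases "fst p = snd p")
        case False
        then have "(\<lambda>n. - DQ (\<epsilon> n) (fst p - snd p)) \<longlonglongrightarrow> 1 / (pi * (fst p - snd p)\<^sup>2)"
          unfolding \<epsilon>_def by (intro DQ_tendsto) simp
        from tendsto_mult_right[OF this, of "(u (fst p) - u (snd p)) * (v (fst p) - v (snd p))"]
        show ?thesis by simp
      qed simp
    qed
    show "AE p in lborel \<Otimes>\<^sub>M lborel. norm (- DQ (\<epsilon> n) (fst p - snd p) * ((u (fst p) - u (snd p)) * (v (fst p) - v (snd p))))
       \<le> (1 / pi) * (\<bar>(u (fst p) - u (snd p)) * (v (fst p) - v (snd p))\<bar> / (fst p - snd p)\<^sup>2)" for n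
    proof (rule AE_I2)
      fix p :: "real \<times> real"
      show "norm (- DQ (\<epsilon> n) (fst p - snd p) * ((u (fst p) - u (snd p)) * (v (fst p) - v (snd p))))
       \<le> (1 / pi) * (\<bar>(u (fst p) - u (snd p)) * (v (fst p) - v (snd p))\<bar> / (fst p - snd p)\<^sup>2)"
      proof (cases "fst p = snd p")
        case False
        define z where "z = fst p - snd p"
        have z: "z \<noteq> 0" using False by (simp add: z_def)
        have "\<bar>DQ (\<epsilon> n) z\<bar> \<le> 1 / (pi * (z\<^sup>2 + (\<epsilon> n)\<^sup>2))" by (rule DQ_abs_le[OF \<epsilon>])
        also have "\<dots> \<le> 1 / (pi * z\<^sup>2)"
          using z by (intro divide_left_mono mult_left_mono) (auto simp: add_pos_nonneg)
        finally have "\<bar>DQ (\<epsilon> n) z\<bar> * \<bar>(u (fst p) - u (snd p)) * (v (fst p) - v (snd p))\<bar>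
          \<le> 1 / (pi * z\<^sup>2) * \<bar>(u (fst p) - u (snd p)) * (v (fst p) - v (snd p))\<bar>"
          by (rule mult_right_mono) simp
        then show ?thesis unfolding z_def[symmetric] by (simp add: abs_mult)
      qed simp
    qed
  qed measurable
  from tendsto_mult_left[OF this, of "1 / 2"]
  have "(\<lambda>n. LINT x|lborel. conv (QK (\<epsilon> n)) (deriv u) x * v x) \<longlonglongrightarrow> (1 / 2) *
      integral\<^sup>L (lborel \<Otimes>\<^sub>M lborel) (\<lambda>p. (1 / pi) * ((u (fst p) - u (snd p)) * (v (fst p) - v (snd p)) / (fst p - snd p)\<^sup>2))"
    unfolding eq .
  from LIMSEQ_unique[OF hilbert_pairing[OF Lg Lv] this[unfolded \<epsilon>_def]]
  show ?thesis
    unfolding integral_mult_right_zero by (simp add: case_prod_unfold)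
qed

subsection \<open>The weighted energy inequality\<close>

text \<open>On the interval of radius \<open>h\<close> around \<open>x\<close>,
  \<open>(w x)^2\<close> is compared with \<open>(w y)^2\<close> and with the difference quotient,
  which costs at most \<open>h^2\<close>. Integrating gives
  \<open>2 * h * (w x)^2 \<le> 2 * h^2 * n + 2 * (l2 w)^2\<close>, and \<open>h\<close> remains to
  be chosen.\<close>

lemma sobolev_pointwise:
  fixes w :: "real \<Rightarrow> real"
  assumes w: "L2 w" and i: "integrable lborel (\<lambda>y. (w x - w y)\<^sup>2 / (x - y)\<^sup>2)" and pos: "l2 w > 0"
  shows "(w x) ^ 4 \<le> 4 * (l2 w)\<^sup>2 * (LINT y|lborel. (w x - w y)\<^sup>2 / (x - y)\<^sup>2)"
proof (cases "w x = 0")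
  case True
  have "0 \<le> (LINT y|lborel. (w x - w y)\<^sup>2 / (x - y)\<^sup>2)"
    by (intro Bochner_Integration.integral_nonneg) simp
  then show ?thesis using True by simp
next
  case False
  define n where "n = (LINT y|lborel. (w x - w y)\<^sup>2 / (x - y)\<^sup>2)"
  \<comment> \<open>With this radius the left side equals \<open>4 * (l2 w)^2\<close>, so the last
    term takes up half of it.\<close>
  define h where "h = 2 * (l2 w)\<^sup>2 / (w x)\<^sup>2"
  have h: "h > 0" using False pos by (simp add: h_def)
  define J where "J y = (indicator {x - h..x + h} y :: real)" for y
  have iJ: "integrable lborel J" "(LINT y|lborel. J y) = 2 * h"
    unfolding J_def[abs_def] using h
    by (auto intro!: integrable_real_indicator simp: emeasure_lborel_Icc_eq)
  have "(LINT y|lborel. (w x)\<^sup>2 * J y) \<le> (LINT y|lborel. 2 * h\<^sup>2 * ((w x - w y)\<^sup>2 / (x - y)\<^sup>2) + 2 * (w y)\<^sup>2)"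
  proof (rule integral_mono)
    show "integrable lborel (\<lambda>y. (w x)\<^sup>2 * J y)" using iJ by auto
    show "integrable lborel (\<lambda>y. 2 * h\<^sup>2 * ((w x - w y)\<^sup>2 / (x - y)\<^sup>2) + 2 * (w y)\<^sup>2)"
      by (intro Bochner_Integration.integrable_add integrable_mult_right i L2_square_integrable w)
    fix y
    show "(w x)\<^sup>2 * J y \<le> 2 * h\<^sup>2 * ((w x - w y)\<^sup>2 / (x - y)\<^sup>2) + 2 * (w y)\<^sup>2"
    proof (cases "y \<in> {x - h..x + h}")
      case True
      have sq: "(w x)\<^sup>2 \<le> 2 * (w x - w y)\<^sup>2 + 2 * (w y)\<^sup>2"
        using zero_le_power2[of "w x - 2 * w y"] by (simp add: power2_eq_square algebra_simps)
      have "(w x - w y)\<^sup>2 \<le> h\<^sup>2 * ((w x - w y)\<^sup>2 / (x - y)\<^sup>2)"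
      proof (cases "x = y")
        case False
        have "(x - y)\<^sup>2 \<le> h\<^sup>2" using True h by (simp add: abs_le_square_iff[symmetric] abs_le_iff)
        then have "(x - y)\<^sup>2 * (w x - w y)\<^sup>2 \<le> h\<^sup>2 * (w x - w y)\<^sup>2" by (rule mult_right_mono) simp
        then show ?thesis using False by (simp add: field_simps)
      qed simp
      then show ?thesis using sq True by (simp add: J_def)
    qed (simp add: J_def)
  qed
  also have "\<dots> = 2 * h\<^sup>2 * n + 2 * (l2 w)\<^sup>2"
    unfolding n_def l2_square
    by (simp only: Bochner_Integration.integral_add[OF integrable_mult_right[OF i] integrable_mult_right[OF L2_square_integrable[OF w]]]
      integral_mult_right_zero)
  also have "(LINT y|lborel. (w x)\<^sup>2 * J y) = 4 * (l2 w)\<^sup>2"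
    using iJ False by (simp add: h_def)
  finally have "(l2 w)\<^sup>2 \<le> h\<^sup>2 * n" by simp
  also have "h\<^sup>2 * n = (l2 w)\<^sup>2 * (4 * (l2 w)\<^sup>2 * n / (w x) ^ 4)"
    by (simp add: h_def power_divide power_mult_distrib power2_eq_square power4_eq_xxxx mult_ac)
  finally have "(l2 w)\<^sup>2 * 1 \<le> (l2 w)\<^sup>2 * (4 * (l2 w)\<^sup>2 * n / (w x) ^ 4)" by simp
  then have "1 \<le> 4 * (l2 w)\<^sup>2 * n / (w x) ^ 4"
    by (rule mult_left_le_imp_le) (use pos in simp)
  then show ?thesis using False by (simp add: n_def le_divide_eq)
qed

text \<open>A Gagliardo-Nirenberg inequality: the fourth power of the \<open>L^4\<close> norm is at
  most \<open>4 * (l2 w)^2 * N\<close>, obtained by integrating \<open>sobolev_pointwise\<close> in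
  \<open>x\<close>. This is the estimate that meets the cubic term.\<close>

lemma sobolev_L4:
  assumes [measurable]: "w \<in> borel_measurable borel"
    and w: "\<And>x. \<bar>w x\<bar> \<le> C" "\<And>x y. \<bar>w x - w y\<bar> \<le> C * \<bar>x - y\<bar>" "\<And>x. R < \<bar>x\<bar> \<Longrightarrow> w x = 0"
  defines "N \<equiv> integral\<^sup>L (lborel \<Otimes>\<^sub>M lborel) (\<lambda>(x, y). (w x - w y)\<^sup>2 / (x - y)\<^sup>2)"
  shows "L2 w" "L2 (\<lambda>x. (w x)\<^sup>2)" "0 \<le> N" "l2 (\<lambda>x. (w x)\<^sup>2) \<le> 2 * l2 w * sqrt N"
proof -
  have C: "0 \<le> C" using w(1)[of 0] by linarith
  show Lw: "L2 w"
    by (rule l2_mono(1)[OF L2_indicator_interval[of C "-R" R]])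
      (use w(1,3) C in \<open>auto simp: indicator_def abs_le_iff not_le\<close>)
  show L: "L2 (\<lambda>x. (w x)\<^sup>2)"
    using L2_bounded_mult[OF Lw _ w(1)] by (simp add: power2_eq_square)
  have i: "integrable (lborel \<Otimes>\<^sub>M lborel) (\<lambda>(x, y). (w x - w y)\<^sup>2 / (x - y)\<^sup>2)"
    using integrable_difference_quotients(2)[of w w C R] w by (simp add: power2_eq_square)
  show N0: "0 \<le> N" unfolding N_def
    by (intro Bochner_Integration.integral_nonneg) auto
  show "l2 (\<lambda>x. (w x)\<^sup>2) \<le> 2 * l2 w * sqrt N"
  proof (cases "l2 w = 0")
    case True
    then have "AE x in lborel. w x = 0" using l2_eq_0_AE[OF Lw] by simp
    then have "AE x in lborel. (w x)\<^sup>2 = 0" by eventually_elim simp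
    then have "l2 (\<lambda>x. (w x)\<^sup>2) = 0" using l2_eq_0_AE[OF L] by simp
    then show ?thesis using True by simp
  next
    case False
    then have pos: "l2 w > 0" using l2_nonneg[of w] by linarith
    have "(l2 (\<lambda>x. (w x)\<^sup>2))\<^sup>2 = (LINT x|lborel. (w x) ^ 4)" by (simp add: l2_square flip: power_mult)
    also have "\<dots> \<le> (LINT x|lborel. 4 * (l2 w)\<^sup>2 * (LINT y|lborel. (w x - w y)\<^sup>2 / (x - y)\<^sup>2))"
    proof (rule integral_mono_AE)
      show "integrable lborel (\<lambda>x. (w x) ^ 4)" using L2_square_integrable[OF L] by (simp flip: power_mult)
      show "integrable lborel (\<lambda>x. 4 * (l2 w)\<^sup>2 * (LINT y|lborel. (w x - w y)\<^sup>2 / (x - y)\<^sup>2))"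
        using lborel_pair.integrable_fst[OF i] by (intro integrable_mult_right)
      show "AE x in lborel. (w x) ^ 4 \<le> 4 * (l2 w)\<^sup>2 * (LINT y|lborel. (w x - w y)\<^sup>2 / (x - y)\<^sup>2)"
        using lborel_pair.AE_integrable_fst[OF i] by eventually_elim (rule sobolev_pointwise[OF Lw _ pos])
    qed
    also have "\<dots> = 4 * (l2 w)\<^sup>2 * N"
      unfolding N_def lborel_pair.integral_fst[OF i, symmetric] by simp
    also have "\<dots> = (2 * l2 w * sqrt N)\<^sup>2" using N0 by (simp add: power_mult_distrib)
    finally show ?thesis by (rule power2_le_imp_le) (use N0 in simp)
  qed
qed

text \<open>A Schur constant: for fixed \<open>x\<close> the substitution
  \<open>z = c * x + d * y\<close> costs \<open>1 / \<bar>d\<bar>\<close>.\<close>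

lemma affine_kernel_bound:
  fixes k h :: "real \<Rightarrow> real"
  assumes k: "integrable lborel k" and h: "integrable lborel h" and d: "d \<noteq> 0"
  shows "integrable (lborel \<Otimes>\<^sub>M lborel) (\<lambda>(x, y). \<bar>k (c * x + d * y)\<bar> * h x)"
    and "integral\<^sup>L (lborel \<Otimes>\<^sub>M lborel) (\<lambda>(x, y). \<bar>k (c * x + d * y)\<bar> * h x)
       = (LINT z|lborel. \<bar>k z\<bar>) / \<bar>d\<bar> * (LINT x|lborel. h x)"
proof -
  have [measurable]: "k \<in> borel_measurable borel" "h \<in> borel_measurable borel" using k h by auto
  have e: "integrable lborel (\<lambda>y. \<bar>k (c * x + d * y)\<bar>)"
      "(LINT y|lborel. \<bar>k (c * x + d * y)\<bar>) = (LINT z|lborel. \<bar>k z\<bar>) / \<bar>d\<bar>" for x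
    using lborel_integrable_real_affine[OF integrable_abs[OF k] d, of "c * x"]
      lborel_integral_real_affine[OF d, of "\<lambda>z. \<bar>k z\<bar>" "c * x"] d
    by auto
  show i: "integrable (lborel \<Otimes>\<^sub>M lborel) (\<lambda>(x, y). \<bar>k (c * x + d * y)\<bar> * h x)"
  proof (rule lborel_pair.Fubini_integrable)
    show "integrable lborel (\<lambda>x. LINT y|lborel. norm (case (x, y) of (x, y) \<Rightarrow> \<bar>k (c * x + d * y)\<bar> * h x))"
      using h by (simp add: abs_mult e)
    show "AE x in lborel. integrable lborel (\<lambda>y. case (x, y) of (x, y) \<Rightarrow> \<bar>k (c * x + d * y)\<bar> * h x)"
      using e by auto
  qed measurable
  show "integral\<^sup>L (lborel \<Otimes>\<^sub>M lborel) (\<lambda>(x, y). \<bar>k (c * x + d * y)\<bar> * h x)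
       = (LINT z|lborel. \<bar>k z\<bar>) / \<bar>d\<bar> * (LINT x|lborel. h x)"
    unfolding lborel_pair.integral_fst[OF i, symmetric] by (simp add: e)
qed

text \<open>\<open>b\<close> is the square root of the slope of \<open>\<Phi>\<close>; the condition on \<open>k\<close> makes the kernel
  \<open>((b x - b y) / (x - y))\<^sup>2\<close>, the error of moving \<open>b\<close> inside the \<open>H^{1/2}\<close> seminorm, Hilbert-Schmidt
  with a norm that shrinks under dilation.\<close>

locale weight =
  fixes \<Phi> \<Phi>1 \<Phi>2 \<Phi>3 b k :: "real \<Rightarrow> real" and M N3 :: real
  assumes smooth: "smooth \<Phi>"
    and D1: "\<And>x. (\<Phi> has_real_derivative \<Phi>1 x) (at x)"
    and D2: "\<And>x. (\<Phi>1 has_real_derivative \<Phi>2 x) (at x)"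
    and D3: "\<And>x. (\<Phi>2 has_real_derivative \<Phi>3 x) (at x)"
    and C3: "continuous_on UNIV \<Phi>3"
    and M: "\<And>x. \<bar>\<Phi> x\<bar> \<le> M" "\<And>x. \<bar>\<Phi>1 x\<bar> \<le> M" "\<And>x. \<bar>\<Phi>2 x\<bar> \<le> M" "\<And>x. \<bar>\<Phi>3 x\<bar> \<le> M"
    and N3: "integrable lborel \<Phi>3" "(LINT x|lborel. \<bar>\<Phi>3 x\<bar>) \<le> N3"
    and square: "\<And>x. \<Phi>1 x = (b x)\<^sup>2"
    and b: "\<And>x. \<bar>b x\<bar> \<le> M" "\<And>x y. \<bar>b x - b y\<bar> \<le> M * \<bar>x - y\<bar>"
    and k: "L2 k" "\<And>x. 0 \<le> k x" "\<And>x y. (b x - b y)\<^sup>2 \<le> (x - y)\<^sup>2 * (k x * k y)"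
begin

lemma continuous: "continuous_on UNIV \<Phi>" "continuous_on UNIV \<Phi>1" "continuous_on UNIV \<Phi>2"
  using D1 D2 D3 DERIV_continuous_on by blast+

lemma b_measurable [measurable]: "b \<in> borel_measurable borel"
proof (rule borel_measurable_continuous_onI)
  have "M-lipschitz_on UNIV b"
    using b M(1)[of 0] by (intro lipschitz_onI) (auto simp: dist_real_def)
  then show "continuous_on UNIV b" by (rule lipschitz_on_continuous_on)
qed

lemma measurable_weights [measurable]:
  "\<Phi> \<in> borel_measurable borel" "\<Phi>1 \<in> borel_measurable borel" "\<Phi>2 \<in> borel_measurable borel" "\<Phi>3 \<in> borel_measurable borel"
  using continuous C3 by (auto intro: borel_measurable_continuous_onI)

text \<open>Integrating by parts in \<open>x\<close> and in \<open>y\<close> costs the factor \<open>s (1 - s)\<close>, which exactly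
  compensates the two Schur constants.\<close>

lemma commutator_slice:
  assumes u: "test_fun u" and s: "0 < s" "s < 1"
  shows "\<bar>integral\<^sup>L (lborel \<Otimes>\<^sub>M lborel) (\<lambda>(x, y). \<Phi>1 (s * x + (1 - s) * y) * (deriv u x * deriv u y))\<bar>
     \<le> N3 / 2 * (l2 u)\<^sup>2"
proof -
  define g where "g = deriv u"
  have g: "test_fun g" unfolding g_def by (rule test_fun_deriv[OF u])
  have [measurable]: "u \<in> borel_measurable borel" "g \<in> borel_measurable borel" using u g by (auto simp: test_fun_measurable)
  define A where "A x y = s * x + (1 - s) * y" for x y
  have [measurable]: "(\<lambda>p. A (fst p) (snd p)) \<in> borel_measurable (lborel \<Otimes>\<^sub>M lborel)" unfolding A_def by measurable
  have dA: "((\<lambda>x. A x y) has_real_derivative s) (at x)" "((\<lambda>y. A x y) has_real_derivative (1 - s)) (at y)" for x y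
    unfolding A_def by (auto intro!: derivative_eq_intros)
  have cA: "continuous_on UNIV (\<lambda>x. A x y)" "continuous_on UNIV (\<lambda>y. A x y)" for x y
    unfolding A_def by (intro continuous_intros)+
  have ip: "integrable (lborel \<Otimes>\<^sub>M lborel) (\<lambda>(x, y). \<phi> (A x y) * (f x * h y))"
    if "integrable lborel f" "integrable lborel h" "\<phi> \<in> borel_measurable borel" "\<And>z. \<bar>\<phi> z\<bar> \<le> M" for \<phi> f h
  proof -
    have [measurable]: "\<phi> \<in> borel_measurable borel" by fact
    have "integrable (lborel \<Otimes>\<^sub>M lborel) (\<lambda>(x, y). (\<lambda>p. \<phi> (A (fst p) (snd p))) (x, y) * (f x * h y))"
      by (rule integrable_product_bounded[where K=M]) (use that in auto)
    then show ?thesis by simp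
  qed
  note iu = test_fun_integrable[OF u] and ig = test_fun_integrable[OF g]
  have P1: "(LINT x|lborel. g x * \<Phi>1 (A x y)) = - (LINT x|lborel. u x * (\<Phi>2 (A x y) * s))" for y
    unfolding g_def
    by (rule integral_by_parts_test(3)[OF u DERIV_chain2[OF D2 dA(1)]])
      (intro continuous_intros continuous_on_compose2[OF continuous(3) cA(1)] subset_UNIV)
  have P2: "(LINT y|lborel. g y * \<Phi>2 (A x y)) = - (LINT y|lborel. u y * (\<Phi>3 (A x y) * (1 - s)))" for x
    unfolding g_def
    by (rule integral_by_parts_test(3)[OF u DERIV_chain2[OF D3 dA(2)]])
      (intro continuous_intros continuous_on_compose2[OF C3 cA(2)] subset_UNIV)
  have "integral\<^sup>L (lborel \<Otimes>\<^sub>M lborel) (\<lambda>(x, y). \<Phi>1 (A x y) * (g x * g y))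
     = (LINT y|lborel. LINT x|lborel. \<Phi>1 (A x y) * (g x * g y))"
    by (rule lborel_pair.integral_snd[symmetric]) (rule ip; (rule ig M measurable_weights)+)
  also have "\<dots> = (LINT y|lborel. (LINT x|lborel. g x * \<Phi>1 (A x y)) * g y)"
    by (simp add: mult_ac flip: integral_mult_left_zero)
  also have "\<dots> = (LINT y|lborel. LINT x|lborel. (- s) * (\<Phi>2 (A x y) * (u x * g y)))"
    unfolding P1 by (simp add: mult_ac flip: integral_mult_left_zero integral_mult_right_zero)
  also have "\<dots> = (LINT x|lborel. LINT y|lborel. (- s) * (\<Phi>2 (A x y) * (u x * g y)))"
  proof (rule lborel_pair.Fubini_integral)
    show "integrable (lborel \<Otimes>\<^sub>M lborel) (\<lambda>(x, y). (- s) * (\<Phi>2 (A x y) * (u x * g y)))"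
      using integrable_mult_right[OF ip[OF iu ig measurable_weights(3) M(3)], of "- s"]
      by (simp add: case_prod_unfold)
  qed
  also have "\<dots> = (LINT x|lborel. (- s) * u x * (LINT y|lborel. g y * \<Phi>2 (A x y)))"
    by (simp add: mult_ac flip: integral_mult_right_zero)
  also have "\<dots> = (LINT x|lborel. LINT y|lborel. s * (1 - s) * (\<Phi>3 (A x y) * (u x * u y)))"
    unfolding P2 by (simp add: mult_ac flip: integral_mult_right_zero)
  also have "\<dots> = integral\<^sup>L (lborel \<Otimes>\<^sub>M lborel) (\<lambda>(x, y). s * (1 - s) * (\<Phi>3 (A x y) * (u x * u y)))"
  proof (rule lborel_pair.integral_fst)
    show "integrable (lborel \<Otimes>\<^sub>M lborel) (\<lambda>(x, y). s * (1 - s) * (\<Phi>3 (A x y) * (u x * u y)))"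
      using integrable_mult_right[OF ip[OF iu iu measurable_weights(4) M(4)], of "s * (1 - s)"]
      by (simp add: case_prod_unfold)
  qed
  finally have eq: "integral\<^sup>L (lborel \<Otimes>\<^sub>M lborel) (\<lambda>(x, y). \<Phi>1 (A x y) * (g x * g y))
     = s * (1 - s) * integral\<^sup>L (lborel \<Otimes>\<^sub>M lborel) (\<lambda>(x, y). \<Phi>3 (A x y) * (u x * u y))"
    by (simp add: case_prod_unfold)
  have iu2: "integrable lborel (\<lambda>x. (u x)\<^sup>2)" by (intro L2_square_integrable test_fun_L2 u)
  define n where "n = (LINT x|lborel. \<bar>\<Phi>3 x\<bar>)"
  \<comment> \<open>The constants for the two squares are \<open>n / (1 - s)\<close> and
    \<open>n / s\<close>, with sum \<open>n / (s * (1 - s))\<close>, so the prefactor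
    \<open>s * (1 - s)\<close> cancels.\<close>
  have S1: "integrable (lborel \<Otimes>\<^sub>M lborel) (\<lambda>(x, y). \<bar>\<Phi>3 (A x y)\<bar> * (u x)\<^sup>2)"
    "integral\<^sup>L (lborel \<Otimes>\<^sub>M lborel) (\<lambda>(x, y). \<bar>\<Phi>3 (A x y)\<bar> * (u x)\<^sup>2) = n / (1 - s) * (l2 u)\<^sup>2"
    using affine_kernel_bound[OF N3(1) iu2, of "1 - s" s] s unfolding A_def n_def l2_square by auto
  have S2': "integrable (lborel \<Otimes>\<^sub>M lborel) (\<lambda>(x, y). \<bar>\<Phi>3 (A y x)\<bar> * (u x)\<^sup>2)"
    "integral\<^sup>L (lborel \<Otimes>\<^sub>M lborel) (\<lambda>(x, y). \<bar>\<Phi>3 (A y x)\<bar> * (u x)\<^sup>2) = n / s * (l2 u)\<^sup>2"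
    using affine_kernel_bound[OF N3(1) iu2, of s "1 - s"] s unfolding A_def n_def l2_square by (auto simp: add.commute)
  have S2: "integrable (lborel \<Otimes>\<^sub>M lborel) (\<lambda>(x, y). \<bar>\<Phi>3 (A x y)\<bar> * (u y)\<^sup>2)"
    "integral\<^sup>L (lborel \<Otimes>\<^sub>M lborel) (\<lambda>(x, y). \<bar>\<Phi>3 (A x y)\<bar> * (u y)\<^sup>2) = n / s * (l2 u)\<^sup>2"
    using lborel_pair.integrable_product_swap[OF S2'(1)]
      lborel_pair.integral_product_swap[of "\<lambda>(x, y). \<bar>\<Phi>3 (A y x)\<bar> * (u x)\<^sup>2"] S2'
    by (auto simp: case_prod_unfold)
  have "\<bar>integral\<^sup>L (lborel \<Otimes>\<^sub>M lborel) (\<lambda>(x, y). \<Phi>3 (A x y) * (u x * u y))\<bar>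
      \<le> integral\<^sup>L (lborel \<Otimes>\<^sub>M lborel) (\<lambda>p. \<bar>case p of (x, y) \<Rightarrow> \<Phi>3 (A x y) * (u x * u y)\<bar>)"
    by (rule integral_abs_bound)
  also have "\<dots> \<le> integral\<^sup>L (lborel \<Otimes>\<^sub>M lborel) (\<lambda>p. (1 / 2) * ((case p of (x, y) \<Rightarrow> \<bar>\<Phi>3 (A x y)\<bar> * (u x)\<^sup>2)
      + (case p of (x, y) \<Rightarrow> \<bar>\<Phi>3 (A x y)\<bar> * (u y)\<^sup>2)))"
  proof (rule integral_mono)
    show "integrable (lborel \<Otimes>\<^sub>M lborel) (\<lambda>p. \<bar>case p of (x, y) \<Rightarrow> \<Phi>3 (A x y) * (u x * u y)\<bar>)"
      by (intro integrable_abs ip iu measurable_weights M)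
    show "integrable (lborel \<Otimes>\<^sub>M lborel) (\<lambda>p. (1 / 2) * ((case p of (x, y) \<Rightarrow> \<bar>\<Phi>3 (A x y)\<bar> * (u x)\<^sup>2)
      + (case p of (x, y) \<Rightarrow> \<bar>\<Phi>3 (A x y)\<bar> * (u y)\<^sup>2)))"
      by (intro integrable_mult_right Bochner_Integration.integrable_add S1 S2)
    fix p :: "real \<times> real"
    obtain x y where p: "p = (x, y)" by (cases p)
    have "\<bar>u x * u y\<bar> \<le> (1 / 2) * ((u x)\<^sup>2 + (u y)\<^sup>2)"
      using sum_squares_bound[of "\<bar>u x\<bar>" "\<bar>u y\<bar>"] by (simp add: abs_mult)
    then have "\<bar>\<Phi>3 (A x y)\<bar> * \<bar>u x * u y\<bar> \<le> \<bar>\<Phi>3 (A x y)\<bar> * ((1 / 2) * ((u x)\<^sup>2 + (u y)\<^sup>2))"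
      by (rule mult_left_mono) simp
    then show "\<bar>case p of (x, y) \<Rightarrow> \<Phi>3 (A x y) * (u x * u y)\<bar>
      \<le> (1 / 2) * ((case p of (x, y) \<Rightarrow> \<bar>\<Phi>3 (A x y)\<bar> * (u x)\<^sup>2) + (case p of (x, y) \<Rightarrow> \<bar>\<Phi>3 (A x y)\<bar> * (u y)\<^sup>2))"
      unfolding p by (simp add: abs_mult algebra_simps)
  qed
  also have "\<dots> = (1 / 2) * (n / (1 - s) * (l2 u)\<^sup>2 + n / s * (l2 u)\<^sup>2)"
    using S1 S2 by simp
  finally have "s * (1 - s) * \<bar>integral\<^sup>L (lborel \<Otimes>\<^sub>M lborel) (\<lambda>(x, y). \<Phi>3 (A x y) * (u x * u y))\<bar>
     \<le> s * (1 - s) * ((1 / 2) * (n / (1 - s) * (l2 u)\<^sup>2 + n / s * (l2 u)\<^sup>2))"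
    using s by (intro mult_left_mono) auto
  also have "\<dots> = n / 2 * (l2 u)\<^sup>2" using s by (simp add: field_simps)
  also have "\<dots> \<le> N3 / 2 * (l2 u)\<^sup>2" using N3(2) by (intro mult_right_mono) (auto simp: n_def)
  finally show ?thesis
    using s eq unfolding g_def A_def by (simp add: abs_mult)
qed

text \<open>The difference quotient is the mean of the slope \<open>\<Phi>1\<close> along the
  segment from \<open>y\<close> to \<open>x\<close>. Fubini exchanges this mean with the double
  integral, and each slice obeys a bound independent of \<open>s\<close>.\<close>

lemma commutator_bound:
  assumes u: "test_fun u"
  shows "\<bar>integral\<^sup>L (lborel \<Otimes>\<^sub>M lborel) (\<lambda>(x, y). (\<Phi> x - \<Phi> y) / (x - y) * (deriv u x * deriv u y))\<bar>
     \<le> N3 / 2 * (l2 u)\<^sup>2"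
proof -
  define g where "g = deriv u"
  have g: "test_fun g" unfolding g_def by (rule test_fun_deriv[OF u])
  have [measurable]: "g \<in> borel_measurable borel" using g by (rule test_fun_measurable)
  have ig: "integrable lborel g" by (rule test_fun_integrable[OF g])
  have M0: "0 \<le> M" using M(1)[of 0] by linarith
  \<comment> \<open>Fubini between the plane, as a single factor, and the segment parameter.\<close>
  interpret P: pair_sigma_finite "lborel \<Otimes>\<^sub>M lborel :: (real \<times> real) measure" "lborel :: real measure"
    unfolding lborel_prod ..
  define J where "J s = (indicator {0..1} s :: real)" for s :: real
  have [measurable]: "J \<in> borel_measurable borel" unfolding J_def[abs_def] by measurable
  have iJ: "integrable lborel J" "(LINT s|lborel. J s) = 1"
    unfolding J_def[abs_def] by (auto intro!: integrable_real_indicator simp: emeasure_lborel_Icc_eq)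
  have J: "0 \<le> J s" "J s \<le> 1" for s by (auto simp: J_def indicator_def)
  define G where "G p = g (fst p) * g (snd p)" for p
  have [measurable]: "G \<in> borel_measurable (lborel \<Otimes>\<^sub>M lborel)" unfolding G_def by measurable
  have iG: "integrable (lborel \<Otimes>\<^sub>M lborel) G"
    using integrable_product_bounded[OF ig ig, of "\<lambda>_. 1" 1] by (simp add: G_def[abs_def] case_prod_unfold)
  define F where "F p s = J s * (\<Phi>1 (s * fst p + (1 - s) * snd p) * G p)" for p s
  have [measurable]: "(\<lambda>(p, s). F p s) \<in> borel_measurable ((lborel \<Otimes>\<^sub>M lborel) \<Otimes>\<^sub>M lborel)"
    unfolding F_def by measurable
  have Fle: "\<bar>F p s\<bar> \<le> M * \<bar>G p\<bar> * J s" for p s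
  proof -
    have "\<bar>\<Phi>1 (s * fst p + (1 - s) * snd p)\<bar> * \<bar>G p\<bar> \<le> M * \<bar>G p\<bar>"
      by (intro mult_right_mono M) simp
    from mult_left_mono[OF this J(1)[of s]] show ?thesis
      using J(1)[of s] by (simp add: F_def abs_mult mult_ac)
  qed
  have iFs: "integrable lborel (F p)" for p
    by (rule Bochner_Integration.integrable_bound[OF integrable_mult_right[OF iJ(1), of "M * \<bar>G p\<bar>"]])
      (use Fle[of p] in \<open>auto intro: order_trans[OF _ abs_ge_self] simp: F_def[abs_def]\<close>)
  have iF: "integrable ((lborel \<Otimes>\<^sub>M lborel) \<Otimes>\<^sub>M lborel) (\<lambda>(p, s). F p s)"
  proof (rule P.Fubini_integrable)
    show "integrable (lborel \<Otimes>\<^sub>M lborel) (\<lambda>p. LINT s|lborel. norm (case (p, s) of (p, s) \<Rightarrow> F p s))"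
    proof (rule Bochner_Integration.integrable_bound)
      show "integrable (lborel \<Otimes>\<^sub>M lborel) (\<lambda>p. M * G p)" using iG by (rule integrable_mult_right)
      show "AE p in lborel \<Otimes>\<^sub>M lborel. norm (LINT s|lborel. norm (case (p, s) of (p, s) \<Rightarrow> F p s)) \<le> norm (M * G p)"
      proof (rule AE_I2)
        fix p
        have "(LINT s|lborel. \<bar>F p s\<bar>) \<le> (LINT s|lborel. M * \<bar>G p\<bar> * J s)"
          by (intro integral_mono integrable_abs iFs integrable_mult_right iJ Fle)
        also have "\<dots> = M * \<bar>G p\<bar>" using iJ(2) by simp
        finally show "norm (LINT s|lborel. norm (case (p, s) of (p, s) \<Rightarrow> F p s)) \<le> norm (M * G p)"
          using M0 by (simp add: abs_mult)
      qed
    qed measurable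
    show "AE p in lborel \<Otimes>\<^sub>M lborel. integrable lborel (\<lambda>s. case (p, s) of (p, s) \<Rightarrow> F p s)"
      using iFs by simp
  qed measurable
  have inner: "(LINT s|lborel. F (x, y) s) = (\<Phi> x - \<Phi> y) / (x - y) * (g x * g y)" if "x \<noteq> y" for x y
  proof -
    have "(LINT s|lborel. \<Phi>1 (s * x + (1 - s) * y) * indicator {0..1} s)
       = \<Phi> (1 * x + (1 - 1) * y) / (x - y) - \<Phi> (0 * x + (1 - 0) * y) / (x - y)"
    proof (rule integral_FTC_Icc_real)
      fix s :: real
      have "((\<lambda>s. s * x + (1 - s) * y) has_real_derivative (x - y)) (at s)"
        by (auto intro!: derivative_eq_intros)
      from DERIV_cdivide[OF DERIV_chain2[OF D1 this], of "x - y"]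
      show "((\<lambda>s. \<Phi> (s * x + (1 - s) * y) / (x - y)) has_real_derivative \<Phi>1 (s * x + (1 - s) * y)) (at s)"
        using that by simp
      have "continuous_on UNIV (\<lambda>s. \<Phi>1 (s * x + (1 - s) * y))"
        by (intro continuous_on_compose2[OF continuous(2)] continuous_intros) auto
      then show "isCont (\<lambda>s. \<Phi>1 (s * x + (1 - s) * y)) s" by (simp add: continuous_on_eq_continuous_at)
    qed simp
    then have "(LINT s|lborel. \<Phi>1 (s * x + (1 - s) * y) * indicator {0..1} s) = (\<Phi> x - \<Phi> y) / (x - y)"
      by (simp add: diff_divide_distrib)
    then have "(\<Phi> x - \<Phi> y) / (x - y) * (g x * g y)
       = (LINT s|lborel. \<Phi>1 (s * x + (1 - s) * y) * indicator {0..1} s) * (g x * g y)" by simp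
    also have "\<dots> = (LINT s|lborel. F (x, y) s)"
      by (simp add: F_def G_def J_def mult_ac flip: integral_mult_left_zero)
    finally show ?thesis by simp
  qed
  have ne: "AE p in lborel \<Otimes>\<^sub>M lborel. fst p \<noteq> (snd p :: real)"
  proof (rule lborel_pair.AE_pair_measure)
    show "{p \<in> space (lborel \<Otimes>\<^sub>M lborel). fst p \<noteq> (snd p :: real)} \<in> sets (lborel \<Otimes>\<^sub>M lborel)" by measurable
    show "AE x in lborel. AE y in lborel. fst (x, y) \<noteq> (snd (x, y) :: real)"
      using AE_neq by (auto simp: eq_commute)
  qed
  have "integral\<^sup>L (lborel \<Otimes>\<^sub>M lborel) (\<lambda>(x, y). (\<Phi> x - \<Phi> y) / (x - y) * (g x * g y))
     = (LINT p|(lborel \<Otimes>\<^sub>M lborel). LINT s|lborel. F p s)"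
  proof (rule integral_cong_AE)
    show "AE p in lborel \<Otimes>\<^sub>M lborel. (case p of (x, y) \<Rightarrow> (\<Phi> x - \<Phi> y) / (x - y) * (g x * g y)) = (LINT s|lborel. F p s)"
      using ne by eventually_elim (auto simp: inner)
  qed measurable
  also have "\<dots> = (LINT s|lborel. LINT p|(lborel \<Otimes>\<^sub>M lborel). F p s)"
    by (rule P.Fubini_integral[OF iF, symmetric])
  finally have "\<bar>integral\<^sup>L (lborel \<Otimes>\<^sub>M lborel) (\<lambda>(x, y). (\<Phi> x - \<Phi> y) / (x - y) * (g x * g y))\<bar>
     = \<bar>LINT s|lborel. LINT p|(lborel \<Otimes>\<^sub>M lborel). F p s\<bar>" by simp
  also have "\<dots> \<le> (LINT s|lborel. \<bar>LINT p|(lborel \<Otimes>\<^sub>M lborel). F p s\<bar>)" by (rule integral_abs_bound)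
  also have "\<dots> \<le> (LINT s|lborel. N3 / 2 * (l2 u)\<^sup>2 * J s)"
  proof (rule integral_mono_AE)
    show "integrable lborel (\<lambda>s. \<bar>LINT p|(lborel \<Otimes>\<^sub>M lborel). F p s\<bar>)"
      by (intro integrable_abs P.integrable_snd[OF iF])
    show "integrable lborel (\<lambda>s. N3 / 2 * (l2 u)\<^sup>2 * J s)" by (intro integrable_mult_right iJ)
    show "AE s in lborel. \<bar>LINT p|(lborel \<Otimes>\<^sub>M lborel). F p s\<bar> \<le> N3 / 2 * (l2 u)\<^sup>2 * J s"
      \<comment> \<open>The slice estimate divides by \<open>s\<close> and by \<open>1 - s\<close>,
        so the two endpoints are discarded as null.\<close>
      using AE_neq[of 0] AE_neq[of 1]
    proof eventually_elim
      fix s :: real assume s: "s \<noteq> 0" "s \<noteq> 1"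
      show "\<bar>LINT p|(lborel \<Otimes>\<^sub>M lborel). F p s\<bar> \<le> N3 / 2 * (l2 u)\<^sup>2 * J s"
      proof (cases "s \<in> {0..1}")
        case True
        then have s': "0 < s" "s < 1" using s by auto
        have "(LINT p|(lborel \<Otimes>\<^sub>M lborel). F p s)
          = integral\<^sup>L (lborel \<Otimes>\<^sub>M lborel) (\<lambda>(x, y). \<Phi>1 (s * x + (1 - s) * y) * (deriv u x * deriv u y))"
          using True by (simp add: F_def G_def J_def g_def case_prod_unfold)
        then show ?thesis using commutator_slice[OF u s'] True by (simp add: J_def)
      qed (simp add: F_def J_def)
    qed
  qed
  also have "\<dots> = N3 / 2 * (l2 u)\<^sup>2" using iJ(2) by simp
  finally show ?thesis unfolding g_def .
qed

lemma lipschitz_\<Phi>: "\<bar>\<Phi> x - \<Phi> y\<bar> \<le> M * \<bar>x - y\<bar>" "\<bar>\<Phi>1 x - \<Phi>1 y\<bar> \<le> M * \<bar>x - y\<bar>"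
  by (rule lipschitz_of_DERIV[OF D1 M(2)] lipschitz_of_DERIV[OF D2 M(3)])+

lemma product_lipschitz:
  assumes "\<And>x. \<bar>\<phi> x\<bar> \<le> M" "\<And>x y. \<bar>\<phi> x - \<phi> y\<bar> \<le> M * \<bar>x - y\<bar>"
    and "\<And>x. \<bar>u x\<bar> \<le> C1" "\<And>x y. \<bar>u x - u y\<bar> \<le> C2 * \<bar>x - y\<bar>"
  shows "\<bar>\<phi> x * u x\<bar> \<le> M * C1" "\<bar>\<phi> x * u x - \<phi> y * u y\<bar> \<le> (M * C1 + M * C2) * \<bar>x - (y :: real)\<bar>"
proof -
  have M0: "0 \<le> M" and C1: "0 \<le> C1" using assms(1)[of 0] assms(3)[of 0] by linarith+
  show "\<bar>\<phi> x * u x\<bar> \<le> M * C1" unfolding abs_mult by (intro mult_mono assms M0) auto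
  have "\<bar>\<phi> x * u x - \<phi> y * u y\<bar> = \<bar>(\<phi> x - \<phi> y) * u x + \<phi> y * (u x - u y)\<bar>" by (simp add: algebra_simps)
  also have "\<dots> \<le> \<bar>\<phi> x - \<phi> y\<bar> * \<bar>u x\<bar> + \<bar>\<phi> y\<bar> * \<bar>u x - u y\<bar>"
    by (metis abs_mult abs_triangle_ineq)
  also have "\<dots> \<le> (M * \<bar>x - y\<bar>) * C1 + M * (C2 * \<bar>x - y\<bar>)"
    by (intro add_mono mult_mono assms M0) (auto simp: M0)
  also have "\<dots> = (M * C1 + M * C2) * \<bar>x - y\<bar>" by (simp add: algebra_simps)
  finally show "\<bar>\<phi> x * u x - \<phi> y * u y\<bar> \<le> (M * C1 + M * C2) * \<bar>x - y\<bar>" .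
qed

text \<open>The smoothing term \<open>N\<close> is the \<open>H^{1/2}\<close> seminorm of \<open>b u\<close>; it is what absorbs the cubic
  nonlinearity.\<close>

lemma smoothing_lower_bound:
  assumes u: "test_fun u"
  obtains N where "0 \<le> N" "(LINT x|lborel. hilbert (deriv u) x * (\<Phi>1 x * u x)) \<ge> (N - (l2 u)\<^sup>2 * (l2 k)\<^sup>2) / (2 * pi)"
    "l2 (\<lambda>x. (b x * u x)\<^sup>2) \<le> 2 * l2 (\<lambda>x. b x * u x) * sqrt N" "L2 (\<lambda>x. (b x * u x)\<^sup>2)" "L2 (\<lambda>x. b x * u x)"
proof -
  have [measurable]: "u \<in> borel_measurable borel" "k \<in> borel_measurable borel"
    using u k by (auto simp: test_fun_measurable L2_measurable)
  have Lu: "L2 u" by (rule test_fun_L2[OF u])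
  obtain R where R: "\<And>x. R < \<bar>x\<bar> \<Longrightarrow> u x = 0" using u by (auto simp: test_fun_iff)
  obtain C1 where C1: "C1 \<ge> 0" "\<And>x. \<bar>u x\<bar> \<le> C1" by (rule test_fun_bounded[OF u]) (rule that)
  obtain C2 where C2: "C2 \<ge> 0" "\<And>x. \<bar>deriv u x\<bar> \<le> C2" by (rule test_fun_bounded[OF test_fun_deriv[OF u]]) (rule that)
  have lip: "\<bar>u x - u y\<bar> \<le> C2 * \<bar>x - y\<bar>" for x y by (rule lipschitz_of_DERIV[OF test_fun_DERIV[OF u] C2(2)])
  have M0: "0 \<le> M" using M(1)[of 0] by linarith
  define C where "C = C1 + C2 + M * C1 + M * C2"
  have CC: "C1 \<le> C" "C2 \<le> C" "M * C1 \<le> C" "M * C1 + M * C2 \<le> C"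
    using C1 C2 M0 by (auto simp: C_def)
  define w where "w x = b x * u x" for x
  have [measurable]: "w \<in> borel_measurable borel" unfolding w_def by measurable
  have le_C: "t * \<bar>x - y\<bar> \<le> C * \<bar>x - y\<bar>" if "t \<le> C" for t x y :: real
    using that by (rule mult_right_mono) simp
  have wC: "\<bar>w x\<bar> \<le> C" "\<bar>w x - w y\<bar> \<le> C * \<bar>x - y\<bar>" "R < \<bar>x\<bar> \<Longrightarrow> w x = 0" for x y
    using order_trans[OF product_lipschitz(1)[OF b C1(2) lip] CC(3)]
      order_trans[OF product_lipschitz(2)[OF b C1(2) lip] le_C[OF CC(4)]] R by (auto simp: w_def)
  have vC: "\<bar>\<Phi>1 x * u x\<bar> \<le> C" "\<bar>\<Phi>1 x * u x - \<Phi>1 y * u y\<bar> \<le> C * \<bar>x - y\<bar>" "R < \<bar>x\<bar> \<Longrightarrow> \<Phi>1 x * u x = 0" for x y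
    using order_trans[OF product_lipschitz(1)[OF M(2) lipschitz_\<Phi>(2) C1(2) lip] CC(3)]
      order_trans[OF product_lipschitz(2)[OF M(2) lipschitz_\<Phi>(2) C1(2) lip] le_C[OF CC(4)]] R by auto
  have uC: "\<bar>u x\<bar> \<le> C" "\<bar>u x - u y\<bar> \<le> C * \<bar>x - y\<bar>" for x y
    using order_trans[OF C1(2) CC(1)] order_trans[OF lip le_C[OF CC(2)]] by auto
  define N where "N = integral\<^sup>L (lborel \<Otimes>\<^sub>M lborel) (\<lambda>(x, y). (w x - w y)\<^sup>2 / (x - y)\<^sup>2)"
  note S = sobolev_L4[of w C R, OF _ wC, folded N_def]
  \<comment> \<open>The commutator error: \<open>(u x - u y) * (b x^2 * u x - b y^2 * u y)\<close>
    equals the square of the increment of \<open>b u\<close> minus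
    \<open>u x * u y * (b x - b y)^2\<close>.\<close>
  define E where "E = (\<lambda>(x, y). u x * u y * ((b x - b y)\<^sup>2 / (x - y)\<^sup>2))"
  have i1: "integrable (lborel \<Otimes>\<^sub>M lborel) (\<lambda>(x, y). (u x - u y) * (\<Phi>1 x * u x - \<Phi>1 y * u y) / (x - y)\<^sup>2)"
    by (rule integrable_difference_quotients(2)[of u "\<lambda>x. \<Phi>1 x * u x" C R]) (use uC vC R in auto)
  have i2: "integrable (lborel \<Otimes>\<^sub>M lborel) (\<lambda>(x, y). (w x - w y)\<^sup>2 / (x - y)\<^sup>2)"
    using integrable_difference_quotients(2)[of w w C R] wC by (simp add: power2_eq_square)
  have id: "(u x - u y) * (\<Phi>1 x * u x - \<Phi>1 y * u y) / (x - y)\<^sup>2 = (w x - w y)\<^sup>2 / (x - y)\<^sup>2 - E (x, y)" for x y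
  proof -
    have "(u x - u y) * (\<Phi>1 x * u x - \<Phi>1 y * u y) = (w x - w y)\<^sup>2 - u x * u y * (b x - b y)\<^sup>2"
      by (simp add: square w_def power2_eq_square algebra_simps)
    then show ?thesis by (simp add: E_def diff_divide_distrib)
  qed
  have iE: "integrable (lborel \<Otimes>\<^sub>M lborel) E"
    using Bochner_Integration.integrable_diff[OF i2 i1] by (simp add: id case_prod_unfold)
  have eq: "integral\<^sup>L (lborel \<Otimes>\<^sub>M lborel) (\<lambda>(x, y). (u x - u y) * (\<Phi>1 x * u x - \<Phi>1 y * u y) / (x - y)\<^sup>2)
     = N - integral\<^sup>L (lborel \<Otimes>\<^sub>M lborel) E"
    using Bochner_Integration.integral_diff[OF i2 iE] by (simp add: id N_def case_prod_unfold)
  have Lau: "L2 (\<lambda>x. \<bar>u x\<bar>)" by (rule L2_abs[OF Lu])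
  define h where "h x = \<bar>u x\<bar> * k x" for x
  have ih: "integrable lborel h" unfolding h_def by (rule L2_mult_integrable[OF Lau k(1)])
  have ihh: "integrable (lborel \<Otimes>\<^sub>M lborel) (\<lambda>(x, y). h x * h y)"
    using integrable_product_bounded[OF ih ih, of "\<lambda>_. 1" 1] by simp
  \<comment> \<open>The bound on the increments of \<open>b\<close> factorises in \<open>x\<close>
    and \<open>y\<close>, so the double integral becomes the square of a single one, to which
    Cauchy-Schwarz applies.\<close>
  have "integral\<^sup>L (lborel \<Otimes>\<^sub>M lborel) E \<le> integral\<^sup>L (lborel \<Otimes>\<^sub>M lborel) (\<lambda>(x, y). h x * h y)"
  proof (rule integral_mono[OF iE ihh])
    fix p :: "real \<times> real"
    obtain x y where p: "p = (x, y)" by (cases p)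
    have "(b x - b y)\<^sup>2 / (x - y)\<^sup>2 \<le> k x * k y"
      using k(3)[of x y] k(2)[of x] k(2)[of y] by (cases "x = y") (auto simp: divide_le_eq mult.commute)
    then have "\<bar>u x * u y\<bar> * ((b x - b y)\<^sup>2 / (x - y)\<^sup>2) \<le> \<bar>u x * u y\<bar> * (k x * k y)"
      by (rule mult_left_mono) simp
    moreover have "u x * u y * ((b x - b y)\<^sup>2 / (x - y)\<^sup>2) \<le> \<bar>u x * u y\<bar> * ((b x - b y)\<^sup>2 / (x - y)\<^sup>2)"
      by (intro mult_right_mono) auto
    ultimately have "u x * u y * ((b x - b y)\<^sup>2 / (x - y)\<^sup>2) \<le> \<bar>u x * u y\<bar> * (k x * k y)" by linarith
    then show "E p \<le> (case p of (x, y) \<Rightarrow> h x * h y)"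
      unfolding p E_def h_def by (simp add: abs_mult mult_ac)
  qed
  also have "\<dots> = (LINT x|lborel. h x)\<^sup>2"
    unfolding lborel_pair.integral_fst[OF ihh, symmetric] by (simp add: power2_eq_square)
  also have "\<dots> \<le> (l2 u * l2 k)\<^sup>2"
  proof (rule power_mono)
    show "(LINT x|lborel. h x) \<le> l2 u * l2 k"
      using L2_Cauchy_Schwarz[OF Lau k(1)] by (simp add: h_def l2_abs)
    show "0 \<le> (LINT x|lborel. h x)" unfolding h_def by (intro Bochner_Integration.integral_nonneg) (simp add: k)
  qed
  finally have E: "integral\<^sup>L (lborel \<Otimes>\<^sub>M lborel) E \<le> (l2 u)\<^sup>2 * (l2 k)\<^sup>2" by (simp add: power_mult_distrib)
  have "(LINT x|lborel. hilbert (deriv u) x * (\<Phi>1 x * u x)) = (1 / (2 * pi)) * (N - integral\<^sup>L (lborel \<Otimes>\<^sub>M lborel) E)"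
    unfolding eq[symmetric] by (rule hilbert_form_difference_quotients[OF u, of _ C R]) (use uC vC R in auto)
  also have "\<dots> \<ge> (1 / (2 * pi)) * (N - (l2 u)\<^sup>2 * (l2 k)\<^sup>2)"
    using E by (intro mult_left_mono) auto
  finally show ?thesis
    using that[of N] S by (simp add: w_def[abs_def])
qed

text \<open>With \<open>X\<close> the derivative of \<open>u * \<Phi>\<close>, the left side pairs
  the flux \<open>- H u' + u^2 / 2\<close> with \<open>2 * X\<close>: it is the time derivative of
  the weighted energy before the drift is added. The commutator and \<open>k\<close> give the error,
  and the seminorm gained from \<open>H\<close> absorbs the cubic part.\<close>

lemma energy_inequality_test:
  assumes u: "test_fun u"
  shows "- 2 * (LINT x|lborel. hilbert (deriv u) x * (deriv u x * \<Phi> x + \<Phi>1 x * u x))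
      + (LINT x|lborel. (u x)\<^sup>2 * (deriv u x * \<Phi> x + \<Phi>1 x * u x))
    \<le> 2 * (l2 u)\<^sup>2 * (LINT x|lborel. \<Phi>1 x * (u x)\<^sup>2) + (N3 / 2 + (l2 k)\<^sup>2) * (l2 u)\<^sup>2 / pi"
proof -
  have [measurable]: "u \<in> borel_measurable borel" "deriv u \<in> borel_measurable borel"
    using u by (auto intro: test_fun_measurable test_fun_deriv)
  have Lu: "L2 u" and Lg: "L2 (deriv u)" using u by (auto intro: test_fun_L2 test_fun_deriv)
  have L\<Phi>: "L2 (\<lambda>x. deriv u x * \<Phi> x)" by (rule L2_mult_bounded[OF Lg _ M(1)]) measurable
  have L1: "L2 (\<lambda>x. \<Phi>1 x * u x)" by (rule L2_bounded_mult[OF Lu _ M(2)]) measurable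
  have H: "L2 (hilbert (deriv u))" by (rule L2_hilbert[OF Lg])
  obtain C1 where C1: "\<And>x. \<bar>u x\<bar> \<le> C1" by (rule test_fun_bounded[OF u]) (rule that)
  obtain N where N: "0 \<le> N" "(LINT x|lborel. hilbert (deriv u) x * (\<Phi>1 x * u x)) \<ge> (N - (l2 u)\<^sup>2 * (l2 k)\<^sup>2) / (2 * pi)"
    "l2 (\<lambda>x. (b x * u x)\<^sup>2) \<le> 2 * l2 (\<lambda>x. b x * u x) * sqrt N" "L2 (\<lambda>x. (b x * u x)\<^sup>2)" "L2 (\<lambda>x. b x * u x)"
    by (rule smoothing_lower_bound[OF u])
  define W where "W = l2 (\<lambda>x. b x * u x)"
  have W2: "W\<^sup>2 = (LINT x|lborel. \<Phi>1 x * (u x)\<^sup>2)"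
    by (simp add: W_def l2_square square power_mult_distrib)
  define T where "T = (LINT x|lborel. hilbert (deriv u) x * (deriv u x * \<Phi> x))"
  have "T = (1 / (2 * pi)) * integral\<^sup>L (lborel \<Otimes>\<^sub>M lborel) (\<lambda>(x, y). (\<Phi> x - \<Phi> y) / (x - y) * (deriv u x * deriv u y))"
    unfolding T_def by (rule hilbert_form_commutator[OF test_fun_deriv[OF u] _ M(1) lipschitz_\<Phi>(1)]) measurable
  then have "\<bar>T\<bar> = (1 / (2 * pi)) * \<bar>integral\<^sup>L (lborel \<Otimes>\<^sub>M lborel) (\<lambda>(x, y). (\<Phi> x - \<Phi> y) / (x - y) * (deriv u x * deriv u y))\<bar>"
    by (simp add: abs_mult)
  also have "\<dots> \<le> (1 / (2 * pi)) * (N3 / 2 * (l2 u)\<^sup>2)"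
    by (intro mult_left_mono commutator_bound u) simp
  finally have T: "\<bar>T\<bar> \<le> (1 / (2 * pi)) * (N3 / 2 * (l2 u)\<^sup>2)" .
  have split: "(LINT x|lborel. hilbert (deriv u) x * (deriv u x * \<Phi> x + \<Phi>1 x * u x))
      = T + (LINT x|lborel. hilbert (deriv u) x * (\<Phi>1 x * u x))"
    unfolding T_def distrib_left
    by (intro Bochner_Integration.integral_add L2_mult_integrable H L\<Phi> L1)
  \<comment> \<open>Integration by parts turns the part with \<open>deriv u\<close> into minus one
    third of the integral of \<open>\<Phi>1 * u^3\<close>, hence 2/3 in total.\<close>
  have cubic: "(LINT x|lborel. (u x)\<^sup>2 * (deriv u x * \<Phi> x + \<Phi>1 x * u x)) = (2 / 3) * (LINT x|lborel. u x * (b x * u x)\<^sup>2)"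
  proof -
    have t3: "test_fun (\<lambda>x. u x * (u x * u x))"
      by (intro test_fun_mult_smooth u smooth_mult test_fun_smooth)
    have d3: "deriv (\<lambda>x. u x * (u x * u x)) = (\<lambda>x. 3 * ((u x)\<^sup>2 * deriv u x))"
      by (rule deriv_eqI) (auto intro!: derivative_eq_intros test_fun_DERIV[OF u] simp: power2_eq_square algebra_simps)
    note B = integral_by_parts_test[OF t3 D1 continuous(2), unfolded d3]
    have e1: "(LINT x|lborel. u x * (u x * u x) * \<Phi>1 x) = (LINT x|lborel. u x * (b x * u x)\<^sup>2)"
      by (intro Bochner_Integration.integral_cong) (auto simp: square power2_eq_square mult_ac)
    have e2: "(LINT x|lborel. 3 * ((u x)\<^sup>2 * deriv u x) * \<Phi> x) = 3 * (LINT x|lborel. (u x)\<^sup>2 * (deriv u x * \<Phi> x))"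
      by (simp only: mult.assoc integral_mult_right_zero)
    have i1: "integrable lborel (\<lambda>x. (u x)\<^sup>2 * (deriv u x * \<Phi> x))"
      using integrable_mult_right[OF B(1), of "1/3"] by (simp add: mult_ac)
    have i2: "integrable lborel (\<lambda>x. (u x)\<^sup>2 * (\<Phi>1 x * u x))"
      using B(2) by (simp add: power2_eq_square mult_ac)
    have "(LINT x|lborel. (u x)\<^sup>2 * (deriv u x * \<Phi> x + \<Phi>1 x * u x))
      = (LINT x|lborel. (u x)\<^sup>2 * (deriv u x * \<Phi> x)) + (LINT x|lborel. (u x)\<^sup>2 * (\<Phi>1 x * u x))"
      unfolding distrib_left by (rule Bochner_Integration.integral_add[OF i1 i2])
    also have "(LINT x|lborel. (u x)\<^sup>2 * (\<Phi>1 x * u x)) = (LINT x|lborel. u x * (b x * u x)\<^sup>2)"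
      by (intro Bochner_Integration.integral_cong) (auto simp: square power2_eq_square mult_ac)
    finally show ?thesis using B(3) unfolding e1 e2 by simp
  qed
  have "(LINT x|lborel. u x * (b x * u x)\<^sup>2) \<le> l2 u * l2 (\<lambda>x. (b x * u x)\<^sup>2)"
    using L2_Cauchy_Schwarz[OF Lu N(4)] by simp
  also have "\<dots> \<le> l2 u * (2 * W * sqrt N)"
    unfolding W_def by (intro mult_left_mono N) simp
  finally have cub: "(2 / 3) * (LINT x|lborel. u x * (b x * u x)\<^sup>2) \<le> (4 / 3) * (l2 u * W * sqrt N)"
    by (simp add: mult_ac)
  define U n where "U = l2 u" and "n = sqrt N"
  have n2: "n\<^sup>2 = N" using N by (simp add: n_def)
  \<comment> \<open>Completing the square with exactly the coefficient \<open>1 / pi\<close> of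
    \<open>N\<close> that the smoothing supplies. The remainder \<open>4 * pi / 9\<close> is below 2
    because \<open>pi < 4\<close>, which is where the threshold for the speed comes from.\<close>
  have "0 \<le> (n - (2 * pi / 3) * (U * W))\<^sup>2" by simp
  then have "(4 * pi / 3) * (U * W * n) \<le> n\<^sup>2 + (4 * pi\<^sup>2 / 9) * (U\<^sup>2 * W\<^sup>2)"
    by (simp add: power2_diff power_mult_distrib power_divide) (simp add: mult_ac)
  then have "(1 / pi) * ((4 * pi / 3) * (U * W * n)) \<le> (1 / pi) * (n\<^sup>2 + (4 * pi\<^sup>2 / 9) * (U\<^sup>2 * W\<^sup>2))"
    by (intro mult_left_mono) auto
  moreover have "(1 / pi) * ((4 * pi / 3) * (U * W * n)) = (4 / 3) * (U * W * n)" by simp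
  moreover have "(1 / pi) * (n\<^sup>2 + (4 * pi\<^sup>2 / 9) * (U\<^sup>2 * W\<^sup>2)) = N / pi + (4 * pi / 9) * (U\<^sup>2 * W\<^sup>2)"
    unfolding n2 by (simp add: distrib_left power2_eq_square[of pi])
  ultimately have "(4 / 3) * (U * W * n) \<le> N / pi + (4 * pi / 9) * (U\<^sup>2 * W\<^sup>2)"
    by (simp only:)
  also have "\<dots> \<le> N / pi + 2 * (U\<^sup>2 * W\<^sup>2)"
    using pi_less_4 by (intro add_left_mono mult_right_mono) auto
  finally have AG: "(4 / 3) * (U * W * n) \<le> N / pi + 2 * (U\<^sup>2 * W\<^sup>2)" .
  have "- 2 * (LINT x|lborel. hilbert (deriv u) x * (\<Phi>1 x * u x)) \<le> - 2 * ((N - U\<^sup>2 * (l2 k)\<^sup>2) / (2 * pi))"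
    using N(2) unfolding U_def by (intro mult_left_mono_neg) auto
  also have "\<dots> = - N / pi + U\<^sup>2 * (l2 k)\<^sup>2 / pi" by (simp add: field_simps)
  finally have A: "- 2 * (LINT x|lborel. hilbert (deriv u) x * (\<Phi>1 x * u x)) \<le> - N / pi + U\<^sup>2 * (l2 k)\<^sup>2 / pi" .
  have "- 2 * T \<le> 2 * ((1 / (2 * pi)) * (N3 / 2 * (l2 u)\<^sup>2))" using T by linarith
  also have "\<dots> = (N3 / 2) * U\<^sup>2 / pi" by (simp add: U_def)
  finally have B: "- 2 * T \<le> (N3 / 2) * U\<^sup>2 / pi" .
  have "(N3 / 2 + (l2 k)\<^sup>2) * U\<^sup>2 / pi = (N3 / 2) * U\<^sup>2 / pi + U\<^sup>2 * (l2 k)\<^sup>2 / pi"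
    by (simp add: field_simps)
  moreover have "2 * U\<^sup>2 * W\<^sup>2 = 2 * (U\<^sup>2 * W\<^sup>2)" by simp
  moreover have "- 2 * (T + (LINT x|lborel. hilbert (deriv u) x * (\<Phi>1 x * u x)))
      = - 2 * T + - 2 * (LINT x|lborel. hilbert (deriv u) x * (\<Phi>1 x * u x))"
    by (rule distrib_left)
  ultimately show ?thesis
    unfolding split cubic W2[symmetric] U_def[symmetric]
    using A B AG cub[folded U_def n_def] by linarith
qed

end

subsection \<open>Sobolev functions\<close>

lemma weak_deriv_diff:
  assumes "L2 f" "L2 g" "L2 f'" "L2 g'" "weak_deriv f g" "weak_deriv f' g'"
  shows "weak_deriv (\<lambda>x. f x - f' x) (\<lambda>x. g x - g' x)"
  unfolding weak_deriv_def
proof (intro allI impI)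
  fix \<psi> assume t: "test_fun \<psi>"
  note L = test_fun_L2[OF t] test_fun_L2[OF test_fun_deriv[OF t]]
  have "(LINT x|lborel. (f x - f' x) * deriv \<psi> x) = (LINT x|lborel. f x * deriv \<psi> x) - (LINT x|lborel. f' x * deriv \<psi> x)"
    unfolding left_diff_distrib by (intro Bochner_Integration.integral_diff L2_mult_integrable assms L)
  also have "\<dots> = - (LINT x|lborel. g x * \<psi> x) - - (LINT x|lborel. g' x * \<psi> x)"
    using assms t by (simp add: weak_deriv_def)
  also have "\<dots> = - (LINT x|lborel. (g x - g' x) * \<psi> x)"
    unfolding left_diff_distrib by (subst Bochner_Integration.integral_diff) (auto intro: L2_mult_integrable assms L)
  finally show "(LINT x|lborel. (f x - f' x) * deriv \<psi> x) = - (LINT x|lborel. (g x - g' x) * \<psi> x)" .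
qed

lemma weak_deriv_cmult:
  assumes "weak_deriv f g"
  shows "weak_deriv (\<lambda>x. c * f x) (\<lambda>x. c * g x)"
  using assms by (simp add: weak_deriv_def mult.assoc)

lemma weak_deriv_add:
  assumes "L2 f" "L2 g" "L2 f'" "L2 g'" "weak_deriv f g" "weak_deriv f' g'"
  shows "weak_deriv (\<lambda>x. f x + f' x) (\<lambda>x. g x + g' x)"
  using weak_deriv_diff[OF assms(1,2) L2_minus[OF assms(3)] L2_minus[OF assms(4)] assms(5)]
    weak_deriv_cmult[OF assms(6), of "-1"] by simp

lemma weak_deriv_mult_smooth:
  assumes f: "L2 f" "L2 g" "weak_deriv f g" and \<Phi>: "smooth \<Phi>" "\<And>x. (\<Phi> has_real_derivative \<Phi>1 x) (at x)"
    and b: "\<And>x. \<bar>\<Phi> x\<bar> \<le> M" "\<And>x. \<bar>\<Phi>1 x\<bar> \<le> M" and [measurable]: "\<Phi>1 \<in> borel_measurable borel"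
  shows "weak_deriv (\<lambda>x. f x * \<Phi> x) (\<lambda>x. g x * \<Phi> x + \<Phi>1 x * f x)"
  unfolding weak_deriv_def
proof (intro allI impI)
  fix \<psi> assume t: "test_fun \<psi>"
  have [measurable]: "\<Phi> \<in> borel_measurable borel" by (rule smooth_measurable[OF \<Phi>(1)])
  have L: "L2 \<psi>" "L2 (deriv \<psi>)" using t by (auto intro: test_fun_L2 test_fun_deriv)
  have L\<Phi>: "L2 (\<lambda>x. \<psi> x * \<Phi> x)" "L2 (\<lambda>x. deriv \<psi> x * \<Phi> x)" "L2 (\<lambda>x. \<psi> x * \<Phi>1 x)"
    by (rule L2_mult_bounded[OF L(1) _ b(1)] L2_mult_bounded[OF L(2) _ b(1)] L2_mult_bounded[OF L(1) _ b(2)]; measurable)+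
  have t': "test_fun (\<lambda>x. \<psi> x * \<Phi> x)" by (rule test_fun_mult_smooth[OF t \<Phi>(1)])
  have d: "deriv (\<lambda>x. \<psi> x * \<Phi> x) = (\<lambda>x. deriv \<psi> x * \<Phi> x + \<psi> x * \<Phi>1 x)"
    by (rule deriv_eqI) (rule DERIV_cong[OF DERIV_mult[OF test_fun_DERIV[OF t] \<Phi>(2)]], simp)
  have "(LINT x|lborel. f x * (deriv \<psi> x * \<Phi> x + \<psi> x * \<Phi>1 x)) = - (LINT x|lborel. g x * (\<psi> x * \<Phi> x))"
    using f(3)[unfolded weak_deriv_def, rule_format, OF t'] unfolding d .
  then have e: "(LINT x|lborel. f x * (deriv \<psi> x * \<Phi> x)) + (LINT x|lborel. f x * (\<psi> x * \<Phi>1 x)) = - (LINT x|lborel. g x * (\<psi> x * \<Phi> x))"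
    unfolding distrib_left by (subst (asm) Bochner_Integration.integral_add) (auto intro: L2_mult_integrable f L\<Phi>)
  have "(LINT x|lborel. (g x * \<Phi> x + \<Phi>1 x * f x) * \<psi> x) = (LINT x|lborel. g x * (\<psi> x * \<Phi> x) + f x * (\<psi> x * \<Phi>1 x))"
    by (intro Bochner_Integration.integral_cong) (auto simp: algebra_simps)
  also have "\<dots> = (LINT x|lborel. g x * (\<psi> x * \<Phi> x)) + (LINT x|lborel. f x * (\<psi> x * \<Phi>1 x))"
    by (intro Bochner_Integration.integral_add L2_mult_integrable f L\<Phi>)
  finally show "(LINT x|lborel. f x * \<Phi> x * deriv \<psi> x) = - (LINT x|lborel. (g x * \<Phi> x + \<Phi>1 x * f x) * \<psi> x)"
    using e by (simp add: mult_ac)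
qed

text \<open>The difference \<open>d\<close> is a weak derivative of 0, so it is orthogonal to all
  test functions. Density in \<open>H1\<close>, applied to the pair consisting of 0 and
  \<open>d\<close>, makes \<open>d\<close> a limit of derivatives of test functions; hence
  \<open>d\<close> is orthogonal to itself.\<close>

lemma weak_deriv_unique:
  assumes "L2 f" "L2 g" "L2 g'" "weak_deriv f g" "weak_deriv f g'"
  shows "AE x in lborel. g x = g' x"
proof -
  define d where "d x = g x - g' x" for x
  have d: "L2 d" unfolding d_def by (intro L2_diff assms)
  have wd: "weak_deriv (\<lambda>x. f x - f x) d"
    unfolding d_def by (rule weak_deriv_diff[OF assms(1,2,1,3,4,5)])
  then have z: "(LINT x|lborel. d x * \<psi> x) = 0" if "test_fun \<psi>" for \<psi>
    using that by (simp add: weak_deriv_def)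
  obtain \<psi> where \<psi>: "\<And>n::nat. test_fun (\<psi> n)" "(\<lambda>n. l2 (\<lambda>x. \<psi> n x - (f x - f x))) \<longlonglongrightarrow> 0"
    "(\<lambda>n. l2 (\<lambda>x. deriv (\<psi> n) x - d x)) \<longlonglongrightarrow> 0"
    by (rule H1_dense[OF _ d wd]) (use L2_zero in simp, rule that)
  have "(\<lambda>n. LINT x|lborel. d x * deriv (\<psi> n) x) \<longlonglongrightarrow> (LINT x|lborel. d x * d x)"
    by (rule L2_tendsto_pairing[OF d d l2_tendsto_const test_fun_L2[OF test_fun_deriv[OF \<psi>(1)]] d \<psi>(3)])
  then have "(\<lambda>n::nat. 0) \<longlonglongrightarrow> (l2 d)\<^sup>2"
    using z[OF test_fun_deriv[OF \<psi>(1)]] by (simp add: l2_square_mult)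
  then have "l2 d = 0" using LIMSEQ_unique[OF tendsto_const] by fastforce
  then show ?thesis using l2_eq_0_AE[OF d] by (simp add: d_def)
qed

lemma
  assumes "H1 f"
  shows H1_L2: "L2 f" and L2_wderiv: "L2 (wderiv f)" and weak_deriv_wderiv: "weak_deriv f (wderiv f)"
proof -
  show "L2 f" using assms by (simp add: H1_def)
  have "\<exists>g. L2 g \<and> weak_deriv f g" using assms by (simp add: H1_def)
  from someI_ex[OF this] show "L2 (wderiv f)" "weak_deriv f (wderiv f)"
    unfolding wderiv_def by auto
qed

lemma H1_norm_eq: "H1_norm f = sqrt ((l2 f)\<^sup>2 + (l2 (wderiv f))\<^sup>2)"
  by (simp add: H1_norm_def l2_square)

lemma l2_le_H1_norm: "l2 f \<le> H1_norm f" "l2 (wderiv f) \<le> H1_norm f"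
  unfolding H1_norm_eq by (auto intro!: real_le_rsqrt)

text \<open>\<open>wderiv\<close> is an arbitrary choice and not literally linear; uniqueness almost
  everywhere replaces linearity.\<close>

lemma l2_wderiv_diff_le:
  assumes f: "H1 f" and g: "H1 g"
  shows "l2 (\<lambda>x. wderiv f x - wderiv g x) \<le> H1_norm (\<lambda>x. f x - g x)"
proof -
  have L: "L2 (\<lambda>x. f x - g x)" "L2 (\<lambda>x. wderiv f x - wderiv g x)"
    by (intro L2_diff H1_L2 L2_wderiv f g)+
  have w: "weak_deriv (\<lambda>x. f x - g x) (\<lambda>x. wderiv f x - wderiv g x)"
    by (intro weak_deriv_diff H1_L2 L2_wderiv weak_deriv_wderiv f g)
  have H: "H1 (\<lambda>x. f x - g x)" unfolding H1_def using L w by blast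
  have "AE x in lborel. wderiv f x - wderiv g x = wderiv (\<lambda>x. f x - g x) x"
    by (rule weak_deriv_unique[OF L L2_wderiv[OF H] w weak_deriv_wderiv[OF H]])
  then have "l2 (\<lambda>x. wderiv f x - wderiv g x) = l2 (wderiv (\<lambda>x. f x - g x))"
    by (rule l2_cong_AE) (use L L2_wderiv[OF H] in \<open>auto simp: L2_measurable\<close>)
  then show ?thesis using l2_le_H1_norm(2)[of "\<lambda>x. f x - g x"] by simp
qed

text \<open>The square is integrated from a point beyond the support; its derivative is
  \<open>2 * \<psi> * deriv \<psi>\<close>.\<close>

lemma test_fun_sup_bound:
  assumes t: "test_fun \<psi>" shows "(\<psi> x)\<^sup>2 \<le> 2 * l2 \<psi> * l2 (deriv \<psi>)"
proof -
  obtain R where R: "\<And>x. R < \<bar>x\<bar> \<Longrightarrow> \<psi> x = 0" using t by (auto simp: test_fun_iff)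
  have L: "L2 \<psi>" "L2 (deriv \<psi>)" using t by (auto intro: test_fun_L2 test_fun_deriv)
  \<comment> \<open>A point to the left both of the support and of \<open>x\<close>.\<close>
  define a where "a = - (\<bar>R\<bar> + \<bar>x\<bar> + 1)"
  have ax: "a \<le> x" and \<psi>a: "\<psi> a = 0" by (auto simp: a_def intro: R)
  have i: "integrable lborel (\<lambda>y. \<bar>\<psi> y\<bar> * \<bar>deriv \<psi> y\<bar>)" by (intro L2_mult_integrable L2_abs L)
  have "(LINT y|lborel. 2 * (\<psi> y * deriv \<psi> y) * indicator {a..x} y) = (\<psi> x)\<^sup>2 - (\<psi> a)\<^sup>2"
  proof (rule integral_FTC_Icc_real[OF ax])
    show "((\<lambda>y. (\<psi> y)\<^sup>2) has_real_derivative 2 * (\<psi> y * deriv \<psi> y)) (at y)" for y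
      by (auto intro!: derivative_eq_intros test_fun_DERIV[OF t] simp: power2_eq_square)
    have "continuous_on UNIV (\<lambda>y. 2 * (\<psi> y * deriv \<psi> y))"
      by (intro continuous_intros test_fun_continuous t test_fun_deriv)
    then show "isCont (\<lambda>y. 2 * (\<psi> y * deriv \<psi> y)) y" for y by (simp add: continuous_on_eq_continuous_at)
  qed
  then have "(\<psi> x)\<^sup>2 = (LINT y|lborel. 2 * (\<psi> y * deriv \<psi> y) * indicator {a..x} y)" by (simp add: \<psi>a)
  also have "\<dots> \<le> (LINT y|lborel. 2 * (\<bar>\<psi> y\<bar> * \<bar>deriv \<psi> y\<bar>))"
  proof (rule integral_mono')
    show "integrable lborel (\<lambda>y. 2 * (\<bar>\<psi> y\<bar> * \<bar>deriv \<psi> y\<bar>))" using i by (rule integrable_mult_right)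
    show "2 * (\<psi> y * deriv \<psi> y) * indicator {a..x} y \<le> 2 * (\<bar>\<psi> y\<bar> * \<bar>deriv \<psi> y\<bar>)" for y
      by (auto simp: indicator_def simp flip: abs_mult)
  qed simp
  also have "\<dots> = 2 * (LINT y|lborel. \<bar>\<psi> y\<bar> * \<bar>deriv \<psi> y\<bar>)" by simp
  also have "\<dots> \<le> 2 * (l2 \<psi> * l2 (deriv \<psi>))"
    using L2_Cauchy_Schwarz[OF L2_abs[OF L(1)] L2_abs[OF L(2)]] by (simp add: l2_abs)
  finally show ?thesis by simp
qed

text \<open>The sup bound of the approximations tends to \<open>sqrt (2 * l2 f * l2 g)\<close>. The
  added 1 leaves room, so a tail of the sequence satisfies one common bound, which the limit
  inherits almost everywhere.\<close>

lemma H1_dense_bounded: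
  assumes f: "L2 f" and g: "L2 g" and w: "weak_deriv f g"
  defines "K \<equiv> sqrt (2 * l2 f * l2 g + 1)"
  obtains \<psi> where "\<And>n::nat. test_fun (\<psi> n)" "(\<lambda>n. l2 (\<lambda>x. \<psi> n x - f x)) \<longlonglongrightarrow> 0"
    "(\<lambda>n. l2 (\<lambda>x. deriv (\<psi> n) x - g x)) \<longlonglongrightarrow> 0"
    "\<And>n x. \<bar>\<psi> n x\<bar> \<le> K" "AE x in lborel. \<bar>f x\<bar> \<le> K"
proof -
  have [measurable]: "f \<in> borel_measurable borel" using f by (rule L2_measurable)
  have K2: "K\<^sup>2 = 2 * l2 f * l2 g + 1" and K0: "0 \<le> K" unfolding K_def by auto
  obtain \<phi> where \<phi>: "\<And>n::nat. test_fun (\<phi> n)" "(\<lambda>n. l2 (\<lambda>x. \<phi> n x - f x)) \<longlonglongrightarrow> 0"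
    "(\<lambda>n. l2 (\<lambda>x. deriv (\<phi> n) x - g x)) \<longlonglongrightarrow> 0"
    by (rule H1_dense[OF f g w]) (rule that)
  have "(\<lambda>n. 2 * l2 (\<phi> n) * l2 (deriv (\<phi> n))) \<longlonglongrightarrow> 2 * l2 f * l2 g"
    by (intro tendsto_intros l2_tendsto_norm \<phi> f g test_fun_L2 test_fun_deriv)
  then have "\<forall>\<^sub>F n in sequentially. 2 * l2 (\<phi> n) * l2 (deriv (\<phi> n)) < K\<^sup>2"
    by (rule order_tendstoD(2)) (simp add: K2)
  then obtain m where m: "\<And>n. n \<ge> m \<Longrightarrow> 2 * l2 (\<phi> n) * l2 (deriv (\<phi> n)) < K\<^sup>2"
    unfolding eventually_sequentially by auto
  define \<psi> where "\<psi> n = \<phi> (n + m)" for n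
  have t: "test_fun (\<psi> n)" for n unfolding \<psi>_def by (rule \<phi>)
  have lim: "(\<lambda>n. l2 (\<lambda>x. \<psi> n x - f x)) \<longlonglongrightarrow> 0" "(\<lambda>n. l2 (\<lambda>x. deriv (\<psi> n) x - g x)) \<longlonglongrightarrow> 0"
    unfolding \<psi>_def by (rule LIMSEQ_ignore_initial_segment[OF \<phi>(2)] LIMSEQ_ignore_initial_segment[OF \<phi>(3)])+
  have b: "\<bar>\<psi> n x\<bar> \<le> K" for n x
  proof -
    have "(\<psi> n x)\<^sup>2 \<le> K\<^sup>2"
      using test_fun_sup_bound[OF t, of n x] m[of "n + m"] unfolding \<psi>_def by simp
    then show ?thesis using K0 by (metis abs_le_square_iff abs_of_nonneg)
  qed
  \<comment> \<open>The excess of \<open>f\<close> over \<open>K\<close> is at most the distance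
    from \<open>f\<close> to any of the bounded approximations, so its norm vanishes.\<close>
  define e where "e x = max 0 (\<bar>f x\<bar> - K)" for x
  have [measurable]: "e \<in> borel_measurable borel" unfolding e_def by measurable
  have le: "L2 e" "l2 e \<le> l2 (\<lambda>x. \<psi> n x - f x)" for n
  proof -
    have "\<bar>e x\<bar> \<le> \<bar>\<psi> n x - f x\<bar>" for x using b[of n x] by (auto simp: e_def)
    from l2_mono[OF L2_diff[OF test_fun_L2[OF t[of n]] f] _ this]
    show "L2 e" "l2 e \<le> l2 (\<lambda>x. \<psi> n x - f x)" by auto
  qed
  have "l2 e \<le> 0" by (rule LIMSEQ_le_const[OF lim(1)]) (use le in auto)
  then have "l2 e = 0" using l2_nonneg[of e] by linarith
  then have "AE x in lborel. e x = 0" using l2_eq_0_AE[OF le(1)] by simp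
  then have "AE x in lborel. \<bar>f x\<bar> \<le> K" by eventually_elim (auto simp: e_def max_def split: if_splits)
  from that[OF t lim b this] show ?thesis .
qed

text \<open>Clamping \<open>h\<close> to \<open>[-K, K]\<close> changes it only on a null set and
  makes the bound hold everywhere.\<close>

lemma L2_AE_bounded_mult:
  assumes f: "L2 f" and [measurable]: "h \<in> borel_measurable borel" and h: "AE x in lborel. \<bar>h x\<bar> \<le> K" and K: "0 \<le> K"
  shows "L2 (\<lambda>x. h x * f x)" "l2 (\<lambda>x. h x * f x) \<le> K * l2 f"
proof -
  have [measurable]: "f \<in> borel_measurable borel" using f by (rule L2_measurable)
  define h' where "h' x = max (- K) (min K (h x))" for x
  have [measurable]: "h' \<in> borel_measurable borel" unfolding h'_def by measurable
  have b: "\<bar>h' x\<bar> \<le> K" for x using K by (auto simp: h'_def)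
  have ae: "AE x in lborel. h' x * f x = h x * f x"
    using h by eventually_elim (auto simp: h'_def)
  have "integrable lborel (\<lambda>x. (h' x * f x)\<^sup>2) \<longleftrightarrow> integrable lborel (\<lambda>x. (h x * f x)\<^sup>2)"
    by (intro integrable_cong_AE) (use ae in auto)
  then show "L2 (\<lambda>x. h x * f x)"
    using L2_square_integrable[OF L2_bounded_mult[OF f _ b]] by (intro L2I) auto
  have "l2 (\<lambda>x. h' x * f x) = l2 (\<lambda>x. h x * f x)" by (rule l2_cong_AE[OF ae]) measurable
  then show "l2 (\<lambda>x. h x * f x) \<le> K * l2 f" using l2_bounded_mult[of f h' K, OF f _ b] by simp
qed

lemma
  assumes f: "L2 f" and g: "L2 g" and w: "weak_deriv f g"
  shows L2_H1_square: "L2 (\<lambda>x. (f x)\<^sup>2)"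
    and l2_H1_square_le: "l2 (\<lambda>x. (f x)\<^sup>2) \<le> sqrt (2 * l2 f * l2 g + 1) * l2 f"
proof -
  have [measurable]: "f \<in> borel_measurable borel" using f by (rule L2_measurable)
  have "AE x in lborel. \<bar>f x\<bar> \<le> sqrt (2 * l2 f * l2 g + 1)"
    by (rule H1_dense_bounded[OF f g w])
  from L2_AE_bounded_mult[OF f _ this]
  show "L2 (\<lambda>x. (f x)\<^sup>2)" "l2 (\<lambda>x. (f x)\<^sup>2) \<le> sqrt (2 * l2 f * l2 g + 1) * l2 f"
    by (simp_all add: power2_eq_square)
qed

text \<open>Every term is continuous along the approximation in \<open>H1\<close>: the Hilbert
  transform by its \<open>L2\<close> bound, the squares because the approximations share a sup
  bound.\<close>

lemma (in weight) energy_inequality: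
  assumes f: "L2 f" and g: "L2 g" and w: "weak_deriv f g"
  shows "- 2 * (LINT x|lborel. hilbert g x * (g x * \<Phi> x + \<Phi>1 x * f x))
      + (LINT x|lborel. (f x)\<^sup>2 * (g x * \<Phi> x + \<Phi>1 x * f x))
    \<le> 2 * (l2 f)\<^sup>2 * (LINT x|lborel. \<Phi>1 x * (f x)\<^sup>2) + (N3 / 2 + (l2 k)\<^sup>2) * (l2 f)\<^sup>2 / pi"
proof -
  have [measurable]: "f \<in> borel_measurable borel" "g \<in> borel_measurable borel"
    using f g by (auto simp: L2_measurable)
  define K where "K = sqrt (2 * l2 f * l2 g + 1)"
  have K0: "0 \<le> K" by (simp add: K_def)
  obtain \<psi> where t: "\<And>n::nat. test_fun (\<psi> n)" and lf: "(\<lambda>n. l2 (\<lambda>x. \<psi> n x - f x)) \<longlonglongrightarrow> 0"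
    and lg: "(\<lambda>n. l2 (\<lambda>x. deriv (\<psi> n) x - g x)) \<longlonglongrightarrow> 0"
    and b: "\<And>n x. \<bar>\<psi> n x\<bar> \<le> K" "AE x in lborel. \<bar>f x\<bar> \<le> K"
    by (rule H1_dense_bounded[OF f g w, folded K_def]) (rule that)
  have L\<psi>: "L2 (\<psi> n)" "L2 (deriv (\<psi> n))" for n using t by (auto intro: test_fun_L2 test_fun_deriv)
  have [measurable]: "\<psi> n \<in> borel_measurable borel" for n using t by (rule test_fun_measurable)
  have Lw: "L2 (\<lambda>x. \<Phi> x * a x)" "L2 (\<lambda>x. \<Phi>1 x * a x)" if "L2 a" for a
    by (rule L2_bounded_mult[OF that _ M(1)] L2_bounded_mult[OF that _ M(2)]; measurable)+
  have LW: "L2 (\<lambda>x. \<Phi> x * a x + \<Phi>1 x * c x)" if "L2 a" "L2 c" for a c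
    by (intro L2_add Lw that)
  have limW: "(\<lambda>n. l2 (\<lambda>x. (\<Phi> x * deriv (\<psi> n) x + \<Phi>1 x * \<psi> n x) - (\<Phi> x * g x + \<Phi>1 x * f x))) \<longlonglongrightarrow> 0"
    by (intro l2_tendsto_add Lw L\<psi> f g l2_tendsto_bounded_mult[OF L\<psi>(2) g lg _ M(1)]
        l2_tendsto_bounded_mult[OF L\<psi>(1) f lf _ M(2)] measurable_weights)
  have limH: "(\<lambda>n. l2 (\<lambda>x. hilbert (deriv (\<psi> n)) x - hilbert g x)) \<longlonglongrightarrow> 0"
  proof (rule Lim_null_comparison[OF always_eventually], rule allI)
    show "norm (l2 (\<lambda>x. hilbert (deriv (\<psi> n)) x - hilbert g x)) \<le> 4 * l2 (\<lambda>x. deriv (\<psi> n) x - g x)" for n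
      using l2_hilbert_diff_le[OF L\<psi>(2) g] by simp
    show "(\<lambda>n. 4 * l2 (\<lambda>x. deriv (\<psi> n) x - g x)) \<longlonglongrightarrow> 0" using tendsto_mult_left[OF lg, of 4] by simp
  qed
  have Lsq: "L2 (\<lambda>x. (\<psi> n x)\<^sup>2)" for n
    using L2_bounded_mult[of "\<psi> n" "\<psi> n" K] L\<psi>(1) b(1) by (simp add: power2_eq_square)
  have limsq: "(\<lambda>n. l2 (\<lambda>x. (\<psi> n x)\<^sup>2 - (f x)\<^sup>2)) \<longlonglongrightarrow> 0"
  proof (rule Lim_null_comparison[OF always_eventually], rule allI)
    fix n
    have "AE x in lborel. \<bar>\<psi> n x + f x\<bar> \<le> 2 * K"
      using b(2)
    proof eventually_elim
      fix x assume "\<bar>f x\<bar> \<le> K"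
      then show "\<bar>\<psi> n x + f x\<bar> \<le> 2 * K" using b(1)[of n x] by linarith
    qed
    then have "l2 (\<lambda>x. (\<psi> n x + f x) * (\<psi> n x - f x)) \<le> 2 * K * l2 (\<lambda>x. \<psi> n x - f x)"
      by (rule L2_AE_bounded_mult(2)[OF L2_diff[OF L\<psi>(1) f], rotated]) (use K0 in auto)
    then show "norm (l2 (\<lambda>x. (\<psi> n x)\<^sup>2 - (f x)\<^sup>2)) \<le> 2 * K * l2 (\<lambda>x. \<psi> n x - f x)"
      by (simp add: power2_eq_square algebra_simps)
  next
    show "(\<lambda>n. 2 * K * l2 (\<lambda>x. \<psi> n x - f x)) \<longlonglongrightarrow> 0" using tendsto_mult_left[OF lf, of "2 * K"] by simp
  qed
  have lim1: "(\<lambda>n. LINT x|lborel. hilbert (deriv (\<psi> n)) x * (\<Phi> x * deriv (\<psi> n) x + \<Phi>1 x * \<psi> n x))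
     \<longlonglongrightarrow> (LINT x|lborel. hilbert g x * (\<Phi> x * g x + \<Phi>1 x * f x))"
    by (intro L2_tendsto_pairing limH limW LW L\<psi> f g L2_hilbert)
  have lim2: "(\<lambda>n. LINT x|lborel. (\<psi> n x)\<^sup>2 * (\<Phi> x * deriv (\<psi> n) x + \<Phi>1 x * \<psi> n x))
     \<longlonglongrightarrow> (LINT x|lborel. (f x)\<^sup>2 * (\<Phi> x * g x + \<Phi>1 x * f x))"
    by (intro L2_tendsto_pairing limsq limW LW L\<psi> f g Lsq L2_H1_square[OF f g w])
  have lim3: "(\<lambda>n. LINT x|lborel. (\<Phi>1 x * \<psi> n x) * \<psi> n x) \<longlonglongrightarrow> (LINT x|lborel. (\<Phi>1 x * f x) * f x)"
    by (intro L2_tendsto_pairing Lw L\<psi> f lf l2_tendsto_bounded_mult[OF L\<psi>(1) f lf _ M(2)] measurable_weights)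
  have lim4: "(\<lambda>n. l2 (\<psi> n)) \<longlonglongrightarrow> l2 f" by (intro l2_tendsto_norm L\<psi> f lf)
  have "- 2 * (LINT x|lborel. hilbert g x * (\<Phi> x * g x + \<Phi>1 x * f x)) + (LINT x|lborel. (f x)\<^sup>2 * (\<Phi> x * g x + \<Phi>1 x * f x))
    \<le> 2 * (l2 f)\<^sup>2 * (LINT x|lborel. (\<Phi>1 x * f x) * f x) + (N3 / 2 + (l2 k)\<^sup>2) * (l2 f)\<^sup>2 / pi"
  proof (rule LIMSEQ_le)
    show "(\<lambda>n. - 2 * (LINT x|lborel. hilbert (deriv (\<psi> n)) x * (\<Phi> x * deriv (\<psi> n) x + \<Phi>1 x * \<psi> n x))
       + (LINT x|lborel. (\<psi> n x)\<^sup>2 * (\<Phi> x * deriv (\<psi> n) x + \<Phi>1 x * \<psi> n x)))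
     \<longlonglongrightarrow> - 2 * (LINT x|lborel. hilbert g x * (\<Phi> x * g x + \<Phi>1 x * f x)) + (LINT x|lborel. (f x)\<^sup>2 * (\<Phi> x * g x + \<Phi>1 x * f x))"
      by (intro tendsto_intros lim1 lim2)
    show "(\<lambda>n. 2 * (l2 (\<psi> n))\<^sup>2 * (LINT x|lborel. (\<Phi>1 x * \<psi> n x) * \<psi> n x) + (N3 / 2 + (l2 k)\<^sup>2) * (l2 (\<psi> n))\<^sup>2 / pi)
     \<longlonglongrightarrow> 2 * (l2 f)\<^sup>2 * (LINT x|lborel. (\<Phi>1 x * f x) * f x) + (N3 / 2 + (l2 k)\<^sup>2) * (l2 f)\<^sup>2 / pi"
      by (intro tendsto_intros lim3 lim4) simp
    show "\<exists>N. \<forall>n\<ge>N. - 2 * (LINT x|lborel. hilbert (deriv (\<psi> n)) x * (\<Phi> x * deriv (\<psi> n) x + \<Phi>1 x * \<psi> n x))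
       + (LINT x|lborel. (\<psi> n x)\<^sup>2 * (\<Phi> x * deriv (\<psi> n) x + \<Phi>1 x * \<psi> n x))
      \<le> 2 * (l2 (\<psi> n))\<^sup>2 * (LINT x|lborel. (\<Phi>1 x * \<psi> n x) * \<psi> n x) + (N3 / 2 + (l2 k)\<^sup>2) * (l2 (\<psi> n))\<^sup>2 / pi"
      using energy_inequality_test[OF t] by (simp add: power2_eq_square mult_ac)
  qed
  then show ?thesis by (simp add: power2_eq_square mult_ac)
qed

text \<open>Both errors, \<open>N3\<close> and the squared norm of \<open>k\<close>, shrink like
  \<open>\<mu>^-2\<close>, while \<open>\<mu> \<ge> 1\<close> preserves the bound \<open>M\<close>.
  The factor \<open>\<mu> ^ (-3/2)\<close> in \<open>k\<close> is forced: the squared increments of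
  \<open>b / sqrt \<mu>\<close> give one \<open>1 / \<mu>\<close>, the rescaled distance two
  more.\<close>

lemma (in weight) weight_affine:
  assumes \<mu>: "\<mu> \<ge> 1"
  shows "weight (\<lambda>x. \<Phi> ((x - m) / \<mu>)) (\<lambda>x. \<Phi>1 ((x - m) / \<mu>) / \<mu>) (\<lambda>x. \<Phi>2 ((x - m) / \<mu>) / \<mu>\<^sup>2)
    (\<lambda>x. \<Phi>3 ((x - m) / \<mu>) / \<mu> ^ 3) (\<lambda>x. b ((x - m) / \<mu>) / sqrt \<mu>) (\<lambda>x. k ((x - m) / \<mu>) / (\<mu> * sqrt \<mu>)) M (N3 / \<mu>\<^sup>2)"
    (is "weight ?f ?f1 ?f2 ?f3 ?b ?k _ _")
    and "l2 (\<lambda>x. k ((x - m) / \<mu>) / (\<mu> * sqrt \<mu>)) = l2 k / \<mu>"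
proof -
  have pos: "\<mu> > 0" using \<mu> by simp
  have M0: "0 \<le> M" using M(1)[of 0] by linarith
  have d: "((\<lambda>x. (x - m) / \<mu>) has_real_derivative 1 / \<mu>) (at x)" for x
    using pos by (auto intro!: derivative_eq_intros)
  have small: "\<bar>v / c\<bar> \<le> M" if "\<bar>v\<bar> \<le> M" "1 \<le> c" for v c
  proof -
    have "\<bar>v\<bar> * 1 \<le> M * c" using that M0 by (intro mult_mono) auto
    then show ?thesis using that(2) by (simp add: divide_le_eq)
  qed
  have s1: "1 \<le> sqrt \<mu>" using \<mu> by simp
  have s2: "sqrt \<mu> * sqrt \<mu> = \<mu>" using pos by simp
  have p2: "1 \<le> \<mu>\<^sup>2" "1 \<le> \<mu> ^ 3" using \<mu> by (auto intro: one_le_power)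
  have aff: "(x - m) / \<mu> = - (m / \<mu>) + (1 / \<mu>) * x" for x by (simp add: diff_divide_distrib)
  have shift_int: "integrable lborel (\<lambda>x. h ((x - m) / \<mu>))" "(LINT x|lborel. h ((x - m) / \<mu>)) = \<mu> * (LINT x|lborel. h x)"
    if "integrable lborel h" for h :: "real \<Rightarrow> real"
    using lborel_integrable_real_affine[OF that, of "1 / \<mu>" "- (m / \<mu>)"] lborel_integral_real_affine[of "1 / \<mu>" h "- (m / \<mu>)"] pos
    unfolding aff by auto
  have ik: "integrable lborel (\<lambda>x. (k x)\<^sup>2)" using k(1) by (rule L2_square_integrable)
  have ksq: "(?k x)\<^sup>2 = (1 / \<mu> ^ 3) * (k ((x - m) / \<mu>))\<^sup>2" for x
    using s2 pos by (simp add: power_divide power_mult_distrib power2_eq_square power3_eq_cube)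
  have [measurable]: "k \<in> borel_measurable borel" using k(1) by (rule L2_measurable)
  have Lk: "L2 ?k"
  proof (rule L2I)
    show "integrable lborel (\<lambda>x. (?k x)\<^sup>2)" unfolding ksq by (intro integrable_mult_right shift_int ik)
  qed measurable
  show "l2 ?k = l2 k / \<mu>"
  proof -
    have "(l2 ?k)\<^sup>2 = (1 / \<mu> ^ 3) * (\<mu> * (l2 k)\<^sup>2)"
      unfolding l2_square ksq integral_mult_right_zero shift_int(2)[OF ik] ..
    also have "\<dots> = (l2 k / \<mu>)\<^sup>2" using pos by (simp add: power_divide power2_eq_square power3_eq_cube)
    finally show ?thesis using pos by (simp add: power2_eq_iff_nonneg)
  qed
  show "weight ?f ?f1 ?f2 ?f3 ?b ?k M (N3 / \<mu>\<^sup>2)"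
  proof
    show "smooth ?f" unfolding aff using smooth_affine[OF smooth, of "1 / \<mu>" "- (m / \<mu>)"] by (simp add: add.commute)
    show "(?f has_real_derivative ?f1 x) (at x)" for x
      using DERIV_chain2[OF D1 d] by simp
    show "(?f1 has_real_derivative ?f2 x) (at x)" for x
      using DERIV_cdivide[OF DERIV_chain2[OF D2 d], of \<mu> x] by (simp add: power2_eq_square)
    show "(?f2 has_real_derivative ?f3 x) (at x)" for x
      using DERIV_cdivide[OF DERIV_chain2[OF D3 d], of "\<mu>\<^sup>2" x]
      by (simp add: power2_eq_square power3_eq_cube mult.assoc)
    show "continuous_on UNIV ?f3"
      using pos by (intro continuous_intros continuous_on_compose2[OF C3]) auto
    show "\<bar>?f x\<bar> \<le> M" "\<bar>?f1 x\<bar> \<le> M" "\<bar>?f2 x\<bar> \<le> M" "\<bar>?f3 x\<bar> \<le> M" "\<bar>?b x\<bar> \<le> M" for x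
      by (intro small M b \<mu> p2 s1)+
    show "integrable lborel ?f3" using shift_int(1)[OF N3(1)] by simp
    have "(LINT x|lborel. \<bar>?f3 x\<bar>) = (1 / \<mu> ^ 3) * (\<mu> * (LINT x|lborel. \<bar>\<Phi>3 x\<bar>))"
      unfolding shift_int(2)[OF integrable_abs[OF N3(1)], symmetric] using pos by simp
    also have "\<dots> = (LINT x|lborel. \<bar>\<Phi>3 x\<bar>) / \<mu>\<^sup>2" using pos by (simp add: power2_eq_square power3_eq_cube)
    also have "\<dots> \<le> N3 / \<mu>\<^sup>2" using N3(2) by (intro divide_right_mono) auto
    finally show "(LINT x|lborel. \<bar>?f3 x\<bar>) \<le> N3 / \<mu>\<^sup>2" .
    show "?f1 x = (?b x)\<^sup>2" for x using pos by (simp add: square power_divide)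
    show "\<bar>?b x - ?b y\<bar> \<le> M * \<bar>x - y\<bar>" for x y
    proof -
      have "\<bar>b ((x - m) / \<mu>) - b ((y - m) / \<mu>)\<bar> \<le> M * \<bar>(x - m) / \<mu> - (y - m) / \<mu>\<bar>" by (rule b)
      also have "\<dots> = M * \<bar>x - y\<bar> / \<mu>" using pos by (simp flip: diff_divide_distrib)
      finally have "\<bar>b ((x - m) / \<mu>) - b ((y - m) / \<mu>)\<bar> / sqrt \<mu> \<le> (M * \<bar>x - y\<bar> / \<mu>) / sqrt \<mu>"
        by (rule divide_right_mono) (use pos in simp)
      moreover have "\<bar>?b x - ?b y\<bar> = \<bar>b ((x - m) / \<mu>) - b ((y - m) / \<mu>)\<bar> / sqrt \<mu>"
        using pos by (simp flip: diff_divide_distrib)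
      ultimately have "\<bar>?b x - ?b y\<bar> \<le> (M * \<bar>x - y\<bar> / \<mu>) / sqrt \<mu>" by simp
      also have "\<dots> \<le> M * \<bar>x - y\<bar>"
      proof -
        have "(M * \<bar>x - y\<bar>) * 1 \<le> (M * \<bar>x - y\<bar>) * (\<mu> * sqrt \<mu>)"
          using M0 mult_mono[OF \<mu> s1] pos by (intro mult_left_mono) auto
        then show ?thesis using pos by (simp add: divide_le_eq)
      qed
      finally show ?thesis .
    qed
    show "L2 ?k" by (rule Lk)
    show "0 \<le> ?k x" for x using k(2) pos by simp
    show "(?b x - ?b y)\<^sup>2 \<le> (x - y)\<^sup>2 * (?k x * ?k y)" for x y
    proof -
      have "(b ((x - m) / \<mu>) - b ((y - m) / \<mu>))\<^sup>2 / \<mu>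
          \<le> ((x - m) / \<mu> - (y - m) / \<mu>)\<^sup>2 * (k ((x - m) / \<mu>) * k ((y - m) / \<mu>)) / \<mu>"
        using pos by (intro divide_right_mono k) auto
      also have "(x - m) / \<mu> - (y - m) / \<mu> = (x - y) / \<mu>" by (simp flip: diff_divide_distrib)
      also have "((x - y) / \<mu>)\<^sup>2 * (k ((x - m) / \<mu>) * k ((y - m) / \<mu>)) / \<mu> = (x - y)\<^sup>2 * (?k x * ?k y)"
        using s2 pos by (simp add: power_divide power2_eq_square)
      also have "(b ((x - m) / \<mu>) - b ((y - m) / \<mu>))\<^sup>2 / \<mu> = (?b x - ?b y)\<^sup>2"
        using pos by (simp add: power_divide flip: diff_divide_distrib)
      finally show ?thesis .
    qed
  qed
qed

subsection \<open>Energy of a solution\<close>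

locale bo =
  fixes u0 :: "real \<Rightarrow> real" and u :: "real \<Rightarrow> real \<Rightarrow> real"
  assumes solution: "BO_solution u0 u"
begin

definition f :: "real \<Rightarrow> real \<Rightarrow> real" where "f t x = u x t"
definition g :: "real \<Rightarrow> real \<Rightarrow> real" where "g t = wderiv (f t)"
text \<open>The flux: in the weak sense the time derivative of \<open>f\<close> is minus the space
  derivative of \<open>F\<close>.\<close>

definition F :: "real \<Rightarrow> real \<Rightarrow> real" where "F t x = - hilbert (g t) x + (f t x)\<^sup>2 / 2"

lemma H1_f: "H1 (f t)"
  using solution by (auto simp: BO_solution_def f_def[abs_def])

lemma L2_f: "L2 (f t)" and L2_g: "L2 (g t)" and wd: "weak_deriv (f t) (g t)"
  unfolding g_def by (intro H1_L2 L2_wderiv weak_deriv_wderiv H1_f)+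

lemma L2_F: "L2 (F t)"
proof -
  have "L2 (\<lambda>x. (1 / 2) * (f t x)\<^sup>2)" by (intro L2_cmult L2_H1_square[OF L2_f L2_g wd])
  from L2_add[OF L2_minus[OF L2_hilbert[OF L2_g]] this, of t] show ?thesis
    by (simp add: F_def[abs_def])
qed

lemma tendsto_f: "((\<lambda>s. l2 (\<lambda>x. f s x - f t x)) \<longlongrightarrow> 0) (at t)"
  and tendsto_g: "((\<lambda>s. l2 (\<lambda>x. g s x - g t x)) \<longlongrightarrow> 0) (at t)"
proof -
  have 1: "((\<lambda>s. H1_norm (\<lambda>x. f s x - f t x)) \<longlongrightarrow> 0) (at t)"
    using solution by (simp add: BO_solution_def f_def)
  show "((\<lambda>s. l2 (\<lambda>x. f s x - f t x)) \<longlongrightarrow> 0) (at t)"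
    by (rule Lim_null_comparison[OF always_eventually 1]) (use l2_le_H1_norm(1) in simp)
  show "((\<lambda>s. l2 (\<lambda>x. g s x - g t x)) \<longlongrightarrow> 0) (at t)"
    by (rule Lim_null_comparison[OF always_eventually 1]) (use l2_wderiv_diff_le[OF H1_f H1_f] in \<open>simp add: g_def\<close>)
qed

text \<open>The uniform bound in \<open>H1\<close> controls \<open>g\<close>, hence its Hilbert
  transform, and through the sup bound also the square of \<open>f\<close>. Uniformity in time is
  what makes the solution Lipschitz in the dual of \<open>H1\<close>.\<close>

lemma F_bounded: obtains K where "K \<ge> 0" "\<And>t. l2 (F t) \<le> K"
proof -
  obtain B where "\<And>t. H1_norm (f t) \<le> B"
    using solution by (auto simp: BO_solution_def f_def[abs_def])
  then have B: "l2 (f t) \<le> B" "l2 (g t) \<le> B" for t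
    using l2_le_H1_norm[of "f t"] unfolding g_def by (meson order_trans)+
  have B0: "0 \<le> B" using B(1)[of 0] l2_nonneg[of "f 0"] by linarith
  define K where "K = 4 * B + (1 / 2) * (sqrt (2 * B * B + 1) * B)"
  have "l2 (F t) \<le> K" for t
  proof -
    have Lsq: "L2 (\<lambda>x. (f t x)\<^sup>2)" by (intro L2_H1_square[OF L2_f L2_g wd])
    have "l2 (F t) = l2 (\<lambda>x. (1 / 2) * (f t x)\<^sup>2 - hilbert (g t) x)" by (simp add: F_def[abs_def])
    also have "\<dots> \<le> l2 (\<lambda>x. (1 / 2) * (f t x)\<^sup>2) + l2 (hilbert (g t))"
      by (intro l2_triangle_diff L2_cmult Lsq L2_hilbert L2_g)
    also have "\<dots> \<le> (1 / 2) * (sqrt (2 * B * B + 1) * B) + 4 * B"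
    proof (rule add_mono)
      have "l2 (\<lambda>x. (1 / 2) * (f t x)\<^sup>2) = (1 / 2) * l2 (\<lambda>x. (f t x)\<^sup>2)" using l2_cmult[of "1/2" "\<lambda>x. (f t x)\<^sup>2"] by simp
      also have "\<dots> \<le> (1 / 2) * (sqrt (2 * l2 (f t) * l2 (g t) + 1) * l2 (f t))"
        by (intro mult_left_mono l2_H1_square_le[OF L2_f L2_g wd]) simp
      also have "\<dots> \<le> (1 / 2) * (sqrt (2 * B * B + 1) * B)"
        using B B0 by (intro mult_left_mono mult_mono real_sqrt_le_mono add_mono) auto
      finally show "l2 (\<lambda>x. (1 / 2) * (f t x)\<^sup>2) \<le> (1 / 2) * (sqrt (2 * B * B + 1) * B)" .
      show "l2 (hilbert (g t)) \<le> 4 * B" using l2_hilbert_le[OF L2_g, of t] B(2)[of t] by simp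
    qed
    finally show ?thesis by (simp add: K_def)
  qed
  moreover have "K \<ge> 0" using B0 by (simp add: K_def)
  ultimately show ?thesis using that by blast
qed

lemma DERIV_test:
  assumes "test_fun \<psi>"
  shows "((\<lambda>s. LINT x|lborel. f s x * \<psi> x) has_real_derivative (LINT x|lborel. F t x * deriv \<psi> x)) (at t)"
  using solution assms by (auto simp: BO_solution_def f_def F_def g_def[abs_def] f_def[abs_def])

text \<open>A Lipschitz bound in time with values in the dual of \<open>H1\<close>: the mean value
  inequality on test functions, extended by density.\<close>

lemma increment_bound:
  assumes K: "\<And>t. l2 (F t) \<le> K" and w: "L2 w" "L2 w'" "weak_deriv w w'"
  shows "\<bar>LINT x|lborel. (f s x - f t x) * w x\<bar> \<le> K * \<bar>s - t\<bar> * l2 w'"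
proof -
  obtain \<psi> where \<psi>: "\<And>n::nat. test_fun (\<psi> n)" "(\<lambda>n. l2 (\<lambda>x. \<psi> n x - w x)) \<longlonglongrightarrow> 0"
    "(\<lambda>n. l2 (\<lambda>x. deriv (\<psi> n) x - w' x)) \<longlonglongrightarrow> 0"
    by (rule H1_dense[OF w]) (rule that)
  have L: "L2 (\<psi> n)" "L2 (deriv (\<psi> n))" for n using \<psi>(1) by (auto intro: test_fun_L2 test_fun_deriv)
  have Ld: "L2 (\<lambda>x. f s x - f t x)" by (intro L2_diff L2_f)
  have "\<bar>LINT x|lborel. (f s x - f t x) * \<psi> n x\<bar> \<le> K * \<bar>s - t\<bar> * l2 (deriv (\<psi> n))" for n
  proof -
    have "\<bar>LINT x|lborel. F r x * deriv (\<psi> n) x\<bar> \<le> K * l2 (deriv (\<psi> n))" for r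
      by (rule order_trans[OF L2_Cauchy_Schwarz[OF L2_F L(2)]]) (intro mult_right_mono K l2_nonneg)
    from lipschitz_of_DERIV[OF DERIV_test[OF \<psi>(1)] this, of s t]
    have "\<bar>(LINT x|lborel. f s x * \<psi> n x) - (LINT x|lborel. f t x * \<psi> n x)\<bar> \<le> K * l2 (deriv (\<psi> n)) * \<bar>s - t\<bar>" .
    also have "(LINT x|lborel. f s x * \<psi> n x) - (LINT x|lborel. f t x * \<psi> n x) = (LINT x|lborel. (f s x - f t x) * \<psi> n x)"
      unfolding left_diff_distrib by (intro Bochner_Integration.integral_diff[symmetric] L2_mult_integrable L2_f L)
    finally show ?thesis by (simp add: mult_ac)
  qed
  moreover have "(\<lambda>n. \<bar>LINT x|lborel. (f s x - f t x) * \<psi> n x\<bar>) \<longlonglongrightarrow> \<bar>LINT x|lborel. (f s x - f t x) * w x\<bar>"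
    by (intro tendsto_rabs L2_tendsto_pairing[OF Ld Ld l2_tendsto_const L(1) w(1) \<psi>(2)])
  moreover have "(\<lambda>n. K * \<bar>s - t\<bar> * l2 (deriv (\<psi> n))) \<longlonglongrightarrow> K * \<bar>s - t\<bar> * l2 w'"
    by (intro tendsto_intros l2_tendsto_norm L w \<psi>)
  ultimately show ?thesis by (intro LIMSEQ_le) auto
qed

text \<open>Extends the equation from test functions to \<open>H1\<close>. By the Lipschitz bound in
  time, the error of replacing \<open>w\<close> by a test function is small uniformly in
  \<open>s\<close>, so it survives the division by \<open>s - t\<close>.\<close>

lemma quotient_tendsto:
  assumes w: "L2 w" "L2 w'" "weak_deriv w w'"
  shows "((\<lambda>s. (LINT x|lborel. (f s x - f t x) * w x) / (s - t)) \<longlongrightarrow> (LINT x|lborel. F t x * w' x)) (at t)"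
proof -
  obtain K where K: "K \<ge> 0" "\<And>t. l2 (F t) \<le> K" by (rule F_bounded) (rule that)
  show ?thesis
    unfolding tendsto_iff dist_real_def
  proof (intro allI impI)
    fix e :: real assume e: "e > 0"
    \<comment> \<open>Makes \<open>K * \<eta>\<close> smaller than \<open>e / 3\<close>; adding 1
      avoids a division by 0.\<close>
    define \<eta> where "\<eta> = e / (3 * (K + 1))"
    have \<eta>: "\<eta> > 0" using e K by (simp add: \<eta>_def)
    have K\<eta>: "K * \<eta> < e / 3" using e K by (simp add: \<eta>_def field_simps)
    obtain \<psi> where \<psi>: "\<And>n::nat. test_fun (\<psi> n)" "(\<lambda>n. l2 (\<lambda>x. \<psi> n x - w x)) \<longlonglongrightarrow> 0"
      "(\<lambda>n. l2 (\<lambda>x. deriv (\<psi> n) x - w' x)) \<longlonglongrightarrow> 0"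
      by (rule H1_dense[OF w]) (rule that)
    from LIMSEQ_D[OF \<psi>(3) \<eta>] obtain n where n: "l2 (\<lambda>x. deriv (\<psi> n) x - w' x) < \<eta>" by auto
    define p where "p = \<psi> n"
    have tp: "test_fun p" unfolding p_def by (rule \<psi>)
    have Lp: "L2 p" "L2 (deriv p)" using tp by (auto intro: test_fun_L2 test_fun_deriv)
    have wp: "weak_deriv p (deriv p)"
      unfolding weak_deriv_def
    proof (intro allI impI)
      fix \<phi> assume t: "test_fun \<phi>"
      show "(LINT x|lborel. p x * deriv \<phi> x) = - (LINT x|lborel. deriv p x * \<phi> x)"
        using integral_by_parts_test(3)[OF t test_fun_DERIV[OF tp] test_fun_continuous[OF test_fun_deriv[OF tp]]]
        by (simp add: mult.commute)
    qed
    have L': "L2 (\<lambda>x. w x - p x)" "L2 (\<lambda>x. w' x - deriv p x)" by (intro L2_diff w Lp)+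
    have wd': "weak_deriv (\<lambda>x. w x - p x) (\<lambda>x. w' x - deriv p x)" by (intro weak_deriv_diff w Lp wp)
    have n': "l2 (\<lambda>x. w' x - deriv p x) < \<eta>" using n l2_commute[of w' "deriv p"] by (simp add: p_def)
    have "((\<lambda>s. ((LINT x|lborel. f s x * p x) - (LINT x|lborel. f t x * p x)) / (s - t)) \<longlongrightarrow> (LINT x|lborel. F t x * deriv p x)) (at t)"
      using DERIV_test[OF tp, of t] by (simp add: has_field_derivative_iff)
    from tendstoD[OF this, of "e / 3"] e
    have "\<forall>\<^sub>F s in at t. \<bar>((LINT x|lborel. f s x * p x) - (LINT x|lborel. f t x * p x)) / (s - t) - (LINT x|lborel. F t x * deriv p x)\<bar> < e / 3"
      by (simp add: dist_real_def)
    moreover have "\<forall>\<^sub>F s in at t. s \<noteq> t" by (simp add: eventually_at_filter)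
    ultimately show "\<forall>\<^sub>F s in at t. \<bar>(LINT x|lborel. (f s x - f t x) * w x) / (s - t) - (LINT x|lborel. F t x * w' x)\<bar> < e"
    proof eventually_elim
      fix s assume a: "\<bar>((LINT x|lborel. f s x * p x) - (LINT x|lborel. f t x * p x)) / (s - t) - (LINT x|lborel. F t x * deriv p x)\<bar> < e / 3"
        and st: "s \<noteq> t"
      have Ld: "L2 (\<lambda>x. f s x - f t x)" by (intro L2_diff L2_f)
      define A where "A = (LINT x|lborel. (f s x - f t x) * (w x - p x))"
      have e1: "(LINT x|lborel. (f s x - f t x) * w x) = A + ((LINT x|lborel. f s x * p x) - (LINT x|lborel. f t x * p x))"
      proof -
        have "(LINT x|lborel. f s x * p x) - (LINT x|lborel. f t x * p x) = (LINT x|lborel. (f s x - f t x) * p x)"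
          unfolding left_diff_distrib by (intro Bochner_Integration.integral_diff[symmetric] L2_mult_integrable L2_f Lp)
        moreover have "A = (LINT x|lborel. (f s x - f t x) * w x) - (LINT x|lborel. (f s x - f t x) * p x)"
          unfolding A_def right_diff_distrib by (intro Bochner_Integration.integral_diff L2_mult_integrable Ld Lp w)
        ultimately show ?thesis by simp
      qed
      have "\<bar>A\<bar> \<le> K * \<bar>s - t\<bar> * l2 (\<lambda>x. w' x - deriv p x)"
        unfolding A_def by (rule increment_bound[OF K(2) L' wd'])
      then have "\<bar>A\<bar> / \<bar>s - t\<bar> \<le> K * l2 (\<lambda>x. w' x - deriv p x)"
        using st by (simp add: divide_le_eq mult_ac)
      also have "\<dots> \<le> K * \<eta>" using n' K by (intro mult_left_mono) auto
      finally have "\<bar>A\<bar> / \<bar>s - t\<bar> < e / 3" using K\<eta> by (rule le_less_trans)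
      then have A: "\<bar>A / (s - t)\<bar> < e / 3" by (simp only: abs_divide)
      have "\<bar>LINT x|lborel. F t x * (w' x - deriv p x)\<bar> \<le> l2 (F t) * l2 (\<lambda>x. w' x - deriv p x)"
        by (rule L2_Cauchy_Schwarz[OF L2_F L'(2)])
      also have "\<dots> \<le> K * \<eta>" using n' K by (intro mult_mono) auto
      finally have C: "\<bar>LINT x|lborel. F t x * (w' x - deriv p x)\<bar> < e / 3" using K\<eta> by simp
      have e2: "(LINT x|lborel. F t x * w' x) = (LINT x|lborel. F t x * (w' x - deriv p x)) + (LINT x|lborel. F t x * deriv p x)"
        unfolding right_diff_distrib by (subst Bochner_Integration.integral_diff) (auto intro: L2_mult_integrable L2_F w Lp)
      have e3: "(LINT x|lborel. (f s x - f t x) * w x) / (s - t) = A / (s - t) + ((LINT x|lborel. f s x * p x) - (LINT x|lborel. f t x * p x)) / (s - t)"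
        unfolding e1 by (rule add_divide_distrib)
      show "\<bar>(LINT x|lborel. (f s x - f t x) * w x) / (s - t) - (LINT x|lborel. F t x * w' x)\<bar> < e"
        unfolding e2 e3 using a A C by linarith
    qed
  qed
qed

end

text \<open>The energy is quadratic in a function known to be differentiable only in a dual sense.
  Writing \<open>f s^2 - f t^2\<close> as \<open>(f s - f t) * (f s + f t)\<close> makes it a
  pairing of an increment with an \<open>H1\<close> function, and continuity in \<open>H1\<close>
  removes the dependence of that function on \<open>s\<close>.\<close>

lemma (in bo) energy_derivative:
  assumes W: "weight \<Phi> \<Phi>1 \<Phi>2 \<Phi>3 b k M N3"
  shows "\<exists>D. ((\<lambda>s. LINT x|lborel. (f s x)\<^sup>2 * \<Phi> (x - c * s)) has_real_derivative D) (at t) \<and>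
    D \<le> (2 * (l2 (f t))\<^sup>2 - c) * (LINT x|lborel. \<Phi>1 (x - c * t) * (f t x)\<^sup>2) + (N3 / 2 + (l2 k)\<^sup>2) * (l2 (f t))\<^sup>2 / pi"
proof -
  interpret W: weight \<Phi> \<Phi>1 \<Phi>2 \<Phi>3 b k M N3 by (rule W)
  define \<Psi> where "\<Psi> s x = \<Phi> (x - c * s)" for s x
  define \<Psi>1 where "\<Psi>1 s x = \<Phi>1 (x - c * s)" for s x
  have V: "weight (\<Psi> s) (\<Psi>1 s) (\<lambda>x. \<Phi>2 (x - c * s)) (\<lambda>x. \<Phi>3 (x - c * s)) (\<lambda>x. b (x - c * s)) (\<lambda>x. k (x - c * s)) M N3" for s
    using W.weight_affine(1)[of 1 "c * s"] by (simp add: \<Psi>_def[abs_def] \<Psi>1_def[abs_def])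
  note V1 = weight.smooth[OF V] weight.D1[OF V]
  note V2 = weight.M(1)[OF V] weight.M(2)[OF V]
  have [measurable]: "\<Psi> s \<in> borel_measurable borel" "\<Psi>1 s \<in> borel_measurable borel" for s
    using weight.measurable_weights(1,2)[OF V] by auto
  obtain K where K: "K \<ge> 0" "\<And>t. l2 (F t) \<le> K" by (rule F_bounded) (rule that)
  \<comment> \<open>The second factor of the difference of squares, times the moving weight;
    \<open>w'\<close> is its weak derivative.\<close>
  define w where "w s x = (f s x + f t x) * \<Psi> s x" for s x
  define w' where "w' s x = (g s x + g t x) * \<Psi> s x + \<Psi>1 s x * (f s x + f t x)" for s x
  have Lfg: "L2 (\<lambda>x. f s x + f t x)" "L2 (\<lambda>x. g s x + g t x)" for s by (intro L2_add L2_f L2_g)+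
  have Lw: "L2 (w s)" for s
    unfolding w_def by (rule L2_mult_bounded[OF Lfg(1) _ V2(1)]) measurable
  have Lw': "L2 (w' s)" for s
    unfolding w'_def by (intro L2_add L2_mult_bounded[OF Lfg(2) _ V2(1)] L2_bounded_mult[OF Lfg(1) _ V2(2)]) measurable
  have wdw: "weak_deriv (w s) (w' s)" for s
    unfolding w_def w'_def
    by (rule weak_deriv_mult_smooth[OF Lfg _ V1 V2]) (intro weak_deriv_add L2_f L2_g wd, measurable)
  have lip: "\<bar>\<Psi> s x - \<Psi> t x\<bar> \<le> M * \<bar>c\<bar> * \<bar>s - t\<bar>" "\<bar>\<Psi>1 s x - \<Psi>1 t x\<bar> \<le> M * \<bar>c\<bar> * \<bar>s - t\<bar>" for s x
  proof -
    have "x - c * s - (x - c * t) = - (c * (s - t))" by (simp add: right_diff_distrib)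
    then have "\<bar>x - c * s - (x - c * t)\<bar> = \<bar>c\<bar> * \<bar>s - t\<bar>"
      by (simp add: abs_mult)
    then show "\<bar>\<Psi> s x - \<Psi> t x\<bar> \<le> M * \<bar>c\<bar> * \<bar>s - t\<bar>" "\<bar>\<Psi>1 s x - \<Psi>1 t x\<bar> \<le> M * \<bar>c\<bar> * \<bar>s - t\<bar>"
      using W.lipschitz_\<Phi>[of "x - c * s" "x - c * t"] by (simp_all add: \<Psi>_def \<Psi>1_def mult.assoc)
  qed
  have limw': "((\<lambda>s. l2 (\<lambda>x. w' s x - w' t x)) \<longlongrightarrow> 0) (at t)"
  proof (rule Lim_null_comparison[OF always_eventually], rule allI)
    define r where "r s = M * l2 (\<lambda>x. g s x - g t x) + M * \<bar>c\<bar> * \<bar>s - t\<bar> * (2 * l2 (g t))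
        + (M * l2 (\<lambda>x. f s x - f t x) + M * \<bar>c\<bar> * \<bar>s - t\<bar> * (2 * l2 (f t)))" for s
    show "norm (l2 (\<lambda>x. w' s x - w' t x)) \<le> r s" for s
    proof -
      have L: "L2 (\<lambda>x. g s x - g t x)" "L2 (\<lambda>x. f s x - f t x)" "L2 (\<lambda>x. 2 * g t x)" "L2 (\<lambda>x. 2 * f t x)"
        by (intro L2_diff L2_cmult L2_f L2_g)+
      have md: "(\<lambda>x. \<Psi> s x - \<Psi> t x) \<in> borel_measurable borel" "(\<lambda>x. \<Psi>1 s x - \<Psi>1 t x) \<in> borel_measurable borel"
        by measurable
      have m: "\<Psi> s \<in> borel_measurable borel" "\<Psi>1 s \<in> borel_measurable borel" by measurable
      note A = L2_bounded_mult[OF L(1) m(1) V2(1)] L2_bounded_mult[OF L(3) md(1) lip(1)]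
        L2_bounded_mult[OF L(2) m(2) V2(2)] L2_bounded_mult[OF L(4) md(2) lip(2)]
      note B = l2_bounded_mult[OF L(1) m(1) V2(1)] l2_bounded_mult[OF L(3) md(1) lip(1)]
        l2_bounded_mult[OF L(2) m(2) V2(2)] l2_bounded_mult[OF L(4) md(2) lip(2)]
      have "l2 (\<lambda>x. w' s x - w' t x) = l2 (\<lambda>x. (\<Psi> s x * (g s x - g t x) + (\<Psi> s x - \<Psi> t x) * (2 * g t x))
          + (\<Psi>1 s x * (f s x - f t x) + (\<Psi>1 s x - \<Psi>1 t x) * (2 * f t x)))"
        by (rule arg_cong[where f=l2], rule ext) (simp add: w'_def algebra_simps)
      also have "\<dots> \<le> l2 (\<lambda>x. \<Psi> s x * (g s x - g t x)) + l2 (\<lambda>x. (\<Psi> s x - \<Psi> t x) * (2 * g t x))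
          + (l2 (\<lambda>x. \<Psi>1 s x * (f s x - f t x)) + l2 (\<lambda>x. (\<Psi>1 s x - \<Psi>1 t x) * (2 * f t x)))"
        by (intro order_trans[OF l2_triangle] add_mono l2_triangle L2_add A)
      also have "\<dots> \<le> r s"
        using add_mono[OF add_mono[OF B(1,2)] add_mono[OF B(3,4)]] l2_cmult[of 2 "g t"] l2_cmult[of 2 "f t"]
        by (simp add: r_def)
      finally show ?thesis by simp
    qed
    have "(r \<longlongrightarrow> M * 0 + M * \<bar>c\<bar> * \<bar>t - t\<bar> * (2 * l2 (g t)) + (M * 0 + M * \<bar>c\<bar> * \<bar>t - t\<bar> * (2 * l2 (f t)))) (at t)"
      unfolding r_def by (intro tendsto_intros tendsto_f tendsto_g)
    then show "(r \<longlongrightarrow> 0) (at t)" by simp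
  qed
  define X where "X x = g t x * \<Psi> t x + \<Psi>1 t x * f t x" for x
  have w't: "w' t x = 2 * X x" for x by (simp add: w'_def X_def algebra_simps)
  have LX: "L2 X" unfolding X_def[abs_def]
    by (intro L2_add L2_mult_bounded[OF L2_g _ V2(1)] L2_bounded_mult[OF L2_f _ V2(2)]) measurable
  have lim1: "((\<lambda>s. (LINT x|lborel. (f s x - f t x) * (w s x - w t x)) / (s - t)) \<longlongrightarrow> 0) (at t)"
  proof (rule Lim_null_comparison)
    show "\<forall>\<^sub>F s in at t. norm ((LINT x|lborel. (f s x - f t x) * (w s x - w t x)) / (s - t)) \<le> K * l2 (\<lambda>x. w' s x - w' t x)"
      unfolding eventually_at_filter
    proof (intro always_eventually allI impI)
      fix s assume "s \<noteq> t"
      moreover have "\<bar>LINT x|lborel. (f s x - f t x) * (w s x - w t x)\<bar> \<le> K * \<bar>s - t\<bar> * l2 (\<lambda>x. w' s x - w' t x)"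
        by (rule increment_bound[OF K(2)]) (intro L2_diff weak_deriv_diff Lw Lw' wdw)+
      ultimately show "norm ((LINT x|lborel. (f s x - f t x) * (w s x - w t x)) / (s - t)) \<le> K * l2 (\<lambda>x. w' s x - w' t x)"
        by (simp add: divide_le_eq mult_ac)
    qed
    show "((\<lambda>s. K * l2 (\<lambda>x. w' s x - w' t x)) \<longlongrightarrow> 0) (at t)"
      using tendsto_mult_left[OF limw', of K] by simp
  qed
  have lim2: "((\<lambda>s. (LINT x|lborel. (f s x - f t x) * w t x) / (s - t)) \<longlongrightarrow> (LINT x|lborel. F t x * w' t x)) (at t)"
    by (rule quotient_tendsto[OF Lw Lw' wdw])
  have if2: "integrable lborel (\<lambda>x. (f s x)\<^sup>2)" for s by (rule L2_square_integrable[OF L2_f])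
  have lim3: "((\<lambda>s. LINT x|lborel. (f t x)\<^sup>2 * ((\<Psi> s x - \<Psi> t x) / (s - t))) \<longlongrightarrow> (LINT x|lborel. (f t x)\<^sup>2 * (- c * \<Psi>1 t x))) (at t)"
    unfolding tendsto_at_iff_sequentially comp_def
  proof (intro allI impI)
    fix Y :: "nat \<Rightarrow> real" assume Y: "\<forall>i. Y i \<in> UNIV - {t}" "Y \<longlonglongrightarrow> t"
    have [measurable]: "f t \<in> borel_measurable borel" using L2_f by (rule L2_measurable)
    show "(\<lambda>i. LINT x|lborel. (f t x)\<^sup>2 * ((\<Psi> (Y i) x - \<Psi> t x) / (Y i - t))) \<longlonglongrightarrow> (LINT x|lborel. (f t x)\<^sup>2 * (- c * \<Psi>1 t x))"
    proof (rule integral_dominated_convergence)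
      show "integrable lborel (\<lambda>x. (f t x)\<^sup>2 * (M * \<bar>c\<bar>))" using if2 by auto
      show "AE x in lborel. (\<lambda>i. (f t x)\<^sup>2 * ((\<Psi> (Y i) x - \<Psi> t x) / (Y i - t))) \<longlonglongrightarrow> (f t x)\<^sup>2 * (- c * \<Psi>1 t x)"
      proof (rule AE_I2, rule tendsto_mult_left)
        fix x
        have "((\<lambda>s. x - c * s) has_real_derivative - c) (at t)" by (auto intro!: derivative_eq_intros)
        from DERIV_chain2[OF W.D1 this]
        have "((\<lambda>s. \<Psi> s x) has_real_derivative \<Psi>1 t x * - c) (at t)" by (simp add: \<Psi>_def[abs_def] \<Psi>1_def)
        then have "((\<lambda>s. (\<Psi> s x - \<Psi> t x) / (s - t)) \<longlongrightarrow> - c * \<Psi>1 t x) (at t)"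
          by (simp add: has_field_derivative_iff mult.commute)
        then show "(\<lambda>i. (\<Psi> (Y i) x - \<Psi> t x) / (Y i - t)) \<longlonglongrightarrow> - c * \<Psi>1 t x"
          using Y unfolding tendsto_at_iff_sequentially comp_def by blast
      qed
      show "AE x in lborel. norm ((f t x)\<^sup>2 * ((\<Psi> (Y i) x - \<Psi> t x) / (Y i - t))) \<le> (f t x)\<^sup>2 * (M * \<bar>c\<bar>)" for i
      proof (rule AE_I2)
        fix x
        have "Y i \<noteq> t" using Y(1) by auto
        then have "\<bar>(\<Psi> (Y i) x - \<Psi> t x) / (Y i - t)\<bar> \<le> M * \<bar>c\<bar>"
          using lip(1)[of "Y i" x] by (simp add: divide_le_eq)
        from mult_left_mono[OF this, of "(f t x)\<^sup>2"]
        show "norm ((f t x)\<^sup>2 * ((\<Psi> (Y i) x - \<Psi> t x) / (Y i - t))) \<le> (f t x)\<^sup>2 * (M * \<bar>c\<bar>)"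
          by (simp add: abs_mult)
      qed
    qed measurable
  qed
  define I where "I s = (LINT x|lborel. (f s x)\<^sup>2 * \<Psi> s x)" for s
  \<comment> \<open>Three contributions: the variation of \<open>w\<close>, vanishing by the
    Lipschitz bound; the fixed \<open>w t\<close>, giving the flux; and the motion of the weight,
    giving the drift.\<close>
  have quot: "(I s - I t) / (s - t) = (LINT x|lborel. (f s x - f t x) * (w s x - w t x)) / (s - t)
      + (LINT x|lborel. (f s x - f t x) * w t x) / (s - t) + (LINT x|lborel. (f t x)\<^sup>2 * ((\<Psi> s x - \<Psi> t x) / (s - t)))" for s
  proof -
    have Ld: "L2 (\<lambda>x. f s x - f t x)" by (intro L2_diff L2_f)
    have i2: "integrable lborel (\<lambda>x. (f r x)\<^sup>2 * \<Psi> q x)" for r q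
      using L2_mult_integrable[OF L2_f[of r] L2_mult_bounded[OF L2_f[of r] _ V2(1)[of q]]] by (simp add: power2_eq_square mult.assoc)
    have e1: "(LINT x|lborel. (f s x - f t x) * (w s x - w t x)) = (LINT x|lborel. (f s x - f t x) * w s x) - (LINT x|lborel. (f s x - f t x) * w t x)"
      unfolding right_diff_distrib by (intro Bochner_Integration.integral_diff L2_mult_integrable Ld Lw)
    have e2: "(LINT x|lborel. (f s x - f t x) * w s x) = I s - (LINT x|lborel. (f t x)\<^sup>2 * \<Psi> s x)"
      unfolding I_def Bochner_Integration.integral_diff[OF i2 i2, symmetric]
      by (intro Bochner_Integration.integral_cong) (auto simp: w_def power2_eq_square algebra_simps)
    have e3: "(LINT x|lborel. (f t x)\<^sup>2 * ((\<Psi> s x - \<Psi> t x) / (s - t))) = ((LINT x|lborel. (f t x)\<^sup>2 * \<Psi> s x) - I t) / (s - t)"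
      unfolding I_def Bochner_Integration.integral_diff[OF i2 i2, symmetric] integral_divide_zero[symmetric]
      by (intro Bochner_Integration.integral_cong) (auto simp: right_diff_distrib)
    show ?thesis unfolding e1 e3 unfolding e2 by (simp flip: add_divide_distrib)
  qed
  define D where "D = (LINT x|lborel. F t x * w' t x) + (LINT x|lborel. (f t x)\<^sup>2 * (- c * \<Psi>1 t x))"
  have "((\<lambda>s. (I s - I t) / (s - t)) \<longlongrightarrow> 0 + (LINT x|lborel. F t x * w' t x) + (LINT x|lborel. (f t x)\<^sup>2 * (- c * \<Psi>1 t x))) (at t)"
    unfolding quot by (intro tendsto_add lim1 lim2 lim3)
  then have DI: "(I has_real_derivative D) (at t)"
    by (simp add: has_field_derivative_iff D_def)
  have "(LINT x|lborel. F t x * w' t x) = - 2 * (LINT x|lborel. hilbert (g t) x * X x) + (LINT x|lborel. (f t x)\<^sup>2 * X x)"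
  proof -
    have iX: "integrable lborel (\<lambda>x. hilbert (g t) x * X x)" "integrable lborel (\<lambda>x. (f t x)\<^sup>2 * X x)"
      by (intro L2_mult_integrable LX L2_hilbert L2_g L2_H1_square[OF L2_f L2_g wd])+
    have "(LINT x|lborel. F t x * w' t x) = (LINT x|lborel. - 2 * (hilbert (g t) x * X x) + (f t x)\<^sup>2 * X x)"
      by (intro Bochner_Integration.integral_cong) (auto simp: F_def w't algebra_simps)
    then show ?thesis
      by (simp only: Bochner_Integration.integral_add[OF integrable_mult_right[OF iX(1)] iX(2)] integral_mult_right_zero)
  qed
  also have "\<dots> \<le> 2 * (l2 (f t))\<^sup>2 * (LINT x|lborel. \<Psi>1 t x * (f t x)\<^sup>2) + (N3 / 2 + (l2 (\<lambda>x. k (x - c * t)))\<^sup>2) * (l2 (f t))\<^sup>2 / pi"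
    using weight.energy_inequality[OF V L2_f L2_g wd, of t t] unfolding X_def .
  also have "l2 (\<lambda>x. k (x - c * t)) = l2 k" by (rule l2_shift)
  finally have le: "(LINT x|lborel. F t x * w' t x) \<le> 2 * (l2 (f t))\<^sup>2 * (LINT x|lborel. \<Psi>1 t x * (f t x)\<^sup>2) + (N3 / 2 + (l2 k)\<^sup>2) * (l2 (f t))\<^sup>2 / pi" .
  have "(LINT x|lborel. (f t x)\<^sup>2 * (- c * \<Psi>1 t x)) = (LINT x|lborel. - c * (\<Psi>1 t x * (f t x)\<^sup>2))"
    by (intro Bochner_Integration.integral_cong) (auto simp: mult_ac)
  then have "(LINT x|lborel. (f t x)\<^sup>2 * (- c * \<Psi>1 t x)) = - c * (LINT x|lborel. \<Psi>1 t x * (f t x)\<^sup>2)"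
    by (simp only: integral_mult_right_zero)
  with le have "D \<le> (2 * (l2 (f t))\<^sup>2 - c) * (LINT x|lborel. \<Psi>1 t x * (f t x)\<^sup>2) + (N3 / 2 + (l2 k)\<^sup>2) * (l2 (f t))\<^sup>2 / pi"
    unfolding D_def left_diff_distrib by linarith
  with DI show ?thesis unfolding I_def \<Psi>_def \<Psi>1_def by blast
qed

text \<open>A weight of slope zero has no errors, so the energy estimate with \<open>c = 0\<close>
  yields the monotonicity of the \<open>L2\<close> norm.\<close>

lemma weight_const: "weight (\<lambda>_. 1) (\<lambda>_. 0) (\<lambda>_. 0) (\<lambda>_. 0) (\<lambda>_. 0) (\<lambda>_. 0) 1 0"
  by unfold_locales (auto simp: smooth_const L2_zero)

lemma (in bo) l2_nonincreasing:
  assumes "0 \<le> t" shows "l2 (f t) \<le> l2 (f 0)"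
proof -
  have "(l2 (f 0))\<^sup>2 \<ge> (l2 (f t))\<^sup>2"
  proof (rule DERIV_nonpos_imp_nonincreasing[OF assms])
    fix s
    show "\<exists>y. ((\<lambda>t. (l2 (f t))\<^sup>2) has_real_derivative y) (at s) \<and> y \<le> 0"
      using energy_derivative[OF weight_const, where t = s and c = 0] by (simp add: l2_square)
  qed
  then show ?thesis by (rule power2_le_imp_le) simp
qed

text \<open>As the \<open>L2\<close> norm does not increase, the condition on \<open>c\<close> keeps
  the coefficient \<open>2 * (l2 (f t))^2 - c\<close> nonpositive at all later times, and only the
  commutator errors are left to integrate.\<close>

lemma (in bo) energy_growth:
  assumes W: "weight \<Phi> \<Phi>1 \<Phi>2 \<Phi>3 b k M N3" and c: "2 * (l2 (f 0))\<^sup>2 \<le> c" and T: "0 \<le> T"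
  shows "(LINT x|lborel. (f T x)\<^sup>2 * \<Phi> (x - c * T))
    \<le> (LINT x|lborel. (f 0 x)\<^sup>2 * \<Phi> x) + (N3 / 2 + (l2 k)\<^sup>2) * (l2 (f 0))\<^sup>2 / pi * T"
proof -
  interpret W: weight \<Phi> \<Phi>1 \<Phi>2 \<Phi>3 b k M N3 by (rule W)
  have N0: "0 \<le> N3"
    by (rule order_trans[OF _ W.N3(2)]) (intro Bochner_Integration.integral_nonneg, simp)
  define E where "E = (N3 / 2 + (l2 k)\<^sup>2) * (l2 (f 0))\<^sup>2 / pi"
  define I where "I s = (LINT x|lborel. (f s x)\<^sup>2 * \<Phi> (x - c * s))" for s
  have "I 0 - E * 0 \<ge> I T - E * T"
  proof (rule DERIV_nonpos_imp_nonincreasing[OF T])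
    fix t assume t: "0 \<le> t" "t \<le> T"
    have le: "(l2 (f t))\<^sup>2 \<le> (l2 (f 0))\<^sup>2" by (intro power_mono l2_nonincreasing t) simp
    obtain D where D: "(I has_real_derivative D) (at t)"
      "D \<le> (2 * (l2 (f t))\<^sup>2 - c) * (LINT x|lborel. \<Phi>1 (x - c * t) * (f t x)\<^sup>2) + (N3 / 2 + (l2 k)\<^sup>2) * (l2 (f t))\<^sup>2 / pi"
      using energy_derivative[OF W, where t = t and c = c] unfolding I_def[abs_def] by blast
    have "(2 * (l2 (f t))\<^sup>2 - c) * (LINT x|lborel. \<Phi>1 (x - c * t) * (f t x)\<^sup>2) \<le> 0"
      using order_trans[OF mult_left_mono[OF le, of 2] c] W.square
      by (intro mult_nonpos_nonneg Bochner_Integration.integral_nonneg) auto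
    moreover have "(N3 / 2 + (l2 k)\<^sup>2) * (l2 (f t))\<^sup>2 / pi \<le> E"
      unfolding E_def using le N0 by (intro divide_right_mono mult_left_mono) auto
    ultimately have "D - E \<le> 0" using D(2) by linarith
    moreover have "((\<lambda>s. I s - E * s) has_real_derivative D - E) (at t)"
      by (auto intro!: derivative_eq_intros D(1))
    ultimately show "\<exists>y. ((\<lambda>s. I s - E * s) has_real_derivative y) (at t) \<and> y \<le> 0" by blast
  qed
  then show ?thesis by (simp add: I_def E_def)
qed

subsection \<open>The explicit weight\<close>

lemma DERIV_inverse_1_plus_square:
  "((\<lambda>x::real. inverse (1 + x\<^sup>2)) has_real_derivative - 2 * x * (inverse (1 + x\<^sup>2))\<^sup>2) (at x)"
proof -
  have "1 + x\<^sup>2 \<noteq> 0" by (metis add_pos_nonneg less_irrefl zero_le_power2 zero_less_one)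
  then show ?thesis by (auto intro!: derivative_eq_intros simp: power2_eq_square)
qed

lemma smooth_inverse_1_plus_square: "smooth (\<lambda>x::real. inverse (1 + x\<^sup>2))"
  unfolding smooth_iff_Cn
proof
  fix n show "Cn n (\<lambda>x::real. inverse (1 + x\<^sup>2))"
  proof (induction n)
    case 0
    show ?case by (rule Cn_0I) (rule DERIV_inverse_1_plus_square)
  next
    case (Suc n)
    have "Cn n (\<lambda>x::real. x)" using smooth_ident smooth_iff_Cn by blast
    then have "Cn n (\<lambda>x::real. - 2 * x * (inverse (1 + x\<^sup>2))\<^sup>2)"
      unfolding power2_eq_square[of "inverse _"] by (intro Cn_mult Cn_const Suc)
    with DERIV_inverse_1_plus_square show ?case by (rule Cn_SucI)
  qed
qed

text \<open>The primitive of \<open>(1 + z^2)^-2\<close> that vanishes at minus infinity. The slope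
  is a square by design: its root \<open>b\<close> is the rational function
  \<open>1 / (1 + z^2)\<close>, which also serves as its own \<open>k\<close>.\<close>

definition step :: "real \<Rightarrow> real" where
  "step z = (arctan z + z * inverse (1 + z\<^sup>2)) / 2 + pi / 4"

lemma DERIV_step: "(step has_real_derivative (inverse (1 + z\<^sup>2))\<^sup>2) (at z)"
proof -
  define i where "i = inverse (1 + z\<^sup>2)"
  have nz: "1 + z\<^sup>2 \<noteq> 0" by (metis add_pos_nonneg less_irrefl zero_le_power2 zero_less_one)
  then have i: "i * (1 + z\<^sup>2) = 1" by (simp add: i_def)
  have "(step has_real_derivative (i + (1 * i + - 2 * z * i\<^sup>2 * z)) / 2 + 0) (at z)"
    unfolding step_def[abs_def] i_def
    by (intro DERIV_add DERIV_cdivide DERIV_mult DERIV_arctan DERIV_inverse_1_plus_square DERIV_const DERIV_ident)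
  also have "(i + (1 * i + - 2 * z * i\<^sup>2 * z)) / 2 + 0 = i\<^sup>2"
    using i by algebra
  finally show ?thesis by (simp add: i_def)
qed

lemma smooth_step: "smooth step"
  by (rule smooth_of_DERIV[OF DERIV_step])
    (simp only: power2_eq_square[of "inverse _"], intro smooth_mult smooth_inverse_1_plus_square)

lemma step_at_bot: "(step \<longlongrightarrow> 0) at_bot"
proof -
  have "((\<lambda>z::real. z * inverse (1 + z\<^sup>2)) \<longlongrightarrow> 0) at_bot" by real_asymp
  then have "(step \<longlongrightarrow> (- (pi / 2) + 0) / 2 + pi / 4) at_bot"
    unfolding step_def[abs_def] by (intro tendsto_intros tendsto_arctan_at_bot) auto
  then show ?thesis by simp
qed

lemma step_mono: "x \<le> y \<Longrightarrow> step x \<le> step y"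
  by (rule DERIV_nonneg_imp_nondecreasing) (use DERIV_step zero_le_power2 in blast)+

lemma step_nonneg: "0 \<le> step z"
proof (rule tendsto_upperbound[OF step_at_bot])
  show "\<forall>\<^sub>F x in at_bot. step x \<le> step z"
    unfolding eventually_at_bot_linorder using step_mono by blast
qed simp

lemma step_ge: "0 \<le> z \<Longrightarrow> pi / 4 \<le> step z"
  using step_mono[of 0 z] by (simp add: step_def)

text \<open>The number 28 is \<open>4 + 24\<close>, the bound for the third derivative in
  \<open>weight_step\<close>; the locale asks for one constant for all bounds.\<close>

lemma step_le: "step z \<le> 28"
proof -
  have "2 * z \<le> 1 + z\<^sup>2" using zero_le_power2[of "z - 1"] by (simp add: power2_eq_square algebra_simps)
  moreover have "0 < 1 + z\<^sup>2" by (simp add: add_pos_nonneg)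
  ultimately have "z * inverse (1 + z\<^sup>2) \<le> 1" by (simp add: field_simps)
  with arctan_ubound[of z] have "arctan z + z * inverse (1 + z\<^sup>2) \<le> pi / 2 + 1" by (intro add_mono) auto
  then have "step z \<le> (pi / 2 + 1) / 2 + pi / 4" by (simp only: step_def add_right_mono divide_right_mono)
  also have "\<dots> = (pi + 1) / 2" by (simp add: field_simps)
  also have "\<dots> \<le> 28" using pi_less_4 by simp
  finally show ?thesis .
qed

text \<open>The condition on \<open>k\<close> reduces to
  \<open>(x + y)^2 \<le> (1 + x^2) * (1 + y^2)\<close>, in which the two sides differ by
  \<open>(1 - x * y)^2\<close>.\<close>

lemma weight_step:
  "weight step (\<lambda>z. (inverse (1 + z\<^sup>2))\<^sup>2) (\<lambda>z. - 4 * z * (inverse (1 + z\<^sup>2)) ^ 3)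
    (\<lambda>z. - 4 * (inverse (1 + z\<^sup>2)) ^ 3 + 24 * z\<^sup>2 * (inverse (1 + z\<^sup>2)) ^ 4)
    (\<lambda>z. inverse (1 + z\<^sup>2)) (\<lambda>z. inverse (1 + z\<^sup>2)) 28 (28 * pi)"
  and l2_inverse_1_plus_square: "(l2 (\<lambda>z. inverse (1 + z\<^sup>2)))\<^sup>2 \<le> pi"
proof -
  define i :: "real \<Rightarrow> real" where "i z = inverse (1 + z\<^sup>2)" for z
  have pos: "0 < 1 + z\<^sup>2" for z :: real by (simp add: add_pos_nonneg)
  have i0: "0 \<le> i z" and i1: "i z \<le> 1" and ii: "i z * (1 + z\<^sup>2) = 1" for z
    using pos[of z] by (auto simp: i_def inverse_le_1_iff)
  have zi: "z\<^sup>2 * i z \<le> 1" for z using ii[of z] i0[of z] by (simp add: algebra_simps)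
  have zi': "\<bar>z\<bar> * i z \<le> 1" for z
  proof (rule power2_le_imp_le)
    show "(\<bar>z\<bar> * i z)\<^sup>2 \<le> 1\<^sup>2"
      using mult_mono[OF zi[of z] i1[of z]] i0[of z] by (simp add: power2_eq_square mult_ac abs_mult_self_eq flip: mult.assoc[of "\<bar>z\<bar>" "\<bar>z\<bar>"])
  qed simp
  have Di: "(i has_real_derivative - 2 * z * (i z)\<^sup>2) (at z)" for z
    unfolding i_def[abs_def] by (rule DERIV_inverse_1_plus_square)
  have si: "smooth i" unfolding i_def[abs_def] by (rule smooth_inverse_1_plus_square)
  have [measurable]: "i \<in> borel_measurable borel" using si by (rule smooth_measurable)
  have ci: "continuous_on UNIV i" using si by (rule smooth_continuous)
  have int: "integrable lborel i" "(LINT z|lborel. i z) = pi"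
    using integrable_inverse_1_plus_square' integral_inverse_1_plus_square
    by (simp_all add: i_def[abs_def] inverse_eq_divide)
  have p1: "i z ^ Suc n \<le> i z" for n z
    using i0[of z] i1[of z] by (simp add: mult_left_le power_le_one)
  have i3: "\<bar>- 4 * i z ^ 3 + 24 * z\<^sup>2 * i z ^ 4\<bar> \<le> 28 * i z" for z
  proof -
    have "\<bar>- 4 * i z ^ 3 + 24 * z\<^sup>2 * i z ^ 4\<bar> \<le> 4 * i z ^ 3 + 24 * (z\<^sup>2 * i z ^ 4)"
      using i0[of z] by (simp add: abs_le_iff)
    also have "z\<^sup>2 * i z ^ 4 = (z\<^sup>2 * i z) * i z ^ 3" by (simp add: eval_nat_numeral)
    also have "\<dots> \<le> 1 * i z ^ 3" using i0 zi by (intro mult_right_mono) auto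
    finally show ?thesis using p1[of z 2] by (simp add: numeral_3_eq_3)
  qed
  have isq: "integrable lborel (\<lambda>z. (i z)\<^sup>2)"
    by (rule Bochner_Integration.integrable_bound[OF int(1)])
      (use p1[of _ 1] i0 in \<open>auto simp: numeral_2_eq_2\<close>)
  have L2i: "L2 i" by (rule L2I) (use isq in auto)
  have "(l2 i)\<^sup>2 \<le> (LINT z|lborel. i z)"
    unfolding l2_square
    by (intro integral_mono isq int) (use p1[of _ 1] in \<open>simp add: numeral_2_eq_2\<close>)
  then show "(l2 (\<lambda>z. inverse (1 + z\<^sup>2)))\<^sup>2 \<le> pi" using int(2) by (simp add: i_def[abs_def])
  \<comment> \<open>One factor \<open>i x * i y\<close> of the square becomes
    \<open>k x * k y\<close>; the other compensates \<open>(x + y)^2\<close>.\<close>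
  have diff: "i x - i y = (y - x) * (x + y) * (i x * i y)" for x y
    using ii[of x] ii[of y] by algebra
  have "weight step (\<lambda>z. (i z)\<^sup>2) (\<lambda>z. - 4 * z * i z ^ 3) (\<lambda>z. - 4 * i z ^ 3 + 24 * z\<^sup>2 * i z ^ 4) i i 28 (28 * pi)"
  proof
    show "smooth step" by (rule smooth_step)
    show "(step has_real_derivative (i z)\<^sup>2) (at z)" for z unfolding i_def by (rule DERIV_step)
    show "((\<lambda>z. (i z)\<^sup>2) has_real_derivative - 4 * z * i z ^ 3) (at z)" for z
      by (auto intro!: derivative_eq_intros Di simp: eval_nat_numeral)
    show "((\<lambda>z. - 4 * z * i z ^ 3) has_real_derivative - 4 * i z ^ 3 + 24 * z\<^sup>2 * i z ^ 4) (at z)" for z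
      by (auto intro!: derivative_eq_intros Di simp: eval_nat_numeral)
    show "continuous_on UNIV (\<lambda>z. - 4 * i z ^ 3 + 24 * z\<^sup>2 * i z ^ 4)"
      by (intro continuous_intros ci)
    show "\<bar>step z\<bar> \<le> 28" for z using step_nonneg[of z] step_le[of z] by simp
    show "\<bar>(i z)\<^sup>2\<bar> \<le> 28" for z using p1[of z 1] i1[of z] by (simp add: numeral_2_eq_2)
    show "\<bar>- 4 * z * i z ^ 3\<bar> \<le> 28" for z
    proof -
      have "\<bar>- 4 * z * i z ^ 3\<bar> = 4 * ((\<bar>z\<bar> * i z) * (i z)\<^sup>2)"
        using i0[of z] by (simp add: abs_mult eval_nat_numeral)
      also have "\<dots> \<le> 4 * (1 * 1)"
        using i0 i1 zi' by (intro mult_left_mono mult_mono power_le_one) auto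
      finally show ?thesis by simp
    qed
    show "\<bar>- 4 * i z ^ 3 + 24 * z\<^sup>2 * i z ^ 4\<bar> \<le> 28" for z
      using i3[of z] i1[of z] by linarith
    show int3: "integrable lborel (\<lambda>z. - 4 * i z ^ 3 + 24 * z\<^sup>2 * i z ^ 4)"
      by (rule Bochner_Integration.integrable_bound[OF integrable_mult_right[OF int(1), of 28]])
        (use i3 i0 in auto)
    have "(LINT z|lborel. \<bar>- 4 * i z ^ 3 + 24 * z\<^sup>2 * i z ^ 4\<bar>) \<le> (LINT z|lborel. 28 * i z)"
      by (intro integral_mono integrable_abs int3 integrable_mult_right int i3)
    then show "(LINT z|lborel. \<bar>- 4 * i z ^ 3 + 24 * z\<^sup>2 * i z ^ 4\<bar>) \<le> 28 * pi"
      using int(2) by simp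
    show "(i z)\<^sup>2 = (i z)\<^sup>2" for z ..
    show "\<bar>i z\<bar> \<le> 28" for z using i0[of z] i1[of z] by simp
    have sum: "(x + y)\<^sup>2 * (i x * i y) \<le> 1" for x y
    proof -
      have "(x + y)\<^sup>2 \<le> (1 + x\<^sup>2) * (1 + y\<^sup>2)"
        using zero_le_power2[of "1 - x * y"] by (simp add: power2_eq_square algebra_simps)
      then have "(x + y)\<^sup>2 * (i x * i y) \<le> ((1 + x\<^sup>2) * (1 + y\<^sup>2)) * (i x * i y)"
        using i0 by (intro mult_right_mono) auto
      also have "\<dots> = (i x * (1 + x\<^sup>2)) * (i y * (1 + y\<^sup>2))" by (simp only: mult_ac)
      finally show ?thesis by (simp add: ii)
    qed
    show sq: "(i x - i y)\<^sup>2 \<le> (x - y)\<^sup>2 * (i x * i y)" for x y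
    proof -
      have "(i x - i y)\<^sup>2 = (x - y)\<^sup>2 * (i x * i y) * ((x + y)\<^sup>2 * (i x * i y))"
        unfolding diff by algebra
      also have "\<dots> \<le> (x - y)\<^sup>2 * (i x * i y) * 1"
        using i0 sum by (intro mult_left_mono) auto
      finally show ?thesis by simp
    qed
    show "\<bar>i x - i y\<bar> \<le> 28 * \<bar>x - y\<bar>" for x y
    proof -
      have "(i x - i y)\<^sup>2 \<le> (x - y)\<^sup>2 * (1 * 1)"
        using i0 i1 by (intro order_trans[OF sq] mult_left_mono mult_mono) auto
      then have "\<bar>i x - i y\<bar> \<le> 1 * \<bar>x - y\<bar>" by (simp add: abs_le_square_iff)
      also have "\<dots> \<le> 28 * \<bar>x - y\<bar>" by (rule mult_right_mono) auto
      finally show ?thesis .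
    qed
    show "L2 i" by (rule L2i)
    show "0 \<le> i z" for z by (rule i0)
  qed
  then show "weight step (\<lambda>z. (inverse (1 + z\<^sup>2))\<^sup>2) (\<lambda>z. - 4 * z * (inverse (1 + z\<^sup>2)) ^ 3)
    (\<lambda>z. - 4 * (inverse (1 + z\<^sup>2)) ^ 3 + 24 * z\<^sup>2 * (inverse (1 + z\<^sup>2)) ^ 4)
    (\<lambda>z. inverse (1 + z\<^sup>2)) (\<lambda>z. inverse (1 + z\<^sup>2)) 28 (28 * pi)"
    unfolding i_def[abs_def] .
qed

context bo
begin

text \<open>Since 3/4 is below 1, the argument of \<open>step\<close> tends to minus infinity at
  every fixed \<open>x\<close>.\<close>

lemma step_energy_tendsto:
  "((\<lambda>T. LINT x|lborel. (f 0 x)\<^sup>2 * step ((x - T) / T powr (3/4))) \<longlongrightarrow> 0) at_top"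
proof -
  have [measurable]: "f 0 \<in> borel_measurable borel" using L2_f by (rule L2_measurable)
  have [measurable]: "step \<in> borel_measurable borel" using smooth_step by (rule smooth_measurable)
  have "((\<lambda>T. LINT x|lborel. (f 0 x)\<^sup>2 * step ((x - T) / T powr (3/4))) \<longlongrightarrow> (LINT x|lborel. (f 0 x)\<^sup>2 * 0)) at_top"
  proof (rule integral_dominated_convergence_at_top)
    show "integrable lborel (\<lambda>x. (f 0 x)\<^sup>2 * 28)" using L2_square_integrable[OF L2_f] by auto
    show "\<forall>\<^sub>F T in at_top. AE x in lborel. norm ((f 0 x)\<^sup>2 * step ((x - T) / T powr (3/4))) \<le> (f 0 x)\<^sup>2 * 28"
      using step_nonneg step_le by (intro always_eventually allI AE_I2) (auto simp: abs_mult intro!: mult_left_mono)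
    show "AE x in lborel. ((\<lambda>T. (f 0 x)\<^sup>2 * step ((x - T) / T powr (3/4))) \<longlongrightarrow> (f 0 x)\<^sup>2 * 0) at_top"
    proof (rule AE_I2, rule tendsto_mult_left)
      fix x :: real
      have "filterlim (\<lambda>T. (x - T) / T powr (3/4)) at_bot at_top" by real_asymp
      then show "((\<lambda>T. step ((x - T) / T powr (3/4))) \<longlongrightarrow> 0) at_top"
        by (rule filterlim_compose[OF step_at_bot])
    qed
  qed measurable
  then show ?thesis by simp
qed

text \<open>For each \<open>T\<close> the weight is chosen afresh, with centre \<open>T\<close> and
  width \<open>T powr (3/4)\<close> at time 0, and is followed up to time \<open>T\<close>.\<close>

lemma step_energy_bound:
  assumes c: "2 * (l2 (f 0))\<^sup>2 \<le> c" and T: "1 \<le> T"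
  shows "(LINT x|lborel. (f T x)\<^sup>2 * step ((x - c * T - T) / T powr (3/4)))
    \<le> (LINT x|lborel. (f 0 x)\<^sup>2 * step ((x - T) / T powr (3/4))) + 15 * (l2 (f 0))\<^sup>2 * T powr (- 1/2)"
proof -
  define \<mu> where "\<mu> = T powr (3/4)"
  have \<mu>: "1 \<le> \<mu>" using T by (simp add: \<mu>_def ge_one_powr_ge_zero)
  define l where "l = l2 (\<lambda>z. inverse (1 + z\<^sup>2))"
  have l: "l\<^sup>2 \<le> pi" unfolding l_def by (rule l2_inverse_1_plus_square)
  note W = weight.weight_affine[OF weight_step \<mu>, of T]
  \<comment> \<open>Half of \<open>28 * pi\<close> for the third derivative and at most
    \<open>pi\<close> for the norm of \<open>k\<close> give \<open>15 * pi\<close>.\<close>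
  have "(28 * pi / \<mu>\<^sup>2 / 2 + (l / \<mu>)\<^sup>2) \<le> 15 * pi / \<mu>\<^sup>2"
  proof -
    have "l\<^sup>2 / \<mu>\<^sup>2 \<le> pi / \<mu>\<^sup>2" using l by (intro divide_right_mono) auto
    then show ?thesis by (simp add: power_divide)
  qed
  then have "(28 * pi / \<mu>\<^sup>2 / 2 + (l / \<mu>)\<^sup>2) * (l2 (f 0))\<^sup>2 / pi * T \<le> (15 * pi / \<mu>\<^sup>2) * (l2 (f 0))\<^sup>2 / pi * T"
    using T by (intro mult_right_mono divide_right_mono) auto
  also have "\<dots> = 15 * (l2 (f 0))\<^sup>2 * (T / \<mu>\<^sup>2)" by simp
  also have "T / \<mu>\<^sup>2 = T powr (- 1/2)"
  proof -
    have "\<mu>\<^sup>2 = T powr (3/2)" by (simp add: \<mu>_def power2_eq_square flip: powr_add)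
    then have "T / \<mu>\<^sup>2 = T powr 1 / T powr (3/2)" using T by simp
    also have "\<dots> = T powr (1 - 3/2)" by (rule powr_diff[symmetric])
    also have "\<dots> = T powr (- 1/2)" by simp
    finally show ?thesis .
  qed
  finally show ?thesis
    using energy_growth[OF W(1) c, of T] T unfolding W(2) l_def[symmetric] by (simp add: \<mu>_def)
qed

lemma l2_right_tendsto:
  assumes c: "2 * (l2 (f 0))\<^sup>2 \<le> c"
  shows "((\<lambda>t. LINT x:{x. (c + 1) * t \<le> x}|lborel. (f t x)\<^sup>2) \<longlongrightarrow> 0) at_top"
proof -
  \<comment> \<open>The factor \<open>4 / pi\<close> inverts the lower bound \<open>pi / 4\<close>
    of \<open>step\<close> on the right half-line. At time \<open>T\<close> that half-line starts at
    \<open>c * T + T\<close>, whence the speed \<open>c + 1\<close>.\<close>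
  define r where "r T = 4 / pi * ((LINT x|lborel. (f 0 x)\<^sup>2 * step ((x - T) / T powr (3/4))) + 15 * (l2 (f 0))\<^sup>2 * T powr (- 1/2))" for T
  have "((\<lambda>T::real. T powr (- 1/2)) \<longlongrightarrow> 0) at_top" by real_asymp
  then have "(r \<longlongrightarrow> 4 / pi * (0 + 15 * (l2 (f 0))\<^sup>2 * 0)) at_top"
    unfolding r_def by (intro tendsto_intros step_energy_tendsto)
  then have r: "(r \<longlongrightarrow> 0) at_top" by simp
  have "\<forall>\<^sub>F T in at_top. norm (LINT x:{x. (c + 1) * T \<le> x}|lborel. (f T x)\<^sup>2) \<le> r T"
    using eventually_ge_at_top[of 1]
  proof eventually_elim
    fix T :: real assume T: "1 \<le> T"
    define J where "J = (LINT x:{x. (c + 1) * T \<le> x}|lborel. (f T x)\<^sup>2)"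
    have [measurable]: "f T \<in> borel_measurable borel" using L2_f by (rule L2_measurable)
    have [measurable]: "step \<in> borel_measurable borel" using smooth_step by (rule smooth_measurable)
    have if2: "integrable lborel (\<lambda>x. (f T x)\<^sup>2)" by (rule L2_square_integrable[OF L2_f])
    have J0: "0 \<le> J" unfolding J_def set_lebesgue_integral_def by (intro Bochner_Integration.integral_nonneg) auto
    have "pi / 4 * J = (LINT x|lborel. pi / 4 * (indicator {x. (c + 1) * T \<le> x} x * (f T x)\<^sup>2))"
      by (simp add: J_def set_lebesgue_integral_def)
    also have "\<dots> \<le> (LINT x|lborel. (f T x)\<^sup>2 * step ((x - c * T - T) / T powr (3/4)))"
    proof (rule integral_mono)
      show "integrable lborel (\<lambda>x. pi / 4 * (indicator {x. (c + 1) * T \<le> x} x * (f T x)\<^sup>2))"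
        by (intro integrable_mult_right Bochner_Integration.integrable_bound[OF if2])
          (auto simp: indicator_def)
      show "integrable lborel (\<lambda>x. (f T x)\<^sup>2 * step ((x - c * T - T) / T powr (3/4)))"
        using step_nonneg step_le
        by (intro Bochner_Integration.integrable_bound[OF integrable_mult_left[OF if2, of 28]])
          (auto simp: abs_mult intro!: mult_left_mono)
      show "pi / 4 * (indicator {x. (c + 1) * T \<le> x} x * (f T x)\<^sup>2) \<le> (f T x)\<^sup>2 * step ((x - c * T - T) / T powr (3/4))" for x
      proof (cases "(c + 1) * T \<le> x")
        case True
        then have "0 \<le> (x - c * T - T) / T powr (3/4)" by (simp add: distrib_right)
        from mult_right_mono[OF step_ge[OF this], of "(f T x)\<^sup>2"] show ?thesis
          using True by (simp add: mult.commute)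
      next
        case False
        then show ?thesis using step_nonneg by simp
      qed
    qed
    also have "\<dots> \<le> pi / 4 * r T"
      using step_energy_bound[OF c T] by (simp add: r_def)
    finally have "J \<le> r T" by simp
    with J0 show "norm (LINT x:{x. (c + 1) * T \<le> x}|lborel. (f T x)\<^sup>2) \<le> r T" by (simp add: J_def)
  qed
  then show ?thesis using r by (rule Lim_null_comparison)
qed

end

theorem theorem1p4:
  "\<exists>C0 :: real \<Rightarrow> real. (\<forall>r. 0 < C0 r) \<and>
     (\<forall>u0 u. H1 u0 \<longrightarrow> BO_solution u0 u \<longrightarrow>
        ((\<lambda>t. sqrt (LINT x:{x. C0 (H1_norm u0) * t \<le> x}|lborel. (u x t)\<^sup>2)) \<longlongrightarrow> 0) at_top)"
proof (intro exI[of _ "\<lambda>r. 2 * r\<^sup>2 + 1"] conjI allI impI)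
  \<comment> \<open>Here \<open>2 * r^2\<close> is the drift needed to dominate the cubic term and 1
    accounts for the initial position of the weight.\<close>
  show "0 < 2 * r\<^sup>2 + (1::real)" for r by (simp add: add_nonneg_pos)
  fix u0 and u :: "real \<Rightarrow> real \<Rightarrow> real" assume u0: "H1 u0" and u: "BO_solution u0 u"
  interpret bo u0 u by standard (rule u)
  \<comment> \<open>The initial value is attained only almost everywhere, which still determines the
    \<open>L2\<close> norm at time 0.\<close>
  have "AE x in lborel. f 0 x = u0 x" using u by (simp add: BO_solution_def f_def)
  then have "l2 (f 0) = l2 u0" by (rule l2_cong_AE[OF _ L2_measurable[OF L2_f] L2_measurable[OF H1_L2[OF u0]]])
  then have "l2 (f 0) \<le> H1_norm u0" using l2_le_H1_norm(1)[of u0] by simp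
  then have "2 * (l2 (f 0))\<^sup>2 \<le> 2 * (H1_norm u0)\<^sup>2" by (simp add: power_mono)
  from tendsto_real_sqrt[OF l2_right_tendsto[OF this]]
  show "((\<lambda>t. sqrt (LINT x:{x. (2 * (H1_norm u0)\<^sup>2 + 1) * t \<le> x}|lborel. (u x t)\<^sup>2)) \<longlongrightarrow> 0) at_top"
    by (simp add: f_def)
qed

end
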